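(* Let $(M,\sigma)$ be a hyperbolic surface of genus $\geq 2$ and total area $A$. There exists a constant $C=C(\sigma)>0$ such that, for any Riemannian metric $g$ on $M$ of nonpositive Gaussian curvature and total area $A$ that is conformally equivalent to $\sigma$, and for all $k\in\mathbb{N}$, $$\lambda_k(g)\geq C\lambda_k(\sigma).$$ In particular, over all nonpositively curved metrics $g$ in a fixed conformal class, the quantity $\lambda_1(g)\,\mathrm{vol}_g(M)$ is uniformly bounded away from $0$. Similarly, on the universal cover, $\widetilde\lambda_1(\widetilde g)\geq C\,\widetilde\lambda_1(\widetilde\sigma)$ for every such $g$.
   Context: $M$ is a smooth closed surface. A hyperbolic metric is a Riemannian metric of constant Gaussian curvature $-1$. $g$ is conformally equivalent to $\sigma$ if $g=e^{2u}\sigma$ for a smooth function $u\colon M\to\mathbb{R}$. $0=\lambda_0(g)<\lambda_1(g)\leq\lambda_2(g)\leq\cdots$ denotes the spectrum (eigenvalues with multiplicity) of the nonnegative Laplacian of $(M,g)$, characterized by $\lambda_k(g)=\inf_{V_k}\sup_{0\neq f\in V_k}\frac{\int_M|\nabla_g f|_g^2\,dv_g}{\int_M f^2\,dv_g}$ where $V_k$ runs over the $(k+1)$-dimensional subspaces of $H^1(M)$. $\widetilde\lambda_1(\widetilde g)$ denotes the bottom of the $L^2$-spectrum of the Laplacian of the lifted metric $\widetilde g$ on the universal cover $\widetilde M$. *)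

theory Defs
  imports "HOL-Analysis.Analysis"
begin

section \<open>Smooth functions of two variables\<close>

definition partial_deriv :: "2 \<Rightarrow> (real^2 \<Rightarrow> real) \<Rightarrow> real^2 \<Rightarrow> real" where
  "partial_deriv i f x = frechet_derivative f (at x) (axis i 1)"

(* Meant for open sets S only. *)
fun C_k_on :: "nat \<Rightarrow> (real^2) set \<Rightarrow> (real^2 \<Rightarrow> real) \<Rightarrow> bool" where
  "C_k_on 0 S f \<longleftrightarrow> continuous_on S f"
| "C_k_on (Suc k) S f \<longleftrightarrow> f differentiable_on S \<and> (\<forall>i. C_k_on k S (partial_deriv i f))"

definition smooth_on :: "(real^2) set \<Rightarrow> (real^2 \<Rightarrow> real) \<Rightarrow> bool" where
  "smooth_on S f \<longleftrightarrow> (\<forall>k. C_k_on k S f)"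


section \<open>Smooth surfaces\<close>

text \<open>
  A surface is (the universe of) a Hausdorff, second countable type together with a smooth atlas.
  A chart is a pair of its domain and its coordinate map; only the values of the coordinate map on
  the domain matter.
\<close>

type_synonym 'm chart = "'m set \<times> ('m \<Rightarrow> real^2)"

definition chart_inv :: "'m chart \<Rightarrow> real^2 \<Rightarrow> 'm" where
  "chart_inv c = inv_into (fst c) (snd c)"

definition in_charts :: "'m chart \<Rightarrow> 'n chart \<Rightarrow> ('m \<Rightarrow> 'n) \<Rightarrow> real^2 \<Rightarrow> real^2" where
  "in_charts c d F = snd d \<circ> F \<circ> chart_inv c"

definition smooth_map :: "'m::topological_space chart set \<Rightarrow> 'n::topological_space chart set
    \<Rightarrow> ('m \<Rightarrow> 'n) \<Rightarrow> bool" where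
  "smooth_map A B F \<longleftrightarrow> continuous_on UNIV F \<and>
    (\<forall>c\<in>A. \<forall>d\<in>B. \<forall>i. smooth_on (snd c ` (fst c \<inter> F -` fst d)) (\<lambda>x. in_charts c d F x $ i))"

definition smooth_fun :: "'m chart set \<Rightarrow> ('m \<Rightarrow> real) \<Rightarrow> bool" where
  "smooth_fun A f \<longleftrightarrow> (\<forall>c\<in>A. smooth_on (snd c ` fst c) (f \<circ> chart_inv c))"

definition smooth_atlas :: "'m::topological_space chart set \<Rightarrow> bool" where
  "smooth_atlas A \<longleftrightarrow>
    (\<forall>c\<in>A. open (fst c) \<and> open (snd c ` fst c) \<and>
            homeomorphism (fst c) (snd c ` fst c) (snd c) (chart_inv c)) \<and>
    (\<Union>c\<in>A. fst c) = UNIV \<and>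
    smooth_map A A id"

(* The matrix of the tangent map of F at p with respect to the coordinate bases of c and d. *)
definition tangent_matrix :: "'m chart \<Rightarrow> 'n chart \<Rightarrow> ('m \<Rightarrow> 'n) \<Rightarrow> 'm \<Rightarrow> real^2^2" where
  "tangent_matrix c d F p = jacobian (in_charts c d F) (at (snd c p))"

definition chart_at :: "'m chart set \<Rightarrow> 'm \<Rightarrow> 'm chart" where
  "chart_at A p = (SOME c. c \<in> A \<and> p \<in> fst c)"

text \<open>
  The genus is the maximal number of disjoint simple closed curves which together do not
  separate the surface.
\<close>

definition genus :: "'m::topological_space set \<Rightarrow> enat" where
  "genus S = (SUP n \<in> {n. \<exists>\<gamma> :: nat \<Rightarrow> real \<Rightarrow> 'm.
      (\<forall>i<n. simple_path (\<gamma> i) \<and> pathfinish (\<gamma> i) = pathstart (\<gamma> i) \<and> path_image (\<gamma> i) \<subseteq> S) \<and>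
      disjoint_family_on (\<lambda>i. path_image (\<gamma> i)) {..<n} \<and>
      connected (S - (\<Union>i<n. path_image (\<gamma> i)))}. enat n)"


section \<open>Riemannian metrics, curvature and area\<close>

text \<open>
  A tensor field is given by its components at each point with respect to each chart, subject to
  the transformation law: \<^term>\<open>g c p\<close> is the Gram matrix of the coordinate vector fields
  of \<^term>\<open>c\<close> at \<^term>\<open>p\<close>. Components at points outside the domain of the chart are
  irrelevant.
\<close>

type_synonym 'm metric_field = "'m chart \<Rightarrow> 'm \<Rightarrow> real^2^2"
type_synonym 'm covector_field = "'m chart \<Rightarrow> 'm \<Rightarrow> real^2"

definition riemannian_metric :: "'m chart set \<Rightarrow> 'm metric_field \<Rightarrow> bool" where
  "riemannian_metric A g \<longleftrightarrow>
    (\<forall>c\<in>A.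
      (\<forall>i j. smooth_on (snd c ` fst c) (\<lambda>x. g c (chart_inv c x) $ i $ j)) \<and>
      (\<forall>p\<in>fst c. transpose (g c p) = g c p \<and> (\<forall>v. v \<noteq> 0 \<longrightarrow> v \<bullet> (g c p *v v) > 0))) \<and>
    (\<forall>c\<in>A. \<forall>d\<in>A. \<forall>p\<in>fst c \<inter> fst d.
      g c p = transpose (tangent_matrix c d id p) ** g d p ** tangent_matrix c d id p)"

definition conformally_equivalent ::
  "'m chart set \<Rightarrow> 'm metric_field \<Rightarrow> 'm metric_field \<Rightarrow> bool" where
  "conformally_equivalent A g h \<longleftrightarrow>
    (\<exists>u. smooth_fun A u \<and> (\<forall>c\<in>A. \<forall>p\<in>fst c. g c p = exp (2 * u p) *\<^sub>R h c p))"

definition christoffel :: "(real^2 \<Rightarrow> real^2^2) \<Rightarrow> 2 \<Rightarrow> 2 \<Rightarrow> 2 \<Rightarrow> real^2 \<Rightarrow> real" where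
  "christoffel G k i j x = 1/2 * (\<Sum>l\<in>UNIV. matrix_inv (G x) $ k $ l *
      (partial_deriv i (\<lambda>y. G y $ j $ l) x + partial_deriv j (\<lambda>y. G y $ i $ l) x
        - partial_deriv l (\<lambda>y. G y $ i $ j) x))"

(* The l-th component of R(d_i, d_j) d_k, where
   R(X, Y) Z = nabla_X nabla_Y Z - nabla_Y nabla_X Z - nabla_[X,Y] Z. *)
definition riemann_tensor :: "(real^2 \<Rightarrow> real^2^2) \<Rightarrow> 2 \<Rightarrow> 2 \<Rightarrow> 2 \<Rightarrow> 2 \<Rightarrow> real^2 \<Rightarrow> real" where
  "riemann_tensor G l i j k x =
    partial_deriv i (christoffel G l j k) x - partial_deriv j (christoffel G l i k) x
    + (\<Sum>m\<in>UNIV. christoffel G l i m x * christoffel G m j k x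
                - christoffel G l j m x * christoffel G m i k x)"

(* K = <R(d_1, d_2) d_2, d_1> / det g, computed in the chart c *)
definition gauss_curvature :: "'m metric_field \<Rightarrow> 'm chart \<Rightarrow> 'm \<Rightarrow> real" where
  "gauss_curvature g c p =
    (let G = (\<lambda>x. g c (chart_inv c x)); x = snd c p
     in (\<Sum>l\<in>UNIV. G x $ 1 $ l * riemann_tensor G l 1 2 2 x) / det (G x))"

definition hyperbolic_metric :: "'m chart set \<Rightarrow> 'm metric_field \<Rightarrow> bool" where
  "hyperbolic_metric A g \<longleftrightarrow>
    riemannian_metric A g \<and> (\<forall>c\<in>A. \<forall>p\<in>fst c. gauss_curvature g c p = -1)"

definition nonpositively_curved :: "'m chart set \<Rightarrow> 'm metric_field \<Rightarrow> bool" where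
  "nonpositively_curved A g \<longleftrightarrow> (\<forall>c\<in>A. \<forall>p\<in>fst c. gauss_curvature g c p \<le> 0)"

(* The unique Borel measure which is sqrt (det g) dx in every chart. *)
definition vol :: "'m::topological_space chart set \<Rightarrow> 'm metric_field \<Rightarrow> 'm measure" where
  "vol A g = (THE \<mu>. sets \<mu> = sets borel \<and>
    (\<forall>c\<in>A. \<forall>S\<in>sets borel. S \<subseteq> fst c \<longrightarrow>
      emeasure \<mu> S = (\<integral>\<^sup>+x. ennreal (sqrt (det (g c (chart_inv c x)))) * indicator (snd c ` S) x \<partial>lborel)))"

definition total_area :: "'m::topological_space chart set \<Rightarrow> 'm metric_field \<Rightarrow> real" where
  "total_area A g = measure (vol A g) UNIV"


section \<open>Sobolev spaces\<close>

definition covector_field :: "'m::topological_space chart set \<Rightarrow> 'm covector_field \<Rightarrow> bool" where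
  "covector_field A \<omega> \<longleftrightarrow>
    (\<forall>c\<in>A. set_borel_measurable borel (fst c) (\<omega> c)) \<and>
    (\<forall>c\<in>A. \<forall>d\<in>A. \<forall>p\<in>fst c \<inter> fst d.
      \<omega> c p = transpose (tangent_matrix c d id p) *v \<omega> d p)"

(* By the transformation laws the value does not depend on the choice of the chart. *)
definition covector_inner :: "'m chart set \<Rightarrow> 'm metric_field \<Rightarrow> 'm covector_field
    \<Rightarrow> 'm covector_field \<Rightarrow> 'm \<Rightarrow> real" where
  "covector_inner A g \<alpha> \<beta> p =
    (let c = chart_at A p in \<alpha> c p \<bullet> (matrix_inv (g c p) *v \<beta> c p))"

definition differential :: "('m \<Rightarrow> real) \<Rightarrow> 'm covector_field" where
  "differential f c p = (\<chi> i. partial_deriv i (f \<circ> chart_inv c) (snd c p))"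

definition test_fun :: "'m::topological_space chart set \<Rightarrow> ('m \<Rightarrow> real) \<Rightarrow> bool" where
  "test_fun A \<phi> \<longleftrightarrow> smooth_fun A \<phi> \<and> compact (closure {p. \<phi> p \<noteq> 0})"

definition L2 :: "'m::topological_space chart set \<Rightarrow> 'm metric_field \<Rightarrow> ('m \<Rightarrow> real) set" where
  "L2 A g = {f \<in> borel_measurable borel. integrable (vol A g) (\<lambda>p. (f p)\<^sup>2)}"

text \<open>
  The space \<^term>\<open>H1 A g\<close> below is the completion of the compactly supported smooth functions
  for the Sobolev norm, realised inside the square integrable functions. On a closed surface this
  is the usual space, since every smooth function has compact support; on a general surface it is
  the space with vanishing boundary values, which agrees with the full one if the metric is
  complete. \<open>H1_differential A g f \<omega>\<close> says that \<^term>\<open>\<omega>\<close> is the weak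
  differential of \<^term>\<open>f\<close>, which is unique up to null sets. Elements are functions, to be
  identified when they agree almost everywhere.
\<close>

definition H1_differential :: "'m::topological_space chart set \<Rightarrow> 'm metric_field \<Rightarrow> ('m \<Rightarrow> real)
    \<Rightarrow> 'm covector_field \<Rightarrow> bool" where
  "H1_differential A g f \<omega> \<longleftrightarrow>
    f \<in> L2 A g \<and> covector_field A \<omega> \<and> integrable (vol A g) (covector_inner A g \<omega> \<omega>) \<and>
    (\<exists>\<phi> :: nat \<Rightarrow> 'm \<Rightarrow> real. (\<forall>n. test_fun A (\<phi> n)) \<and>
      (\<lambda>n. \<integral>\<^sup>+p. ennreal ((f p - \<phi> n p)\<^sup>2) \<partial>vol A g) \<longlonglongrightarrow> 0 \<and>
      (\<lambda>n. \<integral>\<^sup>+p. ennreal (covector_inner A g (\<lambda>c q. \<omega> c q - differential (\<phi> n) c q)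
                                           (\<lambda>c q. \<omega> c q - differential (\<phi> n) c q) p) \<partial>vol A g)
        \<longlonglongrightarrow> 0)"

definition H1 :: "'m::topological_space chart set \<Rightarrow> 'm metric_field \<Rightarrow> ('m \<Rightarrow> real) set" where
  "H1 A g = {f. \<exists>\<omega>. H1_differential A g f \<omega>}"

definition weak_differential :: "'m::topological_space chart set \<Rightarrow> 'm metric_field
    \<Rightarrow> ('m \<Rightarrow> real) \<Rightarrow> 'm covector_field" where
  "weak_differential A g f = (SOME \<omega>. H1_differential A g f \<omega>)"


section \<open>Eigenvalues of the Laplacian\<close>

definition rayleigh_quotient :: "'m::topological_space chart set \<Rightarrow> 'm metric_field
    \<Rightarrow> ('m \<Rightarrow> real) \<Rightarrow> real" where
  "rayleigh_quotient A g f =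
    (LINT p|vol A g. covector_inner A g (weak_differential A g f) (weak_differential A g f) p) /
    (LINT p|vol A g. (f p)\<^sup>2)"

(* V is an n-dimensional subspace; linear independence is meant modulo null functions. *)
definition H1_subspace :: "'m::topological_space chart set \<Rightarrow> 'm metric_field \<Rightarrow> nat
    \<Rightarrow> ('m \<Rightarrow> real) set \<Rightarrow> bool" where
  "H1_subspace A g n V \<longleftrightarrow>
    (\<exists>b :: nat \<Rightarrow> 'm \<Rightarrow> real. (\<forall>i<n. b i \<in> H1 A g) \<and>
      (\<forall>a :: nat \<Rightarrow> real. (AE p in vol A g. (\<Sum>i<n. a i * b i p) = 0) \<longrightarrow> (\<forall>i<n. a i = 0)) \<and>
      V = range (\<lambda>a :: nat \<Rightarrow> real. \<lambda>p. \<Sum>i<n. a i * b i p))"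

definition eigenvalue :: "'m::topological_space chart set \<Rightarrow> 'm metric_field \<Rightarrow> nat \<Rightarrow> ereal" where
  "eigenvalue A g k =
    (INF V \<in> {V. H1_subspace A g (k + 1) V}.
      SUP f \<in> {f \<in> V. \<not> (AE p in vol A g. f p = 0)}. ereal (rayleigh_quotient A g f))"


section \<open>The universal cover and the bottom of its spectrum\<close>

definition universal_cover :: "'n::topological_space chart set \<Rightarrow> 'm::topological_space chart set
    \<Rightarrow> ('n \<Rightarrow> 'm) \<Rightarrow> bool" where
  "universal_cover B A \<pi> \<longleftrightarrow>
    smooth_atlas B \<and> simply_connected (UNIV :: 'n set) \<and> covering_space UNIV \<pi> UNIV \<and>
    smooth_map B A \<pi> \<and>
    (\<forall>d\<in>B. \<forall>c\<in>A. \<forall>x\<in>fst d \<inter> \<pi> -` fst c. invertible (tangent_matrix d c \<pi> x))"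

definition lifted_metric :: "'m chart set \<Rightarrow> ('n \<Rightarrow> 'm) \<Rightarrow> 'm metric_field \<Rightarrow> 'n metric_field" where
  "lifted_metric A \<pi> g d x =
    (let c = chart_at A (\<pi> x); J = tangent_matrix d c \<pi> x
     in transpose J ** g c (\<pi> x) ** J)"

text \<open>
  The nonnegative Laplacian as an unbounded operator on the square integrable functions, given by
  its graph: it is the self-adjoint (Friedrichs) extension of the Laplacian on compactly supported
  smooth functions, and the only one if the metric is complete. Since it is self-adjoint and real,
  its spectrum is the set of all real numbers \<open>z\<close> for which \<open>\<Delta> - z\<close> is not a bijection
  from the domain onto the real square integrable functions with bounded inverse.
\<close>

definition laplacian :: "'m::topological_space chart set \<Rightarrow> 'm metric_field \<Rightarrow> ('m \<Rightarrow> real)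
    \<Rightarrow> ('m \<Rightarrow> real) \<Rightarrow> bool" where
  "laplacian A g f h \<longleftrightarrow> f \<in> H1 A g \<and> h \<in> L2 A g \<and>
    (\<forall>\<phi>. test_fun A \<phi> \<longrightarrow>
      (LINT p|vol A g. covector_inner A g (weak_differential A g f) (differential \<phi>) p) =
      (LINT p|vol A g. h p * \<phi> p))"

(* Boundedness of the inverse includes injectivity modulo null functions. *)
definition L2_spectrum :: "'m::topological_space chart set \<Rightarrow> 'm metric_field \<Rightarrow> real set" where
  "L2_spectrum A g = {z. \<not> (
    (\<forall>w\<in>L2 A g. \<exists>f. laplacian A g f (\<lambda>p. w p + z * f p)) \<and>
    (\<exists>b. \<forall>f h. laplacian A g f h \<longrightarrow>
      (LINT p|vol A g. (f p)\<^sup>2) \<le> b * (LINT p|vol A g. (h p - z * f p)\<^sup>2)))}"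

definition spectrum_bottom :: "'m::topological_space chart set \<Rightarrow> 'm metric_field \<Rightarrow> ereal" where
  "spectrum_bottom A g = (INF z \<in> L2_spectrum A g. ereal z)"

end

(* The Dirichlet energy on a surface is conformally invariant. Hence, for g = exp (2 u) h, an upper
   bound exp (2 u) <= K gives lambda_k(g) >= lambda_k(h) / K, and likewise for the bottom of the
   spectrum of the lifted metrics. Nonpositive curvature of g gives such a bound, with K a constant
   depending only on h times the area of g: by the formula for the curvature of exp (2 u) h the
   Laplacian of u is bounded below, so w = exp (2 u) satisfies L w >= - kappa w for the divergence
   form L of the Laplacian, and the maximum of w is controlled by its integral, which is the area of
   g. This last step tests the inequality at a maximum point against a cut-off of the fundamental
   solution with frozen coefficients. For the first eigenvalue one also needs lambda_1(h) > 0, which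
   follows from the Poincare inequality on coordinate squares, chained along a finite cover. *)

theory Submission
  imports Defs
begin

section \<open>Calculus of smooth functions of two variables\<close>

text \<open>\<open>weak_differential\<close> is a \<open>SOME\<close> and
  \<open>spectrum_bottom\<close> is defined through the resolvent, so neither can be compared
  directly. The weak differential is first shown unique almost everywhere. The bottom of the
  spectrum is identified, without the spectral theorem, with the largest m such that m |\<phi>|^2
  \<le> |d\<phi>|^2 in L2 for all test functions: below such an m the Riesz theorem inverts Delta -
  z, and such an m outside the spectrum can be enlarged. Test functions have classical
  differentials, so on the cover this inequality is compared just as on the base; what it needs
  there is the bound on u, which lifts with u.

  The sup bound is only needed at a maximum point x0 of u. Then w \<le> w(x0) on the whole box, so
  the error of the test function, of size 1 / |x - x0|, contributes at most a small multiple of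
  w(x0) near x0, which is absorbed, and elsewhere at most a multiple of the integral of w. The
  constant has to be fixed before g, u and x0, since it must be uniform in g; this dictates the
  quantifiers of the local lemmas.\<close>

lemma partial_deriv_eqI: "(f has_derivative f') (at x) ==> partial_deriv i f x = f' (axis i 1)"
  unfolding partial_deriv_def by (metis frechet_derivative_at)

lemma partial_deriv_cong_open:
  assumes "open S" "x \<in> S" "\<And>y. y \<in> S ==> f y = g y"
  shows "partial_deriv i f x = partial_deriv i g x"
proof -
  have "(f has_derivative f') (at x) \<longleftrightarrow> (g has_derivative f') (at x)" for f'
    using has_derivative_transform_within_open[of _ f' x UNIV S] assms by metis
  then show ?thesis unfolding partial_deriv_def frechet_derivative_def by simp
qed

lemma differentiable_on_openD: "f differentiable_on S ==> open S ==> x \<in> S ==> f differentiable (at x)"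
  by (metis differentiable_on_eq_differentiable_at)

lemma C_k_on_cong:
  assumes "open S" "\<And>y. y \<in> S ==> f y = g y" "C_k_on k S f"
  shows "C_k_on k S g"
  using assms
proof (induction k arbitrary: f g)
  case 0
  then show ?case using continuous_on_cong by fastforce
next
  case (Suc k)
  have "g differentiable_on S"
    unfolding differentiable_on_eq_differentiable_at[OF Suc.prems(1)]
    unfolding differentiable_def
  proof
    fix x assume "x \<in> S"
    then obtain f' where "(f has_derivative f') (at x)"
      using Suc.prems differentiable_on_openD[of f S x] by (auto simp: differentiable_def)
    then have "(g has_derivative f') (at x)"
      using has_derivative_transform_within_open Suc.prems(1,2) \<open>x \<in> S\<close> by blast
    then show "\<exists>D. (g has_derivative D) (at x)" by blast
  qed
  moreover have "C_k_on k S (partial_deriv i g)" for i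
    using Suc.IH[of "partial_deriv i f" "partial_deriv i g"] Suc.prems
      partial_deriv_cong_open[OF Suc.prems(1) _ Suc.prems(2)] by auto
  ultimately show ?case by simp
qed

lemma C_k_on_Suc_D: "C_k_on (Suc k) S f ==> C_k_on k S f"
  by (induction k arbitrary: f) (auto intro: differentiable_imp_continuous_on)

lemma C_k_on_const: "C_k_on k S (\<lambda>x. c)"
proof (induction k arbitrary: c)
  case (Suc k)
  have "partial_deriv i (\<lambda>x. c) = (\<lambda>x. 0)" for i
    by (rule ext) (rule partial_deriv_eqI[of _ "\<lambda>x. 0"], auto)
  with Suc show ?case by simp
qed auto

lemma C_k_on_coord: "C_k_on k S (\<lambda>x. x $ j)"
proof (cases k)
  case (Suc k)
  have "partial_deriv i (\<lambda>x. x $ j) = (\<lambda>x. axis i 1 $ j)" for i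
    by (rule ext, rule partial_deriv_eqI) (simp add: bounded_linear_imp_has_derivative bounded_linear_vec_nth)
  then show ?thesis using Suc C_k_on_const
    by (simp add: differentiable_on_def bounded_linear_imp_differentiable bounded_linear_vec_nth)
qed (auto intro!: continuous_intros)

lemma partial_deriv_add:
  "f differentiable (at x) ==> g differentiable (at x) ==>
    partial_deriv i (\<lambda>y. f y + g y) x = partial_deriv i f x + partial_deriv i g x"
  by (rule trans, rule partial_deriv_eqI[OF has_derivative_add])
     (auto simp: frechet_derivative_works[symmetric] partial_deriv_def)

lemma partial_deriv_mult:
  "f differentiable (at x) ==> g differentiable (at x) ==>
    partial_deriv i (\<lambda>y. f y * g y) x = f x * partial_deriv i g x + partial_deriv i f x * g x"
  by (rule trans, rule partial_deriv_eqI[OF has_derivative_mult])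
     (auto simp: frechet_derivative_works[symmetric] partial_deriv_def)

lemma partial_deriv_compose:
  assumes "f differentiable (at x)" "(F has_field_derivative d) (at (f x))"
  shows "partial_deriv i (\<lambda>y. F (f y)) x = d * partial_deriv i f x"
proof -
  have "(f has_derivative frechet_derivative f (at x)) (at x)"
    using assms(1) frechet_derivative_works by blast
  from partial_deriv_eqI[OF DERIV_compose_FDERIV[OF assms(2) this], of i]
  show ?thesis by (simp add: partial_deriv_def mult.commute)
qed

lemma differentiable_compose_real:
  fixes f :: "real^2 \<Rightarrow> real" and F :: "real \<Rightarrow> real"
  assumes "f differentiable (at x)" "(F has_field_derivative d) (at (f x))"
  shows "(\<lambda>y. F (f y)) differentiable (at x)"
proof -
  have "(f has_derivative frechet_derivative f (at x)) (at x)"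
    using assms(1) frechet_derivative_works by blast
  from DERIV_compose_FDERIV[OF assms(2) this] show ?thesis unfolding differentiable_def by blast
qed

lemma C_k_on_add:
  assumes "open S" "C_k_on k S f" "C_k_on k S g" shows "C_k_on k S (\<lambda>x. f x + g x)"
  using assms
proof (induction k arbitrary: f g)
  case (Suc k)
  have "C_k_on k S (partial_deriv i (\<lambda>x. f x + g x))" for i
  proof (rule C_k_on_cong[OF Suc.prems(1)])
    show "C_k_on k S (\<lambda>x. partial_deriv i f x + partial_deriv i g x)"
      using Suc.prems by (intro Suc.IH) auto
    show "partial_deriv i f y + partial_deriv i g y = partial_deriv i (\<lambda>x. f x + g x) y" if "y \<in> S" for y
      using Suc.prems that by (subst partial_deriv_add) (auto dest: differentiable_on_openD)
  qed
  with Suc.prems show ?case by (auto intro: differentiable_on_add)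
qed (auto intro!: continuous_intros)

lemma C_k_on_mult:
  assumes "open S" "C_k_on k S f" "C_k_on k S g" shows "C_k_on k S (\<lambda>x. f x * g x)"
  using assms
proof (induction k arbitrary: f g)
  case (Suc k)
  have "C_k_on k S (partial_deriv i (\<lambda>x. f x * g x))" for i
  proof (rule C_k_on_cong[OF Suc.prems(1)])
    show "C_k_on k S (\<lambda>x. f x * partial_deriv i g x + partial_deriv i f x * g x)"
      using Suc.prems C_k_on_Suc_D[OF Suc.prems(2)] C_k_on_Suc_D[OF Suc.prems(3)]
      by (intro C_k_on_add Suc.IH) auto
    show "f y * partial_deriv i g y + partial_deriv i f y * g y = partial_deriv i (\<lambda>x. f x * g x) y" if "y \<in> S" for y
      using Suc.prems that by (subst partial_deriv_mult) (auto dest: differentiable_on_openD)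
  qed
  with Suc.prems show ?case by (auto intro: differentiable_on_mult)
qed (auto intro!: continuous_intros)

text \<open>The outer function comes with all its derivatives, as a sequence in which
  \<open>F (Suc n)\<close> differentiates \<open>F n\<close>. This is what the induction needs: by
  the chain rule a partial derivative of \<open>F n\<close> after f is \<open>F (Suc n)\<close>
  after f times a partial derivative of f, so n has to be arbitrary.\<close>

lemma C_k_on_compose:
  fixes F :: "nat \<Rightarrow> real \<Rightarrow> real"
  assumes "open S" "\<And>n t. t \<in> T ==> (F n has_field_derivative F (Suc n) t) (at t)"
    and "C_k_on k S f" "\<And>x. x \<in> S ==> f x \<in> T"
  shows "C_k_on k S (\<lambda>x. F n (f x))"
  using assms(3)
proof (induction k arbitrary: n)
  case 0
  have "continuous_on T (F n)" for n
    using assms(2) by (meson DERIV_isCont continuous_at_imp_continuous_on)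
  then show ?case using 0 assms(4) continuous_on_compose2[of T "F n" S f] by auto
next
  case (Suc k)
  have d: "f differentiable (at x)" if "x \<in> S" for x
    using Suc.prems that assms(1) by (auto dest: differentiable_on_openD)
  have "C_k_on k S (partial_deriv i (\<lambda>x. F n (f x)))" for i
  proof (rule C_k_on_cong[OF assms(1)])
    show "C_k_on k S (\<lambda>x. F (Suc n) (f x) * partial_deriv i f x)"
      using Suc.prems C_k_on_Suc_D[OF Suc.prems] by (intro C_k_on_mult assms Suc.IH) auto
    show "F (Suc n) (f y) * partial_deriv i f y = partial_deriv i (\<lambda>x. F n (f x)) y" if "y \<in> S" for y
      by (rule partial_deriv_compose[symmetric, OF d assms(2)[OF assms(4)]]) (use that in auto)
  qed
  moreover have "(\<lambda>x. F n (f x)) differentiable (at x)" if "x \<in> S" for x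
    using that by (intro differentiable_compose_real[OF d assms(2)[OF assms(4)]])
  ultimately show ?case by (auto intro: differentiable_at_imp_differentiable_on)
qed

lemma smooth_on_cong: "open S ==> (\<And>y. y \<in> S ==> f y = g y) ==> smooth_on S f ==> smooth_on S g"
  unfolding smooth_on_def by (metis C_k_on_cong)

lemma smooth_on_imp_continuous_on: "smooth_on S f ==> continuous_on S f"
  unfolding smooth_on_def by (metis C_k_on.simps(1))

lemma smooth_on_imp_differentiable: "smooth_on S f ==> open S ==> x \<in> S ==> f differentiable (at x)"
  unfolding smooth_on_def by (metis C_k_on.simps(2) differentiable_on_openD)

lemma smooth_on_const [simp]: "smooth_on S (\<lambda>x. c)"
  unfolding smooth_on_def by (simp add: C_k_on_const)

lemma smooth_on_coord [simp]: "smooth_on S (\<lambda>x. x $ j)"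
  unfolding smooth_on_def by (simp add: C_k_on_coord)

lemma smooth_on_partial: "smooth_on S f ==> smooth_on S (partial_deriv i f)"
  unfolding smooth_on_def by (metis C_k_on.simps(2))

lemma smooth_on_add: "open S ==> smooth_on S f ==> smooth_on S g ==> smooth_on S (\<lambda>x. f x + g x)"
  unfolding smooth_on_def by (simp add: C_k_on_add)

lemma smooth_on_mult: "open S ==> smooth_on S f ==> smooth_on S g ==> smooth_on S (\<lambda>x. f x * g x)"
  unfolding smooth_on_def by (simp add: C_k_on_mult)

lemma smooth_on_minus: "open S ==> smooth_on S f ==> smooth_on S (\<lambda>x. - f x)"
  using smooth_on_mult[of S "\<lambda>x. -1" f] by simp

lemma smooth_on_diff: "open S ==> smooth_on S f ==> smooth_on S g ==> smooth_on S (\<lambda>x. f x - g x)"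
  using smooth_on_add[of S f "\<lambda>x. - g x"] smooth_on_minus[of S g] by simp

lemma smooth_on_power: "open S ==> smooth_on S f ==> smooth_on S (\<lambda>x. f x ^ n)"
  by (induction n) (auto intro: smooth_on_mult)

lemma smooth_on_sum: "open S ==> (\<And>i. i \<in> I ==> smooth_on S (f i)) ==> smooth_on S (\<lambda>x. \<Sum>i\<in>I. f i x)"
  by (induction I rule: infinite_finite_induct) (auto intro: smooth_on_add)

lemma smooth_on_exp: "open S ==> smooth_on S f ==> smooth_on S (\<lambda>x. exp (f x))"
  unfolding smooth_on_def using C_k_on_compose[of S UNIV "\<lambda>n. exp"] by (auto intro: DERIV_exp)

lemma smooth_on_powr:
  assumes "open S" "smooth_on S f" "\<And>x. x \<in> S ==> f x > 0"
  shows "smooth_on S (\<lambda>x. f x powr a)"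
proof -
  \<comment> \<open>The n-th derivative of t powr a: a falling factorial times a lower
    power.\<close>
  define F where "F n t = (\<Prod>j<n. a - real j) * t powr (a - real n)" for n and t :: real
  have "(F n has_field_derivative F (Suc n) t) (at t)" if "t \<in> {0<..}" for n t
    unfolding F_def using DERIV_cmult[OF has_real_derivative_powr[of t "a - real n"], of "\<Prod>j<n. a - real j"] that
    by (simp add: mult.assoc diff_diff_eq add.commute)
  then have "C_k_on k S (\<lambda>x. F 0 (f x))" for k
    by (rule C_k_on_compose[of S "{0<..}" F k f 0, OF assms(1)])
      (use assms in \<open>auto simp: smooth_on_def\<close>)
  then show ?thesis by (simp add: F_def smooth_on_def)
qed

lemma smooth_on_inverse:
  assumes "open S" "smooth_on S f" "\<And>x. x \<in> S ==> f x > 0"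
  shows "smooth_on S (\<lambda>x. inverse (f x))"
proof (rule smooth_on_cong[OF assms(1) _ smooth_on_powr[OF assms, of "-1"]])
  show "f y powr - 1 = inverse (f y)" if "y \<in> S" for y
    using assms(3)[OF that] by (simp add: powr_minus)
qed auto

lemma smooth_on_divide:
  "open S ==> smooth_on S g ==> smooth_on S f ==> (\<And>x. x \<in> S ==> f x > 0) ==> smooth_on S (\<lambda>x. g x / f x)"
  using smooth_on_mult[of S g "\<lambda>x. inverse (f x)"] smooth_on_inverse[of S f] by (simp add: divide_inverse)

lemma smooth_on_sqrt:
  assumes "open S" "smooth_on S f" "\<And>x. x \<in> S ==> f x > 0"
  shows "smooth_on S (\<lambda>x. sqrt (f x))"
proof (rule smooth_on_cong[OF assms(1) _ smooth_on_powr[OF assms, of "1/2"]])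
  show "f y powr (1/2) = sqrt (f y)" if "y \<in> S" for y
    using assms(3)[OF that] by (simp add: powr_half_sqrt)
qed auto

text \<open>Only the first derivative is computed; it is a partial derivative of f over f, whose
  smoothness is known from \<open>smooth_on_inverse\<close>. So the function is C^(k+1) for every k,
  and with it C^k.\<close>

lemma smooth_on_ln:
  assumes "open S" "smooth_on S f" "\<And>x. x \<in> S ==> f x > 0"
  shows "smooth_on S (\<lambda>x. ln (f x))"
proof -
  have d: "f differentiable (at x)" if "x \<in> S" for x
    using assms that by (auto intro: smooth_on_imp_differentiable)
  have *: "C_k_on k S (partial_deriv i (\<lambda>x. ln (f x)))" for i k
  proof (rule C_k_on_cong[OF assms(1)])
    show "C_k_on k S (\<lambda>x. inverse (f x) * partial_deriv i f x)"
      using smooth_on_mult[OF assms(1) smooth_on_inverse[OF assms] smooth_on_partial[OF assms(2)]]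
      by (simp add: smooth_on_def)
    show "inverse (f y) * partial_deriv i f y = partial_deriv i (\<lambda>x. ln (f x)) y" if "y \<in> S" for y
      using d[OF that] assms(3)[OF that]
      by (intro partial_deriv_compose[symmetric]) (auto intro!: derivative_eq_intros simp: field_simps)
  qed
  have "(\<lambda>x. ln (f x)) differentiable (at x)" if "x \<in> S" for x
    using that by (intro differentiable_compose_real[OF d DERIV_ln[OF assms(3)]])
  then have "C_k_on (Suc k) S (\<lambda>x. ln (f x))" for k
    using * by (auto intro: differentiable_at_imp_differentiable_on)
  then show ?thesis unfolding smooth_on_def by (metis C_k_on_Suc_D)
qed

lemma smooth_on_has_derivative:
  assumes "f differentiable (at x)"
  shows "(f has_derivative (\<lambda>h. h $ 1 * partial_deriv 1 f x + h $ 2 * partial_deriv 2 f x)) (at x)"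
proof -
  interpret bounded_linear "frechet_derivative f (at x)"
    using assms frechet_derivative_works has_derivative_bounded_linear by blast
  have "frechet_derivative f (at x) h = h $ 1 * partial_deriv 1 f x + h $ 2 * partial_deriv 2 f x" for h
  proof -
    have "h = h $ 1 *\<^sub>R axis 1 1 + h $ 2 *\<^sub>R axis 2 1"
      by (simp add: vec_eq_iff forall_2 axis_def)
    then show ?thesis unfolding partial_deriv_def by (metis add scaleR real_scaleR_def)
  qed
  then have "frechet_derivative f (at x) = (\<lambda>h. h $ 1 * partial_deriv 1 f x + h $ 2 * partial_deriv 2 f x)"
    by blast
  then show ?thesis using assms by (metis frechet_derivative_works)
qed

lemma partial_deriv_has_field_derivative:
  assumes "f differentiable (at (a + t *\<^sub>R axis i 1))"
  shows "((\<lambda>s. f (a + s *\<^sub>R axis i 1)) has_field_derivative partial_deriv i f (a + t *\<^sub>R axis i 1)) (at t)"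
proof -
  let ?f' = "frechet_derivative f (at (a + t *\<^sub>R axis i 1))"
  have "((\<lambda>s. f (a + s *\<^sub>R axis i 1)) has_derivative (\<lambda>h. ?f' (h *\<^sub>R axis i 1))) (at t)"
    by (rule has_derivative_compose[of "\<lambda>s. a + s *\<^sub>R axis i 1" "\<lambda>h. h *\<^sub>R axis i 1" t UNIV f])
      (use assms in \<open>auto intro!: derivative_eq_intros simp: frechet_derivative_works[symmetric]\<close>)
  moreover have "?f' (h *\<^sub>R axis i 1) = ?f' (axis i 1) * h" for h
    using linear_cmul[OF has_derivative_linear[OF assms[unfolded frechet_derivative_works]]] by simp
  then have "(\<lambda>h. ?f' (h *\<^sub>R axis i 1)) = (*) (?f' (axis i 1))" by blast
  ultimately show ?thesis
    unfolding has_field_derivative_def partial_deriv_def by metis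
qed

text \<open>The mean value theorem is applied twice to the second difference, first in direction i
  and then in direction j. The difference is symmetric in i and j while the mixed derivative is
  taken in a definite order, so two instances compare the two orders.\<close>

lemma mixed_difference_mvt:
  assumes "0 < h" "\<And>s t. 0 \<le> s ==> s \<le> h ==> 0 \<le> t ==> t \<le> h ==> x + s *\<^sub>R axis i 1 + t *\<^sub>R axis j 1 \<in> S"
    and "open S" "smooth_on S f"
  shows "\<exists>s t. 0 \<le> s \<and> s \<le> h \<and> 0 \<le> t \<and> t \<le> h \<and>
    f (x + h *\<^sub>R axis i 1 + h *\<^sub>R axis j 1) - f (x + h *\<^sub>R axis i 1) - f (x + h *\<^sub>R axis j 1) + f x
      = h * h * partial_deriv j (partial_deriv i f) (x + s *\<^sub>R axis i 1 + t *\<^sub>R axis j 1)"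
proof -
  let ?p = "\<lambda>s. f (x + h *\<^sub>R axis j 1 + s *\<^sub>R axis i 1) - f (x + s *\<^sub>R axis i 1)"
  have in1: "x + h *\<^sub>R axis j 1 + s *\<^sub>R axis i 1 \<in> S" if "0 \<le> s" "s \<le> h" for s
    using assms(2)[of s h] that \<open>0 < h\<close> by (simp add: algebra_simps)
  have in2: "x + s *\<^sub>R axis i 1 \<in> S" if "0 \<le> s" "s \<le> h" for s
    using assms(2)[of s 0] that \<open>0 < h\<close> by (simp add: algebra_simps)
  have "\<exists>s>0. s < h \<and> ?p h - ?p 0 = (h - 0) * (partial_deriv i f (x + h *\<^sub>R axis j 1 + s *\<^sub>R axis i 1)
        - partial_deriv i f (x + s *\<^sub>R axis i 1))"
    by (rule MVT2[OF \<open>0 < h\<close>], rule DERIV_diff;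
        intro partial_deriv_has_field_derivative smooth_on_imp_differentiable[OF assms(4,3)] in1 in2) auto
  then obtain s where s: "0 < s" "s < h" and
    e1: "?p h - ?p 0 = h * (partial_deriv i f (x + h *\<^sub>R axis j 1 + s *\<^sub>R axis i 1)
        - partial_deriv i f (x + s *\<^sub>R axis i 1))" by auto
  have "\<exists>t>0. t < h \<and> partial_deriv i f (x + s *\<^sub>R axis i 1 + h *\<^sub>R axis j 1)
       - partial_deriv i f (x + s *\<^sub>R axis i 1 + 0 *\<^sub>R axis j 1)
       = (h - 0) * partial_deriv j (partial_deriv i f) (x + s *\<^sub>R axis i 1 + t *\<^sub>R axis j 1)"
    by (rule MVT2[OF \<open>0 < h\<close>],
        intro partial_deriv_has_field_derivative smooth_on_imp_differentiable[OF smooth_on_partial[OF assms(4)] assms(3)] assms(2))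
      (use s in auto)
  then obtain t where t: "0 < t" "t < h" and
    e2: "partial_deriv i f (x + s *\<^sub>R axis i 1 + h *\<^sub>R axis j 1) - partial_deriv i f (x + s *\<^sub>R axis i 1)
       = h * partial_deriv j (partial_deriv i f) (x + s *\<^sub>R axis i 1 + t *\<^sub>R axis j 1)" by auto
  show ?thesis
    using s t e1 e2 by (intro exI[of _ s] exI[of _ t]) (auto simp: algebra_simps)
qed

text \<open>Schwarz's theorem: the same second difference equals h^2 times either mixed derivative
  at some point near x, so different values at x would contradict continuity.\<close>

lemma partial_deriv_commute:
  assumes "open S" "smooth_on S f" "x \<in> S"
  shows "partial_deriv j (partial_deriv i f) x = partial_deriv i (partial_deriv j f) x"
proof (rule ccontr)
  let ?F = "partial_deriv j (partial_deriv i f)" and ?G = "partial_deriv i (partial_deriv j f)"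
  assume neq: "?F x \<noteq> ?G x"
  define e where "e = \<bar>?F x - ?G x\<bar> / 2"
  have e: "e > 0" using neq by (simp add: e_def)
  have cF: "isCont ?F x" and cG: "isCont ?G x"
    using smooth_on_imp_continuous_on[OF smooth_on_partial[OF smooth_on_partial[OF assms(2)]]] assms(1,3)
    by (auto simp: continuous_on_eq_continuous_at)
  obtain d1 where d1: "d1 > 0" "\<And>y. dist y x < d1 ==> dist (?F y) (?F x) < e"
    using cF e unfolding continuous_at_eps_delta by metis
  obtain d2 where d2: "d2 > 0" "\<And>y. dist y x < d2 ==> dist (?G y) (?G x) < e"
    using cG e unfolding continuous_at_eps_delta by metis
  obtain d3 where d3: "d3 > 0" "ball x d3 \<subseteq> S"
    using assms open_contains_ball by blast
  \<comment> \<open>Points x + s e_i + t e_j with s, t \<le> h lie within 2 h of x, so a third of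
    each radius leaves a strict inequality.\<close>
  define h where "h = min d1 (min d2 d3) / 3"
  have h: "h > 0" "3 * h \<le> d1" "3 * h \<le> d2" "3 * h \<le> d3" using d1 d2 d3 by (auto simp: h_def)
  have near: "dist (x + s *\<^sub>R axis i 1 + t *\<^sub>R axis j 1) x < 3 * h"
    if "0 \<le> s" "s \<le> h" "0 \<le> t" "t \<le> h" for s t i j
  proof -
    have "dist (x + s *\<^sub>R axis i 1 + t *\<^sub>R axis j 1) x = norm (s *\<^sub>R axis i 1 + t *\<^sub>R axis j (1::real) :: real^2)"
      by (simp add: dist_norm add.commute)
    also have "\<dots> \<le> s + t" by (rule order_trans[OF norm_triangle_ineq]) (use that in auto)
    finally show ?thesis using that h by linarith
  qed
  have inS: "x + s *\<^sub>R axis i 1 + t *\<^sub>R axis j 1 \<in> S"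
    if "0 \<le> s" "s \<le> h" "0 \<le> t" "t \<le> h" for s t i j
    using near[OF that, of i j] d3 h by (auto simp: dist_commute subset_iff)
  obtain s t where st: "0 \<le> s" "s \<le> h" "0 \<le> t" "t \<le> h" and 1:
    "f (x + h *\<^sub>R axis i 1 + h *\<^sub>R axis j 1) - f (x + h *\<^sub>R axis i 1) - f (x + h *\<^sub>R axis j 1) + f x
      = h * h * ?F (x + s *\<^sub>R axis i 1 + t *\<^sub>R axis j 1)"
    using mixed_difference_mvt[OF h(1) _ assms(1,2), of x i j] inS by blast
  obtain s' t' where st': "0 \<le> s'" "s' \<le> h" "0 \<le> t'" "t' \<le> h" and 2:
    "f (x + h *\<^sub>R axis j 1 + h *\<^sub>R axis i 1) - f (x + h *\<^sub>R axis j 1) - f (x + h *\<^sub>R axis i 1) + f x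
      = h * h * ?G (x + s' *\<^sub>R axis j 1 + t' *\<^sub>R axis i 1)"
    using mixed_difference_mvt[OF h(1) _ assms(1,2), of x j i] inS by blast
  have "h * h * ?F (x + s *\<^sub>R axis i 1 + t *\<^sub>R axis j 1) = h * h * ?G (x + s' *\<^sub>R axis j 1 + t' *\<^sub>R axis i 1)"
    using 1 2 by (simp add: algebra_simps)
  then have "?F (x + s *\<^sub>R axis i 1 + t *\<^sub>R axis j 1) = ?G (x + s' *\<^sub>R axis j 1 + t' *\<^sub>R axis i 1)"
    using h by simp
  moreover have "dist (?F (x + s *\<^sub>R axis i 1 + t *\<^sub>R axis j 1)) (?F x) < e"
    by (rule d1) (use near[OF st, of i j] h in linarith)
  moreover have "dist (?G (x + s' *\<^sub>R axis j 1 + t' *\<^sub>R axis i 1)) (?G x) < e"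
    by (rule d2) (use near[OF st', of j i] h in linarith)
  ultimately show False unfolding e_def dist_real_def by (auto simp: abs_if split: if_splits)
qed

section \<open>Surfaces and continuous metrics\<close>

lemma sets_borel_preimage_open:
  fixes f :: "'a::topological_space \<Rightarrow> 'b::topological_space"
  assumes "open U" "continuous_on U f" "S \<in> sets borel"
  shows "U \<inter> f -` S \<in> sets borel"
proof -
  have "f -` S \<inter> space (restrict_space borel U) \<in> sets (restrict_space borel U)"
    by (rule measurable_sets[OF borel_measurable_continuous_on_restrict[OF assms(2)] assms(3)])
  then show ?thesis
    using assms(1) by (subst (asm) sets_restrict_space_iff) (auto simp: space_restrict_space Int_commute)
qed

lemma differentiable_vec_componentwise:
  fixes f :: "'a::real_normed_vector \<Rightarrow> real^'n::finite"
  assumes "\<And>i. (\<lambda>x. f x $ i) differentiable (at a)"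
  shows "f differentiable (at a)"
proof -
  obtain f' where f': "\<And>i. ((\<lambda>x. f x $ i) has_derivative f' i) (at a)"
    using assms unfolding differentiable_def by metis
  have "(f has_derivative (\<lambda>h. \<chi> i. f' i h)) (at a)"
    using f' by (subst has_derivative_componentwise_within) (auto simp: Basis_vec_def inner_axis)
  then show ?thesis by (auto simp: differentiable_def)
qed

lemma jacobian_eqI:
  fixes f :: "real^'n \<Rightarrow> real^'m"
  assumes "(f has_derivative (\<lambda>h. M *v h)) (at x)" shows "jacobian f (at x) = M"
  unfolding jacobian_def using frechet_derivative_at[OF assms] by (metis matrix_of_matrix_vector_mul)

lemma jacobian_has_derivative:
  fixes f :: "real^'n \<Rightarrow> real^'m"
  assumes "f differentiable (at x)"
  shows "(f has_derivative (\<lambda>h. jacobian f (at x) *v h)) (at x)"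
  using assms jacobian_works by blast

lemma matrix_inv_eqI:
  fixes M N :: "real^'n^'n"
  assumes "M ** N = mat 1"
  shows "matrix_inv M = N"
proof -
  have "N ** M = mat 1" using assms by (simp add: matrix_left_right_inverse)
  then have "M ** matrix_inv M = mat 1"
    unfolding matrix_inv_def using assms by (metis (mono_tags, lifting) someI_ex)
  then show ?thesis using \<open>N ** M = mat 1\<close>
    by (metis matrix_mul_assoc matrix_mul_lid matrix_mul_rid)
qed

locale surface =
  fixes A :: "'m::{t2_space, second_countable_topology} chart set"
  assumes atlas: "smooth_atlas A"
begin

lemma open_dom: "c \<in> A ==> open (fst c)"
  and open_img: "c \<in> A ==> open (snd c ` fst c)"
  and chart_homeo: "c \<in> A ==> homeomorphism (fst c) (snd c ` fst c) (snd c) (chart_inv c)"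
  and cover: "(\<Union>c\<in>A. fst c) = UNIV"
  using atlas unfolding smooth_atlas_def by auto

lemma chart_inv_snd [simp]: "c \<in> A ==> p \<in> fst c ==> chart_inv c (snd c p) = p"
  using chart_homeo homeomorphism_apply1 by blast

lemma snd_chart_inv [simp]: "c \<in> A ==> x \<in> snd c ` fst c ==> snd c (chart_inv c x) = x"
  using chart_homeo homeomorphism_apply2 by blast

lemma chart_inv_in [simp]: "c \<in> A ==> x \<in> snd c ` fst c ==> chart_inv c x \<in> fst c"
  by auto

lemma continuous_chart: "c \<in> A ==> continuous_on (fst c) (snd c)"
  and continuous_chart_inv: "c \<in> A ==> continuous_on (snd c ` fst c) (chart_inv c)"
  using chart_homeo homeomorphism_cont1 homeomorphism_cont2 by blast+

lemma chart_at_in: "chart_at A p \<in> A" "p \<in> fst (chart_at A p)"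
proof -
  have "\<exists>c. c \<in> A \<and> p \<in> fst c" using cover by blast
  from someI_ex[OF this] show "chart_at A p \<in> A" "p \<in> fst (chart_at A p)"
    by (auto simp: chart_at_def)
qed

lemma image_eq_preimage: "c \<in> A ==> S \<subseteq> fst c ==> snd c ` S = snd c ` fst c \<inter> chart_inv c -` S"
  by (auto simp: subset_iff image_iff)

lemma open_image: "c \<in> A ==> open S ==> S \<subseteq> fst c ==> open (snd c ` S)"
  using continuous_open_preimage[OF continuous_chart_inv open_img] image_eq_preimage[of c S] by presburger

lemma borel_image: "c \<in> A ==> S \<in> sets borel ==> S \<subseteq> fst c ==> snd c ` S \<in> sets borel"
  using sets_borel_preimage_open[OF open_img continuous_chart_inv] image_eq_preimage[of c S] by presburger

lemma borel_dom [measurable]: "c \<in> A ==> fst c \<in> sets borel"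
  by (simp add: open_dom)

lemma transition_smooth:
  assumes "c \<in> A" "d \<in> A"
  shows "smooth_on (snd c ` (fst c \<inter> fst d)) (\<lambda>x. in_charts c d id x $ i)"
  using atlas assms unfolding smooth_atlas_def smooth_map_def by auto

lemma transition_differentiable:
  assumes "c \<in> A" "d \<in> A" "p \<in> fst c" "p \<in> fst d"
  shows "in_charts c d id differentiable (at (snd c p))"
  by (intro differentiable_vec_componentwise smooth_on_imp_differentiable[OF transition_smooth[OF assms(1,2)]]
      open_image assms open_Int open_dom) (use assms in auto)

end

section \<open>Chain rule for maps and functions in charts\<close>

text \<open>\<open>chart_inv\<close> is meaningless outside the chart image, so composing the
  coordinate expressions of F and G gives that of \<open>G \<circ> F\<close> only where F maps into
  the domain of d. This is an open set around the point, which is enough to transfer the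
  derivative.\<close>

lemma tangent_matrix_compose:
  fixes A :: "'m::{t2_space, second_countable_topology} chart set"
    and B :: "'n::{t2_space, second_countable_topology} chart set"
  assumes "surface A" "surface B" "c \<in> A" "d \<in> B" "p \<in> fst c" "F p \<in> fst d"
    and "continuous_on UNIV F"
    and "in_charts c d F differentiable (at (snd c p))"
    and "in_charts d e G differentiable (at (snd d (F p)))"
  shows "tangent_matrix c e (G \<circ> F) p = tangent_matrix d e G (F p) ** tangent_matrix c d F p"
    and "in_charts c e (G \<circ> F) differentiable (at (snd c p))"
proof -
  interpret A: surface A by fact
  interpret B: surface B by fact
  let ?S = "snd c ` (fst c \<inter> F -` fst d)"
  have "open (F -` fst d)"
    using assms(4,7) by (auto intro!: open_vimage B.open_dom)
  then have o: "open ?S" by (intro A.open_image assms open_Int A.open_dom) auto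
  have eq: "(in_charts d e G \<circ> in_charts c d F) x = in_charts c e (G \<circ> F) x" if "x \<in> ?S" for x
    using that assms(3,4) by (auto simp: in_charts_def)
  have at: "in_charts c d F (snd c p) = snd d (F p)" using assms by (simp add: in_charts_def)
  have "(in_charts d e G \<circ> in_charts c d F has_derivative
     (\<lambda>h. (tangent_matrix d e G (F p) ** tangent_matrix c d F p) *v h)) (at (snd c p))"
    using diff_chain_at[OF jacobian_has_derivative[OF assms(8)], of "in_charts d e G", unfolded at,
      OF jacobian_has_derivative[OF assms(9)]]
    by (simp add: o_def[of "\<lambda>h. _ *v h"] tangent_matrix_def matrix_vector_mul_assoc)
  then have *: "(in_charts c e (G \<circ> F) has_derivative
     (\<lambda>h. (tangent_matrix d e G (F p) ** tangent_matrix c d F p) *v h)) (at (snd c p))"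
    by (rule has_derivative_transform_within_open[OF _ o _ eq]) (use assms in auto)
  show "tangent_matrix c e (G \<circ> F) p = tangent_matrix d e G (F p) ** tangent_matrix c d F p"
    using jacobian_eqI[OF *] by (simp add: tangent_matrix_def)
  show "in_charts c e (G \<circ> F) differentiable (at (snd c p))"
    using * differentiable_def by blast
qed

text \<open>The chain rule on the same open set as in \<open>tangent_matrix_compose\<close>. For F =
  id it becomes the transformation law of differentials,
  \<open>differential_transform\<close>.\<close>

lemma differential_in_chart:
  assumes "surface A" "surface B" "c \<in> A" "d \<in> B" "p \<in> fst c" "F p \<in> fst d"
    and "continuous_on UNIV F"
    and "in_charts c d F differentiable (at (snd c p))"
    and "(f \<circ> chart_inv d) differentiable (at (snd d (F p)))"
  shows "differential (f \<circ> F) c p = transpose (tangent_matrix c d F p) *v differential f d (F p)"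
proof -
  interpret A: surface A by fact
  interpret B: surface B by fact
  let ?S = "snd c ` (fst c \<inter> F -` fst d)"
  let ?Df = "frechet_derivative (f \<circ> chart_inv d) (at (snd d (F p)))"
  have "open (F -` fst d)"
    using assms(4,7) by (auto intro!: open_vimage B.open_dom)
  then have o: "open ?S" by (intro A.open_image assms open_Int A.open_dom) auto
  have eq: "((f \<circ> chart_inv d) \<circ> in_charts c d F) x = (f \<circ> F \<circ> chart_inv c) x" if "x \<in> ?S" for x
    using that assms(3,4) by (auto simp: in_charts_def)
  have at: "in_charts c d F (snd c p) = snd d (F p)" using assms by (simp add: in_charts_def)
  have D: "((f \<circ> chart_inv d) has_derivative ?Df) (at (in_charts c d F (snd c p)))"
    using assms(9) by (simp add: at frechet_derivative_works[symmetric])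
  have "((f \<circ> chart_inv d) \<circ> in_charts c d F has_derivative
      ?Df \<circ> (\<lambda>h. tangent_matrix c d F p *v h)) (at (snd c p))"
    unfolding tangent_matrix_def
    by (rule diff_chain_at[OF jacobian_has_derivative[OF assms(8)] D])
  then have *: "(f \<circ> F \<circ> chart_inv c has_derivative ?Df \<circ> (\<lambda>h. tangent_matrix c d F p *v h)) (at (snd c p))"
    by (rule has_derivative_transform_within_open[OF _ o _ eq]) (use assms in auto)
  have lin: "?Df v = v $ 1 * differential f d (F p) $ 1 + v $ 2 * differential f d (F p) $ 2" for v
    using fun_cong[OF frechet_derivative_at[OF smooth_on_has_derivative[OF assms(9)]], of v, symmetric]
    by (simp add: differential_def)
  show ?thesis
    unfolding vec_eq_iff
    by (auto simp: differential_def[of "f \<circ> F"] partial_deriv_eqI[OF *] lin matrix_vector_mult_def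
        transpose_def sum_2 axis_def if_distrib[where f="\<lambda>x. _ * x"] forall_2 cong: if_cong)
qed

context surface begin

lemma tangent_matrix_id: "c \<in> A ==> p \<in> fst c ==> tangent_matrix c c id p = mat 1"
proof -
  assume c: "c \<in> A" "p \<in> fst c"
  have "(in_charts c c id has_derivative (\<lambda>h. mat 1 *v h)) (at (snd c p))"
    by (rule has_derivative_transform_within_open[OF _ open_img[OF c(1)], of id])
      (use c in \<open>auto simp: in_charts_def id_def\<close>)
  then show ?thesis by (simp add: tangent_matrix_def jacobian_eqI)
qed

lemma transition_compose:
  assumes "c \<in> A" "d \<in> A" "e \<in> A" "p \<in> fst c" "p \<in> fst d" "p \<in> fst e"
  shows "tangent_matrix c e id p = tangent_matrix d e id p ** tangent_matrix c d id p"
  using tangent_matrix_compose(1)[of A A c d p id e id] assms transition_differentiable surface_axioms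
  by (simp add: continuous_on_id)

lemma transition_inverse:
  assumes "c \<in> A" "d \<in> A" "p \<in> fst c" "p \<in> fst d"
  shows "tangent_matrix d c id p ** tangent_matrix c d id p = mat 1"
  using transition_compose[of c d c p] assms tangent_matrix_id by simp

lemma smooth_fun_differentiable:
  assumes "smooth_fun A f" "c \<in> A" "p \<in> fst c"
  shows "(f \<circ> chart_inv c) differentiable (at (snd c p))"
  using assms unfolding smooth_fun_def by (intro smooth_on_imp_differentiable[OF _ open_img]) auto

lemma differential_transform:
  assumes "smooth_fun A f" "c \<in> A" "d \<in> A" "p \<in> fst c" "p \<in> fst d"
  shows "differential f c p = transpose (tangent_matrix c d id p) *v differential f d p"
  using differential_in_chart[of A A c d p id f] assms transition_differentiable surface_axioms
    smooth_fun_differentiable by (simp add: continuous_on_id)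

lemma smooth_fun_continuous:
  assumes "smooth_fun A f" shows "continuous_on UNIV f"
proof -
  have "continuous_on (fst c) f" if "c \<in> A" for c
  proof -
    have "continuous_on (fst c) ((f \<circ> chart_inv c) \<circ> snd c)"
      using assms that unfolding smooth_fun_def
      by (intro continuous_on_compose continuous_chart smooth_on_imp_continuous_on) auto
    then show ?thesis by (rule continuous_on_eq) (use that in auto)
  qed
  then have "continuous_on (\<Union>c\<in>A. fst c) f"
    by (intro continuous_on_open_UN) (auto simp: open_dom)
  then show ?thesis by (simp add: cover)
qed

end

section \<open>Continuous Riemannian metrics\<close>

text \<open>Area, Sobolev space and spectrum are built on this notion because it is easily verified
  for a lifted metric. Smooth components of the metric matter only for the curvature argument, which
  takes place on the base.\<close>

definition cmetric :: "'m::topological_space chart set \<Rightarrow> 'm metric_field \<Rightarrow> bool" where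
  "cmetric A g \<longleftrightarrow>
    (\<forall>c\<in>A. continuous_on (fst c) (g c) \<and>
      (\<forall>p\<in>fst c. transpose (g c p) = g c p \<and> (\<forall>v. v \<noteq> 0 \<longrightarrow> v \<bullet> (g c p *v v) > 0))) \<and>
    (\<forall>c\<in>A. \<forall>d\<in>A. \<forall>p\<in>fst c \<inter> fst d.
      g c p = transpose (tangent_matrix c d id p) ** g d p ** tangent_matrix c d id p)"

lemma spd_2:
  fixes G :: "real^2^2"
  assumes "transpose G = G" "\<And>v. v \<noteq> 0 ==> v \<bullet> (G *v v) > 0"
  shows "G $ 2 $ 1 = G $ 1 $ 2" "G $ 1 $ 1 > 0" "G $ 2 $ 2 > 0" "det G > 0"
    "det G = G $ 1 $ 1 * G $ 2 $ 2 - (G $ 1 $ 2)\<^sup>2"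
proof -
  show s: "G $ 2 $ 1 = G $ 1 $ 2" using arg_cong[OF assms(1), of "\<lambda>M. M $ 1 $ 2"] by (simp add: transpose_def)
  have q: "v \<bullet> (G *v v) = v $ 1 * v $ 1 * G $ 1 $ 1 + 2 * (v $ 1 * v $ 2 * G $ 1 $ 2) + v $ 2 * v $ 2 * G $ 2 $ 2" for v
    by (simp add: inner_vec_def matrix_vector_mult_def sum_2 s algebra_simps)
  have nz: "(vector [a, b] :: real^2) \<noteq> 0" if "a \<noteq> 0 \<or> b \<noteq> 0" for a b :: real
    using that by (auto simp: vec_eq_iff forall_2)
  show 1: "G $ 1 $ 1 > 0" using assms(2)[OF nz[of 1 0]] by (simp add: q)
  show "G $ 2 $ 2 > 0" using assms(2)[OF nz[of 0 1]] by (simp add: q)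
  show d: "det G = G $ 1 $ 1 * G $ 2 $ 2 - (G $ 1 $ 2)\<^sup>2"
    by (simp add: det_2 s power2_eq_square)
  \<comment> \<open>The vector (-G12, G11) is chosen because its quadratic form is G11 times the
    determinant.\<close>
  have "0 < G $ 1 $ 1 * (G $ 1 $ 1 * G $ 2 $ 2 - (G $ 1 $ 2)\<^sup>2)"
    using assms(2)[OF nz[of "- G $ 1 $ 2" "G $ 1 $ 1"]] 1
    by (simp add: q power2_eq_square algebra_simps)
  then show "det G > 0" using 1 by (simp add: d zero_less_mult_iff)
qed

lemma matrix_inv_2:
  fixes G :: "real^2^2"
  assumes "det G \<noteq> 0"
  shows "matrix_inv G = vector [vector [G $ 2 $ 2 / det G, - G $ 1 $ 2 / det G], vector [- G $ 2 $ 1 / det G, G $ 1 $ 1 / det G]]"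
  by (rule matrix_inv_eqI) (use assms in \<open>simp add: vec_eq_iff forall_2 matrix_matrix_mult_def sum_2 mat_def field_simps, simp add: det_2\<close>)

section \<open>The Riemannian measure\<close>

text \<open>Bridge between the gauge integral, for which the change of variables
  \<open>cov_invertible_nonneg_eq\<close> is stated, and the Lebesgue integral that defines
  areas.\<close>

lemma has_integral_iff_nn_integral_indicator:
  fixes f :: "'a::euclidean_space \<Rightarrow> real"
  assumes "(\<lambda>x. indicator S x * f x) \<in> borel_measurable borel" "\<And>x. x \<in> S ==> 0 \<le> f x" "0 \<le> r"
  shows "(f has_integral r) S \<longleftrightarrow> (\<integral>\<^sup>+x. ennreal (f x) * indicator S x \<partial>lborel) = ennreal r"
proof
  assume "(f has_integral r) S"
  then show "(\<integral>\<^sup>+x. ennreal (f x) * indicator S x \<partial>lborel) = ennreal r"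
    using assms by (intro nn_integral_has_integral_lebesgue') auto
next
  assume *: "(\<integral>\<^sup>+x. ennreal (f x) * indicator S x \<partial>lborel) = ennreal r"
  have "(\<integral>\<^sup>+x. ennreal (indicator S x * f x) \<partial>lborel) = (\<integral>\<^sup>+x. ennreal (f x) * indicator S x \<partial>lborel)"
    by (intro nn_integral_cong) (auto simp: indicator_def)
  with * have "((\<lambda>x. indicator S x * f x) has_integral r) UNIV"
    using assms by (intro nn_integral_has_integral) (auto simp: indicator_def)
  then have "((\<lambda>x. if x \<in> S then f x else 0) has_integral r) UNIV"
    by (rule has_integral_eq[rotated]) (auto simp: indicator_def)
  then show "(f has_integral r) S" by (simp add: has_integral_restrict_UNIV)
qed

lemma nn_integral_change_of_variables:
  fixes f :: "real^'n::{finite,wellorder} \<Rightarrow> real" and g h :: "real^'n::_ \<Rightarrow> real^'n::_"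
  assumes "\<And>x. x \<in> S ==> (g has_derivative g' x) (at x within S)"
      and "\<And>y. y \<in> T ==> (h has_derivative h' y) (at y within T)"
      and "\<And>y. y \<in> T ==> 0 \<le> f y"
      and "\<And>x. x \<in> S ==> g x \<in> T \<and> h(g x) = x"
      and "\<And>y. y \<in> T ==> h y \<in> S \<and> g(h y) = y"
      and "\<And>y. y \<in> T ==> h' y \<circ> g'(h y) = id"
      and m: "(\<lambda>x. indicator T x * f x) \<in> borel_measurable borel"
        "(\<lambda>x. indicator S x * (\<bar>det (matrix (g' x))\<bar> * f(g x))) \<in> borel_measurable borel"
  shows "(\<integral>\<^sup>+x. ennreal (\<bar>det (matrix (g' x))\<bar> * f(g x)) * indicator S x \<partial>lborel)
       = (\<integral>\<^sup>+x. ennreal (f x) * indicator T x \<partial>lborel)" (is "?L = ?R")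
proof -
  have iff: "?L = ennreal r \<longleftrightarrow> ?R = ennreal r" if "0 \<le> r" for r
    using cov_invertible_nonneg_eq[OF assms(1-6), where b=r]
      has_integral_iff_nn_integral_indicator[OF m(1) assms(3) that]
      has_integral_iff_nn_integral_indicator[OF m(2) _ that] assms(3,4) by fastforce
  \<comment> \<open>If the left side is finite, \<open>iff\<close> applies to its value; otherwise
    no finite value is taken by either side, so both are infinite.\<close>
  show ?thesis
  proof (cases ?L)
    case (real r)
    then show ?thesis using iff[of r] by simp
  next
    case top
    then show ?thesis using iff by (cases ?R) auto
  qed
qed

context surface
begin

text \<open>Second countability via Lindelof. Countably many charts are what allows the measure to
  be assembled from disjoint Borel pieces, one for each chart.\<close>

lemma countable_chart_cover:
  "\<exists>ch :: nat \<Rightarrow> 'm chart. (\<forall>n. ch n \<in> A) \<and> (\<Union>n. fst (ch n)) = UNIV"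
proof -
  obtain F where F: "F \<subseteq> fst ` A" "countable F" "\<Union>F = \<Union>(fst ` A)"
    using Lindelof[of "fst ` A"] open_dom by (metis (no_types, lifting) imageE)
  have UF: "\<Union>F = UNIV" using F cover by simp
  then have "F \<noteq> {}" by auto
  have "\<exists>c. c \<in> A \<and> fst c = from_nat_into F n" for n
    using from_nat_into[OF \<open>F \<noteq> {}\<close>, of n] F(1) by (metis imageE subset_iff)
  then obtain ch where ch: "\<And>n. ch n \<in> A \<and> fst (ch n) = from_nat_into F n" by metis
  show ?thesis
    by (rule exI[of _ ch]) (use ch UF range_from_nat_into[OF \<open>F \<noteq> {}\<close> F(2)] in auto)
qed

end

locale metric_surface = surface A for A :: "'m::{t2_space, second_countable_topology} chart set" +
  fixes g :: "'m metric_field"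
  assumes cmetric: "cmetric A g"
begin

lemma continuous_metric: "c \<in> A ==> continuous_on (fst c) (g c)"
  using cmetric unfolding cmetric_def by blast

lemma metric_spd:
  assumes "c \<in> A" "p \<in> fst c"
  shows "g c p $ 2 $ 1 = g c p $ 1 $ 2" "g c p $ 1 $ 1 > 0" "g c p $ 2 $ 2 > 0" "det (g c p) > 0"
    "det (g c p) = g c p $ 1 $ 1 * g c p $ 2 $ 2 - (g c p $ 1 $ 2)\<^sup>2"
proof -
  have "transpose (g c p) = g c p" "v \<noteq> 0 ==> v \<bullet> (g c p *v v) > 0" for v
    using cmetric assms unfolding cmetric_def by blast+
  from spd_2[OF this] show "g c p $ 2 $ 1 = g c p $ 1 $ 2" "g c p $ 1 $ 1 > 0" "g c p $ 2 $ 2 > 0"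
    "det (g c p) > 0" "det (g c p) = g c p $ 1 $ 1 * g c p $ 2 $ 2 - (g c p $ 1 $ 2)\<^sup>2"
    by blast+
qed

lemma metric_transform:
  "c \<in> A ==> d \<in> A ==> p \<in> fst c ==> p \<in> fst d ==>
    g c p = transpose (tangent_matrix c d id p) ** g d p ** tangent_matrix c d id p"
  using cmetric unfolding cmetric_def by blast

definition area_density :: "'m chart \<Rightarrow> real^2 \<Rightarrow> real" where
  "area_density c x = sqrt (det (g c (chart_inv c x)))"

lemma area_density_pos: "c \<in> A ==> x \<in> snd c ` fst c ==> area_density c x > 0"
  using metric_spd(4)[of c "chart_inv c x"] by (simp add: area_density_def)

lemma continuous_area_density:
  assumes "c \<in> A" shows "continuous_on (snd c ` fst c) (area_density c)"
proof -
  have "continuous_on (snd c ` fst c) (\<lambda>x. g c (chart_inv c x))"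
    by (rule continuous_on_compose2[OF continuous_metric[OF assms] continuous_chart_inv[OF assms]]) (use assms in auto)
  then show ?thesis unfolding area_density_def det_2 by (intro continuous_intros)
qed

lemma measurable_area_density [measurable]:
  assumes "c \<in> A" "S \<in> sets borel" "S \<subseteq> fst c"
  shows "(\<lambda>x. indicator (snd c ` S) x * area_density c x) \<in> borel_measurable borel"
  using borel_measurable_continuous_on_indicator[OF borel_image[OF assms]
      continuous_on_subset[OF continuous_area_density[OF assms(1)]]] assms(3) by auto

lemma area_density_transform:
  assumes "c \<in> A" "d \<in> A" "p \<in> fst c" "p \<in> fst d"
  shows "area_density c (snd c p) = \<bar>det (tangent_matrix c d id p)\<bar> * area_density d (snd d p)"
  using metric_transform[OF assms] assms
  by (simp add: area_density_def det_mul real_sqrt_mult det_transpose)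

text \<open>Change of variables along the transition map: since det (T^t G T) = (det T)^2 det G, the
  density picks up exactly the absolute Jacobian determinant.\<close>

lemma chart_area_eq:
  assumes "c \<in> A" "d \<in> A" "S \<in> sets borel" "S \<subseteq> fst c" "S \<subseteq> fst d"
  shows "(\<integral>\<^sup>+x. ennreal (area_density c x) * indicator (snd c ` S) x \<partial>lborel)
       = (\<integral>\<^sup>+x. ennreal (area_density d x) * indicator (snd d ` S) x \<partial>lborel)"
proof -
  let ?g = "in_charts c d id" and ?h = "in_charts d c id"
  let ?g' = "\<lambda>x v. tangent_matrix c d id (chart_inv c x) *v v"
  let ?h' = "\<lambda>x v. tangent_matrix d c id (chart_inv d x) *v v"
  have g: "?g (snd c p) = snd d p" "?h (snd d p) = snd c p" if "p \<in> S" for p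
    using that assms by (auto simp: in_charts_def)
  have dens: "\<bar>det (matrix (?g' x))\<bar> * area_density d (?g x) = area_density c x" if "x \<in> snd c ` S" for x
    using that assms area_density_transform[of c d] by (auto simp: in_charts_def subset_iff)
  have "(\<integral>\<^sup>+x. ennreal (\<bar>det (matrix (?g' x))\<bar> * area_density d (?g x)) * indicator (snd c ` S) x \<partial>lborel)
       = (\<integral>\<^sup>+x. ennreal (area_density d x) * indicator (snd d ` S) x \<partial>lborel)"
  proof (rule nn_integral_change_of_variables)
    show "(?g has_derivative ?g' x) (at x within snd c ` S)" if "x \<in> snd c ` S" for x
      using that assms jacobian_has_derivative[OF transition_differentiable[of c d]]
      by (auto simp: tangent_matrix_def subset_iff intro: has_derivative_at_withinI)
    show "(?h has_derivative ?h' x) (at x within snd d ` S)" if "x \<in> snd d ` S" for x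
      using that assms jacobian_has_derivative[OF transition_differentiable[of d c]]
      by (auto simp: tangent_matrix_def subset_iff intro: has_derivative_at_withinI)
    show "0 \<le> area_density d y" if "y \<in> snd d ` S" for y
      using area_density_pos[of d y] that assms by force
    show "?g x \<in> snd d ` S \<and> ?h (?g x) = x" if "x \<in> snd c ` S" for x
      using that g by auto
    show "?h y \<in> snd c ` S \<and> ?g (?h y) = y" if "y \<in> snd d ` S" for y
      using that g by auto
    show "?h' y \<circ> ?g' (?h y) = id" if y: "y \<in> snd d ` S" for y
    proof -
      obtain p where p: "p \<in> S" "y = snd d p" using y by blast
      then have "chart_inv c (?h y) = p" "chart_inv d y = p" using g assms by (auto simp: subset_iff)
      then show ?thesis using transition_inverse[of c d p] p assms
        by (auto simp: fun_eq_iff matrix_vector_mul_assoc subset_iff)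
    qed
    show "(\<lambda>x. indicator (snd d ` S) x * area_density d x) \<in> borel_measurable borel"
      by (rule measurable_area_density) (use assms in auto)
    have "(\<lambda>x. indicator (snd c ` S) x * area_density c x) \<in> borel_measurable borel"
      by (rule measurable_area_density) (use assms in auto)
    also have "(\<lambda>x. indicator (snd c ` S) x * area_density c x)
       = (\<lambda>x. indicator (snd c ` S) x * (\<bar>det (matrix (?g' x))\<bar> * area_density d (?g x)))"
      using dens by (auto simp: fun_eq_iff indicator_def simp del: matrix_of_matrix_vector_mul)
    finally show "(\<lambda>x. indicator (snd c ` S) x * (\<bar>det (matrix (?g' x))\<bar> * area_density d (?g x))) \<in> borel_measurable borel" .
  qed
  moreover have "(\<integral>\<^sup>+x. ennreal (\<bar>det (matrix (?g' x))\<bar> * area_density d (?g x)) * indicator (snd c ` S) x \<partial>lborel)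
     = (\<integral>\<^sup>+x. ennreal (area_density c x) * indicator (snd c ` S) x \<partial>lborel)"
    by (intro nn_integral_cong) (use dens in \<open>auto simp: indicator_def simp del: matrix_of_matrix_vector_mul\<close>)
  ultimately show ?thesis by simp
qed

text \<open>The property under the definite description in \<open>vol\<close>; its existence and
  uniqueness show that \<open>vol\<close> denotes.\<close>

definition vol_spec :: "'m measure \<Rightarrow> bool" where
  "vol_spec \<mu> \<longleftrightarrow> sets \<mu> = sets borel \<and>
    (\<forall>c\<in>A. \<forall>S\<in>sets borel. S \<subseteq> fst c \<longrightarrow>
      emeasure \<mu> S = (\<integral>\<^sup>+x. ennreal (area_density c x) * indicator (snd c ` S) x \<partial>lborel))"

text \<open>The specification only speaks of sets inside one chart. Every Borel set splits into
  countably many disjoint sets of that kind, so countable additivity decides the rest.\<close>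

lemma vol_spec_unique:
  assumes "vol_spec \<mu>" "vol_spec \<nu>" shows "\<mu> = \<nu>"
proof (rule measure_eqI)
  show "sets \<mu> = sets \<nu>" using assms by (simp add: vol_spec_def)
  fix S assume "S \<in> sets \<mu>"
  then have S: "S \<in> sets borel" using assms by (simp add: vol_spec_def)
  obtain ch where "(\<forall>n::nat. ch n \<in> A) \<and> (\<Union>n. fst (ch n)) = UNIV"
    using countable_chart_cover ..
  then have ch: "ch n \<in> A" "(\<Union>n. fst (ch n)) = UNIV" for n by simp_all
  define E where "E = disjointed (\<lambda>n. fst (ch n))"
  define D where "D n = S \<inter> E n" for n
  have E: "E n \<in> sets borel" "E n \<subseteq> fst (ch n)" for n
    using ch(1) disjointed_subset[of "\<lambda>n. fst (ch n)" n]
    by (auto simp: E_def disjointed_def intro!: sets.Diff sets.countable_UN)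
  have djE: "disjoint_family E" and UE: "(\<Union>n. E n) = UNIV"
    unfolding E_def using ch(2) by (auto simp: disjoint_family_disjointed UN_disjointed_eq)
  have D: "D n \<in> sets borel" "D n \<subseteq> fst (ch n)" for n
    using E[of n] S unfolding D_def by (auto intro: sets.Int)
  have dj: "disjoint_family D"
    using djE unfolding D_def disjoint_family_on_def by blast
  have U: "(\<Union>n. D n) = S" using UE unfolding D_def by blast
  have eq: "emeasure \<mu> (D n) = emeasure \<nu> (D n)" for n
    using assms D[of n] ch(1)[of n] unfolding vol_spec_def by auto
  have "emeasure \<mu> S = (\<Sum>n. emeasure \<mu> (D n))"
    using suminf_emeasure[OF _ dj, of \<mu>] D(1) assms(1) U by (simp add: vol_spec_def image_subset_iff)
  also have "\<dots> = emeasure \<nu> S"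
    using suminf_emeasure[OF _ dj, of \<nu>] D(1) assms(2) U by (simp add: vol_spec_def image_subset_iff eq)
  finally show "emeasure \<mu> S = emeasure \<nu> S" .
qed

text \<open>The area of S computed in one chart and pushed forward to the surface. The value
  \<open>undefined\<close> merely makes the inverse chart a total Borel function; for S inside the
  chart the density vanishes there.\<close>

definition chart_measure :: "'m chart \<Rightarrow> 'm set \<Rightarrow> 'm measure" where
  "chart_measure c S = distr (density lborel (\<lambda>x. ennreal (indicator (snd c ` S) x * area_density c x)))
     borel (\<lambda>x. if x \<in> snd c ` fst c then chart_inv c x else undefined)"

lemma measurable_chart_inv:
  assumes "c \<in> A"
  shows "(\<lambda>x. if x \<in> snd c ` fst c then chart_inv c x else undefined) \<in> borel_measurable borel"
  using assms open_img[OF assms] borel_measurable_continuous_on_restrict[OF continuous_chart_inv[OF assms]]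
  by (subst measurable_If_restrict_space_iff) (auto simp: Collect_mem_eq)

lemma nn_integral_chart_measure:
  assumes "c \<in> A" "S \<in> sets borel" "S \<subseteq> fst c" "h \<in> borel_measurable borel"
  shows "(\<integral>\<^sup>+p. h p \<partial>chart_measure c S)
    = (\<integral>\<^sup>+x. ennreal (area_density c x) * h (chart_inv c x) * indicator (snd c ` S) x \<partial>lborel)"
proof -
  have m: "(\<lambda>x. if x \<in> snd c ` fst c then chart_inv c x else undefined) \<in> measurable borel borel"
    by (rule measurable_chart_inv[OF assms(1)])
  have d: "(\<lambda>x. ennreal (indicator (snd c ` S) x * area_density c x)) \<in> borel_measurable borel"
    using measurable_area_density[OF assms(1-3)] by measurable
  show ?thesis
    unfolding chart_measure_def using m d assms(4)
    by (subst nn_integral_distr; (subst nn_integral_density)?)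
      (use assms(3) in \<open>auto intro!: nn_integral_cong simp: indicator_def subset_iff image_iff\<close>)
qed

lemma emeasure_chart_measure:
  assumes "c \<in> A" "S \<in> sets borel" "S \<subseteq> fst c" "T \<in> sets borel"
  shows "emeasure (chart_measure c S) T
    = (\<integral>\<^sup>+x. ennreal (area_density c x) * indicator (snd c ` (S \<inter> T)) x \<partial>lborel)"
proof -
  have "emeasure (chart_measure c S) T = (\<integral>\<^sup>+p. indicator T p \<partial>chart_measure c S)"
    using assms(4) by (simp add: chart_measure_def)
  also have "\<dots> = (\<integral>\<^sup>+x. ennreal (area_density c x) * indicator (snd c ` (S \<inter> T)) x \<partial>lborel)"
    by (subst nn_integral_chart_measure[OF assms(1-3)])
      (use assms in \<open>auto intro!: nn_integral_cong simp: indicator_def subset_iff\<close>)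
  finally show ?thesis .
qed

text \<open>The measure is the sum of the chart measures of the disjointed pieces
  \<open>D n\<close>. By \<open>chart_area_eq\<close> each piece of a set S can be recomputed in
  whichever chart contains S, so the sum has the required value in every chart.\<close>

lemma vol_spec_exists: "\<exists>\<mu>. vol_spec \<mu>"
proof -
  obtain ch where "(\<forall>n::nat. ch n \<in> A) \<and> (\<Union>n. fst (ch n)) = UNIV"
    using countable_chart_cover ..
  then have ch: "ch n \<in> A" "(\<Union>n. fst (ch n)) = UNIV" for n by simp_all
  define D where "D = disjointed (\<lambda>n. fst (ch n))"
  have D: "D n \<in> sets borel" "D n \<subseteq> fst (ch n)" for n
    using ch(1) disjointed_subset[of "\<lambda>n. fst (ch n)" n]
    by (auto simp: D_def disjointed_def intro!: sets.Diff sets.countable_UN)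
  have dj: "disjoint_family D" and U: "(\<Union>n. D n) = UNIV"
    unfolding D_def using ch(2) by (auto simp: disjoint_family_disjointed UN_disjointed_eq)
  define m where "m S = (\<Sum>n. emeasure (chart_measure (ch n) (D n)) S)" for S
  define \<mu> where "\<mu> = measure_of UNIV (sets borel) m"
  have sets: "sets \<mu> = sets borel" unfolding \<mu>_def using sets.sigma_sets_eq[of borel] by simp
  have em: "emeasure \<mu> S = m S" if "S \<in> sets borel" for S
  proof (rule emeasure_measure_of[OF \<mu>_def])
    show "positive (sets \<mu>) m" by (simp add: positive_def m_def)
    show "countably_additive (sets \<mu>) m"
    proof (rule countably_additiveI)
      fix F :: "nat \<Rightarrow> 'm set" assume F: "range F \<subseteq> sets \<mu>" "disjoint_family F"
      let ?a = "\<lambda>n i. emeasure (chart_measure (ch n) (D n)) (F i)"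
      \<comment> \<open>Countable additivity exchanges two infinite sums; one of them is read as an
        integral over the counting measure so that \<open>nn_integral_suminf\<close>
        applies.\<close>
      have "(\<Sum>i. m (F i)) = (\<Sum>i. \<integral>\<^sup>+n. ?a n i \<partial>count_space UNIV)"
        by (simp add: m_def nn_integral_count_space_nat)
      also have "\<dots> = (\<integral>\<^sup>+n. (\<Sum>i. ?a n i) \<partial>count_space UNIV)"
        by (rule nn_integral_suminf[symmetric]) simp
      also have "\<dots> = (\<Sum>n. \<Sum>i. ?a n i)" by (simp add: nn_integral_count_space_nat)
      also have "\<dots> = m (\<Union>i. F i)"
        unfolding m_def using F sets by (intro suminf_cong suminf_emeasure) (auto simp: chart_measure_def)
      finally show "(\<Sum>i. m (F i)) = m (\<Union>i. F i)" .
    qed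
  qed (use that sets in auto)
  have "vol_spec \<mu>" unfolding vol_spec_def
  proof (intro conjI ballI impI sets)
    fix c S assume c: "c \<in> A" and S: "S \<in> sets borel" "S \<subseteq> fst c"
    have "emeasure \<mu> S = (\<Sum>n. emeasure (chart_measure (ch n) (D n)) S)" using em S by (simp add: m_def)
    also have "\<dots> = (\<Sum>n. emeasure (chart_measure c S) (D n))"
      using c S D ch(1) chart_area_eq[of "ch _" c "D _ \<inter> S"]
      by (intro suminf_cong) (auto simp: emeasure_chart_measure Int_commute subset_iff)
    also have "\<dots> = emeasure (chart_measure c S) (\<Union>n. D n)"
      using D dj by (intro suminf_emeasure) (auto simp: chart_measure_def)
    also have "\<dots> = (\<integral>\<^sup>+x. ennreal (area_density c x) * indicator (snd c ` S) x \<partial>lborel)"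
      unfolding U using c S by (simp add: emeasure_chart_measure)
    finally show "emeasure \<mu> S = (\<integral>\<^sup>+x. ennreal (area_density c x) * indicator (snd c ` S) x \<partial>lborel)" .
  qed
  then show ?thesis by blast
qed

lemma vol_spec_iff: "vol_spec \<mu> \<longleftrightarrow> \<mu> = vol A g"
proof -
  have "vol A g = (THE \<mu>. vol_spec \<mu>)"
    unfolding vol_def vol_spec_def area_density_def ..
  then show ?thesis using vol_spec_exists vol_spec_unique by (metis the_equality)
qed

lemma sets_vol [measurable_cong, simp]: "sets (vol A g) = sets borel"
  using vol_spec_iff[of "vol A g"] by (simp add: vol_spec_def)

lemma space_vol [simp]: "space (vol A g) = UNIV"
  using sets_eq_imp_space_eq[OF sets_vol] by simp

lemma emeasure_vol:
  "c \<in> A ==> S \<in> sets borel ==> S \<subseteq> fst c ==>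
    emeasure (vol A g) S = (\<integral>\<^sup>+x. ennreal (area_density c x) * indicator (snd c ` S) x \<partial>lborel)"
  using vol_spec_iff[of "vol A g"] by (simp add: vol_spec_def)

lemma nn_integral_vol_chart:
  assumes "c \<in> A" "S \<in> sets borel" "S \<subseteq> fst c" and [measurable]: "h \<in> borel_measurable borel"
  shows "(\<integral>\<^sup>+p. h p * indicator S p \<partial>vol A g)
    = (\<integral>\<^sup>+x. ennreal (area_density c x) * h (chart_inv c x) * indicator (snd c ` S) x \<partial>lborel)"
proof -
  have "density (vol A g) (indicator S) = chart_measure c S"
  proof (rule measure_eqI)
    fix T assume "T \<in> sets (density (vol A g) (indicator S))"
    then have T: "T \<in> sets borel" by simp
    have "emeasure (density (vol A g) (indicator S)) T = emeasure (vol A g) (S \<inter> T)"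
      using assms T by (subst emeasure_density) (auto simp: indicator_inter_arith[symmetric])
    also have "\<dots> = emeasure (chart_measure c S) T"
      using assms T by (subst emeasure_vol[of c]) (auto simp: emeasure_chart_measure)
    finally show "emeasure (density (vol A g) (indicator S)) T = emeasure (chart_measure c S) T" .
  qed (simp add: chart_measure_def)
  moreover have "(\<integral>\<^sup>+p. h p \<partial>density (vol A g) (indicator S)) = (\<integral>\<^sup>+p. indicator S p * h p \<partial>vol A g)"
    using assms by (intro nn_integral_density) auto
  ultimately show ?thesis using nn_integral_chart_measure[OF assms] by (simp add: mult.commute)
qed

end

text \<open>In dimension two the determinant scales by exp (2 u)^2, hence the area density by exp (2
  u). The measure with that density therefore meets the specification of
  \<open>vol A g\<close>.\<close>

lemma vol_conformal:
  assumes "metric_surface A g" "metric_surface A h" "u \<in> borel_measurable borel"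
    and "\<And>c p. c \<in> A ==> p \<in> fst c ==> g c p = exp (2 * u p) *\<^sub>R h c p"
  shows "vol A g = density (vol A h) (\<lambda>p. ennreal (exp (2 * u p)))"
proof -
  interpret G: metric_surface A g by fact
  interpret H: metric_surface A h by fact
  have [measurable]: "u \<in> borel_measurable borel" by fact
  have d: "G.area_density c x = H.area_density c x * exp (2 * u (chart_inv c x))" if "c \<in> A" "x \<in> snd c ` fst c" for c x
  proof -
    have "chart_inv c x \<in> fst c" using that by auto
    moreover have "det (exp (2 * u p) *\<^sub>R M) = (exp (2 * u p))\<^sup>2 * det M" for p and M :: "real^2^2"
      by (simp add: det_2 power2_eq_square algebra_simps)
    ultimately show ?thesis unfolding G.area_density_def H.area_density_def
      by (simp add: assms(4)[OF that(1)] real_sqrt_mult)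
  qed
  have "G.vol_spec (density (vol A h) (\<lambda>p. ennreal (exp (2 * u p))))"
    unfolding G.vol_spec_def
  proof (intro conjI ballI impI)
    fix c S assume c: "c \<in> A" and S: "S \<in> sets borel" "S \<subseteq> fst c"
    have "emeasure (density (vol A h) (\<lambda>p. ennreal (exp (2 * u p)))) S
        = (\<integral>\<^sup>+p. ennreal (exp (2 * u p)) * indicator S p \<partial>vol A h)"
      using S by (intro emeasure_density) auto
    also have "\<dots> = (\<integral>\<^sup>+x. ennreal (H.area_density c x) * ennreal (exp (2 * u (chart_inv c x))) * indicator (snd c ` S) x \<partial>lborel)"
      using c S by (intro H.nn_integral_vol_chart) auto
    also have "\<dots> = (\<integral>\<^sup>+x. ennreal (G.area_density c x) * indicator (snd c ` S) x \<partial>lborel)"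
      using c S d[OF c] H.area_density_pos[OF c]
      by (intro nn_integral_cong) (auto simp: indicator_def ennreal_mult' less_imp_le subset_iff)
    finally show "emeasure (density (vol A h) (\<lambda>p. ennreal (exp (2 * u p)))) S
       = (\<integral>\<^sup>+x. ennreal (G.area_density c x) * indicator (snd c ` S) x \<partial>lborel)" .
  qed simp
  then show ?thesis by (simp add: G.vol_spec_iff)
qed

section \<open>Square integrable vector-valued functions\<close>

text \<open>Vector values let one theory serve functions, frame components of covector fields, and
  the pairs of both that carry the H1 norm.\<close>

definition sq_int :: "'a measure \<Rightarrow> ('a \<Rightarrow> 'b::euclidean_space) \<Rightarrow> bool" where
  "sq_int M f \<longleftrightarrow> f \<in> borel_measurable M \<and> integrable M (\<lambda>x. f x \<bullet> f x)"

definition ip :: "'a measure \<Rightarrow> ('a \<Rightarrow> 'b::euclidean_space) \<Rightarrow> ('a \<Rightarrow> 'b) \<Rightarrow> real" where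
  "ip M f g = (LINT x|M. f x \<bullet> g x)"

lemma inner_le_sq_sum:
  fixes x y :: "'b::real_inner" shows "\<bar>x \<bullet> y\<bar> \<le> x \<bullet> x + y \<bullet> y"
proof -
  have "0 \<le> (x + y) \<bullet> (x + y)" "0 \<le> (x - y) \<bullet> (x - y)" "0 \<le> x \<bullet> x" "0 \<le> y \<bullet> y" by simp_all
  then show ?thesis by (simp add: inner_add inner_diff inner_commute abs_le_iff)
qed

lemma sq_int_inner:
  assumes "sq_int M f" "sq_int M g" shows "integrable M (\<lambda>x. f x \<bullet> g x)"
proof (rule Bochner_Integration.integrable_bound)
  have [measurable]: "f \<in> borel_measurable M" "g \<in> borel_measurable M" using assms by (auto simp: sq_int_def)
  show "integrable M (\<lambda>x. f x \<bullet> f x + g x \<bullet> g x)" using assms by (auto simp: sq_int_def)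
  show "(\<lambda>x. f x \<bullet> g x) \<in> borel_measurable M" by measurable
  show "AE x in M. norm (f x \<bullet> g x) \<le> norm (f x \<bullet> f x + g x \<bullet> g x)"
    using inner_le_sq_sum by (auto intro!: AE_I2 order_trans[OF _ abs_ge_self])
qed

lemma sq_int_scaleR: "sq_int M f ==> sq_int M (\<lambda>x. c *\<^sub>R f x)"
  by (auto simp: sq_int_def)

lemma sq_int_add:
  assumes "sq_int M f" "sq_int M g" shows "sq_int M (\<lambda>x. f x + g x)"
  using assms sq_int_inner[OF assms] sq_int_inner[OF assms(2,1)] unfolding sq_int_def
  by (auto simp: inner_add_left inner_add_right)

lemma sq_int_diff: "sq_int M f ==> sq_int M g ==> sq_int M (\<lambda>x. f x - g x)"
  using sq_int_add[OF _ sq_int_scaleR[of M g "-1"], of f] by simp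

lemma ip_commute: "ip M f g = ip M g f" by (simp add: ip_def inner_commute)

lemma ip_nonneg: "0 \<le> ip M f f" by (simp add: ip_def)

lemma ip_add_left: "sq_int M f ==> sq_int M g ==> sq_int M h ==> ip M (\<lambda>x. f x + g x) h = ip M f h + ip M g h"
  by (simp add: ip_def inner_add_left sq_int_inner)

lemma ip_add_right: "sq_int M f ==> sq_int M g ==> sq_int M h ==> ip M h (\<lambda>x. f x + g x) = ip M h f + ip M h g"
  by (simp add: ip_def inner_add_right sq_int_inner)

lemma ip_diff_left: "sq_int M f ==> sq_int M g ==> sq_int M h ==> ip M (\<lambda>x. f x - g x) h = ip M f h - ip M g h"
  by (simp add: ip_def inner_diff_left sq_int_inner)

lemma ip_diff_right: "sq_int M f ==> sq_int M g ==> sq_int M h ==> ip M h (\<lambda>x. f x - g x) = ip M h f - ip M h g"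
  by (simp add: ip_def inner_diff_right sq_int_inner)

lemma ip_scaleR_left: "ip M (\<lambda>x. c *\<^sub>R f x) h = c * ip M f h"
  by (simp add: ip_def)

lemma ip_scaleR_right: "ip M h (\<lambda>x. c *\<^sub>R f x) = c * ip M h f"
  by (simp add: ip_def)

text \<open>The discriminant criterion behind the Cauchy-Schwarz inequalities below, including the
  one for a merely semidefinite form. With a = 0 it forces b = 0, which is how the Euler-Lagrange
  equation is extracted in \<open>weak_solution_exists\<close>.\<close>

lemma nonneg_quadratic_discriminant:
  fixes a b c :: real
  assumes "\<And>t. 0 \<le> a + 2 * b * t + c * t\<^sup>2" shows "b\<^sup>2 \<le> a * c"
proof (cases "c = 0")
  case True
  have "b = 0"
  proof (rule ccontr)
    assume "b \<noteq> 0"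
    then have "a + 2 * b * (- (a + 1) / (2 * b)) + c * (- (a + 1) / (2 * b))\<^sup>2 = -1"
      by (simp add: True field_simps)
    then show False using assms[of "- (a + 1) / (2 * b)"] by simp
  qed
  then show ?thesis by (simp add: True)
next
  case False
  have "c > 0"
  proof (rule ccontr)
    assume "\<not> c > 0"
    then have c: "c < 0" using False by simp
    \<comment> \<open>Chosen so that t \<ge> 1 and |c| t exceeds |a| + 2 |b|, which makes the
      quadratic negative at t.\<close>
    define t where "t = (\<bar>a\<bar> + 1) / \<bar>c\<bar> + 2 * \<bar>b\<bar> / \<bar>c\<bar> + 1"
    have "t \<ge> 1" unfolding t_def by auto
    have ct: "\<bar>c\<bar> * t = \<bar>a\<bar> + 1 + 2 * \<bar>b\<bar> + \<bar>c\<bar>" using c by (simp add: t_def field_simps)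
    have "c * t\<^sup>2 = - (\<bar>c\<bar> * t) * t" using c by (simp add: power2_eq_square)
    also have "\<dots> = - ((\<bar>a\<bar> + 1 + \<bar>c\<bar>) * t) - 2 * \<bar>b\<bar> * t" unfolding ct by (simp add: algebra_simps)
    finally have e: "c * t\<^sup>2 = - ((\<bar>a\<bar> + 1 + \<bar>c\<bar>) * t) - 2 * \<bar>b\<bar> * t" .
    have "(\<bar>a\<bar> + 1 + \<bar>c\<bar>) * 1 \<le> (\<bar>a\<bar> + 1 + \<bar>c\<bar>) * t" using \<open>t \<ge> 1\<close> by (intro mult_left_mono) auto
    moreover have "b * t \<le> \<bar>b\<bar> * t" using \<open>t \<ge> 1\<close> by (intro mult_right_mono) auto
    ultimately have "a + 2 * b * t + c * t\<^sup>2 < 0" unfolding e by (auto simp: algebra_simps)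
    with assms[of t] show False by simp
  qed
  then show ?thesis using assms[of "- b / c"] by (simp add: field_simps power2_eq_square)
qed

lemma ip_Cauchy_Schwarz:
  assumes "sq_int M f" "sq_int M g" shows "(ip M f g)\<^sup>2 \<le> ip M f f * ip M g g"
proof (rule nonneg_quadratic_discriminant)
  fix t :: real
  have "0 \<le> ip M (\<lambda>x. f x + t *\<^sub>R g x) (\<lambda>x. f x + t *\<^sub>R g x)" by (rule ip_nonneg)
  also have "\<dots> = ip M f f + 2 * ip M f g * t + ip M g g * t\<^sup>2"
    using assms by (simp add: ip_add_left ip_add_right ip_scaleR_left ip_scaleR_right sq_int_add sq_int_scaleR
        ip_commute[of M g f] power2_eq_square algebra_simps)
  finally show "0 \<le> ip M f f + 2 * ip M f g * t + ip M g g * t\<^sup>2" .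
qed

lemma ip_tendsto_left:
  assumes "\<And>n. sq_int M (F n)" "sq_int M f" "sq_int M g"
    and "(\<lambda>n. ip M (\<lambda>x. f x - F n x) (\<lambda>x. f x - F n x)) \<longlonglongrightarrow> 0"
  shows "(\<lambda>n. ip M (F n) g) \<longlonglongrightarrow> ip M f g"
proof -
  have "(\<lambda>n. sqrt (ip M (\<lambda>x. f x - F n x) (\<lambda>x. f x - F n x) * ip M g g)) \<longlonglongrightarrow> sqrt (0 * ip M g g)"
    by (intro tendsto_intros assms)
  moreover have "\<bar>ip M f g - ip M (F n) g\<bar> \<le> sqrt (ip M (\<lambda>x. f x - F n x) (\<lambda>x. f x - F n x) * ip M g g)" for n
    using ip_Cauchy_Schwarz[OF sq_int_diff[OF assms(2,1)] assms(3), of n] assms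
    by (intro real_le_rsqrt) (simp add: ip_diff_left)
  ultimately have "(\<lambda>n. ip M f g - ip M (F n) g) \<longlonglongrightarrow> 0"
    by (intro Lim_null_comparison[of "\<lambda>n. ip M f g - ip M (F n) g"]) auto
  from tendsto_diff[OF tendsto_const[of "ip M f g"] this] show ?thesis by simp
qed

lemma ip_tendsto_self:
  assumes "\<And>n. sq_int M (F n)" "sq_int M f"
    and "(\<lambda>n. ip M (\<lambda>x. f x - F n x) (\<lambda>x. f x - F n x)) \<longlonglongrightarrow> 0"
  shows "(\<lambda>n. ip M (F n) (F n)) \<longlonglongrightarrow> ip M f f"
proof -
  have "ip M (F n) (F n) = ip M (\<lambda>x. f x - F n x) (\<lambda>x. f x - F n x) + 2 * ip M (F n) f - ip M f f" for n
    using assms by (simp add: ip_diff_left ip_diff_right sq_int_diff ip_commute[of M f "F n"])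
  moreover have "(\<lambda>n. ip M (\<lambda>x. f x - F n x) (\<lambda>x. f x - F n x) + 2 * ip M (F n) f - ip M f f) \<longlonglongrightarrow> 0 + 2 * ip M f f - ip M f f"
    by (intro tendsto_intros assms ip_tendsto_left)
  ultimately show ?thesis by simp
qed

lemma nn_integral_ip:
  assumes "sq_int M f" shows "(\<integral>\<^sup>+x. ennreal (f x \<bullet> f x) \<partial>M) = ennreal (ip M f f)"
  unfolding ip_def using assms by (intro nn_integral_eq_integral) (auto simp: sq_int_def)

lemma sq_int_iff_nn:
  assumes "f \<in> borel_measurable M" shows "sq_int M f \<longleftrightarrow> (\<integral>\<^sup>+x. ennreal (f x \<bullet> f x) \<partial>M) < \<infinity>"
  using assms unfolding sq_int_def by (auto simp: integrable_iff_bounded)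

text \<open>A sequence with \<open>\<parallel>F (n+1) - F n\<parallel> < 2 ^ (- n)\<close> converges almost everywhere, because
  \<open>t \<le> 2 ^ (- n) + 2 ^ n t ^ 2\<close> bounds the increments by an almost everywhere summable sequence.\<close>

lemma L2_fast_Cauchy_AE_convergent:
  fixes F :: "nat \<Rightarrow> 'a \<Rightarrow> 'b::euclidean_space"
  assumes "\<And>n. sq_int M (F n)"
    and "\<And>n. ip M (\<lambda>x. F (Suc n) x - F n x) (\<lambda>x. F (Suc n) x - F n x) \<le> 1 / 4 ^ n"
  shows "AE x in M. convergent (\<lambda>n. F n x)"
proof -
  have [measurable]: "F n \<in> borel_measurable M" for n using assms(1) by (simp add: sq_int_def)
  define d where "d n x = F (Suc n) x - F n x" for n x
  have [measurable]: "d n \<in> borel_measurable M" for n unfolding d_def by measurable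
  have dint: "sq_int M (d n)" for n unfolding d_def by (intro sq_int_diff assms)
  have "(\<integral>\<^sup>+x. (\<Sum>n. ennreal (2 ^ n * (d n x \<bullet> d n x))) \<partial>M) = (\<Sum>n. \<integral>\<^sup>+x. ennreal (2 ^ n * (d n x \<bullet> d n x)) \<partial>M)"
    by (intro nn_integral_suminf) measurable
  also have "\<dots> = (\<Sum>n. ennreal (2 ^ n * ip M (d n) (d n)))"
    by (intro suminf_cong) (simp add: ennreal_mult' nn_integral_cmult nn_integral_ip[OF dint])
  also have "\<dots> \<le> (\<Sum>n. ennreal ((1/2) ^ n))"
  proof (intro suminf_le ennreal_leI)
    fix n
    have "2 ^ n * ip M (d n) (d n) \<le> 2 ^ n * (1 / 4 ^ n)"
      using assms(2)[of n] by (intro mult_left_mono) (auto simp: d_def[abs_def])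
    also have "\<dots> = (1/2::real) ^ n" by (simp add: power_divide power_mult_distrib[symmetric] divide_simps)
    finally show "2 ^ n * ip M (d n) (d n) \<le> (1/2) ^ n" .
  qed auto
  also have "\<dots> = ennreal 2"
    by (subst suminf_ennreal2) (auto simp: suminf_geometric)
  finally have "(\<integral>\<^sup>+x. (\<Sum>n. ennreal (2 ^ n * (d n x \<bullet> d n x))) \<partial>M) \<noteq> \<infinity>"
    by (auto simp: top_unique)
  then have "AE x in M. (\<Sum>n. ennreal (2 ^ n * (d n x \<bullet> d n x))) \<noteq> \<infinity>"
    by (intro nn_integral_PInf_AE) auto
  then show ?thesis
  proof (rule AE_mp, intro AE_I2 impI)
    fix x assume "(\<Sum>n. ennreal (2 ^ n * (d n x \<bullet> d n x))) \<noteq> \<infinity>"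
    then have s: "summable (\<lambda>n. 2 ^ n * (d n x \<bullet> d n x))"
      by (intro summable_suminf_not_top) (auto simp: top_unique)
    have "norm (d n x) \<le> (1/2) ^ n + 2 ^ n * (d n x \<bullet> d n x)" for n
    proof (cases "norm (d n x) \<le> (1/2) ^ n")
      case True then show ?thesis by (simp add: add_increasing2)
    next
      case False
      then have "1 \<le> 2 ^ n * norm (d n x)" by (simp add: power_divide divide_simps mult.commute)
      then have "norm (d n x) \<le> 2 ^ n * norm (d n x) * norm (d n x)"
        using mult_right_mono[of 1 "2 ^ n * norm (d n x)" "norm (d n x)"] by simp
      then show ?thesis by (simp add: dot_square_norm power2_eq_square add_increasing mult.assoc)
    qed
    then have "summable (\<lambda>n. norm (d n x))"
      by (intro summable_comparison_test'[OF summable_add[OF summable_geometric[of "1/2::real"] s]]) auto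
    then have "summable (\<lambda>n. d n x)" by (rule summable_norm_cancel)
    then have "convergent (\<lambda>n. \<Sum>i<n. d i x)" by (simp add: summable_iff_convergent)
    moreover have "(\<Sum>i<n. d i x) = F n x - F 0 x" for n
      unfolding d_def by (rule sum_lessThan_telescope)
    ultimately show "convergent (\<lambda>n. F n x)"
      using convergent_diff_const_right_iff[of "\<lambda>n. F n x" "F 0 x"] by simp
  qed
qed

text \<open>Riesz-Fischer: a rapidly Cauchy subsequence converges almost everywhere, and Fatou's
  lemma turns this back into convergence in the norm, for the whole sequence.\<close>

lemma L2_complete:
  fixes F :: "nat \<Rightarrow> 'a \<Rightarrow> 'b::euclidean_space"
  assumes sq: "\<And>n. sq_int M (F n)"
    and Cauchy: "\<And>e. e > 0 ==> \<exists>N. \<forall>m\<ge>N. \<forall>n\<ge>N. ip M (\<lambda>x. F m x - F n x) (\<lambda>x. F m x - F n x) < e"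
  shows "\<exists>f. sq_int M f \<and> (\<lambda>n. ip M (\<lambda>x. f x - F n x) (\<lambda>x. f x - F n x)) \<longlonglongrightarrow> 0"
proof -
  have [measurable]: "F n \<in> borel_measurable M" for n using sq by (simp add: sq_int_def)
  define N where "N k = (SOME N. \<forall>m\<ge>N. \<forall>n\<ge>N. ip M (\<lambda>x. F m x - F n x) (\<lambda>x. F m x - F n x) < 1 / 4 ^ k)" for k :: nat
  have N: "ip M (\<lambda>x. F m x - F n x) (\<lambda>x. F m x - F n x) < 1 / 4 ^ k" if "m \<ge> N k" "n \<ge> N k" for k m n
    using someI_ex[OF Cauchy[of "1 / 4 ^ k"]] that unfolding N_def by auto
  \<comment> \<open>The summand k sends \<open>r k\<close> to infinity; the sum makes it monotone
    and at least \<open>N k\<close>.\<close>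
  define r where "r k = k + (\<Sum>i\<le>k. N i)" for k
  have rN: "N k \<le> r k" for k unfolding r_def by (simp add: member_le_sum trans_le_add2)
  have mono: "r k \<le> r (Suc k)" for k unfolding r_def by simp
  have rk: "k \<le> r k" for k unfolding r_def by simp
  have AEc: "AE x in M. convergent (\<lambda>k. F (r k) x)"
    by (rule L2_fast_Cauchy_AE_convergent[OF sq])
      (rule less_imp_le[OF N], auto intro: order_trans[OF rN mono] rN)
  define f where "f x = lim (\<lambda>k. F (r k) x)" for x
  have [measurable]: "f \<in> borel_measurable M" unfolding f_def by measurable
  have bound: "(\<integral>\<^sup>+x. ennreal ((f x - F n x) \<bullet> (f x - F n x)) \<partial>M) \<le> ennreal (1 / 4 ^ k)" if "n \<ge> N k" for n k
  proof -
    have "(\<integral>\<^sup>+x. ennreal ((f x - F n x) \<bullet> (f x - F n x)) \<partial>M)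
       = (\<integral>\<^sup>+x. liminf (\<lambda>j. ennreal ((F (r j) x - F n x) \<bullet> (F (r j) x - F n x))) \<partial>M)"
    proof (rule nn_integral_cong_AE, rule AE_mp[OF AEc], intro AE_I2 impI)
      fix x assume "convergent (\<lambda>k. F (r k) x)"
      then have "(\<lambda>k. F (r k) x) \<longlonglongrightarrow> f x" by (simp add: f_def convergent_LIMSEQ_iff)
      then have "(\<lambda>j. ennreal ((F (r j) x - F n x) \<bullet> (F (r j) x - F n x))) \<longlonglongrightarrow> ennreal ((f x - F n x) \<bullet> (f x - F n x))"
        by (intro tendsto_intros)
      then show "ennreal ((f x - F n x) \<bullet> (f x - F n x)) = liminf (\<lambda>j. ennreal ((F (r j) x - F n x) \<bullet> (F (r j) x - F n x)))"
        by (rule lim_imp_Liminf[OF trivial_limit_sequentially, symmetric])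
    qed
    also have "\<dots> \<le> liminf (\<lambda>j. \<integral>\<^sup>+x. ennreal ((F (r j) x - F n x) \<bullet> (F (r j) x - F n x)) \<partial>M)"
      by (intro nn_integral_liminf) measurable
    also have "\<dots> \<le> ennreal (1 / 4 ^ k)"
    proof (rule order_trans[OF Liminf_le_Limsup Limsup_bounded], simp, rule eventually_sequentiallyI[of "N k"])
      fix j assume "N k \<le> j"
      then have "N k \<le> r j" using rk[of j] by simp
      then show "(\<integral>\<^sup>+x. ennreal ((F (r j) x - F n x) \<bullet> (F (r j) x - F n x)) \<partial>M) \<le> ennreal (1 / 4 ^ k)"
        using N[of k "r j" n] that by (simp add: nn_integral_ip[OF sq_int_diff[OF sq sq]] ennreal_leI less_imp_le)
    qed
    finally show ?thesis .
  qed
  have sqd: "sq_int M (\<lambda>x. f x - F (N 0) x)"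
    using bound[of 0 "N 0"] by (subst sq_int_iff_nn) (auto simp: le_less_trans)
  have sqf: "sq_int M f" using sq_int_add[OF sqd sq[of "N 0"]] by simp
  have b2: "ip M (\<lambda>x. f x - F n x) (\<lambda>x. f x - F n x) \<le> 1 / 4 ^ k" if "n \<ge> N k" for n k
    using bound[OF that] by (simp add: nn_integral_ip[OF sq_int_diff[OF sqf sq]] )
  have "(\<lambda>n. ip M (\<lambda>x. f x - F n x) (\<lambda>x. f x - F n x)) \<longlonglongrightarrow> 0"
  proof (rule LIMSEQ_I)
    fix e :: real assume "e > 0"
    then obtain k where "(1/4::real) ^ k < e" using real_arch_pow_inv[of e "1/4"] by auto
    then have "norm (ip M (\<lambda>x. f x - F n x) (\<lambda>x. f x - F n x) - 0) < e" if "n \<ge> N k" for n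
      using b2[OF that] ip_nonneg[of M "\<lambda>x. f x - F n x"] by (simp add: power_divide)
    then show "\<exists>no. \<forall>n\<ge>no. norm (ip M (\<lambda>x. f x - F n x) (\<lambda>x. f x - F n x) - 0) < e" by blast
  qed
  with sqf show ?thesis by blast
qed

section \<open>Orthonormal frames and the Sobolev space\<close>

lemma borel_measurable_vecI:
  fixes f :: "'a \<Rightarrow> real^'n::finite"
  assumes "\<And>i. (\<lambda>x. f x $ i) \<in> borel_measurable M"
  shows "f \<in> borel_measurable M"
  using assms by (subst borel_measurable_euclidean_space) (auto simp: Basis_vec_def inner_axis)

lemma borel_measurable_vec_nthI:
  fixes f :: "'a \<Rightarrow> 'b::real_normed_vector^'n::finite"
  assumes "f \<in> borel_measurable M"
  shows "(\<lambda>x. f x $ i) \<in> borel_measurable M"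
  by (rule borel_measurable_continuous_on[OF _ assms]) (intro continuous_intros)

lemma jacobian_nth:
  fixes f :: "real^2 \<Rightarrow> real^'n::finite"
  assumes "f differentiable (at x)"
  shows "jacobian f (at x) $ i $ j = partial_deriv j (\<lambda>x. f x $ i) x"
proof -
  have "(f has_derivative frechet_derivative f (at x)) (at x)"
    using assms by (simp add: frechet_derivative_works)
  from bounded_linear.has_derivative[OF bounded_linear_vec_nth[of i] this]
  show ?thesis by (simp add: jacobian_def matrix_def partial_deriv_eqI)
qed

lemma
  assumes "surface A" "surface B" "smooth_map A B F" "c \<in> A" "d \<in> B"
  shows smooth_map_differentiable:
      "\<And>p. p \<in> fst c ==> F p \<in> fst d ==> in_charts c d F differentiable (at (snd c p))"
    and continuous_tangent_matrix:
      "continuous_on (fst c \<inter> F -` fst d) (\<lambda>p. tangent_matrix c d F p $ i $ j)"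
proof -
  interpret A: surface A by fact
  interpret B: surface B by fact
  have "open (F -` fst d)"
    using assms(3,5) by (intro open_vimage B.open_dom) (auto simp: smooth_map_def)
  then have o: "open (snd c ` (fst c \<inter> F -` fst d))"
    by (intro A.open_image assms open_Int A.open_dom) auto
  have sm: "smooth_on (snd c ` (fst c \<inter> F -` fst d)) (\<lambda>x. in_charts c d F x $ i)" for i
    using assms unfolding smooth_map_def by blast
  show d: "in_charts c d F differentiable (at (snd c p))" if "p \<in> fst c" "F p \<in> fst d" for p
    by (rule differentiable_vec_componentwise, rule smooth_on_imp_differentiable[OF sm o]) (use that in auto)
  have "continuous_on (fst c \<inter> F -` fst d) (\<lambda>p. partial_deriv j (\<lambda>x. in_charts c d F x $ i) (snd c p))"
    by (rule continuous_on_compose2[OF smooth_on_imp_continuous_on[OF smooth_on_partial[OF sm]]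
        continuous_on_subset[OF A.continuous_chart[OF assms(4)]]]) auto
  then show "continuous_on (fst c \<inter> F -` fst d) (\<lambda>p. tangent_matrix c d F p $ i $ j)"
    by (rule continuous_on_eq) (use d in \<open>auto simp: tangent_matrix_def jacobian_nth\<close>)
qed

context surface begin

lemma smooth_map_id: "smooth_map A A id"
  using atlas by (simp add: smooth_atlas_def)

definition cover_chart :: "nat \<Rightarrow> 'm chart" where
  "cover_chart = (SOME ch. (\<forall>n. ch n \<in> A) \<and> (\<Union>n. fst (ch n)) = UNIV)"

text \<open>\<open>chart_at\<close> is an arbitrary choice at each point, so nothing built on it is
  visibly measurable. The first chart of a countable cover is a choice that is constant on each of
  countably many Borel sets.\<close>

definition base_chart :: "'m \<Rightarrow> 'm chart" where
  "base_chart p = cover_chart (LEAST n. p \<in> fst (cover_chart n))"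

lemma cover_chart: "cover_chart n \<in> A" "(\<Union>n. fst (cover_chart n)) = UNIV"
  using someI_ex[OF countable_chart_cover] unfolding cover_chart_def by blast+

lemma base_chart_in: "base_chart p \<in> A" "p \<in> fst (base_chart p)"
proof -
  have "p \<in> (\<Union>n. fst (cover_chart n))" using cover_chart(2) by simp
  then have "\<exists>n. p \<in> fst (cover_chart n)" by blast
  from LeastI_ex[OF this] show "p \<in> fst (base_chart p)" by (simp add: base_chart_def)
  show "base_chart p \<in> A" by (simp add: base_chart_def cover_chart)
qed

lemma measurable_base_chart:
  fixes F :: "'m chart \<Rightarrow> 'm \<Rightarrow> 'b::topological_space"
  assumes "\<And>c. c \<in> A ==> F c \<in> borel_measurable (restrict_space borel (fst c))"
  shows "(\<lambda>p. F (base_chart p) p) \<in> borel_measurable borel"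
proof -
  define D where "D n = fst (cover_chart n) - (\<Union>i<n. fst (cover_chart i))" for n
  have D: "D n \<in> sets borel" "D n \<subseteq> fst (cover_chart n)" for n
    using cover_chart(1) by (auto simp: D_def intro!: sets.Diff sets.countable_UN)
  have base: "base_chart p = cover_chart n" if "p \<in> D n" for p n
  proof -
    have "(LEAST m. p \<in> fst (cover_chart m)) = n"
    proof (rule Least_equality)
      show "p \<in> fst (cover_chart n)" using that by (simp add: D_def)
      show "n \<le> m" if "p \<in> fst (cover_chart m)" for m
        using \<open>p \<in> D n\<close> that by (cases "n \<le> m") (auto simp: D_def)
    qed
    then show ?thesis by (simp add: base_chart_def)
  qed
  have UD: "p \<in> D (LEAST n. p \<in> fst (cover_chart n))" for p
    using base_chart_in(2)[of p] unfolding D_def base_chart_def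
    by (auto dest: not_less_Least)
  show ?thesis
  proof (rule measurable_piecewise_restrict[of "range D"])
    show "space borel \<subseteq> \<Union> (range D)" using UD by auto
    fix E assume "E \<in> range D"
    then obtain n where E: "E = D n" by auto
    then show "E \<inter> space borel \<in> sets borel" using D by simp
    have "F (cover_chart n) \<in> borel_measurable (restrict_space borel E)"
      unfolding E by (rule measurable_restrict_mono[OF assms[OF cover_chart(1)] D(2)])
    moreover have "F (cover_chart n) \<in> borel_measurable (restrict_space borel E) \<longleftrightarrow>
        (\<lambda>p. F (base_chart p) p) \<in> borel_measurable (restrict_space borel E)"
      by (rule measurable_cong) (simp add: space_restrict_space E base)
    ultimately show "(\<lambda>p. F (base_chart p) p) \<in> borel_measurable (restrict_space borel E)" by simp
  qed auto
qed

lemma covector_field_transform: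
  "covector_field A \<omega> ==> c \<in> A ==> d \<in> A ==> p \<in> fst c ==> p \<in> fst d ==>
    \<omega> c p = transpose (tangent_matrix c d id p) *v \<omega> d p"
  unfolding covector_field_def by blast

lemma covector_field_measurable:
  "covector_field A \<omega> ==> c \<in> A ==> \<omega> c \<in> borel_measurable (restrict_space borel (fst c))"
  using borel_dom[of c] unfolding covector_field_def set_borel_measurable_def
  by (subst borel_measurable_restrict_space_iff) auto

lemma differential_continuous:
  assumes "smooth_fun A f" "c \<in> A" shows "continuous_on (fst c) (\<lambda>p. differential f c p $ i)"
proof -
  have "smooth_on (snd c ` fst c) (f \<circ> chart_inv c)" using assms by (auto simp: smooth_fun_def)
  from continuous_on_compose2[OF smooth_on_imp_continuous_on[OF smooth_on_partial[OF this]]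
        continuous_chart[OF assms(2)]]
  show ?thesis by (simp add: differential_def)
qed

lemma covector_field_differential:
  assumes "smooth_fun A f" shows "covector_field A (differential f)"
  unfolding covector_field_def set_borel_measurable_def
proof (intro conjI ballI)
  fix c assume c: "c \<in> A"
  have "continuous_on (fst c) (differential f c)"
    using differential_continuous[OF assms c] by (subst continuous_on_componentwise) (auto simp: Basis_vec_def inner_axis)
  then show "(\<lambda>x. indicator (fst c) x *\<^sub>R differential f c x) \<in> borel_measurable borel"
    using c by (intro borel_measurable_continuous_on_indicator borel_dom)
qed (use assms differential_transform in blast)

lemma smooth_fun_add:
  assumes "smooth_fun A f" "smooth_fun A h" shows "smooth_fun A (\<lambda>p. a * f p + b * h p)"
  unfolding smooth_fun_def
proof
  fix c assume c: "c \<in> A"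
  then have "smooth_on (snd c ` fst c) (\<lambda>x. a * (f \<circ> chart_inv c) x + b * (h \<circ> chart_inv c) x)"
    using assms unfolding smooth_fun_def by (intro smooth_on_add smooth_on_mult open_img) (auto simp: o_def)
  then show "smooth_on (snd c ` fst c) ((\<lambda>p. a * f p + b * h p) \<circ> chart_inv c)" by (simp add: o_def)
qed

lemma test_fun_add:
  assumes "test_fun A f" "test_fun A h" shows "test_fun A (\<lambda>p. a * f p + b * h p)"
  unfolding test_fun_def
proof
  show "smooth_fun A (\<lambda>p. a * f p + b * h p)" using assms smooth_fun_add unfolding test_fun_def by blast
  let ?K = "closure {p. f p \<noteq> 0} \<union> closure {p. h p \<noteq> 0}"
  have "compact ?K" using assms by (simp add: test_fun_def compact_Un)
  have "{p. a * f p + b * h p \<noteq> 0} \<subseteq> ?K"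
  proof
    fix p assume "p \<in> {p. a * f p + b * h p \<noteq> 0}"
    then have "p \<in> {p. f p \<noteq> 0} \<or> p \<in> {p. h p \<noteq> 0}" by auto
    then show "p \<in> ?K" by (elim disjE) (simp_all add: subsetD[OF closure_subset])
  qed
  then have "closure {p. a * f p + b * h p \<noteq> 0} \<subseteq> ?K" by (rule closure_minimal) auto
  then show "compact (closure {p. a * f p + b * h p \<noteq> 0})"
    using compact_Int_closed[OF \<open>compact ?K\<close> closed_closure[of "{p. a * f p + b * h p \<noteq> 0}"]]
    by (simp add: Int_absorb1)
qed

lemma differential_add:
  assumes "smooth_fun A f" "smooth_fun A h" "c \<in> A" "p \<in> fst c"
  shows "differential (\<lambda>p. a * f p + b * h p) c p = a *\<^sub>R differential f c p + b *\<^sub>R differential h c p"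
proof -
  note d = smooth_fun_differentiable[OF assms(1,3,4)] smooth_fun_differentiable[OF assms(2,3,4)]
  have "partial_deriv i ((\<lambda>p. a * f p + b * h p) \<circ> chart_inv c) (snd c p)
     = a * partial_deriv i (f \<circ> chart_inv c) (snd c p) + b * partial_deriv i (h \<circ> chart_inv c) (snd c p)" for i
    using partial_deriv_eqI[OF has_derivative_add[OF
        has_derivative_mult_right[OF d(1)[unfolded frechet_derivative_works], of a]
        has_derivative_mult_right[OF d(2)[unfolded frechet_derivative_works], of b]], of i]
    by (simp add: o_def partial_deriv_def)
  then show ?thesis by (simp add: differential_def vec_eq_iff)
qed

lemma differential_zero_off_support:
  assumes "smooth_fun A f" "c \<in> A" "p \<in> fst c" "p \<notin> closure {p. f p \<noteq> 0}"
  shows "differential f c p = 0"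
proof -
  let ?U = "fst c - closure {p. f p \<noteq> 0}"
  have "open (snd c ` ?U)" using assms by (intro open_image open_Diff open_dom) auto
  then have "partial_deriv i (f \<circ> chart_inv c) (snd c p) = partial_deriv i (\<lambda>x. 0) (snd c p)" for i
  proof (rule partial_deriv_cong_open)
    show "snd c p \<in> snd c ` ?U" using assms by auto
    show "(f \<circ> chart_inv c) y = 0" if "y \<in> snd c ` ?U" for y
      using that assms closure_subset[of "{p. f p \<noteq> 0}"] by auto
  qed
  moreover have "partial_deriv i (\<lambda>x. 0) x = 0" for i x
    by (rule trans[OF partial_deriv_eqI[of _ "\<lambda>x. 0"]]) auto
  ultimately show ?thesis by (simp add: differential_def vec_eq_iff)
qed

end

section \<open>Orthonormal frames\<close>

text \<open>Gram-Schmidt: the values of \<xi> on the orthonormal vectors e1 = d1 / sqrt G11 and e2 =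
  (G11 d2 - G12 d1) / sqrt (G11 det G) made from the coordinate vectors d1, d2. The explicit formula
  is visibly measurable in G and \<xi>.\<close>

definition frame_components :: "real^2^2 \<Rightarrow> real^2 \<Rightarrow> real^2" where
  "frame_components G \<xi> = vector [\<xi> $ 1 / sqrt (G $ 1 $ 1), (G $ 1 $ 1 * \<xi> $ 2 - G $ 1 $ 2 * \<xi> $ 1) / sqrt (G $ 1 $ 1 * det G)]"

text \<open>The covector with prescribed values on that orthonormal frame, found by solving the
  triangular system.\<close>

definition covector_of_components :: "real^2^2 \<Rightarrow> real^2 \<Rightarrow> real^2" where
  "covector_of_components G x = vector [sqrt (G $ 1 $ 1) * x $ 1,
     (sqrt (G $ 1 $ 1 * det G) * x $ 2 + G $ 1 $ 2 * (sqrt (G $ 1 $ 1) * x $ 1)) / G $ 1 $ 1]"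

lemma frame_components_inner:
  assumes "G $ 2 $ 1 = G $ 1 $ 2" "G $ 1 $ 1 > 0" "det G > 0"
  shows "\<xi> \<bullet> (matrix_inv G *v \<eta>) = frame_components G \<xi> \<bullet> frame_components G \<eta>"
proof -
  have d: "det G = G $ 1 $ 1 * G $ 2 $ 2 - G $ 1 $ 2 * G $ 1 $ 2" by (simp add: det_2 assms)
  have "frame_components G \<xi> \<bullet> frame_components G \<eta> = \<xi> $ 1 * \<eta> $ 1 / G $ 1 $ 1
    + (G $ 1 $ 1 * \<xi> $ 2 - G $ 1 $ 2 * \<xi> $ 1) * (G $ 1 $ 1 * \<eta> $ 2 - G $ 1 $ 2 * \<eta> $ 1) / (G $ 1 $ 1 * det G)"
    using assms by (simp add: frame_components_def inner_vec_def sum_2 abs_mult)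
  also have "\<dots> = (\<xi> $ 1 * \<eta> $ 1 * det G
    + (G $ 1 $ 1 * \<xi> $ 2 - G $ 1 $ 2 * \<xi> $ 1) * (G $ 1 $ 1 * \<eta> $ 2 - G $ 1 $ 2 * \<eta> $ 1)) / (G $ 1 $ 1 * det G)"
    using assms by (simp add: field_simps)
  also have "\<xi> $ 1 * \<eta> $ 1 * det G
    + (G $ 1 $ 1 * \<xi> $ 2 - G $ 1 $ 2 * \<xi> $ 1) * (G $ 1 $ 1 * \<eta> $ 2 - G $ 1 $ 2 * \<eta> $ 1)
    = G $ 1 $ 1 * (\<xi> $ 1 * (G $ 2 $ 2 * \<eta> $ 1 - G $ 1 $ 2 * \<eta> $ 2) + \<xi> $ 2 * (G $ 1 $ 1 * \<eta> $ 2 - G $ 1 $ 2 * \<eta> $ 1))"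
    unfolding d by (simp add: algebra_simps)
  also have "\<dots> / (G $ 1 $ 1 * det G) = \<xi> \<bullet> (matrix_inv G *v \<eta>)"
    using assms by (simp add: matrix_inv_2 inner_vec_def sum_2 matrix_vector_mult_def field_simps)
  finally show ?thesis by simp
qed

lemma frame_components_of_components:
  assumes "G $ 1 $ 1 > 0" "det G > 0"
  shows "frame_components G (covector_of_components G x) = x"
  using assms by (simp add: frame_components_def covector_of_components_def vec_eq_iff forall_2)

lemma frame_components_linear:
  "frame_components G (a *\<^sub>R \<xi> + b *\<^sub>R \<eta>) = a *\<^sub>R frame_components G \<xi> + b *\<^sub>R frame_components G \<eta>"
  by (simp add: frame_components_def vec_eq_iff forall_2 add_divide_distrib[symmetric] diff_divide_distrib[symmetric] algebra_simps)

context metric_surface begin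

text \<open>In an orthonormal frame the metric disappears, so square integrable covector fields
  become elements of an ordinary vector-valued L2 space. The frame may jump where
  \<open>base_chart\<close> changes; it is only claimed to be Borel.\<close>

definition frame :: "'m covector_field \<Rightarrow> 'm \<Rightarrow> real^2" where
  "frame \<omega> p = frame_components (g (base_chart p) p) (\<omega> (base_chart p) p)"

text \<open>The way back: it gives an L2 limit of frames components in every chart, with the
  transformation law required of a \<open>covector_field\<close>.\<close>

definition coframe :: "('m \<Rightarrow> real^2) \<Rightarrow> 'm covector_field" where
  "coframe X c p = transpose (tangent_matrix c (base_chart p) id p) *v
     covector_of_components (g (base_chart p) p) (X p)"

text \<open>With S inverse to the Jacobian T, the law for the metric inverts to S g^(-1) S^t, and
  the factors T^t of the two covectors cancel against S and S^t.\<close>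

lemma covector_inner_chart_eq:
  assumes "c \<in> A" "d \<in> A" "p \<in> fst c" "p \<in> fst d"
    and "\<alpha> c p = transpose (tangent_matrix c d id p) *v \<alpha> d p"
    and "\<beta> c p = transpose (tangent_matrix c d id p) *v \<beta> d p"
  shows "\<alpha> c p \<bullet> (matrix_inv (g c p) *v \<beta> c p) = \<alpha> d p \<bullet> (matrix_inv (g d p) *v \<beta> d p)"
proof -
  let ?T = "tangent_matrix c d id p" and ?S = "tangent_matrix d c id p" and ?I = "matrix_inv (g d p)"
  have TS: "?T ** ?S = mat 1" "?S ** ?T = mat 1" using assms transition_inverse by blast+
  have tr: "transpose ?S ** transpose ?T = mat 1" "transpose ?T ** transpose ?S = mat 1"
    using TS by (metis matrix_transpose_mul transpose_mat)+
  have GI: "g d p ** ?I = mat 1"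
    using matrix_inv_2[of "g d p"] metric_spd[OF assms(2,4)]
    by (metis invertible_det_nz invertible_def matrix_inv_eqI order_less_irrefl)
  have "g c p ** (?S ** ?I ** transpose ?S) = transpose ?T ** (g d p ** ((?T ** ?S) ** ?I)) ** transpose ?S"
    by (subst metric_transform[OF assms(1-4)]) (simp only: matrix_mul_assoc)
  also have "\<dots> = mat 1" by (simp add: TS GI tr)
  finally have inv: "matrix_inv (g c p) = ?S ** ?I ** transpose ?S" by (rule matrix_inv_eqI)
  have "matrix_inv (g c p) *v \<beta> c p = (?S ** ?I ** (transpose ?S ** transpose ?T)) *v \<beta> d p"
    unfolding inv assms(6) by (simp only: matrix_vector_mul_assoc matrix_mul_assoc)
  then have "\<alpha> c p \<bullet> (matrix_inv (g c p) *v \<beta> c p) = \<alpha> d p \<bullet> (?T *v ((?S ** ?I) *v \<beta> d p))"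
    unfolding assms(5) by (simp add: tr transpose_matrix_vector dot_lmul_matrix)
  then show ?thesis by (simp add: matrix_vector_mul_assoc matrix_mul_assoc TS)
qed

lemma covector_inner_in_chart:
  assumes "covector_field A \<alpha>" "covector_field A \<beta>" "c \<in> A" "p \<in> fst c"
  shows "covector_inner A g \<alpha> \<beta> p = \<alpha> c p \<bullet> (matrix_inv (g c p) *v \<beta> c p)"
  unfolding covector_inner_def Let_def
  by (rule covector_inner_chart_eq)
    (use assms chart_at_in covector_field_transform in blast)+

lemma covector_inner_frame:
  assumes "covector_field A \<alpha>" "covector_field A \<beta>"
  shows "covector_inner A g \<alpha> \<beta> p = frame \<alpha> p \<bullet> frame \<beta> p"
  unfolding covector_inner_in_chart[OF assms base_chart_in] frame_def
  by (rule frame_components_inner) (use metric_spd[OF base_chart_in] in auto)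

lemma measurable_metric:
  "c \<in> A ==> (\<lambda>p. g c p $ i $ j) \<in> borel_measurable (restrict_space borel (fst c))"
  by (intro borel_measurable_continuous_on_restrict continuous_intros continuous_metric)

lemma measurable_det_metric:
  "c \<in> A ==> (\<lambda>p. det (g c p)) \<in> borel_measurable (restrict_space borel (fst c))"
  unfolding det_2 by (intro borel_measurable_diff borel_measurable_times measurable_metric)

lemma measurable_frame:
  assumes "covector_field A \<omega>" shows "frame \<omega> \<in> borel_measurable borel"
  unfolding frame_def
proof (rule measurable_base_chart, rule borel_measurable_vecI)
  fix c i assume c: "c \<in> A"
  note [measurable] = measurable_metric[OF c] measurable_det_metric[OF c]
    borel_measurable_vec_nthI[OF covector_field_measurable[OF assms c]]
  show "(\<lambda>p. frame_components (g c p) (\<omega> c p) $ i) \<in> borel_measurable (restrict_space borel (fst c))"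
    using exhaust_2[of i] by (elim disjE) (simp_all add: frame_components_def)
qed

lemma frame_linear: "frame (\<lambda>c q. a *\<^sub>R \<alpha> c q + b *\<^sub>R \<beta> c q) p = a *\<^sub>R frame \<alpha> p + b *\<^sub>R frame \<beta> p"
  unfolding frame_def by (rule frame_components_linear)

lemma frame_diff: "frame (\<lambda>c q. \<alpha> c q - \<beta> c q) p = frame \<alpha> p - frame \<beta> p"
  using frame_linear[of 1 \<alpha> "-1" \<beta> p] by simp

lemma frame_coframe: "frame (coframe X) p = X p"
  using metric_spd[OF base_chart_in, of p]
  by (simp add: frame_def coframe_def tangent_matrix_id base_chart_in frame_components_of_components)

text \<open>Measurability is the issue, as the base chart changes from point to point. The formula
  is checked for each fixed chart e on the overlap with c, and \<open>measurable_base_chart\<close>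
  glues the results.\<close>

lemma covector_field_coframe:
  assumes "X \<in> borel_measurable borel" shows "covector_field A (coframe X)"
  unfolding covector_field_def set_borel_measurable_def
proof (intro conjI ballI)
  fix c assume c: "c \<in> A"
  have "(\<lambda>p. indicator (fst c) p *\<^sub>R (transpose (tangent_matrix c e id p) *v covector_of_components (g e p) (X p)))
     \<in> borel_measurable (restrict_space borel (fst e))" if e: "e \<in> A" for e
  proof -
    let ?H = "\<lambda>p. transpose (tangent_matrix c e id p) *v covector_of_components (g e p) (X p)"
    let ?R = "restrict_space borel (fst c \<inter> fst e)"
    have [measurable]: "(\<lambda>p. tangent_matrix c e id p $ i $ j) \<in> borel_measurable ?R" for i j
      using continuous_tangent_matrix[OF surface_axioms surface_axioms smooth_map_id c e, of i j]
      by (intro borel_measurable_continuous_on_restrict) simp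
    have [measurable]: "(\<lambda>p. g e p $ i $ j) \<in> borel_measurable ?R" "(\<lambda>p. det (g e p)) \<in> borel_measurable ?R" for i j
      by (rule measurable_restrict_mono[OF measurable_metric[OF e]] measurable_restrict_mono[OF measurable_det_metric[OF e]], auto)+
    have [measurable]: "(\<lambda>p. X p $ i) \<in> borel_measurable ?R" for i
      by (rule measurable_restrict_space1[OF borel_measurable_vec_nthI[OF assms]])
    have "?H \<in> borel_measurable ?R"
    proof (rule borel_measurable_vecI)
      fix i :: 2
      show "(\<lambda>p. ?H p $ i) \<in> borel_measurable ?R"
        by (simp add: matrix_vector_mult_def sum_2 transpose_def covector_of_components_def)
    qed
    then have "(\<lambda>p. indicator (fst c \<inter> fst e) p *\<^sub>R ?H p) \<in> borel_measurable borel"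
      using c e by (subst (asm) borel_measurable_restrict_space_iff) auto
    moreover have "(\<lambda>p. indicator (fst c \<inter> fst e) p *\<^sub>R ?H p) = (\<lambda>p. indicator (fst e) p *\<^sub>R indicator (fst c) p *\<^sub>R ?H p)"
      by (auto simp: fun_eq_iff indicator_def)
    ultimately show ?thesis
      using e by (subst borel_measurable_restrict_space_iff) auto
  qed
  from measurable_base_chart[of "\<lambda>e p. indicator (fst c) p *\<^sub>R (transpose (tangent_matrix c e id p) *v covector_of_components (g e p) (X p))", OF this]
  show "(\<lambda>p. indicator (fst c) p *\<^sub>R coframe X c p) \<in> borel_measurable borel"
    by (simp add: coframe_def)
next
  fix c d p assume "c \<in> A" "d \<in> A" "p \<in> fst c \<inter> fst d"
  then have "tangent_matrix c (base_chart p) id p = tangent_matrix d (base_chart p) id p ** tangent_matrix c d id p"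
    by (intro transition_compose base_chart_in) auto
  then show "coframe X c p = transpose (tangent_matrix c d id p) *v coframe X d p"
    by (simp only: coframe_def matrix_transpose_mul matrix_vector_mul_assoc)
qed

end

text \<open>Parallelogram law: the right side minus the left side is the squared norm of a x - b
  y.\<close>

lemma ip_linear_combination_le:
  assumes "sq_int M x" "sq_int M y"
  shows "ip M (\<lambda>p. a *\<^sub>R x p + b *\<^sub>R y p) (\<lambda>p. a *\<^sub>R x p + b *\<^sub>R y p)
     \<le> 2 * a\<^sup>2 * ip M x x + 2 * b\<^sup>2 * ip M y y"
proof -
  have "0 \<le> ip M (\<lambda>p. a *\<^sub>R x p - b *\<^sub>R y p) (\<lambda>p. a *\<^sub>R x p - b *\<^sub>R y p)" by (rule ip_nonneg)
  then show ?thesis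
    using assms by (simp add: ip_add_left ip_add_right ip_diff_left ip_diff_right sq_int_add sq_int_diff sq_int_scaleR
        ip_scaleR_left ip_scaleR_right power2_eq_square ip_commute[of M y x] algebra_simps)
qed

section \<open>Jets and the H1 norm\<close>

context metric_surface begin

lemma emeasure_compact_finite:
  assumes "compact K" shows "emeasure (vol A g) K < \<infinity>"
proof -
  have "\<exists>V. open V \<and> p \<in> V \<and> emeasure (vol A g) V < \<infinity>" for p
  proof -
    let ?c = "chart_at A p"
    have c: "?c \<in> A" "p \<in> fst ?c" by (rule chart_at_in)+
    have "snd ?c p \<in> snd ?c ` fst ?c" using c(2) by (rule imageI)
    then obtain r where r: "r > 0" "cball (snd ?c p) r \<subseteq> snd ?c ` fst ?c"
      using open_img[OF c(1)] unfolding open_contains_cball by blast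
    let ?V = "fst ?c \<inter> snd ?c -` ball (snd ?c p) r"
    have "bounded (area_density ?c ` cball (snd ?c p) r)"
      by (intro compact_imp_bounded compact_continuous_image continuous_on_subset[OF continuous_area_density] c r) simp
    then obtain B where "B > 0" "\<forall>y\<in>area_density ?c ` cball (snd ?c p) r. norm y \<le> B"
      unfolding bounded_pos by blast
    then have B: "\<bar>area_density ?c x\<bar> \<le> B" if "x \<in> cball (snd ?c p) r" for x
      using that by simp
    have o: "open ?V" by (intro continuous_open_preimage continuous_chart c open_dom) simp
    have "emeasure (vol A g) ?V = (\<integral>\<^sup>+x. ennreal (area_density ?c x) * indicator (snd ?c ` ?V) x \<partial>lborel)"
      by (intro emeasure_vol c) (use o in auto)
    also have "\<dots> \<le> (\<integral>\<^sup>+x. ennreal B * indicator (cball (snd ?c p) r) x \<partial>lborel)"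
    proof (intro nn_integral_mono)
      fix x
      show "ennreal (area_density ?c x) * indicator (snd ?c ` ?V) x \<le> ennreal B * indicator (cball (snd ?c p) r) x"
      proof (cases "x \<in> snd ?c ` ?V")
        case True
        then have "x \<in> cball (snd ?c p) r" by auto
        with B[OF this] True show ?thesis by (auto simp: indicator_def intro!: ennreal_leI)
      qed simp
    qed
    also have "\<dots> = ennreal B * emeasure lborel (cball (snd ?c p) r)" by (simp add: nn_integral_cmult_indicator)
    also have "\<dots> < \<infinity>" using emeasure_bounded_finite[of "cball (snd ?c p) r"] by (simp add: ennreal_mult_less_top)
    finally show ?thesis using o c r(1) by (intro exI[of _ ?V]) simp
  qed
  then have "\<forall>p. \<exists>V. open V \<and> p \<in> V \<and> emeasure (vol A g) V < \<infinity>" by blast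
  from choice[OF this] obtain V where "\<forall>p. open (V p) \<and> p \<in> V p \<and> emeasure (vol A g) (V p) < \<infinity>" ..
  then have V: "open (V p)" "p \<in> V p" "emeasure (vol A g) (V p) < \<infinity>" for p by simp_all
  obtain D where D: "D \<subseteq> K" "finite D" "K \<subseteq> (\<Union>p\<in>D. V p)"
    by (rule compactE_image[OF assms, of K V]) (use V in blast)+
  have "emeasure (vol A g) K \<le> emeasure (vol A g) (\<Union>p\<in>D. V p)"
    using V D by (intro emeasure_mono) auto
  also have "\<dots> \<le> (\<Sum>p\<in>D. emeasure (vol A g) (V p))"
    using V D by (intro emeasure_subadditive_finite) auto
  also have "\<dots> < \<infinity>" using V D by simp
  finally show ?thesis .
qed

text \<open>The squared H1 norm is the squared L2 norm of this pair. Convergence of functions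
  together with their differentials thus becomes a single convergence in L2, and completeness is
  inherited.\<close>

definition jet :: "('m \<Rightarrow> real) \<Rightarrow> 'm covector_field \<Rightarrow> 'm \<Rightarrow> real \<times> (real^2)" where
  "jet f \<omega> p = (f p, frame \<omega> p)"

abbreviation test_jet :: "('m \<Rightarrow> real) \<Rightarrow> 'm \<Rightarrow> real \<times> (real^2)" where
  "test_jet \<phi> \<equiv> jet \<phi> (differential \<phi>)"

lemma jet_inner: "jet f \<alpha> p \<bullet> jet h \<beta> p = f p * h p + frame \<alpha> p \<bullet> frame \<beta> p"
  by (simp add: jet_def)

lemma jet_diff: "jet f \<alpha> p - jet h \<beta> p = jet (\<lambda>p. f p - h p) (\<lambda>c q. \<alpha> c q - \<beta> c q) p"
  by (simp add: jet_def frame_diff)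

lemma test_jet_linear:
  assumes "smooth_fun A f" "smooth_fun A h"
  shows "test_jet (\<lambda>p. a * f p + b * h p) p = a *\<^sub>R test_jet f p + b *\<^sub>R test_jet h p"
proof -
  have "frame (differential (\<lambda>p. a * f p + b * h p)) p = a *\<^sub>R frame (differential f) p + b *\<^sub>R frame (differential h) p"
    unfolding frame_def using differential_add[OF assms base_chart_in] by (simp add: frame_components_linear)
  then show ?thesis by (simp add: jet_def)
qed

lemma measurable_jet:
  assumes "f \<in> borel_measurable borel" "covector_field A \<omega>"
  shows "jet f \<omega> \<in> borel_measurable borel"
  unfolding jet_def[abs_def] using assms measurable_frame[OF assms(2)] by (intro borel_measurable_Pair)

text \<open>The frame may be discontinuous where \<open>base_chart\<close> jumps, but its squared
  length is the metric norm of the differential. That can be computed in any chart, by the cofactor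
  formula for the inverse metric, and is continuous there.\<close>

lemma frame_differential_continuous:
  assumes "smooth_fun A f" shows "continuous_on UNIV (\<lambda>p. frame (differential f) p \<bullet> frame (differential f) p)"
proof -
  have "continuous_on (fst c) (\<lambda>p. covector_inner A g (differential f) (differential f) p)" if c: "c \<in> A" for c
  proof -
    have m: "continuous_on (fst c) (\<lambda>p. g c p $ i $ j)" for i j
      by (intro continuous_intros continuous_metric c)
    have det: "continuous_on (fst c) (\<lambda>p. det (g c p))" unfolding det_2 by (intro continuous_intros m)
    note d = differential_continuous[OF assms c]
    have gen: "continuous_on S (\<lambda>p. (x p * (w p * x p - v p * y p) + y p * (u p * y p - v p * x p)) / e p)"
      if "continuous_on S x" "continuous_on S y" "continuous_on S u" "continuous_on S v" "continuous_on S w"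
        "continuous_on S e" "\<And>p. p \<in> S ==> e p \<noteq> 0"
      for S :: "'m set" and x y u v w e :: "'m \<Rightarrow> real"
      using that by (intro continuous_intros) auto
    have "continuous_on (fst c) (\<lambda>p. (differential f c p $ 1 * (g c p $ 2 $ 2 * differential f c p $ 1 - g c p $ 1 $ 2 * differential f c p $ 2)
        + differential f c p $ 2 * (g c p $ 1 $ 1 * differential f c p $ 2 - g c p $ 1 $ 2 * differential f c p $ 1)) / det (g c p))"
      by (rule gen[OF d d m m m det]) (use metric_spd(4)[OF c] in force)
    then show ?thesis
    proof (rule continuous_on_eq)
      fix p assume p: "p \<in> fst c"
      note s = metric_spd[OF c p]
      show "(differential f c p $ 1 * (g c p $ 2 $ 2 * differential f c p $ 1 - g c p $ 1 $ 2 * differential f c p $ 2)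
        + differential f c p $ 2 * (g c p $ 1 $ 1 * differential f c p $ 2 - g c p $ 1 $ 2 * differential f c p $ 1)) / det (g c p)
        = covector_inner A g (differential f) (differential f) p"
        using s by (simp add: covector_inner_in_chart[OF covector_field_differential[OF assms] covector_field_differential[OF assms] c p]
          matrix_inv_2 inner_vec_def sum_2 matrix_vector_mult_def field_simps)
    qed
  qed
  then have "continuous_on (\<Union>c\<in>A. fst c) (\<lambda>p. covector_inner A g (differential f) (differential f) p)"
    by (intro continuous_on_open_UN) (auto simp: open_dom)
  then show ?thesis
    by (simp add: cover covector_inner_frame[OF covector_field_differential[OF assms] covector_field_differential[OF assms]])
qed

text \<open>The squared length is continuous, vanishes off the support, and the support is compact,
  hence of finite area.\<close>

lemma test_jet_sq_int:
  assumes "test_fun A f" shows "sq_int (vol A g) (test_jet f)"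
proof -
  let ?K = "closure {p. f p \<noteq> 0}"
  let ?q = "\<lambda>p. test_jet f p \<bullet> test_jet f p"
  have sm: "smooth_fun A f" and K: "compact ?K" using assms by (auto simp: test_fun_def)
  have cont: "continuous_on UNIV ?q"
    unfolding jet_inner by (intro continuous_intros frame_differential_continuous smooth_fun_continuous sm)
  then have "bounded (?q ` ?K)"
    by (intro compact_imp_bounded compact_continuous_image K) (rule continuous_on_subset, auto)
  then obtain B where "\<forall>y\<in>?q ` ?K. norm y \<le> B" unfolding bounded_pos by blast
  then have B: "\<bar>?q p\<bar> \<le> B" if "p \<in> ?K" for p using that by simp
  have zero: "?q p = 0" if "p \<notin> ?K" for p
  proof -
    have "f p = 0" using that closure_subset[of "{p. f p \<noteq> 0}"] by auto
    moreover have "frame (differential f) p = 0"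
      unfolding frame_def differential_zero_off_support[OF sm base_chart_in that]
      by (simp add: frame_components_def vec_eq_iff forall_2)
    ultimately show ?thesis by (simp add: jet_inner)
  qed
  have m: "test_jet f \<in> borel_measurable (vol A g)"
    using measurable_jet[OF borel_measurable_continuous_onI[OF smooth_fun_continuous[OF sm]] covector_field_differential[OF sm]]
    by (simp add: measurable_cong_sets[OF sets_vol refl])
  have "(\<integral>\<^sup>+p. ennreal (?q p) \<partial>vol A g) \<le> (\<integral>\<^sup>+p. ennreal B * indicator ?K p \<partial>vol A g)"
  proof (intro nn_integral_mono)
    fix p
    show "ennreal (?q p) \<le> ennreal B * indicator ?K p"
    proof (cases "p \<in> ?K")
      case True
      then show ?thesis using B[OF True] by (auto intro!: ennreal_leI)
    next
      case False
      then show ?thesis using zero[OF False] by simp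
    qed
  qed
  also have "\<dots> = ennreal B * emeasure (vol A g) ?K" by (simp add: nn_integral_cmult_indicator)
  also have "\<dots> < \<infinity>" using emeasure_compact_finite[OF K] by (simp add: ennreal_mult_less_top)
  finally show ?thesis by (subst sq_int_iff_nn[OF m])
qed

lemma borel_measurable_vol [simp]: "f \<in> borel_measurable (vol A g) \<longleftrightarrow> f \<in> borel_measurable borel"
  by (simp add: measurable_cong_sets[OF sets_vol refl])

lemma covector_field_diff:
  assumes "covector_field A \<alpha>" "covector_field A \<beta>" shows "covector_field A (\<lambda>c q. a *\<^sub>R \<alpha> c q + b *\<^sub>R \<beta> c q)"
  unfolding covector_field_def
proof (intro conjI ballI)
  fix c assume "c \<in> A"
  then have [measurable]: "(\<lambda>x. indicator (fst c) x *\<^sub>R \<alpha> c x) \<in> borel_measurable borel"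
      "(\<lambda>x. indicator (fst c) x *\<^sub>R \<beta> c x) \<in> borel_measurable borel"
    using assms unfolding covector_field_def set_borel_measurable_def by blast+
  have "(\<lambda>x. a *\<^sub>R (indicator (fst c) x *\<^sub>R \<alpha> c x) + b *\<^sub>R (indicator (fst c) x *\<^sub>R \<beta> c x)) \<in> borel_measurable borel"
    by measurable
  then show "set_borel_measurable borel (fst c) (\<lambda>q. a *\<^sub>R \<alpha> c q + b *\<^sub>R \<beta> c q)"
    by (simp add: set_borel_measurable_def scaleR_add_right mult.commute)
next
  fix c d p assume "c \<in> A" "d \<in> A" "p \<in> fst c \<inter> fst d"
  then show "a *\<^sub>R \<alpha> c p + b *\<^sub>R \<beta> c p = transpose (tangent_matrix c d id p) *v (a *\<^sub>R \<alpha> d p + b *\<^sub>R \<beta> d p)"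
    using covector_field_transform[OF assms(1), of c d p] covector_field_transform[OF assms(2), of c d p]
    by (simp add: matrix_vector_right_distrib matrix_vector_mult_scaleR)
qed

lemma ip_jet:
  assumes "sq_int (vol A g) (jet f \<alpha>)" "sq_int (vol A g) (jet h \<beta>)"
    "f \<in> borel_measurable borel" "h \<in> borel_measurable borel" "covector_field A \<alpha>" "covector_field A \<beta>"
  shows "sq_int (vol A g) f" "sq_int (vol A g) (frame \<alpha>)"
    "ip (vol A g) (jet f \<alpha>) (jet h \<beta>) = ip (vol A g) f h + ip (vol A g) (frame \<alpha>) (frame \<beta>)"
proof -
  have *: "sq_int (vol A g) f \<and> sq_int (vol A g) (frame \<alpha>)"
    if "sq_int (vol A g) (jet f \<alpha>)" "f \<in> borel_measurable borel" "covector_field A \<alpha>" for f \<alpha>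
  proof -
    have [measurable]: "f \<in> borel_measurable borel" "frame \<alpha> \<in> borel_measurable borel" using that measurable_frame by auto
    have i: "integrable (vol A g) (\<lambda>p. f p * f p + frame \<alpha> p \<bullet> frame \<alpha> p)"
      using that(1) by (simp add: sq_int_def jet_inner)
    have "integrable (vol A g) (\<lambda>p. f p * f p)"
    proof (rule Bochner_Integration.integrable_bound[OF i])
      show "(\<lambda>p. f p * f p) \<in> borel_measurable (vol A g)" unfolding borel_measurable_vol by measurable
    qed (auto intro!: AE_I2)
    moreover have "integrable (vol A g) (\<lambda>p. frame \<alpha> p \<bullet> frame \<alpha> p)"
    proof (rule Bochner_Integration.integrable_bound[OF i])
      show "(\<lambda>p. frame \<alpha> p \<bullet> frame \<alpha> p) \<in> borel_measurable (vol A g)" unfolding borel_measurable_vol by measurable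
    qed (auto intro!: AE_I2)
    ultimately show ?thesis by (simp add: sq_int_def)
  qed
  show "sq_int (vol A g) f" "sq_int (vol A g) (frame \<alpha>)" using * assms by blast+
  then show "ip (vol A g) (jet f \<alpha>) (jet h \<beta>) = ip (vol A g) f h + ip (vol A g) (frame \<alpha>) (frame \<beta>)"
    using *[OF assms(2,4,6)] sq_int_inner[of "vol A g" f h] sq_int_inner[of "vol A g" "frame \<alpha>" "frame \<beta>"]
    by (simp add: ip_def jet_inner)
qed

text \<open>Two nonnegative sequences tend to 0 exactly if their sum does; this merges the two
  limits of the definition into one L2 limit of jets.\<close>

lemma H1_differential_iff:
  "H1_differential A g f \<omega> \<longleftrightarrow> f \<in> borel_measurable borel \<and> covector_field A \<omega> \<and> sq_int (vol A g) (jet f \<omega>) \<and>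
    (\<exists>\<phi>. (\<forall>n. test_fun A (\<phi> n)) \<and>
      (\<lambda>n. ip (vol A g) (\<lambda>p. jet f \<omega> p - test_jet (\<phi> n) p) (\<lambda>p. jet f \<omega> p - test_jet (\<phi> n) p)) \<longlonglongrightarrow> 0)"
  (is "?L \<longleftrightarrow> f \<in> _ \<and> _ \<and> ?S \<and> (\<exists>\<phi>. ?T \<phi> \<and> ?C \<phi>)")
proof (cases "f \<in> borel_measurable borel \<and> covector_field A \<omega>")
  case True
  then have f [measurable]: "f \<in> borel_measurable borel" and w: "covector_field A \<omega>" by auto
  have fr [measurable]: "frame \<omega> \<in> borel_measurable borel" using measurable_frame[OF w] .
  have S: "?S \<longleftrightarrow> f \<in> L2 A g \<and> integrable (vol A g) (covector_inner A g \<omega> \<omega>)"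
  proof
    assume ?S
    from ip_jet(1,2)[OF this this f f w w] f show "f \<in> L2 A g \<and> integrable (vol A g) (covector_inner A g \<omega> \<omega>)"
      by (simp add: L2_def sq_int_def power2_eq_square covector_inner_frame[OF w w, abs_def])
  next
    assume "f \<in> L2 A g \<and> integrable (vol A g) (covector_inner A g \<omega> \<omega>)"
    then show ?S using measurable_jet[OF f w]
      by (simp add: L2_def sq_int_def power2_eq_square covector_inner_frame[OF w w, abs_def] jet_inner)
  qed
  have "?C \<phi> \<longleftrightarrow> (\<lambda>n. \<integral>\<^sup>+p. ennreal ((f p - \<phi> n p)\<^sup>2) \<partial>vol A g) \<longlonglongrightarrow> 0 \<and>
      (\<lambda>n. \<integral>\<^sup>+p. ennreal (covector_inner A g (\<lambda>c q. \<omega> c q - differential (\<phi> n) c q)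
                                           (\<lambda>c q. \<omega> c q - differential (\<phi> n) c q) p) \<partial>vol A g) \<longlonglongrightarrow> 0"
    if S: ?S and T: "?T \<phi>" for \<phi>
  proof -
    have sm: "smooth_fun A (\<phi> n)" for n using T by (simp add: test_fun_def)
    let ?f = "\<lambda>n p. f p - \<phi> n p" and ?w = "\<lambda>n c q. \<omega> c q - differential (\<phi> n) c q"
    have m: "?f n \<in> borel_measurable borel" for n
      using borel_measurable_continuous_onI[OF smooth_fun_continuous[OF sm]] by measurable
    have cw: "covector_field A (?w n)" for n
      using covector_field_diff[OF w covector_field_differential[OF sm], of 1 "-1"] by simp
    have sq: "sq_int (vol A g) (jet (?f n) (?w n))" for n
      using sq_int_diff[OF S test_jet_sq_int, of "\<phi> n"] T by (simp add: jet_diff)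
    note J = ip_jet[OF sq sq m m cw cw]
    have 1: "(\<integral>\<^sup>+p. ennreal ((f p - \<phi> n p)\<^sup>2) \<partial>vol A g) = ennreal (ip (vol A g) (?f n) (?f n))" for n
      using nn_integral_ip[OF J(1)] by (simp add: power2_eq_square)
    have 2: "(\<integral>\<^sup>+p. ennreal (covector_inner A g (?w n) (?w n) p) \<partial>vol A g) = ennreal (ip (vol A g) (frame (?w n)) (frame (?w n)))" for n
      using nn_integral_ip[OF J(2)] by (simp add: covector_inner_frame[OF cw cw])
    have 3: "ip (vol A g) (\<lambda>p. jet f \<omega> p - test_jet (\<phi> n) p) (\<lambda>p. jet f \<omega> p - test_jet (\<phi> n) p)
        = ip (vol A g) (?f n) (?f n) + ip (vol A g) (frame (?w n)) (frame (?w n))" for n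
      using J(3) by (simp add: jet_diff)
    have "(\<lambda>n. ip (vol A g) (?f n) (?f n) + ip (vol A g) (frame (?w n)) (frame (?w n))) \<longlonglongrightarrow> 0 \<longleftrightarrow>
       (\<lambda>n. ip (vol A g) (?f n) (?f n)) \<longlonglongrightarrow> 0 \<and> (\<lambda>n. ip (vol A g) (frame (?w n)) (frame (?w n))) \<longlonglongrightarrow> 0"
      (is "?a \<longlonglongrightarrow> 0 \<longleftrightarrow> ?b \<longlonglongrightarrow> 0 \<and> ?c \<longlonglongrightarrow> 0")
    proof
      assume a: "?a \<longlonglongrightarrow> 0"
      have "?b \<longlonglongrightarrow> 0" by (rule Lim_null_comparison[OF _ a]) (simp add: ip_nonneg)
      moreover have "?c \<longlonglongrightarrow> 0" by (rule Lim_null_comparison[OF _ a]) (simp add: ip_nonneg)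
      ultimately show "?b \<longlonglongrightarrow> 0 \<and> ?c \<longlonglongrightarrow> 0" ..
    qed (use tendsto_add[of ?b 0 sequentially ?c 0] in simp)
    then show ?thesis unfolding 1 2 3 by (simp add: ennreal_tendsto_0_iff ip_nonneg)
  qed
  then show ?thesis
    unfolding H1_differential_def using S f w by blast
next
  case False
  then show ?thesis by (auto simp: H1_differential_def L2_def)
qed

lemma H1_differentialD:
  assumes "H1_differential A g f \<omega>"
  shows "f \<in> borel_measurable borel" "covector_field A \<omega>" "sq_int (vol A g) (jet f \<omega>)"
    "sq_int (vol A g) f" "sq_int (vol A g) (frame \<omega>)"
  using assms ip_jet(1,2)[of f \<omega> f \<omega>] by (auto simp: H1_differential_iff)

text \<open>The L2 limit of the jets is a pair of measurable functions, and \<open>coframe\<close>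
  turns the second of them into a covector field, so the limit is again a jet. This supplies the
  minimiser in \<open>weak_solution_exists\<close>.\<close>

lemma H1_complete:
  assumes "\<And>n. test_fun A (\<phi> n)"
    and "\<And>e. e > 0 ==> \<exists>N. \<forall>m\<ge>N. \<forall>n\<ge>N. ip (vol A g) (\<lambda>p. test_jet (\<phi> m) p - test_jet (\<phi> n) p)
          (\<lambda>p. test_jet (\<phi> m) p - test_jet (\<phi> n) p) < e"
  shows "\<exists>f \<omega>. H1_differential A g f \<omega> \<and>
    (\<lambda>n. ip (vol A g) (\<lambda>p. jet f \<omega> p - test_jet (\<phi> n) p) (\<lambda>p. jet f \<omega> p - test_jet (\<phi> n) p)) \<longlonglongrightarrow> 0"
proof -
  obtain X where X: "sq_int (vol A g) X"
    "(\<lambda>n. ip (vol A g) (\<lambda>p. X p - test_jet (\<phi> n) p) (\<lambda>p. X p - test_jet (\<phi> n) p)) \<longlonglongrightarrow> 0"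
    using L2_complete[OF test_jet_sq_int[OF assms(1)] assms(2)] by blast
  have Xm: "X \<in> borel_measurable borel" using X(1) by (simp add: sq_int_def)
  have f: "(\<lambda>p. fst (X p)) \<in> borel_measurable borel"
    by (rule measurable_compose[OF Xm borel_measurable_continuous_onI]) (rule continuous_on_fst[OF continuous_on_id])
  have s: "(\<lambda>p. snd (X p)) \<in> borel_measurable borel"
    by (rule measurable_compose[OF Xm borel_measurable_continuous_onI]) (rule continuous_on_snd[OF continuous_on_id])
  have eq: "jet (\<lambda>p. fst (X p)) (coframe (\<lambda>p. snd (X p))) = X"
    by (simp add: jet_def fun_eq_iff frame_coframe)
  have "H1_differential A g (\<lambda>p. fst (X p)) (coframe (\<lambda>p. snd (X p)))"
    unfolding H1_differential_iff eq using X f covector_field_coframe[OF s] assms(1) by blast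
  then show ?thesis using X(2) eq
    by (intro exI[of _ "\<lambda>p. fst (X p)"] exI[of _ "coframe (\<lambda>p. snd (X p))"]) simp
qed

lemma H1_differential_test:
  assumes "test_fun A \<phi>" shows "H1_differential A g \<phi> (differential \<phi>)"
proof -
  have "smooth_fun A \<phi>" using assms by (simp add: test_fun_def)
  then show ?thesis unfolding H1_differential_iff
    using assms test_jet_sq_int[OF assms] covector_field_differential
      borel_measurable_continuous_onI[OF smooth_fun_continuous]
    by (auto intro!: exI[of _ "\<lambda>_. \<phi>"] simp: ip_def)
qed

lemma H1_differential_linear:
  assumes "H1_differential A g f \<alpha>" "H1_differential A g h \<beta>"
  shows "H1_differential A g (\<lambda>p. a * f p + b * h p) (\<lambda>c q. a *\<^sub>R \<alpha> c q + b *\<^sub>R \<beta> c q)"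
proof -
  let ?M = "vol A g"
  obtain \<phi> where \<phi>: "\<And>n. test_fun A (\<phi> n)"
    "(\<lambda>n. ip ?M (\<lambda>p. jet f \<alpha> p - test_jet (\<phi> n) p) (\<lambda>p. jet f \<alpha> p - test_jet (\<phi> n) p)) \<longlonglongrightarrow> 0"
    using assms(1) unfolding H1_differential_iff by blast
  obtain \<psi> where \<psi>: "\<And>n. test_fun A (\<psi> n)"
    "(\<lambda>n. ip ?M (\<lambda>p. jet h \<beta> p - test_jet (\<psi> n) p) (\<lambda>p. jet h \<beta> p - test_jet (\<psi> n) p)) \<longlonglongrightarrow> 0"
    using assms(2) unfolding H1_differential_iff by blast
  have sm: "smooth_fun A (\<phi> n)" "smooth_fun A (\<psi> n)" for n using \<phi> \<psi> by (auto simp: test_fun_def)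
  have jet: "jet (\<lambda>p. a * f p + b * h p) (\<lambda>c q. a *\<^sub>R \<alpha> c q + b *\<^sub>R \<beta> c q) = (\<lambda>p. a *\<^sub>R jet f \<alpha> p + b *\<^sub>R jet h \<beta> p)"
    by (simp add: jet_def fun_eq_iff frame_linear)
  let ?x = "\<lambda>n p. jet f \<alpha> p - test_jet (\<phi> n) p" and ?y = "\<lambda>n p. jet h \<beta> p - test_jet (\<psi> n) p"
  have sq: "sq_int ?M (?x n)" "sq_int ?M (?y n)" for n
    by (intro sq_int_diff H1_differentialD(3)[OF assms(1)] H1_differentialD(3)[OF assms(2)] test_jet_sq_int \<phi> \<psi>)+
  have eq: "a *\<^sub>R jet f \<alpha> p + b *\<^sub>R jet h \<beta> p - test_jet (\<lambda>p. a * \<phi> n p + b * \<psi> n p) p = a *\<^sub>R ?x n p + b *\<^sub>R ?y n p" for n p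
    by (simp add: test_jet_linear[OF sm] algebra_simps)
  have le: "ip ?M (\<lambda>p. a *\<^sub>R ?x n p + b *\<^sub>R ?y n p) (\<lambda>p. a *\<^sub>R ?x n p + b *\<^sub>R ?y n p)
     \<le> 2 * a\<^sup>2 * ip ?M (?x n) (?x n) + 2 * b\<^sup>2 * ip ?M (?y n) (?y n)" for n
    by (rule ip_linear_combination_le[OF sq])
  have "(\<lambda>n. 2 * a\<^sup>2 * ip ?M (?x n) (?x n) + 2 * b\<^sup>2 * ip ?M (?y n) (?y n)) \<longlonglongrightarrow> 2 * a\<^sup>2 * 0 + 2 * b\<^sup>2 * 0"
    by (intro tendsto_intros \<phi> \<psi>)
  then have L0: "(\<lambda>n. 2 * a\<^sup>2 * ip ?M (?x n) (?x n) + 2 * b\<^sup>2 * ip ?M (?y n) (?y n)) \<longlonglongrightarrow> 0"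
    by simp
  have lim: "(\<lambda>n. ip ?M (\<lambda>p. a *\<^sub>R ?x n p + b *\<^sub>R ?y n p) (\<lambda>p. a *\<^sub>R ?x n p + b *\<^sub>R ?y n p)) \<longlonglongrightarrow> 0"
  proof (rule Lim_null_comparison[OF _ L0], rule always_eventually, rule allI)
    fix n
    show "norm (ip ?M (\<lambda>p. a *\<^sub>R ?x n p + b *\<^sub>R ?y n p) (\<lambda>p. a *\<^sub>R ?x n p + b *\<^sub>R ?y n p))
      \<le> 2 * a\<^sup>2 * ip ?M (?x n) (?x n) + 2 * b\<^sup>2 * ip ?M (?y n) (?y n)"
      using le[of n] by (simp only: real_norm_def abs_of_nonneg[OF ip_nonneg])
  qed
  show ?thesis unfolding H1_differential_iff jet
  proof (intro conjI exI[of _ "\<lambda>n p. a * \<phi> n p + b * \<psi> n p"] allI)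
    show "(\<lambda>p. a * f p + b * h p) \<in> borel_measurable borel"
      using H1_differentialD(1)[OF assms(1)] H1_differentialD(1)[OF assms(2)] by measurable
    show "covector_field A (\<lambda>c q. a *\<^sub>R \<alpha> c q + b *\<^sub>R \<beta> c q)"
      by (intro covector_field_diff H1_differentialD(2)[OF assms(1)] H1_differentialD(2)[OF assms(2)])
    show "sq_int ?M (\<lambda>p. a *\<^sub>R jet f \<alpha> p + b *\<^sub>R jet h \<beta> p)"
      by (intro sq_int_add sq_int_scaleR H1_differentialD(3)[OF assms(1)] H1_differentialD(3)[OF assms(2)])
    show "test_fun A (\<lambda>p. a * \<phi> n p + b * \<psi> n p)" for n by (intro test_fun_add \<phi> \<psi>)
    show "(\<lambda>n. ip ?M (\<lambda>p. a *\<^sub>R jet f \<alpha> p + b *\<^sub>R jet h \<beta> p - test_jet (\<lambda>p. a * \<phi> n p + b * \<psi> n p) p)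
          (\<lambda>p. a *\<^sub>R jet f \<alpha> p + b *\<^sub>R jet h \<beta> p - test_jet (\<lambda>p. a * \<phi> n p + b * \<psi> n p) p)) \<longlonglongrightarrow> 0"
      unfolding eq by (rule lim)
  qed
qed

lemma test_fun_zero: "test_fun A (\<lambda>p. 0)"
  unfolding test_fun_def smooth_fun_def by (simp add: o_def)

lemma H1_sum:
  "(\<And>i. i < (n::nat) ==> b i \<in> H1 A g) ==> (\<lambda>p. \<Sum>i<n. a i * b i p) \<in> H1 A g"
proof (induction n)
  case 0
  show ?case using H1_differential_test[OF test_fun_zero] by (auto simp: H1_def)
next
  case (Suc n)
  have "(\<lambda>p. \<Sum>i<n. a i * b i p) \<in> H1 A g" by (rule Suc.IH) (simp add: Suc.prems)
  moreover have "b n \<in> H1 A g" by (simp add: Suc.prems)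
  ultimately obtain \<alpha> \<beta> where "H1_differential A g (\<lambda>p. \<Sum>i<n. a i * b i p) \<alpha>" "H1_differential A g (b n) \<beta>"
    unfolding H1_def mem_Collect_eq by (elim exE) (rule that)
  from H1_differential_linear[OF this, of 1 "a n"] show ?case by (auto simp: H1_def)
qed

lemma weak_differential: "f \<in> H1 A g ==> H1_differential A g f (weak_differential A g f)"
  unfolding H1_def weak_differential_def by (simp add: someI_ex)

end

section \<open>Conformally equivalent metrics\<close>

lemma matrix_mult_scaleR: "(x *\<^sub>R M) ** (y *\<^sub>R N) = (x * y) *\<^sub>R (M ** (N :: real^'n^'n))"
  by (simp add: matrix_matrix_mult_def vec_eq_iff sum_distrib_left algebra_simps)

lemma matrix_vector_mult_scaleR_left: "(x *\<^sub>R M) *v v = x *\<^sub>R (M *v (v :: real^'n))"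
  by (simp add: matrix_vector_mult_def vec_eq_iff sum_distrib_left mult.assoc)

text \<open>Measurability and boundedness of u are the properties that pass to the factor pulled
  back to a cover. The bound b only identifies the function spaces; the quantitative upper bound K
  on exp (2 u) is a separate hypothesis of the comparison lemmas.\<close>

locale conformal_pair = G: metric_surface A g + H: metric_surface A h
  for A :: "'m::{t2_space, second_countable_topology} chart set" and g h +
  fixes u :: "'m \<Rightarrow> real" and b :: real
  assumes conf: "c \<in> A ==> p \<in> fst c ==> g c p = exp (2 * u p) *\<^sub>R h c p"
    and u_measurable [measurable]: "u \<in> borel_measurable borel"
    and u_bounded: "\<bar>u p\<bar> \<le> b"
begin

text \<open>By this symmetry each inclusion between the spaces of g and h has to be proved in one
  direction only.\<close>

lemma conformal_swap: "conformal_pair A h g (\<lambda>p. - u p) b"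
proof unfold_locales
  show "h c p = exp (2 * - u p) *\<^sub>R g c p" if "c \<in> A" "p \<in> fst c" for c p
    by (simp add: conf[OF that] exp_minus)
qed (use u_bounded in auto)

lemma vol_eq: "vol A g = density (vol A h) (\<lambda>p. ennreal (exp (2 * u p)))"
  by (rule vol_conformal) (use G.metric_surface_axioms H.metric_surface_axioms conf in auto)

lemma AE_vol_iff: "(AE p in vol A g. P p) \<longleftrightarrow> (AE p in vol A h. P p)"
  unfolding vol_eq by (subst AE_density) auto

lemma covector_inner_eq: "covector_inner A g \<alpha> \<beta> p = exp (- (2 * u p)) * covector_inner A h \<alpha> \<beta> p"
proof -
  have det: "det (h (chart_at A p) p) \<noteq> 0"
    using H.metric_spd(4)[OF G.chart_at_in, of p] by simp
  have "matrix_inv (g (chart_at A p) p) = exp (- (2 * u p)) *\<^sub>R matrix_inv (h (chart_at A p) p)"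
  proof (rule matrix_inv_eqI)
    have "h (chart_at A p) p ** matrix_inv (h (chart_at A p) p) = mat 1"
      using det by (metis invertible_det_nz invertible_def matrix_inv_eqI)
    then show "g (chart_at A p) p ** (exp (- (2 * u p)) *\<^sub>R matrix_inv (h (chart_at A p) p)) = mat 1"
      by (simp add: conf[OF G.chart_at_in] matrix_mult_scaleR exp_minus)
  qed
  then show ?thesis
    by (simp add: covector_inner_def Let_def matrix_vector_mult_scaleR_left)
qed

lemma covector_inner_measurable:
  assumes "covector_field A \<alpha>" "covector_field A \<beta>"
  shows "covector_inner A h \<alpha> \<beta> \<in> borel_measurable borel"
proof -
  have [measurable]: "H.frame \<alpha> \<in> borel_measurable borel" "H.frame \<beta> \<in> borel_measurable borel"
    using assms H.measurable_frame by auto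
  show ?thesis unfolding H.covector_inner_frame[OF assms, abs_def] by measurable
qed

text \<open>Conformal invariance in dimension two: the factor exp (- 2 u) of the inverse metric
  cancels the factor exp (2 u) of the area.\<close>

lemma energy_eq:
  assumes "covector_field A \<alpha>" "covector_field A \<beta>"
  shows "(LINT p|vol A g. covector_inner A g \<alpha> \<beta> p) = (LINT p|vol A h. covector_inner A h \<alpha> \<beta> p)"
proof -
  have m: "covector_inner A g \<alpha> \<beta> \<in> borel_measurable (vol A h)"
    using conformal_pair.covector_inner_measurable[OF conformal_swap assms] by simp
  have "(LINT p|vol A g. covector_inner A g \<alpha> \<beta> p) = (LINT p|vol A h. exp (2 * u p) *\<^sub>R covector_inner A g \<alpha> \<beta> p)"
    unfolding vol_eq using m by (intro integral_density) auto
  then show ?thesis by (simp add: covector_inner_eq mult.assoc[symmetric] exp_add[symmetric])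
qed

lemma nn_energy_eq:
  assumes "covector_field A \<alpha>"
  shows "(\<integral>\<^sup>+p. ennreal (covector_inner A g \<alpha> \<alpha> p) \<partial>vol A g) = (\<integral>\<^sup>+p. ennreal (covector_inner A h \<alpha> \<alpha> p) \<partial>vol A h)"
proof -
  have m: "covector_inner A g \<alpha> \<alpha> \<in> borel_measurable (vol A h)"
    using conformal_pair.covector_inner_measurable[OF conformal_swap assms assms] by simp
  have "(\<integral>\<^sup>+p. ennreal (covector_inner A g \<alpha> \<alpha> p) \<partial>vol A g)
     = (\<integral>\<^sup>+p. ennreal (exp (2 * u p)) * ennreal (covector_inner A g \<alpha> \<alpha> p) \<partial>vol A h)"
    unfolding vol_eq using m by (intro nn_integral_density) auto
  then show ?thesis
    by (simp add: covector_inner_eq ennreal_mult'[symmetric] mult.assoc[symmetric] exp_add[symmetric])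
qed

lemma nn_integral_le:
  assumes "F \<in> borel_measurable borel" "\<And>p. exp (2 * u p) \<le> K"
  shows "(\<integral>\<^sup>+p. F p \<partial>vol A g) \<le> ennreal K * (\<integral>\<^sup>+p. F p \<partial>vol A h)"
proof -
  have "(\<integral>\<^sup>+p. F p \<partial>vol A g) = (\<integral>\<^sup>+p. ennreal (exp (2 * u p)) * F p \<partial>vol A h)"
    unfolding vol_eq using assms(1) by (intro nn_integral_density) auto
  also have "\<dots> \<le> (\<integral>\<^sup>+p. ennreal K * F p \<partial>vol A h)"
    by (intro nn_integral_mono mult_right_mono ennreal_leI assms) simp
  also have "\<dots> = ennreal K * (\<integral>\<^sup>+p. F p \<partial>vol A h)"
    using assms(1) by (intro nn_integral_cmult) simp
  finally show ?thesis .
qed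

lemma exp_le: "exp (2 * u p) \<le> exp (2 * b)"
  using u_bounded[of p] by simp

text \<open>The same approximating test functions work: the energies agree exactly, and squared L2
  norms grow by at most the factor exp (2 b).\<close>

lemma H1_differential_mono:
  assumes "H1_differential A h f \<omega>" shows "H1_differential A g f \<omega>"
proof -
  note h = assms[unfolded H1_differential_def]
  have f [measurable]: "f \<in> borel_measurable borel" and w: "covector_field A \<omega>" using h by (auto simp: L2_def)
  have mg: "covector_inner A g \<omega> \<omega> \<in> borel_measurable borel"
    by (rule conformal_pair.covector_inner_measurable[OF conformal_swap w w])
  have "f \<in> L2 A g"
  proof -
    have "(\<integral>\<^sup>+p. ennreal ((f p)\<^sup>2) \<partial>vol A g) \<le> ennreal (exp (2 * b)) * (\<integral>\<^sup>+p. ennreal ((f p)\<^sup>2) \<partial>vol A h)"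
      by (intro nn_integral_le exp_le) measurable
    also have "\<dots> < \<infinity>"
      using h by (auto simp: L2_def integrable_iff_bounded ennreal_mult_less_top)
    finally show ?thesis by (simp add: L2_def integrable_iff_bounded)
  qed
  moreover have "integrable (vol A g) (covector_inner A g \<omega> \<omega>)"
  proof -
    have nn: "covector_inner A k \<omega> \<omega> p \<ge> 0" if "metric_surface A k" for k p
      using that w by (simp add: metric_surface.covector_inner_frame)
    have "(\<integral>\<^sup>+p. ennreal (covector_inner A h \<omega> \<omega> p) \<partial>vol A h) < \<infinity>"
      using h nn[OF H.metric_surface_axioms] by (simp add: integrable_iff_bounded)
    then show ?thesis
      using nn[OF G.metric_surface_axioms] mg by (simp add: integrable_iff_bounded nn_energy_eq[OF w])
  qed
  moreover obtain \<phi> where \<phi>: "\<And>n. test_fun A (\<phi> n)"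
      "(\<lambda>n. \<integral>\<^sup>+p. ennreal ((f p - \<phi> n p)\<^sup>2) \<partial>vol A h) \<longlonglongrightarrow> 0"
      "(\<lambda>n. \<integral>\<^sup>+p. ennreal (covector_inner A h (\<lambda>c q. \<omega> c q - differential (\<phi> n) c q)
                                           (\<lambda>c q. \<omega> c q - differential (\<phi> n) c q) p) \<partial>vol A h) \<longlonglongrightarrow> 0"
    using h by blast
  moreover have "(\<lambda>n. \<integral>\<^sup>+p. ennreal ((f p - \<phi> n p)\<^sup>2) \<partial>vol A g) \<longlonglongrightarrow> 0"
  proof (rule tendsto_sandwich[OF always_eventually always_eventually tendsto_const])
    have [measurable]: "\<phi> n \<in> borel_measurable borel" for n
      using \<phi>(1) by (intro borel_measurable_continuous_onI G.smooth_fun_continuous) (auto simp: test_fun_def)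
    show "\<forall>n. (\<integral>\<^sup>+p. ennreal ((f p - \<phi> n p)\<^sup>2) \<partial>vol A g) \<le> ennreal (exp (2 * b)) * (\<integral>\<^sup>+p. ennreal ((f p - \<phi> n p)\<^sup>2) \<partial>vol A h)"
      by (intro allI nn_integral_le exp_le) measurable
    show "(\<lambda>n. ennreal (exp (2 * b)) * (\<integral>\<^sup>+p. ennreal ((f p - \<phi> n p)\<^sup>2) \<partial>vol A h)) \<longlonglongrightarrow> 0"
      using ennreal_tendsto_cmult[OF _ \<phi>(2), of "ennreal (exp (2 * b))"] by simp
  qed simp
  moreover have "covector_field A (\<lambda>c q. \<omega> c q - differential (\<phi> n) c q)" for n
    using H.covector_field_diff[OF w G.covector_field_differential, of "\<phi> n" 1 "-1"] \<phi>(1) by (simp add: test_fun_def)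
  ultimately show ?thesis
    unfolding H1_differential_def using w by (auto simp: nn_energy_eq intro!: exI[of _ \<phi>])
qed

lemma H1_differential_eq: "H1_differential A g = H1_differential A h"
  using H1_differential_mono conformal_pair.H1_differential_mono[OF conformal_swap] by (intro ext) blast

lemma H1_eq: "H1 A g = H1 A h" and weak_differential_eq: "weak_differential A g = weak_differential A h"
  unfolding H1_def weak_differential_def[abs_def] H1_differential_eq by auto

lemma H1_subspace_eq: "H1_subspace A g n = H1_subspace A h n"
  unfolding H1_subspace_def[abs_def] H1_eq AE_vol_iff ..

lemma L2_norm_le:
  assumes "f \<in> borel_measurable borel" "integrable (vol A h) (\<lambda>p. (f p)\<^sup>2)" "integrable (vol A g) (\<lambda>p. (f p)\<^sup>2)"
    "\<And>p. exp (2 * u p) \<le> K"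
  shows "(LINT p|vol A g. (f p)\<^sup>2) \<le> K * (LINT p|vol A h. (f p)\<^sup>2)"
proof -
  have [measurable]: "f \<in> borel_measurable borel" by fact
  have K: "K \<ge> 0" using assms(4) by (meson exp_ge_zero order_trans)
  have "ennreal (LINT p|vol A g. (f p)\<^sup>2) = (\<integral>\<^sup>+p. ennreal ((f p)\<^sup>2) \<partial>vol A g)"
    using assms(3) by (intro nn_integral_eq_integral[symmetric]) auto
  also have "\<dots> \<le> ennreal K * (\<integral>\<^sup>+p. ennreal ((f p)\<^sup>2) \<partial>vol A h)"
    by (intro nn_integral_le assms) measurable
  also have "(\<integral>\<^sup>+p. ennreal ((f p)\<^sup>2) \<partial>vol A h) = ennreal (LINT p|vol A h. (f p)\<^sup>2)"
    using assms(2) by (intro nn_integral_eq_integral) auto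
  finally show ?thesis using K by (simp add: ennreal_mult'[symmetric])
qed

text \<open>The numerators coincide by conformal invariance, so only the L2 norms in the
  denominators are compared.\<close>

lemma rayleigh_quotient_le:
  assumes "f \<in> H1 A h" "\<not> (AE p in vol A h. f p = 0)" "\<And>p. exp (2 * u p) \<le> K"
  shows "rayleigh_quotient A h f \<le> K * rayleigh_quotient A g f"
proof -
  have fg: "f \<in> H1 A g" using assms(1) H1_eq by simp
  note dh = H.H1_differentialD[OF H.weak_differential[OF assms(1)]]
    and dg = G.H1_differentialD[OF G.weak_differential[OF fg]]
  have ih: "integrable (vol A h) (\<lambda>p. (f p)\<^sup>2)" and ig: "integrable (vol A g) (\<lambda>p. (f p)\<^sup>2)"
    using dh(4) dg(4) by (auto simp: sq_int_def power2_eq_square)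
  let ?E = "LINT p|vol A h. covector_inner A h (weak_differential A h f) (weak_differential A h f) p"
  have E: "?E \<ge> 0" using dh(2) by (intro integral_nonneg_AE AE_I2) (simp add: H.covector_inner_frame)
  have Eg: "(LINT p|vol A g. covector_inner A g (weak_differential A g f) (weak_differential A g f) p) = ?E"
    using energy_eq[OF dh(2) dh(2)] by (simp add: weak_differential_eq)
  have pos: "(LINT p|vol A k. (f p)\<^sup>2) > 0" if "integrable (vol A k) (\<lambda>p. (f p)\<^sup>2)" "\<not> (AE p in vol A k. f p = 0)" for k
    using that integral_nonneg_eq_0_iff_AE[OF that(1)] integral_nonneg_AE[where M="vol A k" and f="\<lambda>p. (f p)\<^sup>2"]
    by (auto simp: less_le)
  have ph: "(LINT p|vol A h. (f p)\<^sup>2) > 0" using pos[OF ih] assms(2) by simp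
  have pg: "(LINT p|vol A g. (f p)\<^sup>2) > 0" using pos[OF ig] assms(2) AE_vol_iff by simp
  have le: "(LINT p|vol A g. (f p)\<^sup>2) \<le> K * (LINT p|vol A h. (f p)\<^sup>2)"
    using L2_norm_le[OF dh(1) ih ig assms(3)] .
  have "?E * (LINT p|vol A g. (f p)\<^sup>2) \<le> ?E * (K * (LINT p|vol A h. (f p)\<^sup>2))"
    by (rule mult_left_mono[OF le E])
  then show ?thesis
    unfolding rayleigh_quotient_def Eg using ph pg by (simp add: field_simps)
qed

text \<open>Both min-max values run over the same subspaces V, with the same null functions
  excluded, so it suffices to compare the suprema over each V.\<close>

lemma eigenvalue_compare:
  assumes K: "K > 0" "\<And>p. exp (2 * u p) \<le> K"
  shows "ereal (1 / K) * eigenvalue A h k \<le> eigenvalue A g k"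
  unfolding eigenvalue_def
proof (rule INF_greatest)
  fix V assume "V \<in> {V. H1_subspace A g (k + 1) V}"
  then have V: "V \<in> {V. H1_subspace A h (k + 1) V}" by (simp add: H1_subspace_eq)
  let ?Sh = "SUP f \<in> {f \<in> V. \<not> (AE p in vol A h. f p = 0)}. ereal (rayleigh_quotient A h f)"
  let ?Sg = "SUP f \<in> {f \<in> V. \<not> (AE p in vol A g. f p = 0)}. ereal (rayleigh_quotient A g f)"
  have "?Sh \<le> ereal K * ?Sg"
  proof (rule SUP_least)
    fix f assume f: "f \<in> {f \<in> V. \<not> (AE p in vol A h. f p = 0)}"
    obtain b where b: "\<And>i. i < k + 1 ==> b i \<in> H1 A h" "V = range (\<lambda>a :: nat \<Rightarrow> real. \<lambda>p. \<Sum>i<k+1. a i * b i p)"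
      using V unfolding H1_subspace_def by blast
    then obtain a :: "nat \<Rightarrow> real" where a: "f = (\<lambda>p. \<Sum>i<k+1. a i * b i p)" using f by auto
    have "f \<in> H1 A h" unfolding a by (rule H.H1_sum) (rule b(1))
    then have "ereal (rayleigh_quotient A h f) \<le> ereal K * ereal (rayleigh_quotient A g f)"
      using rayleigh_quotient_le[of f K] f K by simp
    also have "\<dots> \<le> ereal K * ?Sg"
      using f K AE_vol_iff by (intro ereal_mult_left_mono SUP_upper) auto
    finally show "ereal (rayleigh_quotient A h f) \<le> ereal K * ?Sg" .
  qed
  have "ereal (1 / K) * (INF V \<in> {V. H1_subspace A h (k + 1) V}.
      SUP f \<in> {f \<in> V. \<not> (AE p in vol A h. f p = 0)}. ereal (rayleigh_quotient A h f)) \<le> ereal (1 / K) * ?Sh"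
    using V K by (intro ereal_mult_left_mono INF_lower) auto
  also have "\<dots> \<le> ereal (1 / K) * (ereal K * ?Sg)"
    using K \<open>?Sh \<le> ereal K * ?Sg\<close> by (intro ereal_mult_left_mono) auto
  also have "\<dots> = ?Sg" using K by (simp add: mult.assoc[symmetric] one_ereal_def[symmetric])
  finally show "ereal (1 / K) * (INF V \<in> {V. H1_subspace A h (k + 1) V}.
      SUP f \<in> {f \<in> V. \<not> (AE p in vol A h. f p = 0)}. ereal (rayleigh_quotient A h f)) \<le> ?Sg" .
qed

end

section \<open>Integration by parts on boxes\<close>

text \<open>The coordinate that varies comes last, so that the inner integral in Fubini's theorem
  runs along direction i.\<close>

definition coord_pair :: "2 \<Rightarrow> real \<Rightarrow> real \<Rightarrow> real^2" where
  "coord_pair i t s = (\<chi> j. if j = i then s else t)"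

lemma coord_pair_axis: "coord_pair i t s = coord_pair i t 0 + s *\<^sub>R axis i 1"
  by (simp add: coord_pair_def vec_eq_iff axis_def)

lemma other_index: "\<exists>j::2. j \<noteq> i \<and> (UNIV = {i, j})"
proof -
  have "i = 1 \<or> i = 2" by (rule exhaust_2)
  then show ?thesis
  proof
    assume "i = 1" then show ?thesis by (intro exI[of _ 2]) (simp add: UNIV_2)
  next
    assume "i = 2" then show ?thesis by (intro exI[of _ 1]) (auto simp: UNIV_2)
  qed
qed

lemma measurable_coord_pair: "(\<lambda>(t, s). coord_pair i t s) \<in> borel_measurable (lborel \<Otimes>\<^sub>M lborel)"
proof (rule borel_measurable_vecI)
  fix k
  show "(\<lambda>x. (case x of (t, s) \<Rightarrow> coord_pair i t s) $ k) \<in> borel_measurable (lborel \<Otimes>\<^sub>M lborel)"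
    by (cases "k = i") (simp_all add: coord_pair_def case_prod_beta)
qed

text \<open>The map only permutes coordinates, and Lebesgue measure is determined by the volumes of
  boxes.\<close>

lemma lborel_coord_pair: "distr (lborel \<Otimes>\<^sub>M lborel) borel (\<lambda>(t, s). coord_pair i t s) = lborel"
proof (rule lborel_eqI[symmetric])
  fix l u :: "real^2" assume le: "\<And>b. b \<in> Basis ==> l \<bullet> b \<le> u \<bullet> b"
  obtain j where j: "j \<noteq> i" "UNIV = {i, j}" using other_index by blast
  have le': "l $ k \<le> u $ k" for k using le[of "axis k 1"] by (simp add: inner_axis)
  have "(\<lambda>(t, s). coord_pair i t s) -` box l u \<inter> space (lborel \<Otimes>\<^sub>M lborel) = {l $ j <..< u $ j} \<times> {l $ i <..< u $ i}"
    using j by (auto simp: mem_box_cart coord_pair_def space_pair_measure split: if_splits) (metis UNIV_I insertE singletonD)+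
  then have "emeasure (distr (lborel \<Otimes>\<^sub>M lborel) borel (\<lambda>(t, s). coord_pair i t s)) (box l u)
    = emeasure (lborel \<Otimes>\<^sub>M lborel) ({l $ j <..< u $ j} \<times> {l $ i <..< u $ i})"
    by (subst emeasure_distr[OF measurable_coord_pair]) auto
  also have "\<dots> = ennreal (u $ j - l $ j) * ennreal (u $ i - l $ i)"
    by (subst lborel.emeasure_pair_measure_Times) (auto simp: le')
  also have "\<dots> = ennreal (\<Prod>k\<in>UNIV. u $ k - l $ k)"
    using j(1) by (subst j(2)) (simp add: ennreal_mult'[symmetric] le' mult.commute)
  also have "(\<Prod>k\<in>UNIV. u $ k - l $ k) = (\<Prod>b\<in>Basis. (u - l) \<bullet> b)"
    unfolding Basis_vec_def by (simp add: inner_axis inner_diff_left prod.UNION_disjoint axis_eq_axis)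
  finally show "emeasure (distr (lborel \<Otimes>\<^sub>M lborel) borel (\<lambda>(t, s). coord_pair i t s)) (box l u)
     = (\<Prod>b\<in>Basis. (u - l) \<bullet> b)" .
qed simp

lemma nn_integral_coord_pair:
  assumes [measurable]: "f \<in> borel_measurable borel"
  shows "(\<integral>\<^sup>+x. f x \<partial>(lborel :: (real^2) measure)) = (\<integral>\<^sup>+t. \<integral>\<^sup>+s. f (coord_pair i t s) \<partial>lborel \<partial>lborel)"
proof -
  note [measurable] = measurable_coord_pair[of i]
  have "(\<integral>\<^sup>+x. f x \<partial>(lborel :: (real^2) measure)) = (\<integral>\<^sup>+x. f (case x of (t, s) \<Rightarrow> coord_pair i t s) \<partial>(lborel \<Otimes>\<^sub>M lborel))"
    by (subst lborel_coord_pair[of i, symmetric]) (rule nn_integral_distr; measurable)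
  also have "\<dots> = (\<integral>\<^sup>+t. \<integral>\<^sup>+s. f (coord_pair i t s) \<partial>lborel \<partial>lborel)"
    by (subst lborel.nn_integral_fst[symmetric]) (simp_all add: measurable_compose[OF measurable_coord_pair assms])
  finally show ?thesis .
qed

lemma integral_coord_pair:
  fixes f :: "real^2 \<Rightarrow> real"
  assumes "integrable lborel f"
  shows "(LINT x|lborel. f x) = (LINT t|lborel. LINT s|lborel. f (coord_pair i t s))"
proof -
  note m [measurable] = measurable_coord_pair[of i]
  have fm [measurable]: "f \<in> borel_measurable borel" using borel_measurable_integrable[OF assms] by simp
  have int: "integrable (lborel \<Otimes>\<^sub>M lborel) (\<lambda>x. f (case x of (t, s) \<Rightarrow> coord_pair i t s))"
    using assms by (subst (asm) lborel_coord_pair[of i, symmetric]) (subst (asm) integrable_distr_eq; simp)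
  have "(LINT x|lborel. f x) = (LINT x|(lborel \<Otimes>\<^sub>M lborel). f (case x of (t, s) \<Rightarrow> coord_pair i t s))"
    by (subst lborel_coord_pair[of i, symmetric]) (rule integral_distr; measurable)
  also have "\<dots> = (LINT t|lborel. LINT s|lborel. f (coord_pair i t s))"
    using lborel_pair.integral_fst'[OF int] by simp
  finally show ?thesis .
qed

lemma integrable_cbox_continuous:
  fixes f :: "'a::euclidean_space \<Rightarrow> real"
  assumes "continuous_on (cbox a b) f" shows "integrable lborel (\<lambda>x. indicator (cbox a b) x * f x)"
  using borel_integrable_compact[OF compact_cbox assms] by (simp add: indicator_def if_distrib cong: if_cong)

text \<open>Fubini with direction i innermost, then the fundamental theorem of calculus on each
  line, at both ends of which X vanishes.\<close>

lemma box_integral_partial_deriv_zero: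
  fixes X :: "real^2 \<Rightarrow> real"
  assumes "open U" "cbox a b \<subseteq> U" "smooth_on U X"
    and "\<And>x. x \<in> cbox a b ==> x $ i = a $ i \<or> x $ i = b $ i ==> X x = 0"
  shows "(LINT x|lborel. indicator (cbox a b) x * partial_deriv i X x) = 0"
proof -
  have cont: "continuous_on U (partial_deriv i X)"
    by (rule smooth_on_imp_continuous_on[OF smooth_on_partial[OF assms(3)]])
  obtain j where j: "j \<noteq> i" "UNIV = {i, j}" using other_index by blast
  have in_box: "coord_pair i t s \<in> cbox a b \<longleftrightarrow> t \<in> {a $ j..b $ j} \<and> s \<in> {a $ i..b $ i}" for t s
  proof -
    have "coord_pair i t s \<in> cbox a b \<longleftrightarrow> (\<forall>k\<in>{i, j}. a $ k \<le> coord_pair i t s $ k \<and> coord_pair i t s $ k \<le> b $ k)"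
      using j(2) by (auto simp: mem_box_cart)
    then show ?thesis using j(1) by (auto simp: coord_pair_def)
  qed
  have inner: "(LINT s|lborel. indicator (cbox a b) (coord_pair i t s) * partial_deriv i X (coord_pair i t s)) = 0" for t
  proof (cases "t \<in> {a $ j..b $ j} \<and> a $ i \<le> b $ i")
    case True
    let ?c = "\<lambda>s. coord_pair i t s"
    have sub: "?c s \<in> U" if "s \<in> {a $ i..b $ i}" for s using that True in_box assms(2) by blast
    have "(LINT s|lborel. indicator {a $ i..b $ i} s *\<^sub>R partial_deriv i X (?c s)) = X (?c (b $ i)) - X (?c (a $ i))"
    proof (rule integral_FTC_atLeastAtMost)
      show "a $ i \<le> b $ i" using True by simp
      show "((\<lambda>s. X (?c s)) has_vector_derivative partial_deriv i X (?c s)) (at s within {a $ i..b $ i})"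
        if "a $ i \<le> s" "s \<le> b $ i" for s
        using partial_deriv_has_field_derivative[of X "coord_pair i t 0" s i]
          smooth_on_imp_differentiable[OF assms(3,1) sub, of s] that
        by (simp add: coord_pair_axis[symmetric] has_real_derivative_iff_has_vector_derivative has_vector_derivative_at_within)
      have "continuous_on {a $ i..b $ i} ?c"
        by (subst coord_pair_axis) (intro continuous_intros)
      then show "continuous_on {a $ i..b $ i} (\<lambda>s. partial_deriv i X (?c s))"
        by (rule continuous_on_compose2[OF cont]) (use sub in auto)
    qed
    also have "\<dots> = 0"
    proof -
      have "X (?c s) = 0" if "s = a $ i \<or> s = b $ i" for s
        by (rule assms(4)) (use that True in_box[of t s] in \<open>auto simp: coord_pair_def\<close>)
      then show ?thesis by simp
    qed
    finally show ?thesis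
      using True in_box by (simp add: indicator_def)
  next
    case False
    then have "indicator (cbox a b) (coord_pair i t s) = (0::real)" for s using in_box by auto
    then show ?thesis by simp
  qed
  have "integrable lborel (\<lambda>x. indicator (cbox a b) x * partial_deriv i X x)"
    by (rule integrable_cbox_continuous[OF continuous_on_subset[OF cont assms(2)]])
  from integral_coord_pair[OF this, of i] show ?thesis by (simp add: inner)
qed

lemma box_integration_by_parts:
  assumes "open U" "cbox a b \<subseteq> U" "smooth_on U f" "smooth_on U \<psi>"
    and "\<And>x. x \<in> cbox a b ==> x $ i = a $ i \<or> x $ i = b $ i ==> \<psi> x = 0"
  shows "(LINT x|lborel. indicator (cbox a b) x * (partial_deriv i f x * \<psi> x))
     = - (LINT x|lborel. indicator (cbox a b) x * (f x * partial_deriv i \<psi> x))"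
proof -
  note c = smooth_on_imp_continuous_on[OF smooth_on_mult[OF assms(1)], THEN continuous_on_subset[OF _ assms(2)]]
  have i1: "integrable lborel (\<lambda>x. indicator (cbox a b) x * (f x * partial_deriv i \<psi> x))"
    and i2: "integrable lborel (\<lambda>x. indicator (cbox a b) x * (partial_deriv i f x * \<psi> x))"
    by (intro integrable_cbox_continuous c assms smooth_on_partial)+
  have "indicator (cbox a b) x * (f x * partial_deriv i \<psi> x) + indicator (cbox a b) x * (partial_deriv i f x * \<psi> x)
    = indicator (cbox a b) x * partial_deriv i (\<lambda>y. f y * \<psi> y) x" for x
    using assms(2) smooth_on_imp_differentiable[OF assms(3,1), of x] smooth_on_imp_differentiable[OF assms(4,1), of x]
    by (cases "x \<in> cbox a b") (auto simp: partial_deriv_mult)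
  then have "(LINT x|lborel. indicator (cbox a b) x * (f x * partial_deriv i \<psi> x))
    + (LINT x|lborel. indicator (cbox a b) x * (partial_deriv i f x * \<psi> x))
    = (LINT x|lborel. indicator (cbox a b) x * partial_deriv i (\<lambda>y. f y * \<psi> y) x)"
    by (simp add: Bochner_Integration.integral_add[OF i1 i2, symmetric])
  also have "\<dots> = 0"
    by (rule box_integral_partial_deriv_zero[OF assms(1,2) smooth_on_mult[OF assms(1,3,4)]]) (use assms(5) in auto)
  finally show ?thesis by simp
qed

text \<open>The positive and negative parts of f are densities of two finite measures that agree on
  boxes, an intersection-stable generator. The measures are equal, and uniqueness of densities makes
  the two parts agree.\<close>

lemma AE_zero_if_box_integrals_zero:
  fixes f :: "'a::ordered_euclidean_space \<Rightarrow> real"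
  assumes f: "integrable lborel f" and zero: "\<And>a b. (LINT x|lborel. indicator (cbox a b) x * f x) = 0"
  shows "AE x in lborel. f x = 0"
proof -
  have [measurable]: "f \<in> borel_measurable borel" using f by auto
  let ?P = "\<lambda>x. ennreal (f x)" and ?N = "\<lambda>x. ennreal (- f x)"
  have fin: "(\<integral>\<^sup>+x. ?P x * indicator S x \<partial>lborel) < \<infinity>" for S
  proof -
    have "(\<integral>\<^sup>+x. ?P x * indicator S x \<partial>lborel) \<le> (\<integral>\<^sup>+x. ennreal (norm (f x)) \<partial>lborel)"
      by (intro nn_integral_mono) (auto simp: indicator_def intro!: ennreal_leI)
    also have "\<dots> < \<infinity>" using f by (simp add: integrable_iff_bounded)
    finally show ?thesis .
  qed
  have eq: "(\<integral>\<^sup>+x. ?P x * indicator (cbox a b) x \<partial>lborel) = (\<integral>\<^sup>+x. ?N x * indicator (cbox a b) x \<partial>lborel)" for a b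
  proof -
    let ?h = "\<lambda>x. indicator (cbox a b) x * f x"
    have i: "integrable lborel ?h" by (rule Bochner_Integration.integrable_bound[OF f]) (auto simp: indicator_def)
    have e: "(LINT x|lborel. ?h x) = enn2real (\<integral>\<^sup>+x. ennreal (?h x) \<partial>lborel) - enn2real (\<integral>\<^sup>+x. ennreal (- ?h x) \<partial>lborel)"
      by (rule real_lebesgue_integral_def[OF i])
    have "(\<integral>\<^sup>+x. ennreal (?h x) \<partial>lborel) \<noteq> \<infinity>" "(\<integral>\<^sup>+x. ennreal (- ?h x) \<partial>lborel) \<noteq> \<infinity>"
      using i unfolding real_integrable_def by auto
    then have "(\<integral>\<^sup>+x. ennreal (?h x) \<partial>lborel) = (\<integral>\<^sup>+x. ennreal (- ?h x) \<partial>lborel)"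
      using e zero[of a b] by (simp add: less_top) (metis ennreal_enn2real)
    moreover have "ennreal (?h x) = ?P x * indicator (cbox a b) x" "ennreal (- ?h x) = ?N x * indicator (cbox a b) x" for x
      by (auto simp: indicator_def)
    ultimately show ?thesis by simp
  qed
  have "density lborel ?P = density lborel ?N"
  proof (rule measure_eqI_generator_eq[where E="range (\<lambda>(a, b). cbox a b)" and \<Omega>=UNIV
        and A="\<lambda>n::nat. cbox (- (real n *\<^sub>R One)) (real n *\<^sub>R One)"])
    show "Int_stable (range (\<lambda>(a, b). cbox a b :: 'a set))"
      by (auto simp: Int_stable_def Int_interval image_iff)
    show "sets (density lborel ?P) = sigma_sets UNIV (range (\<lambda>(a, b). cbox a b))"
      "sets (density lborel ?N) = sigma_sets UNIV (range (\<lambda>(a, b). cbox a b))"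
      by (simp_all add: borel_eq_atLeastAtMost cbox_interval)
    show "(\<Union>n::nat. cbox (- (real n *\<^sub>R One)) (real n *\<^sub>R One)) = (UNIV :: 'a set)"
    proof -
      have "(\<Union>n::nat. box (- (real n *\<^sub>R One)) (real n *\<^sub>R One)) \<subseteq> (\<Union>n::nat. cbox (- (real n *\<^sub>R One)) (real n *\<^sub>R One :: 'a))"
        by (intro UN_mono box_subset_cbox) auto
      then show ?thesis by (simp only: UN_box_eq_UNIV top.extremum_unique)
    qed
    show "emeasure (density lborel ?P) X = emeasure (density lborel ?N) X" if "X \<in> range (\<lambda>(a, b). cbox a b)" for X
      using that eq by (auto simp: emeasure_density)
    show "emeasure (density lborel ?P) (cbox (- (real n *\<^sub>R One)) (real n *\<^sub>R One)) \<noteq> \<infinity>" for n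
      using fin[of "cbox (- (real n *\<^sub>R One)) (real n *\<^sub>R One)"] by (simp add: emeasure_density)
  qed auto
  then have "AE x in lborel. ?P x = ?N x"
    using finite_density_unique[of ?P lborel ?N] fin[of UNIV] by simp
  moreover have "f x = 0" if "?P x = ?N x" for x
    using that by (cases "0 \<le> f x") (simp_all add: ennreal_neg ennreal_eq_0_iff)
  ultimately show ?thesis by auto
qed

lemma AE_lborel_coord_neq: "AE x in (lborel :: (real^2) measure). x $ i \<noteq> c"
proof -
  have "closed {x :: real^2. x $ i = c}"
    by (intro closed_Collect_eq continuous_intros)
  then have "{x :: real^2. x $ i = c} \<in> null_sets lborel"
    using negligible_standard_hyperplane[of "axis i 1 :: real^2" c] unfolding negligible_iff_null_sets
    by (simp add: null_sets_completion_iff inner_axis)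
  then show ?thesis by (auto dest: AE_not_in)
qed

lemma sq_int_cbox_continuous:
  fixes f :: "'a::euclidean_space \<Rightarrow> real"
  assumes "continuous_on (cbox a b) f" shows "sq_int lborel (\<lambda>x. indicator (cbox a b) x * f x)"
proof -
  have "(\<lambda>x. (indicator (cbox a b) x * f x) * (indicator (cbox a b) x * f x)) = (\<lambda>x. indicator (cbox a b) x * (f x * f x))"
    by (auto simp: indicator_def)
  then show ?thesis
    using borel_measurable_integrable[OF integrable_cbox_continuous[OF assms]]
      integrable_cbox_continuous[OF continuous_on_mult[OF assms assms]]
    by (simp only: sq_int_def inner_real_def simp_thms measurable_lborel1)
qed

text \<open>Testing the limit against \<open>1 - (1 - w) ^ k\<close>, where the parabola \<open>w\<close> vanishes on two
  opposite sides of a box, shows in the limit of large \<open>k\<close> that it has integral zero over the box.\<close>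

lemma box_weak_derivative_of_zero:
  fixes \<phi> :: "nat \<Rightarrow> real^2 \<Rightarrow> real"
  assumes "open U" "cbox a b \<subseteq> U" "\<And>n. smooth_on U (\<phi> n)"
    and H [measurable]: "H \<in> borel_measurable borel"
    and H0: "\<And>x. x \<notin> cbox a b ==> H x = 0"
    and L0: "(\<lambda>n. \<integral>\<^sup>+x. ennreal ((\<phi> n x)\<^sup>2) * indicator (cbox a b) x \<partial>lborel) \<longlonglongrightarrow> 0"
    and L1: "(\<lambda>n. \<integral>\<^sup>+x. ennreal ((H x - partial_deriv i (\<phi> n) x)\<^sup>2) * indicator (cbox a b) x \<partial>lborel) \<longlonglongrightarrow> 0"
  shows "AE x in lborel. H x = 0"
proof -
  let ?K = "cbox a b"
  define F where "F n x = indicator ?K x * \<phi> n x" for n x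
  define D where "D n x = indicator ?K x * partial_deriv i (\<phi> n) x" for n x
  have sF: "sq_int lborel (F n)" for n unfolding F_def
    by (intro sq_int_cbox_continuous continuous_on_subset[OF smooth_on_imp_continuous_on[OF assms(3)] assms(2)])
  have sD: "sq_int lborel (D n)" for n unfolding D_def
    by (intro sq_int_cbox_continuous continuous_on_subset[OF smooth_on_imp_continuous_on[OF smooth_on_partial[OF assms(3)]] assms(2)])
  have [measurable]: "D n \<in> borel_measurable borel" for n using sD[of n] by (simp add: sq_int_def)
  have L1': "(\<lambda>n. \<integral>\<^sup>+x. ennreal ((H x - D n x) \<bullet> (H x - D n x)) \<partial>lborel) \<longlonglongrightarrow> 0"
  proof -
    have "(\<integral>\<^sup>+x. ennreal ((H x - D n x) \<bullet> (H x - D n x)) \<partial>lborel)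
      = (\<integral>\<^sup>+x. ennreal ((H x - partial_deriv i (\<phi> n) x)\<^sup>2) * indicator ?K x \<partial>lborel)" for n
      by (intro nn_integral_cong) (auto simp: D_def indicator_def power2_eq_square H0)
    then show ?thesis using L1 by simp
  qed
  \<comment> \<open>H is only assumed to be measurable; being at finite distance from the square
    integrable \<open>D n0\<close> it is square integrable itself.\<close>
  then have "eventually (\<lambda>n. (\<integral>\<^sup>+x. ennreal ((H x - D n x) \<bullet> (H x - D n x)) \<partial>lborel) < 1) sequentially"
    by (rule order_tendstoD(2)) simp
  then obtain n0 where "(\<integral>\<^sup>+x. ennreal ((H x - D n0 x) \<bullet> (H x - D n0 x)) \<partial>lborel) < 1"
    by (auto simp: eventually_sequentially)
  then have "sq_int lborel (\<lambda>x. H x - D n0 x)"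
    by (subst sq_int_iff_nn) (auto intro: less_trans)
  then have sH: "sq_int lborel H" using sq_int_add[OF _ sD[of n0], of "\<lambda>x. H x - D n0 x"] by simp
  have cD: "(\<lambda>n. ip lborel (\<lambda>x. H x - D n x) (\<lambda>x. H x - D n x)) \<longlonglongrightarrow> 0"
    using L1' unfolding nn_integral_ip[OF sq_int_diff[OF sH sD]]
    by (subst (asm) ennreal_tendsto_0_iff) (simp_all add: ip_nonneg)
  have "(\<lambda>n. ip lborel (F n) (F n)) \<longlonglongrightarrow> 0"
  proof -
    have "(\<integral>\<^sup>+x. ennreal ((\<phi> n x)\<^sup>2) * indicator ?K x \<partial>lborel) = (\<integral>\<^sup>+x. ennreal (F n x \<bullet> F n x) \<partial>lborel)" for n
      by (intro nn_integral_cong) (auto simp: F_def indicator_def power2_eq_square)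
    then show ?thesis using L0 unfolding nn_integral_ip[OF sF]
      by (simp add: ennreal_tendsto_0_iff ip_nonneg)
  qed
  then have cF: "(\<lambda>n. ip lborel (\<lambda>x. 0 - F n x) (\<lambda>x. 0 - F n x)) \<longlonglongrightarrow> 0" by (simp add: ip_def)
  have s0: "sq_int lborel (\<lambda>x :: real^2. 0 :: real)" by (simp add: sq_int_def)
  have test: "(LINT x|lborel. indicator (cbox c d) x * (H x * \<psi> x)) = 0"
    if cd: "cbox c d \<subseteq> ?K" and sm: "smooth_on U \<psi>"
      and v: "\<And>x. x \<in> cbox c d ==> x $ i = c $ i \<or> x $ i = d $ i ==> \<psi> x = 0" for c d \<psi>
  proof -
    have sub: "cbox c d \<subseteq> U" using cd assms(2) by blast
    let ?G = "\<lambda>x. indicator (cbox c d) x * \<psi> x" and ?G' = "\<lambda>x. indicator (cbox c d) x * partial_deriv i \<psi> x"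
    have sG: "sq_int lborel ?G"
      by (intro sq_int_cbox_continuous continuous_on_subset[OF smooth_on_imp_continuous_on[OF sm] sub])
    have sG': "sq_int lborel ?G'"
      by (intro sq_int_cbox_continuous continuous_on_subset[OF smooth_on_imp_continuous_on[OF smooth_on_partial[OF sm]] sub])
    have e: "ip lborel (D n) ?G = - ip lborel (F n) ?G'" for n
    proof -
      have "ip lborel (D n) ?G = (LINT x|lborel. indicator (cbox c d) x * (partial_deriv i (\<phi> n) x * \<psi> x))"
        unfolding ip_def D_def by (intro Bochner_Integration.integral_cong) (use cd in \<open>auto simp: indicator_def\<close>)
      also have "\<dots> = - (LINT x|lborel. indicator (cbox c d) x * (\<phi> n x * partial_deriv i \<psi> x))"
        by (rule box_integration_by_parts[OF assms(1) sub assms(3) sm v])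
      also have "(LINT x|lborel. indicator (cbox c d) x * (\<phi> n x * partial_deriv i \<psi> x)) = ip lborel (F n) ?G'"
        unfolding ip_def F_def by (intro Bochner_Integration.integral_cong) (use cd in \<open>auto simp: indicator_def\<close>)
      finally show ?thesis .
    qed
    have l1: "(\<lambda>n. ip lborel (D n) ?G) \<longlonglongrightarrow> ip lborel H ?G" by (rule ip_tendsto_left[OF sD sH sG cD])
    have l2: "(\<lambda>n. - ip lborel (F n) ?G') \<longlonglongrightarrow> - ip lborel (\<lambda>x. 0) ?G'"
      by (intro tendsto_minus ip_tendsto_left[OF sF s0 sG' cF])
    have "ip lborel H ?G = 0"
      using LIMSEQ_unique[OF l1[unfolded e] l2] by (simp add: ip_def)
    then show ?thesis by (simp add: ip_def mult.left_commute)
  qed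
  \<comment> \<open>H vanishes off the box, and |t| \<le> 1 + t^2 there.\<close>
  have intH: "integrable lborel H"
  proof (rule Bochner_Integration.integrable_bound)
    have "integrable lborel (\<lambda>x. indicator ?K x * (1::real))" by (rule integrable_cbox_continuous) simp
    then show "integrable lborel (\<lambda>x. indicator ?K x * 1 + H x * H x)"
      using sH unfolding sq_int_def by (intro Bochner_Integration.integrable_add) auto
    have "\<bar>t\<bar> \<le> 1 + t * t" for t :: real
      using zero_le_square[of "\<bar>t\<bar> - 1"] by (simp add: algebra_simps)
    then show "AE x in lborel. norm (H x) \<le> norm (indicator ?K x * 1 + H x * H x)"
      using H0 by (intro AE_I2) (auto simp: indicator_def)
  qed simp
  have zero: "(LINT x|lborel. indicator (cbox c d) x * H x) = 0" if cd: "cbox c d \<subseteq> ?K" for c d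
  \<comment> \<open>A box that is flat or empty in direction i is a null set; the parabola needs a
    positive side length.\<close>
  proof (cases "c $ i < d $ i")
    case False
    have "AE x in lborel. indicator (cbox c d) x * H x = 0"
      using AE_lborel_coord_neq[of i "c $ i"]
    proof (rule AE_mp, intro AE_I2 impI)
      fix x :: "real^2" assume "x $ i \<noteq> c $ i"
      then have "x \<notin> cbox c d" using False unfolding mem_box_cart by (metis antisym_conv not_le order_trans)
      then show "indicator (cbox c d) x * H x = 0" by simp
    qed
    then show ?thesis by (rule integral_eq_zero_AE)
  next
    case True
    \<comment> \<open>The factor normalises the maximum of the parabola to 1, so that 1 - para lies
      in [0, 1) wherever x avoids the two sides, and its powers tend to 0.\<close>
    define para where "para x = 4 / (d $ i - c $ i)\<^sup>2 * ((x $ i - c $ i) * (d $ i - x $ i))" for x :: "real^2"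
    define \<psi> where "\<psi> k x = 1 - (1 - para x) ^ k" for k :: nat and x
    have para: "0 \<le> para x" "para x \<le> 1" if "x \<in> cbox c d" for x
    proof -
      have x: "c $ i \<le> x $ i" "x $ i \<le> d $ i" using that by (auto simp: mem_box_cart)
      then show "0 \<le> para x" by (simp add: para_def)
      have "4 * ((x $ i - c $ i) * (d $ i - x $ i)) \<le> (d $ i - c $ i)\<^sup>2"
        using zero_le_power2[of "(x $ i - c $ i) - (d $ i - x $ i)"] by (simp add: power2_eq_square algebra_simps)
      then show "para x \<le> 1" using True by (simp add: para_def)
    qed
    have smp: "smooth_on U (\<psi> k)" for k
      unfolding \<psi>_def para_def
      by (intro smooth_on_diff smooth_on_power smooth_on_mult smooth_on_const smooth_on_coord assms(1))
    have z: "(LINT x|lborel. indicator (cbox c d) x * (H x * \<psi> (Suc k) x)) = 0" for k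
      by (rule test[OF cd smp]) (auto simp: \<psi>_def para_def)
    have [measurable]: "\<psi> k \<in> borel_measurable borel" for k
      unfolding \<psi>_def para_def by (intro borel_measurable_continuous_onI continuous_intros)
    have "(\<lambda>k. LINT x|lborel. indicator (cbox c d) x * (H x * \<psi> (Suc k) x)) \<longlonglongrightarrow> (LINT x|lborel. indicator (cbox c d) x * H x)"
    proof (rule integral_dominated_convergence[where w="\<lambda>x. \<bar>H x\<bar>"])
      show "integrable lborel (\<lambda>x. \<bar>H x\<bar>)" using intH by simp
      show "AE x in lborel. norm (indicator (cbox c d) x * (H x * \<psi> (Suc k) x)) \<le> \<bar>H x\<bar>" for k
      proof (intro AE_I2)
        fix x
        show "norm (indicator (cbox c d) x * (H x * \<psi> (Suc k) x)) \<le> \<bar>H x\<bar>"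
        proof (cases "x \<in> cbox c d")
          case True
          have "0 \<le> (1 - para x) ^ Suc k" "(1 - para x) ^ Suc k \<le> 1"
            using para[OF True] by (intro zero_le_power power_le_one; simp)+
          then have "\<bar>\<psi> (Suc k) x\<bar> \<le> 1" by (simp add: \<psi>_def del: power_Suc)
          then have "\<bar>H x\<bar> * \<bar>\<psi> (Suc k) x\<bar> \<le> \<bar>H x\<bar> * 1" by (intro mult_left_mono) auto
          then show ?thesis using True by (simp add: abs_mult)
        qed simp
      qed
      have "AE x in lborel. x $ i \<noteq> c $ i \<and> x $ i \<noteq> d $ i"
        using AE_lborel_coord_neq by simp
      then show "AE x in lborel. (\<lambda>k. indicator (cbox c d) x * (H x * \<psi> (Suc k) x)) \<longlonglongrightarrow> indicator (cbox c d) x * H x"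
      proof (rule AE_mp, intro AE_I2 impI)
        fix x :: "real^2" assume ne: "x $ i \<noteq> c $ i \<and> x $ i \<noteq> d $ i"
        show "(\<lambda>k. indicator (cbox c d) x * (H x * \<psi> (Suc k) x)) \<longlonglongrightarrow> indicator (cbox c d) x * H x"
        proof (cases "x \<in> cbox c d")
          case x: True
          then have "c $ i < x $ i" "x $ i < d $ i" using ne by (auto simp: mem_box_cart less_le)
          then have "0 < para x" using True by (simp add: para_def)
          then have "(\<lambda>k. (1 - para x) ^ Suc k) \<longlonglongrightarrow> 0"
            using para[OF x] by (intro LIMSEQ_Suc LIMSEQ_power_zero) auto
          then have "(\<lambda>k. indicator (cbox c d) x * (H x * (1 - (1 - para x) ^ Suc k))) \<longlonglongrightarrow> indicator (cbox c d) x * (H x * (1 - 0))"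
            by (intro tendsto_intros)
          then show ?thesis by (simp add: \<psi>_def)
        qed simp
      qed
    qed measurable
    then show ?thesis unfolding z by (metis LIMSEQ_const_iff)
  qed
  show ?thesis
  proof (rule AE_zero_if_box_integrals_zero[OF intH])
    fix c d :: "real^2"
    obtain c' d' where e: "cbox c d \<inter> ?K = cbox c' d'" using Int_interval by blast
    have "(\<lambda>x. indicator (cbox c d) x * H x) = (\<lambda>x. indicator (cbox c' d') x * H x)"
      using H0 unfolding e[symmetric] by (auto simp: indicator_def fun_eq_iff)
    then show "(LINT x|lborel. indicator (cbox c d) x * H x) = 0"
      using zero[of c' d'] e by auto
  qed
qed

text \<open>Cauchy-Schwarz for the metric: the component is \<xi> applied to the i-th coordinate
  vector, whose squared length is G_ii. In coordinates the difference is the square of a linear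
  expression, divided by the determinant.\<close>

lemma covector_component_le:
  assumes "G $ 2 $ 1 = G $ 1 $ 2" "G $ 1 $ 1 > 0" "G $ 2 $ 2 > 0" "det (G :: real^2^2) > 0"
  shows "(\<xi> $ i)\<^sup>2 \<le> G $ i $ i * (\<xi> \<bullet> (matrix_inv G *v \<xi>))"
proof -
  have d: "det G = G $ 1 $ 1 * G $ 2 $ 2 - G $ 1 $ 2 * G $ 1 $ 2" by (simp add: det_2 assms)
  have q: "\<xi> \<bullet> (matrix_inv G *v \<xi>) = (G $ 2 $ 2 * (\<xi> $ 1)\<^sup>2 - 2 * (G $ 1 $ 2 * \<xi> $ 1 * \<xi> $ 2) + G $ 1 $ 1 * (\<xi> $ 2)\<^sup>2) / det G"
    using assms by (simp add: matrix_inv_2 inner_vec_def sum_2 matrix_vector_mult_def field_simps power2_eq_square)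
  have 1: "(\<xi> $ 1)\<^sup>2 * det G \<le> G $ 1 $ 1 * (G $ 2 $ 2 * (\<xi> $ 1)\<^sup>2 - 2 * (G $ 1 $ 2 * \<xi> $ 1 * \<xi> $ 2) + G $ 1 $ 1 * (\<xi> $ 2)\<^sup>2)"
    using zero_le_power2[of "G $ 1 $ 1 * \<xi> $ 2 - G $ 1 $ 2 * \<xi> $ 1"]
    by (simp add: d power2_eq_square algebra_simps)
  have 2: "(\<xi> $ 2)\<^sup>2 * det G \<le> G $ 2 $ 2 * (G $ 2 $ 2 * (\<xi> $ 1)\<^sup>2 - 2 * (G $ 1 $ 2 * \<xi> $ 1 * \<xi> $ 2) + G $ 1 $ 1 * (\<xi> $ 2)\<^sup>2)"
    using zero_le_power2[of "G $ 2 $ 2 * \<xi> $ 1 - G $ 1 $ 2 * \<xi> $ 2"]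
    by (simp add: d power2_eq_square algebra_simps)
  have "i = 1 \<or> i = 2" by (rule exhaust_2)
  then show ?thesis unfolding q using 1 2 assms(4) by (auto simp: field_simps)
qed

section \<open>Uniqueness of the weak differential and the bottom of the spectrum\<close>

context metric_surface begin

text \<open>One constant for all compactness bounds on a chart box, so that Euclidean and Riemannian
  integrals can be compared in both directions.\<close>

lemma metric_bounded_on_box:
  assumes "c \<in> A" "cbox a b \<subseteq> snd c ` fst c"
  obtains B where "B > 0" "\<And>x. x \<in> cbox a b ==> 1 \<le> B * area_density c x"
    "\<And>x. x \<in> cbox a b ==> area_density c x \<le> B"
    "\<And>x i. x \<in> cbox a b ==> g c (chart_inv c x) $ i $ i \<le> B"
proof -
  let ?K = "cbox a b"
  have cW: "continuous_on ?K (area_density c)"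
    by (rule continuous_on_subset[OF continuous_area_density[OF assms(1)] assms(2)])
  have W: "area_density c x > 0" if "x \<in> ?K" for x
    using area_density_pos[OF assms(1)] that assms(2) by blast
  have cg: "continuous_on ?K (\<lambda>x. g c (chart_inv c x) $ i $ i)" for i
  proof -
    have "continuous_on ?K (\<lambda>x. g c (chart_inv c x))"
      by (rule continuous_on_compose2[OF continuous_metric[OF assms(1)]
            continuous_on_subset[OF continuous_chart_inv[OF assms(1)] assms(2)]]) (use assms in auto)
    then show ?thesis by (intro continuous_intros)
  qed
  have bdd: "\<exists>B. \<forall>x\<in>?K. f x \<le> B" if "continuous_on ?K f" for f :: "real^2 \<Rightarrow> real"
  proof -
    have "bounded (f ` ?K)" by (intro compact_imp_bounded compact_continuous_image that compact_cbox)
    then obtain B where "\<forall>y\<in>f ` ?K. norm y \<le> B" unfolding bounded_iff by blast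
    then show ?thesis by (intro exI[of _ B]) (auto simp: abs_le_iff)
  qed
  obtain B1 where B1: "\<forall>x\<in>?K. 1 / area_density c x \<le> B1"
    using bdd[of "\<lambda>x. 1 / area_density c x"] cW W by (force intro!: continuous_intros)
  obtain B2 where B2: "\<forall>x\<in>?K. area_density c x \<le> B2" using bdd[OF cW] by blast
  obtain B3 where B3: "\<forall>x\<in>?K. g c (chart_inv c x) $ 1 $ 1 \<le> B3" using bdd[OF cg] by blast
  obtain B4 where B4: "\<forall>x\<in>?K. g c (chart_inv c x) $ 2 $ 2 \<le> B4" using bdd[OF cg] by blast
  define B where "B = 1 + \<bar>B1\<bar> + \<bar>B2\<bar> + \<bar>B3\<bar> + \<bar>B4\<bar>"
  show ?thesis
  proof (rule that[of B])
    show "B > 0" by (simp add: B_def)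
    show "1 \<le> B * area_density c x" if "x \<in> ?K" for x
    proof -
      have "1 / area_density c x \<le> B" using B1 that by (force simp: B_def)
      then show ?thesis using W[OF that] by (simp add: field_simps)
    qed
    show "area_density c x \<le> B" if "x \<in> ?K" for x using B2 that by (force simp: B_def)
    show "g c (chart_inv c x) $ i $ i \<le> B" if "x \<in> ?K" for x i
    proof -
      have "i = 1 \<or> i = 2" by (rule exhaust_2)
      moreover have "g c (chart_inv c x) $ 1 $ 1 \<le> B" using B3 that by (force simp: B_def)
      moreover have "g c (chart_inv c x) $ 2 $ 2 \<le> B" using B4 that by (force simp: B_def)
      ultimately show ?thesis by auto
    qed
  qed
qed

lemma nn_integral_box_le_vol:
  assumes "c \<in> A" "cbox a b \<subseteq> snd c ` fst c" "h \<in> borel_measurable borel"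
    and "\<And>x. x \<in> cbox a b ==> 1 \<le> B * area_density c x" "B > 0"
  shows "(\<integral>\<^sup>+x. h (chart_inv c x) * indicator (cbox a b) x \<partial>lborel) \<le> ennreal B * (\<integral>\<^sup>+p. h p \<partial>vol A g)"
proof -
  let ?S = "fst c \<inter> snd c -` cbox a b"
  have S: "?S \<in> sets borel" by (intro sets_borel_preimage_open open_dom continuous_chart assms) simp
  have im: "snd c ` ?S = cbox a b" using assms(2) by auto
  have W: "area_density c x > 0" if "x \<in> cbox a b" for x
    using area_density_pos[OF assms(1)] that assms(2) by blast
  have m: "(\<lambda>x. ennreal (area_density c x) * h (chart_inv c x) * indicator (cbox a b) x) \<in> borel_measurable borel"
  proof -
    have h': "(\<lambda>x. h (if x \<in> snd c ` fst c then chart_inv c x else undefined)) \<in> borel_measurable borel"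
      by (rule measurable_compose[OF measurable_chart_inv[OF assms(1)] assms(3)])
    have d: "(\<lambda>x. ennreal (indicator (snd c ` ?S) x * area_density c x)) \<in> borel_measurable borel"
      using measurable_area_density[OF assms(1) S] by measurable
    have "(\<lambda>x. ennreal (area_density c x) * h (chart_inv c x) * indicator (cbox a b) x)
      = (\<lambda>x. ennreal (indicator (snd c ` ?S) x * area_density c x) * h (if x \<in> snd c ` fst c then chart_inv c x else undefined))"
      unfolding im using assms(2) by (auto simp: fun_eq_iff indicator_def)
    then show ?thesis using h' d by simp
  qed
  have "(\<integral>\<^sup>+x. h (chart_inv c x) * indicator (cbox a b) x \<partial>lborel)
     \<le> (\<integral>\<^sup>+x. ennreal B * (ennreal (area_density c x) * h (chart_inv c x) * indicator (cbox a b) x) \<partial>lborel)"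
  proof (intro nn_integral_mono)
    fix x
    show "h (chart_inv c x) * indicator (cbox a b) x
       \<le> ennreal B * (ennreal (area_density c x) * h (chart_inv c x) * indicator (cbox a b) x)"
    proof (cases "x \<in> cbox a b")
      case True
      have "1 \<le> ennreal B * ennreal (area_density c x)"
        using assms(4)[OF True] assms(5) W[OF True] by (simp add: ennreal_mult'[symmetric] ennreal_1[symmetric] del: ennreal_1)
      from mult_right_mono[OF this, of "h (chart_inv c x)"] show ?thesis using True by (simp add: mult.assoc)
    qed simp
  qed
  also have "\<dots> = ennreal B * (\<integral>\<^sup>+x. ennreal (area_density c x) * h (chart_inv c x) * indicator (cbox a b) x \<partial>lborel)"
    by (intro nn_integral_cmult) (use m in simp)
  also have "(\<integral>\<^sup>+x. ennreal (area_density c x) * h (chart_inv c x) * indicator (cbox a b) x \<partial>lborel) = (\<integral>\<^sup>+p. h p * indicator ?S p \<partial>vol A g)"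
    using nn_integral_vol_chart[OF assms(1) S _ assms(3)] by (simp add: im)
  also have "ennreal B * \<dots> \<le> ennreal B * (\<integral>\<^sup>+p. h p \<partial>vol A g)"
    by (intro mult_left_mono nn_integral_mono) (auto simp: indicator_def)
  finally show ?thesis .
qed

text \<open>A chart image is a countable union of boxes, and countably many charts cover the
  surface, so null sets can be tested box by box with Lebesgue measure.\<close>

lemma AE_vol_iff_charts:
  assumes [measurable]: "Measurable.pred borel P"
    and "\<And>c a b. c \<in> A ==> cbox a b \<subseteq> snd c ` fst c ==> AE x in lborel. x \<in> cbox a b \<longrightarrow> P (chart_inv c x)"
  shows "AE p in vol A g. P p"
proof -
  have "AE p in vol A g. p \<in> fst c \<longrightarrow> P p" if c: "c \<in> A" for c
  proof -
    obtain D where D: "countable D" "D \<subseteq> Pow (snd c ` fst c)" "\<And>X. X \<in> D ==> \<exists>a b. X = cbox a b" "\<Union>D = snd c ` fst c"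
    proof (rule open_countable_Union_open_cbox[OF open_img[OF c]])
      fix D :: "(real^2) set set"
      assume D: "countable D" "D \<subseteq> Pow (snd c ` fst c)" "\<And>X. X \<in> D ==> \<exists>a b. X = cbox a b" "\<Union>D = snd c ` fst c"
      show thesis by (rule that[OF D])
    qed
    have "\<forall>X\<in>D. AE x in lborel. x \<in> X \<longrightarrow> P (chart_inv c x)"
    proof
      fix X assume X: "X \<in> D"
      then obtain a b where "X = cbox a b" using D(3) by blast
      with X D(2) assms(2)[OF c, of a b] show "AE x in lborel. x \<in> X \<longrightarrow> P (chart_inv c x)" by blast
    qed
    then have "AE x in lborel. \<forall>X\<in>D. x \<in> X \<longrightarrow> P (chart_inv c x)"
      by (subst AE_ball_countable[OF D(1)])
    then have ae: "AE x in lborel. x \<in> snd c ` fst c \<longrightarrow> P (chart_inv c x)"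
      by (rule AE_mp) (use D(4) in \<open>auto intro!: AE_I2\<close>)
    let ?N = "{p \<in> fst c. \<not> P p}"
    have N: "?N \<in> sets borel" using c by measurable
    have "emeasure (vol A g) ?N = (\<integral>\<^sup>+x. ennreal (area_density c x) * indicator (snd c ` ?N) x \<partial>lborel)"
      by (rule emeasure_vol[OF c N]) auto
    also have "\<dots> = (\<integral>\<^sup>+x. 0 \<partial>(lborel :: (real^2) measure))"
    proof (rule nn_integral_cong_AE, rule AE_mp[OF ae], intro AE_I2 impI)
      fix x assume "x \<in> snd c ` fst c \<longrightarrow> P (chart_inv c x)"
      then have "x \<notin> snd c ` ?N" using c by auto
      then show "ennreal (area_density c x) * indicator (snd c ` ?N) x = 0" by simp
    qed
    finally have "?N \<in> null_sets (vol A g)" using N by (simp add: null_sets_def)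
    then show ?thesis by (auto dest!: AE_not_in)
  qed
  then have "AE p in vol A g. \<forall>n. p \<in> fst (cover_chart n) \<longrightarrow> P p"
    using cover_chart(1) by (subst AE_all_countable) auto
  then show ?thesis by (rule AE_mp) (use cover_chart(2) in \<open>auto intro!: AE_I2\<close>)
qed

lemma frame_zero_iff_chart:
  assumes "covector_field A \<eta>" "c \<in> A" "p \<in> fst c" "\<And>i. \<eta> c p $ i = 0"
  shows "frame \<eta> p = 0"
proof -
  have "\<eta> c p = 0" using assms(4) by (simp add: vec_eq_iff)
  then have "\<eta> (base_chart p) p = 0"
    using covector_field_transform[OF assms(1) base_chart_in(1) assms(2) base_chart_in(2) assms(3)]
    by (simp add: matrix_vector_mult_def vec_eq_iff)
  then show ?thesis by (simp add: frame_def frame_components_def vec_eq_iff forall_2)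
qed

text \<open>Closability of the differential. Test functions tend to 0 while their differentials tend
  to \<eta>; in a chart box this is the hypothesis of \<open>box_weak_derivative_of_zero\<close> for
  each component of \<eta>, at the cost of powers of the bound B.\<close>

lemma weak_differential_of_zero:
  assumes "H1_differential A g (\<lambda>p. 0) \<eta>" shows "AE p in vol A g. frame \<eta> p = 0"
proof -
  have w: "covector_field A \<eta>" using assms by (simp add: H1_differential_def)
  obtain \<phi> where \<phi>: "\<And>n. test_fun A (\<phi> n)"
      "(\<lambda>n. \<integral>\<^sup>+p. ennreal ((0 - \<phi> n p)\<^sup>2) \<partial>vol A g) \<longlonglongrightarrow> 0"
      "(\<lambda>n. \<integral>\<^sup>+p. ennreal (covector_inner A g (\<lambda>c q. \<eta> c q - differential (\<phi> n) c q)
                                           (\<lambda>c q. \<eta> c q - differential (\<phi> n) c q) p) \<partial>vol A g) \<longlonglongrightarrow> 0"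
    using assms unfolding H1_differential_def by blast
  have sm: "smooth_fun A (\<phi> n)" for n using \<phi>(1) by (simp add: test_fun_def)
  have [measurable]: "frame \<eta> \<in> borel_measurable borel" using measurable_frame[OF w] .
  show ?thesis
  proof (rule AE_vol_iff_charts)
    show "Measurable.pred borel (\<lambda>p. frame \<eta> p = 0)" by measurable
    fix c a b assume c: "c \<in> A" and K: "cbox a b \<subseteq> snd c ` fst c"
    obtain B where B: "B > 0" "\<And>x. x \<in> cbox a b ==> 1 \<le> B * area_density c x"
      "\<And>x i. x \<in> cbox a b ==> g c (chart_inv c x) $ i $ i \<le> B"
      using metric_bounded_on_box[OF c K] by metis
    have "AE x in lborel. x \<in> cbox a b \<longrightarrow> \<eta> c (chart_inv c x) $ i = 0" for i
    proof -
      let ?inv = "\<lambda>x. if x \<in> snd c ` fst c then chart_inv c x else undefined"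
      \<comment> \<open>A component of \<eta> in the chart, extended by 0 to a Borel function on the
        whole plane.\<close>
      let ?H = "\<lambda>x. indicator (cbox a b) x * (indicator (fst c) (?inv x) *\<^sub>R \<eta> c (?inv x)) $ i"
      let ?d = "\<lambda>n c q. \<eta> c q - differential (\<phi> n) c q"
      have cw: "covector_field A (?d n)" for n
        using covector_field_diff[OF w covector_field_differential[OF sm], of 1 "-1"] by simp
      have "(\<lambda>x. (indicator (fst c) (?inv x) *\<^sub>R \<eta> c (?inv x))) \<in> borel_measurable borel"
        using w c unfolding covector_field_def set_borel_measurable_def
        by (intro measurable_compose[OF measurable_chart_inv[OF c]]) blast
      from borel_measurable_vec_nthI[OF this, of i]
      have Hm: "?H \<in> borel_measurable borel" by (intro borel_measurable_times) simp_all
      have Hx: "?H x = \<eta> c (chart_inv c x) $ i" if "x \<in> cbox a b" for x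
        using that K c by auto
      have "AE x in lborel. ?H x = 0"
      proof (rule box_weak_derivative_of_zero[of "snd c ` fst c" a b "\<lambda>n. \<phi> n \<circ> chart_inv c" ?H i])
        show "open (snd c ` fst c)" "cbox a b \<subseteq> snd c ` fst c" by (fact open_img[OF c] K)+
        show "smooth_on (snd c ` fst c) (\<phi> n \<circ> chart_inv c)" for n using sm c by (simp add: smooth_fun_def)
        show "?H \<in> borel_measurable borel" by (fact Hm)
        show "?H x = 0" if "x \<notin> cbox a b" for x using that by simp
        have m1: "(\<lambda>p. ennreal ((0 - \<phi> n p)\<^sup>2)) \<in> borel_measurable borel" for n
          using borel_measurable_continuous_onI[OF smooth_fun_continuous[OF sm]] by measurable
        show "(\<lambda>n. \<integral>\<^sup>+x. ennreal (((\<phi> n \<circ> chart_inv c) x)\<^sup>2) * indicator (cbox a b) x \<partial>lborel) \<longlonglongrightarrow> 0"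
        proof (rule tendsto_sandwich[OF always_eventually always_eventually tendsto_const])
          show "\<forall>n. (\<integral>\<^sup>+x. ennreal (((\<phi> n \<circ> chart_inv c) x)\<^sup>2) * indicator (cbox a b) x \<partial>lborel)
             \<le> ennreal B * (\<integral>\<^sup>+p. ennreal ((0 - \<phi> n p)\<^sup>2) \<partial>vol A g)"
            using nn_integral_box_le_vol[OF c K m1 B(2) B(1)] by simp
          show "(\<lambda>n. ennreal B * (\<integral>\<^sup>+p. ennreal ((0 - \<phi> n p)\<^sup>2) \<partial>vol A g)) \<longlonglongrightarrow> 0"
            using ennreal_tendsto_cmult[OF _ \<phi>(2), of "ennreal B"] by simp
        qed simp
        have m2: "(\<lambda>p. ennreal (B * covector_inner A g (?d n) (?d n) p)) \<in> borel_measurable borel" for n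
          unfolding covector_inner_frame[OF cw cw] using measurable_frame[OF cw] by measurable
        show "(\<lambda>n. \<integral>\<^sup>+x. ennreal ((?H x - partial_deriv i (\<phi> n \<circ> chart_inv c) x)\<^sup>2) * indicator (cbox a b) x \<partial>lborel) \<longlonglongrightarrow> 0"
        proof (rule tendsto_sandwich[OF always_eventually always_eventually tendsto_const])
          show "\<forall>n. (\<integral>\<^sup>+x. ennreal ((?H x - partial_deriv i (\<phi> n \<circ> chart_inv c) x)\<^sup>2) * indicator (cbox a b) x \<partial>lborel)
             \<le> ennreal B * (ennreal B * (\<integral>\<^sup>+p. ennreal (covector_inner A g (?d n) (?d n) p) \<partial>vol A g))"
          proof
            fix n
            have "(\<integral>\<^sup>+x. ennreal ((?H x - partial_deriv i (\<phi> n \<circ> chart_inv c) x)\<^sup>2) * indicator (cbox a b) x \<partial>lborel)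
              \<le> (\<integral>\<^sup>+x. ennreal (B * covector_inner A g (?d n) (?d n) (chart_inv c x)) * indicator (cbox a b) x \<partial>lborel)"
            proof (intro nn_integral_mono)
              fix x
              show "ennreal ((?H x - partial_deriv i (\<phi> n \<circ> chart_inv c) x)\<^sup>2) * indicator (cbox a b) x
                \<le> ennreal (B * covector_inner A g (?d n) (?d n) (chart_inv c x)) * indicator (cbox a b) x"
              proof (cases "x \<in> cbox a b")
                case True
                then have x: "x \<in> snd c ` fst c" using K by blast
                then have p: "chart_inv c x \<in> fst c" using c by simp
                let ?\<xi> = "?d n c (chart_inv c x)" and ?G = "g c (chart_inv c x)"
                note spd = metric_spd[OF c p]
                have e: "?H x - partial_deriv i (\<phi> n \<circ> chart_inv c) x = ?\<xi> $ i"
                  unfolding Hx[OF True] using x c by (simp add: differential_def)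
                have "(?\<xi> $ i)\<^sup>2 \<le> ?G $ i $ i * (?\<xi> \<bullet> (matrix_inv ?G *v ?\<xi>))"
                  by (rule covector_component_le[OF spd(1-4)])
                also have "\<dots> \<le> B * (?\<xi> \<bullet> (matrix_inv ?G *v ?\<xi>))"
                  using B(3)[OF True] frame_components_inner[OF spd(1,2,4), of ?\<xi> ?\<xi>]
                  by (intro mult_right_mono) auto
                also have "\<dots> = B * covector_inner A g (?d n) (?d n) (chart_inv c x)"
                  using covector_inner_in_chart[OF cw cw c p, of n n] by simp
                finally show ?thesis unfolding e using True by (simp add: ennreal_leI)
              qed simp
            qed
            also have "\<dots> \<le> ennreal B * (\<integral>\<^sup>+p. ennreal (B * covector_inner A g (?d n) (?d n) p) \<partial>vol A g)"
              by (rule nn_integral_box_le_vol[OF c K m2 B(2) B(1)])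
            also have "(\<integral>\<^sup>+p. ennreal (B * covector_inner A g (?d n) (?d n) p) \<partial>vol A g)
              = ennreal B * (\<integral>\<^sup>+p. ennreal (covector_inner A g (?d n) (?d n) p) \<partial>vol A g)"
            proof -
              have "(\<lambda>p. ennreal (covector_inner A g (?d n) (?d n) p)) \<in> borel_measurable borel"
                unfolding covector_inner_frame[OF cw cw] using measurable_frame[OF cw] by measurable
              then show ?thesis using B(1)
                by (simp add: ennreal_mult' nn_integral_cmult less_imp_le)
            qed
            finally show "(\<integral>\<^sup>+x. ennreal ((?H x - partial_deriv i (\<phi> n \<circ> chart_inv c) x)\<^sup>2) * indicator (cbox a b) x \<partial>lborel)
               \<le> ennreal B * (ennreal B * (\<integral>\<^sup>+p. ennreal (covector_inner A g (?d n) (?d n) p) \<partial>vol A g))" .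
          qed
          have "(\<lambda>n. ennreal B * (ennreal B * (\<integral>\<^sup>+p. ennreal (covector_inner A g (?d n) (?d n) p) \<partial>vol A g))) \<longlonglongrightarrow> ennreal B * (ennreal B * 0)"
            by (intro ennreal_tendsto_cmult \<phi>(3)) simp_all
          then show "(\<lambda>n. ennreal B * (ennreal B * (\<integral>\<^sup>+p. ennreal (covector_inner A g (?d n) (?d n) p) \<partial>vol A g))) \<longlonglongrightarrow> 0"
            by simp
        qed simp
      qed
      then show ?thesis
      proof (rule AE_mp, intro AE_I2 impI)
        fix x assume h: "?H x = 0" and x: "x \<in> cbox a b"
        from Hx[OF x] h show "\<eta> c (chart_inv c x) $ i = 0" by (rule trans[OF sym])
      qed
    qed
    from this[of 1] this[of 2]
    show "AE x in lborel. x \<in> cbox a b \<longrightarrow> frame \<eta> (chart_inv c x) = 0"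
    proof eventually_elim
      case (elim x)
      show ?case
      proof
        assume x: "x \<in> cbox a b"
        then have "chart_inv c x \<in> fst c" using K c by auto
        then show "frame \<eta> (chart_inv c x) = 0"
          using elim x exhaust_2 by (intro frame_zero_iff_chart[OF w c]) metis+
      qed
    qed
  qed
qed

text \<open>Makes the choice in \<open>weak_differential\<close> harmless: any admissible covector
  field has the same frame almost everywhere.\<close>

lemma H1_differential_unique:
  assumes "H1_differential A g f \<alpha>" "H1_differential A g f \<beta>"
  shows "AE p in vol A g. frame \<alpha> p = frame \<beta> p"
proof -
  have "H1_differential A g (\<lambda>p. 0) (\<lambda>c q. \<alpha> c q - \<beta> c q)"
    using H1_differential_linear[OF assms, of 1 "-1"] by simp
  from weak_differential_of_zero[OF this] show ?thesis
    by (simp add: frame_diff)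
qed

end

section \<open>The form of the shifted Laplacian\<close>

context metric_surface begin

definition energy :: "('m \<Rightarrow> real) \<Rightarrow> real" where
  "energy \<phi> = ip (vol A g) (frame (differential \<phi>)) (frame (differential \<phi>))"

text \<open>A lower bound for the Rayleigh quotients of test functions, multiplied out so that null
  functions need no exception. The largest such m turns out to be the bottom of the spectrum,
  \<open>spectrum_bottom_ge_iff\<close>.\<close>

definition energy_gap :: "real \<Rightarrow> bool" where
  "energy_gap m \<longleftrightarrow> (\<forall>\<phi>. test_fun A \<phi> \<longrightarrow> m * ip (vol A g) \<phi> \<phi> \<le> energy \<phi>)"

text \<open>The bilinear form \<open>\<integral> \<langle>d\<phi>, d\<psi>\<rangle> - z \<integral> \<phi> \<psi>\<close> of the operator \<open>\<Delta> - z\<close>, on jets.\<close>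

definition shift :: "real \<Rightarrow> ('m \<Rightarrow> real \<times> (real^2)) \<Rightarrow> 'm \<Rightarrow> real \<times> (real^2)" where
  "shift z X p = (- z * fst (X p), snd (X p))"

definition qform :: "real \<Rightarrow> ('m \<Rightarrow> real \<times> (real^2)) \<Rightarrow> ('m \<Rightarrow> real \<times> (real^2)) \<Rightarrow> real" where
  "qform z X Y = ip (vol A g) (shift z X) Y"

lemma shift_sq_int:
  assumes "sq_int (vol A g) X" shows "sq_int (vol A g) (shift z X)"
proof -
  have Xm: "X \<in> borel_measurable borel" using assms by (simp add: sq_int_def)
  have cont: "continuous_on UNIV (\<lambda>x::real \<times> (real^2). (- z * fst x, snd x))" by (intro continuous_intros)
  have m: "shift z X \<in> borel_measurable borel"
    unfolding shift_def[abs_def] by (rule measurable_compose[OF Xm borel_measurable_continuous_onI[OF cont]])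
  have "integrable (vol A g) (\<lambda>p. shift z X p \<bullet> shift z X p)"
  proof (rule Bochner_Integration.integrable_bound)
    show "integrable (vol A g) (\<lambda>p. (z\<^sup>2 + 1) * (X p \<bullet> X p))" using assms by (simp add: sq_int_def)
    show "(\<lambda>p. shift z X p \<bullet> shift z X p) \<in> borel_measurable (vol A g)" unfolding borel_measurable_vol using m by measurable
    show "AE p in vol A g. norm (shift z X p \<bullet> shift z X p) \<le> norm ((z\<^sup>2 + 1) * (X p \<bullet> X p))"
    proof (intro AE_I2)
      fix p
      obtain a v where X: "X p = (a, v)" by (cases "X p")
      have "z\<^sup>2 * a\<^sup>2 + v \<bullet> v \<le> (z\<^sup>2 + 1) * (a\<^sup>2 + v \<bullet> v)" by (simp add: algebra_simps)
      moreover have "shift z X p \<bullet> shift z X p = z\<^sup>2 * a\<^sup>2 + v \<bullet> v" "X p \<bullet> X p = a\<^sup>2 + v \<bullet> v"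
        by (simp_all add: shift_def X power2_eq_square algebra_simps)
      moreover have "0 \<le> z\<^sup>2 * a\<^sup>2 + v \<bullet> v" by simp
      ultimately show "norm (shift z X p \<bullet> shift z X p) \<le> norm ((z\<^sup>2 + 1) * (X p \<bullet> X p))"
        by (simp only: real_norm_def)
    qed
  qed
  with m show ?thesis by (simp add: sq_int_def)
qed

lemma qform_commute: "qform z X Y = qform z Y X"
  by (simp add: qform_def ip_def shift_def inner_prod_def inner_commute algebra_simps)

lemma shift_linear: "shift z (\<lambda>p. a *\<^sub>R X p + b *\<^sub>R Y p) = (\<lambda>p. a *\<^sub>R shift z X p + b *\<^sub>R shift z Y p)"
  by (simp add: shift_def fun_eq_iff algebra_simps)

lemma qform_linear_left:
  assumes "sq_int (vol A g) X" "sq_int (vol A g) Y" "sq_int (vol A g) Z"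
  shows "qform z (\<lambda>p. a *\<^sub>R X p + b *\<^sub>R Y p) Z = a * qform z X Z + b * qform z Y Z"
  unfolding qform_def shift_linear
  by (simp add: ip_add_left ip_scaleR_left assms shift_sq_int sq_int_scaleR)

lemma qform_linear_right:
  assumes "sq_int (vol A g) X" "sq_int (vol A g) Y" "sq_int (vol A g) Z"
  shows "qform z Z (\<lambda>p. a *\<^sub>R X p + b *\<^sub>R Y p) = a * qform z Z X + b * qform z Z Y"
  using qform_linear_left[OF assms] qform_commute by metis

lemma qform_quadratic:
  assumes "sq_int (vol A g) X" "sq_int (vol A g) Y"
  shows "qform z (\<lambda>p. a *\<^sub>R X p + b *\<^sub>R Y p) (\<lambda>p. a *\<^sub>R X p + b *\<^sub>R Y p)
    = a\<^sup>2 * qform z X X + 2 * a * b * qform z X Y + b\<^sup>2 * qform z Y Y"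
  using assms by (simp add: qform_linear_left qform_linear_right sq_int_add sq_int_scaleR
      qform_commute[of z Y X] power2_eq_square algebra_simps)

lemma qform_jet:
  assumes "H1_differential A g f \<alpha>" "H1_differential A g h \<beta>"
  shows "qform z (jet f \<alpha>) (jet h \<beta>) = ip (vol A g) (frame \<alpha>) (frame \<beta>) - z * ip (vol A g) f h"
proof -
  have "qform z (jet f \<alpha>) (jet h \<beta>) = (LINT p|vol A g. frame \<alpha> p \<bullet> frame \<beta> p - z * (f p * h p))"
    unfolding qform_def ip_def by (rule Bochner_Integration.integral_cong) (auto simp: shift_def jet_def)
  also have "\<dots> = ip (vol A g) (frame \<alpha>) (frame \<beta>) - z * ip (vol A g) f h"
    using sq_int_inner[OF H1_differentialD(5)[OF assms(1)] H1_differentialD(5)[OF assms(2)]]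
      sq_int_inner[OF H1_differentialD(4)[OF assms(1)] H1_differentialD(4)[OF assms(2)]]
    by (simp add: ip_def)
  finally show ?thesis .
qed

lemma qform_tendsto:
  assumes "\<And>n. sq_int (vol A g) (X n)" "sq_int (vol A g) Y" "sq_int (vol A g) Z"
    and "(\<lambda>n. ip (vol A g) (\<lambda>p. Y p - X n p) (\<lambda>p. Y p - X n p)) \<longlonglongrightarrow> 0"
  shows "(\<lambda>n. qform z (X n) Z) \<longlonglongrightarrow> qform z Y Z"
proof -
  have "(\<lambda>n. qform z Z (X n)) \<longlonglongrightarrow> qform z Z Y"
    unfolding qform_def ip_commute[of _ "shift z Z"]
    by (rule ip_tendsto_left[OF assms(1,2) shift_sq_int[OF assms(3)] assms(4)])
  then show ?thesis by (simp only: qform_commute[of z Z])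
qed

text \<open>The form may be indefinite, so it is not treated as a norm. It is bounded by (1 + |z|)
  times the squared norm of the jet, hence tends to 0 on Y - X n, and expanding it there yields the
  limit.\<close>

lemma qform_tendsto_self:
  assumes "\<And>n. sq_int (vol A g) (X n)" "sq_int (vol A g) Y"
    and lim: "(\<lambda>n. ip (vol A g) (\<lambda>p. Y p - X n p) (\<lambda>p. Y p - X n p)) \<longlonglongrightarrow> 0"
  shows "(\<lambda>n. qform z (X n) (X n)) \<longlonglongrightarrow> qform z Y Y"
proof -
  let ?D = "\<lambda>n p. Y p - X n p"
  have sD: "sq_int (vol A g) (?D n)" for n by (intro sq_int_diff assms)
  have e: "qform z (?D n) (?D n) = qform z Y Y - 2 * qform z (X n) Y + qform z (X n) (X n)" for n
    using qform_quadratic[OF assms(2) assms(1)[of n], of z 1 "-1"] qform_commute[of z Y "X n"] by simp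
  have le: "\<bar>qform z (?D n) (?D n)\<bar> \<le> (1 + \<bar>z\<bar>) * ip (vol A g) (?D n) (?D n)" for n
  proof -
    have i: "integrable (vol A g) (\<lambda>p. ?D n p \<bullet> ?D n p)" using sD[of n] by (simp add: sq_int_def)
    have "\<bar>qform z (?D n) (?D n)\<bar> \<le> (LINT p|vol A g. \<bar>shift z (?D n) p \<bullet> ?D n p\<bar>)"
      unfolding qform_def ip_def by (rule integral_abs_bound)
    also have "\<dots> \<le> (LINT p|vol A g. (1 + \<bar>z\<bar>) * (?D n p \<bullet> ?D n p))"
    proof (rule integral_mono)
      show "integrable (vol A g) (\<lambda>p. \<bar>shift z (?D n) p \<bullet> ?D n p\<bar>)"
        using sq_int_inner[OF shift_sq_int[OF sD] sD, of z n n] by (rule integrable_abs)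
      show "integrable (vol A g) (\<lambda>p. (1 + \<bar>z\<bar>) * (?D n p \<bullet> ?D n p))" using i by simp
      fix p
      obtain a v where D: "?D n p = (a, v)" by (cases "?D n p")
      have "\<bar>- (z * a\<^sup>2) + v \<bullet> v\<bar> \<le> \<bar>z * a\<^sup>2\<bar> + \<bar>v \<bullet> v\<bar>" by (rule order_trans[OF abs_triangle_ineq]) simp
      also have "\<dots> = \<bar>z\<bar> * a\<^sup>2 + v \<bullet> v" by (simp add: abs_mult)
      also have "\<dots> \<le> (1 + \<bar>z\<bar>) * (a\<^sup>2 + v \<bullet> v)" by (simp add: algebra_simps)
      finally show "\<bar>shift z (?D n) p \<bullet> ?D n p\<bar> \<le> (1 + \<bar>z\<bar>) * (?D n p \<bullet> ?D n p)"
        unfolding shift_def D by (simp add: power2_eq_square mult.assoc)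
    qed
    also have "\<dots> = (1 + \<bar>z\<bar>) * ip (vol A g) (?D n) (?D n)" by (simp add: ip_def)
    finally show ?thesis .
  qed
  have D0: "(\<lambda>n. qform z (?D n) (?D n)) \<longlonglongrightarrow> 0"
  proof (rule Lim_null_comparison)
    show "(\<lambda>n. (1 + \<bar>z\<bar>) * ip (vol A g) (?D n) (?D n)) \<longlonglongrightarrow> 0" using tendsto_mult_right_zero[OF lim] by simp
  qed (use le in simp)
  have "(\<lambda>n. qform z (?D n) (?D n) - qform z Y Y + 2 * qform z (X n) Y) \<longlonglongrightarrow> 0 - qform z Y Y + 2 * qform z Y Y"
    by (intro tendsto_intros D0 qform_tendsto[OF assms(1,2,2) lim])
  then show ?thesis unfolding e by simp
qed

lemma energy_nonneg: "0 \<le> energy \<phi>" by (simp add: energy_def ip_nonneg)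

lemma test_qform:
  assumes "test_fun A \<phi>"
  shows "qform z (test_jet \<phi>) (test_jet \<phi>) = energy \<phi> - z * ip (vol A g) \<phi> \<phi>"
  using qform_jet[OF H1_differential_test[OF assms] H1_differential_test[OF assms]] by (simp add: energy_def)

lemma test_jet_norm:
  assumes "test_fun A \<phi>"
  shows "ip (vol A g) (test_jet \<phi>) (test_jet \<phi>) = energy \<phi> + ip (vol A g) \<phi> \<phi>"
  using ip_jet(3)[OF H1_differentialD(3) H1_differentialD(3) H1_differentialD(1) H1_differentialD(1) H1_differentialD(2) H1_differentialD(2),
      OF H1_differential_test[OF assms] H1_differential_test[OF assms] H1_differential_test[OF assms] H1_differential_test[OF assms]
         H1_differential_test[OF assms] H1_differential_test[OF assms]]
  by (simp add: energy_def)

lemma test_jet_add: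
  assumes "test_fun A \<phi>" "test_fun A \<psi>"
  shows "test_jet (\<lambda>p. a * \<phi> p + b * \<psi> p) = (\<lambda>p. a *\<^sub>R test_jet \<phi> p + b *\<^sub>R test_jet \<psi> p)"
  using test_jet_linear[of \<phi> \<psi> a b] assms by (auto simp: test_fun_def)

lemma qform_coercive:
  assumes "energy_gap m" "z < m"
  obtains \<theta> where "\<theta> > 0" "\<And>\<phi>. test_fun A \<phi> ==>
    \<theta> * ip (vol A g) (test_jet \<phi>) (test_jet \<phi>) \<le> qform z (test_jet \<phi>) (test_jet \<phi>)"
proof -
  \<comment> \<open>The requirement is \<theta> m + \<theta> \<le> m - z, obtained by bounding the
    share 1 - \<theta> of the energy below by the gap. The denominator |m| + 1 serves either sign of
    m, and \<theta> \<le> 1 keeps the share nonnegative.\<close>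
  define \<theta> where "\<theta> = min 1 ((m - z) / (\<bar>m\<bar> + 1))"
  have th: "\<theta> > 0" "\<theta> \<le> 1" using assms(2) by (auto simp: \<theta>_def)
  have "\<theta> * (\<bar>m\<bar> + 1) \<le> (m - z) / (\<bar>m\<bar> + 1) * (\<bar>m\<bar> + 1)"
    by (intro mult_right_mono) (auto simp: \<theta>_def)
  then have th2: "\<theta> * (\<bar>m\<bar> + 1) \<le> m - z" by simp
  have th3: "\<theta> * m + \<theta> \<le> m - z"
  proof -
    have "\<theta> * m \<le> \<theta> * \<bar>m\<bar>" using th by (intro mult_left_mono) auto
    then show ?thesis using th2 by (simp add: distrib_left)
  qed
  show ?thesis
  proof (rule that[OF th(1)])
    fix \<phi> assume t: "test_fun A \<phi>"
    let ?N = "ip (vol A g) \<phi> \<phi>" and ?E = "energy \<phi>"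
    have "m * ?N \<le> ?E" using assms(1) t by (simp add: energy_gap_def)
    then have "(1 - \<theta>) * (m * ?N) \<le> (1 - \<theta>) * ?E" using th by (intro mult_left_mono) auto
    moreover have "(\<theta> * m + \<theta>) * ?N \<le> (m - z) * ?N" using th3 by (intro mult_right_mono ip_nonneg)
    ultimately show "\<theta> * ip (vol A g) (test_jet \<phi>) (test_jet \<phi>) \<le> qform z (test_jet \<phi>) (test_jet \<phi>)"
      unfolding test_jet_norm[OF t] test_qform[OF t] by (simp add: algebra_simps)
  qed
qed

text \<open>The Riesz representation theorem for the form, proved by minimising
  \<open>q(\<phi>, \<phi>) - 2 \<integral> w \<phi>\<close> over the test functions.\<close>

lemma weak_solution_exists:
  assumes "energy_gap m" "z < m" "sq_int (vol A g) w"
  shows "\<exists>f \<omega>. H1_differential A g f \<omega> \<and>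
    (\<forall>\<eta>. test_fun A \<eta> \<longrightarrow> qform z (jet f \<omega>) (test_jet \<eta>) = ip (vol A g) w \<eta>)"
proof -
  let ?M = "vol A g"
  obtain \<theta> where \<theta>: "\<theta> > 0" "\<And>\<phi>. test_fun A \<phi> ==>
    \<theta> * ip ?M (test_jet \<phi>) (test_jet \<phi>) \<le> qform z (test_jet \<phi>) (test_jet \<phi>)"
    using qform_coercive[OF assms(1,2)] by blast
  define Q where "Q \<phi> \<psi> = qform z (test_jet \<phi>) (test_jet \<psi>)" for \<phi> \<psi>
  define J where "J \<phi> = Q \<phi> \<phi> - 2 * ip ?M w \<phi>" for \<phi>
  have sq: "sq_int ?M \<phi>" if "test_fun A \<phi>" for \<phi> using H1_differentialD(4)[OF H1_differential_test[OF that]] .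
  have Q_add: "Q (\<lambda>p. a * \<phi> p + b * \<psi> p) (\<lambda>p. a * \<phi> p + b * \<psi> p) = a\<^sup>2 * Q \<phi> \<phi> + 2 * a * b * Q \<phi> \<psi> + b\<^sup>2 * Q \<psi> \<psi>"
    if "test_fun A \<phi>" "test_fun A \<psi>" for a b \<phi> \<psi>
    unfolding Q_def test_jet_add[OF that] by (rule qform_quadratic) (intro test_jet_sq_int that)+
  have w_add: "ip ?M w (\<lambda>p. a * \<phi> p + b * \<psi> p) = a * ip ?M w \<phi> + b * ip ?M w \<psi>"
    if "test_fun A \<phi>" "test_fun A \<psi>" for a b \<phi> \<psi>
    using ip_add_right[OF sq_int_scaleR[OF sq[OF that(1)], of a] sq_int_scaleR[OF sq[OF that(2)], of b] assms(3)]
      ip_scaleR_right[of ?M w a \<phi>] ip_scaleR_right[of ?M w b \<psi>] by simp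
  \<comment> \<open>Completing the square: |\<theta> \<phi> - w|^2 \<ge> 0 together with coercivity
    bounds the functional below.\<close>
  have lower: "- ip ?M w w / \<theta> \<le> J \<phi>" if t: "test_fun A \<phi>" for \<phi>
  proof -
    have "0 \<le> ip ?M (\<lambda>p. \<theta> *\<^sub>R \<phi> p - w p) (\<lambda>p. \<theta> *\<^sub>R \<phi> p - w p)" by (rule ip_nonneg)
    also have "\<dots> = \<theta>\<^sup>2 * ip ?M \<phi> \<phi> - 2 * \<theta> * ip ?M w \<phi> + ip ?M w w"
      using sq[OF t] assms(3) by (simp add: ip_diff_left ip_diff_right ip_scaleR_left ip_scaleR_right sq_int_diff sq_int_scaleR
          ip_commute[of ?M \<phi> w] power2_eq_square algebra_simps del: real_scaleR_def)
    finally have "2 * \<theta> * ip ?M w \<phi> - ip ?M w w \<le> \<theta> * (\<theta> * ip ?M \<phi> \<phi>)" by (simp add: power2_eq_square mult.assoc)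
    also have "\<dots> \<le> \<theta> * Q \<phi> \<phi>"
    proof -
      have "\<theta> * ip ?M \<phi> \<phi> \<le> \<theta> * ip ?M (test_jet \<phi>) (test_jet \<phi>)"
        unfolding test_jet_norm[OF t] using \<theta>(1) energy_nonneg[of \<phi>] by (intro mult_left_mono) auto
      also have "\<dots> \<le> Q \<phi> \<phi>" unfolding Q_def by (rule \<theta>(2)[OF t])
      finally show ?thesis using \<theta>(1) by (intro mult_left_mono) auto
    qed
    finally have "- ip ?M w w \<le> \<theta> * J \<phi>" by (simp add: J_def algebra_simps)
    then show ?thesis using \<theta>(1) by (simp add: field_simps)
  qed
  define j where "j = Inf (J ` {\<phi>. test_fun A \<phi>})"
  have bdd: "bdd_below (J ` {\<phi>. test_fun A \<phi>})" using lower by (auto intro!: bdd_belowI)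
  have jle: "j \<le> J \<phi>" if "test_fun A \<phi>" for \<phi> unfolding j_def using that by (intro cInf_lower bdd) auto
  have "\<exists>\<phi>. test_fun A \<phi> \<and> J \<phi> < j + 1 / real (Suc n)" for n
    using cInf_lessD[of "J ` {\<phi>. test_fun A \<phi>}" "j + 1 / real (Suc n)"] test_fun_zero unfolding j_def by auto
  then obtain \<phi> where \<phi>: "\<And>n. test_fun A (\<phi> n)" "\<And>n. J (\<phi> n) < j + 1 / real (Suc n)" by metis
  \<comment> \<open>Parallelogram law for the form: the midpoint of two almost minimisers cannot go
    below the infimum j, so they are close, and coercivity measures this in the norm of
    jets.\<close>
  have par: "\<theta> * ip ?M (\<lambda>p. test_jet (\<phi> m) p - test_jet (\<phi> n) p) (\<lambda>p. test_jet (\<phi> m) p - test_jet (\<phi> n) p)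
     \<le> 2 / real (Suc m) + 2 / real (Suc n)" for m n
  proof -
    have "j \<le> J (\<lambda>p. 1/2 * \<phi> m p + 1/2 * \<phi> n p)" by (intro jle test_fun_add \<phi>)
    then have "4 * j \<le> Q (\<phi> m) (\<phi> m) + 2 * Q (\<phi> m) (\<phi> n) + Q (\<phi> n) (\<phi> n) - 4 * ip ?M w (\<phi> m) - 4 * ip ?M w (\<phi> n)"
      unfolding J_def Q_add[OF \<phi>(1) \<phi>(1)] w_add[OF \<phi>(1) \<phi>(1)] by (simp add: power2_eq_square)
    moreover have "Q (\<lambda>p. 1 * \<phi> m p + (-1) * \<phi> n p) (\<lambda>p. 1 * \<phi> m p + (-1) * \<phi> n p)
        = Q (\<phi> m) (\<phi> m) - 2 * Q (\<phi> m) (\<phi> n) + Q (\<phi> n) (\<phi> n)"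
      unfolding Q_add[OF \<phi>(1) \<phi>(1)] by simp
    ultimately have "Q (\<lambda>p. 1 * \<phi> m p + (-1) * \<phi> n p) (\<lambda>p. 1 * \<phi> m p + (-1) * \<phi> n p)
        \<le> 2 * (J (\<phi> m) - j) + 2 * (J (\<phi> n) - j)" by (simp add: J_def)
    also have "\<dots> \<le> 2 * (1 / real (Suc m)) + 2 * (1 / real (Suc n))"
      using \<phi>(2)[of m] \<phi>(2)[of n] by (intro add_mono mult_left_mono) linarith+
    finally have "Q (\<lambda>p. 1 * \<phi> m p + (-1) * \<phi> n p) (\<lambda>p. 1 * \<phi> m p + (-1) * \<phi> n p) \<le> 2 / real (Suc m) + 2 / real (Suc n)" by simp
    moreover have "\<theta> * ip ?M (test_jet (\<lambda>p. 1 * \<phi> m p + (-1) * \<phi> n p)) (test_jet (\<lambda>p. 1 * \<phi> m p + (-1) * \<phi> n p))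
      \<le> Q (\<lambda>p. 1 * \<phi> m p + (-1) * \<phi> n p) (\<lambda>p. 1 * \<phi> m p + (-1) * \<phi> n p)"
      unfolding Q_def by (intro \<theta>(2) test_fun_add \<phi>)
    moreover have "test_jet (\<lambda>p. 1 * \<phi> m p + (-1) * \<phi> n p) = (\<lambda>p. test_jet (\<phi> m) p - test_jet (\<phi> n) p)"
      unfolding test_jet_add[OF \<phi>(1) \<phi>(1)] by simp
    ultimately show ?thesis by simp
  qed
  have "\<exists>N. \<forall>m\<ge>N. \<forall>n\<ge>N. ip ?M (\<lambda>p. test_jet (\<phi> m) p - test_jet (\<phi> n) p) (\<lambda>p. test_jet (\<phi> m) p - test_jet (\<phi> n) p) < e"
    if "e > 0" for e
  proof -
    obtain N where N: "1 / real (Suc N) < \<theta> * e / 4"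
      using reals_Archimedean[of "\<theta> * e / 4"] \<theta>(1) \<open>e > 0\<close> by (auto simp: inverse_eq_divide)
    show ?thesis
    proof (intro exI[of _ N] allI impI)
      fix m n assume "N \<le> m" "N \<le> n"
      then have "1 / real (Suc m) \<le> 1 / real (Suc N)" "1 / real (Suc n) \<le> 1 / real (Suc N)" by (simp_all add: frac_le)
      then have "\<theta> * ip ?M (\<lambda>p. test_jet (\<phi> m) p - test_jet (\<phi> n) p) (\<lambda>p. test_jet (\<phi> m) p - test_jet (\<phi> n) p) < \<theta> * e"
      proof -
        have "\<theta> * ip ?M (\<lambda>p. test_jet (\<phi> m) p - test_jet (\<phi> n) p) (\<lambda>p. test_jet (\<phi> m) p - test_jet (\<phi> n) p)
          \<le> 2 * (1 / real (Suc m)) + 2 * (1 / real (Suc n))" using par[of m n] by simp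
        with N \<open>1 / real (Suc m) \<le> _\<close> \<open>1 / real (Suc n) \<le> _\<close> show ?thesis by linarith
      qed
      then show "ip ?M (\<lambda>p. test_jet (\<phi> m) p - test_jet (\<phi> n) p) (\<lambda>p. test_jet (\<phi> m) p - test_jet (\<phi> n) p) < e"
        using \<theta>(1) by simp
    qed
  qed
  from H1_complete[OF \<phi>(1) this] obtain f \<omega> where f: "H1_differential A g f \<omega>"
    "(\<lambda>n. ip ?M (\<lambda>p. jet f \<omega> p - test_jet (\<phi> n) p) (\<lambda>p. jet f \<omega> p - test_jet (\<phi> n) p)) \<longlonglongrightarrow> 0" by blast
  have "qform z (jet f \<omega>) (test_jet \<eta>) = ip ?M w \<eta>" if \<eta>: "test_fun A \<eta>" for \<eta>
  proof -
    have lim: "(\<lambda>n. Q (\<phi> n) \<eta>) \<longlonglongrightarrow> qform z (jet f \<omega>) (test_jet \<eta>)"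
      unfolding Q_def by (rule qform_tendsto[OF test_jet_sq_int[OF \<phi>(1)] H1_differentialD(3)[OF f(1)] test_jet_sq_int[OF \<eta>] f(2)])
    \<comment> \<open>Perturbing an almost minimiser by t \<eta> cannot bring J below j. In the
      limit the constant term of this quadratic in t vanishes, and then so does its linear
      coefficient.\<close>
    have "0 \<le> 0 + 2 * (qform z (jet f \<omega>) (test_jet \<eta>) - ip ?M w \<eta>) * t + Q \<eta> \<eta> * t\<^sup>2" for t
    proof -
      have "0 \<le> 1 / real (Suc n) + 2 * (Q (\<phi> n) \<eta> - ip ?M w \<eta>) * t + Q \<eta> \<eta> * t\<^sup>2" for n
      proof -
        have "j \<le> J (\<lambda>p. 1 * \<phi> n p + t * \<eta> p)" by (intro jle test_fun_add \<phi> \<eta>)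
        also have "\<dots> = J (\<phi> n) + 2 * (Q (\<phi> n) \<eta> - ip ?M w \<eta>) * t + Q \<eta> \<eta> * t\<^sup>2"
          unfolding J_def Q_add[OF \<phi>(1) \<eta>] w_add[OF \<phi>(1) \<eta>] by (simp add: algebra_simps)
        finally show ?thesis using \<phi>(2)[of n] by linarith
      qed
      moreover have "(\<lambda>n. 1 / real (Suc n) + 2 * (Q (\<phi> n) \<eta> - ip ?M w \<eta>) * t + Q \<eta> \<eta> * t\<^sup>2)
         \<longlonglongrightarrow> 0 + 2 * (qform z (jet f \<omega>) (test_jet \<eta>) - ip ?M w \<eta>) * t + Q \<eta> \<eta> * t\<^sup>2"
        by (intro tendsto_add tendsto_mult tendsto_diff tendsto_const lim LIMSEQ_Suc[OF lim_1_over_n])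
      ultimately show ?thesis by (intro LIMSEQ_le_const) auto
    qed
    from nonneg_quadratic_discriminant[OF this] show ?thesis by simp
  qed
  then show ?thesis using f(1) by blast
qed

section \<open>Resolvent, spectrum and spectral gap\<close>

lemma L2_iff_sq_int: "f \<in> L2 A g \<longleftrightarrow> sq_int (vol A g) f"
  by (simp add: L2_def sq_int_def power2_eq_square)

lemma laplacian_iff:
  "laplacian A g f h \<longleftrightarrow> f \<in> H1 A g \<and> sq_int (vol A g) h \<and>
    (\<forall>\<phi>. test_fun A \<phi> \<longrightarrow> ip (vol A g) (frame (weak_differential A g f)) (frame (differential \<phi>)) = ip (vol A g) h \<phi>)"
proof (cases "f \<in> H1 A g")
  case True
  have "(LINT p|vol A g. covector_inner A g (weak_differential A g f) (differential \<phi>) p)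
     = ip (vol A g) (frame (weak_differential A g f)) (frame (differential \<phi>))" if "test_fun A \<phi>" for \<phi>
    unfolding ip_def using H1_differentialD(2)[OF weak_differential[OF True]]
      covector_field_differential[of \<phi>] that by (simp add: covector_inner_frame test_fun_def)
  then show ?thesis using True by (auto simp: laplacian_def L2_iff_sq_int ip_def)
qed (simp add: laplacian_def)

text \<open>The equation in \<open>laplacian\<close> is tested by test functions only. Approximating
  f by them in H1 extends it to f itself, and presents every quantity as a limit over test
  functions, to which a gap applies.\<close>

lemma laplacian_approximation:
  assumes lap: "laplacian A g f h"
  shows "\<exists>\<phi>. (\<forall>n. test_fun A (\<phi> n)) \<and>
    (\<lambda>n. ip (vol A g) (\<phi> n) (\<phi> n)) \<longlonglongrightarrow> ip (vol A g) f f \<and>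
    (\<lambda>n. qform z (test_jet (\<phi> n)) (test_jet (\<phi> n))) \<longlonglongrightarrow> ip (vol A g) (\<lambda>p. h p - z * f p) f \<and>
    (\<forall>v. test_fun A v \<longrightarrow> (\<lambda>n. qform z (test_jet (\<phi> n)) (test_jet v)) \<longlonglongrightarrow> ip (vol A g) (\<lambda>p. h p - z * f p) v)"
proof -
  let ?M = "vol A g"
  have fH: "f \<in> H1 A g" and h: "sq_int ?M h" using lap by (auto simp: laplacian_iff)
  note wd = weak_differential[OF fH]
  note F = H1_differentialD[OF wd]
  obtain \<phi> where \<phi>: "\<And>n. test_fun A (\<phi> n)"
    "(\<lambda>n. ip ?M (\<lambda>p. jet f (weak_differential A g f) p - test_jet (\<phi> n) p) (\<lambda>p. jet f (weak_differential A g f) p - test_jet (\<phi> n) p)) \<longlonglongrightarrow> 0"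
    using wd unfolding H1_differential_iff by blast
  let ?F = "jet f (weak_differential A g f)" and ?r = "\<lambda>p. h p - z * f p"
  have szf: "sq_int ?M (\<lambda>p. z * f p)" using sq_int_scaleR[OF F(4), of z] by simp
  have r: "sq_int ?M ?r" by (intro sq_int_diff h szf)
  have f0: "(\<lambda>n. ip ?M (\<lambda>p. f p - \<phi> n p) (\<lambda>p. f p - \<phi> n p)) \<longlonglongrightarrow> 0"
  proof (rule Lim_null_comparison[OF _ \<phi>(2)], rule always_eventually, rule allI)
    fix n
    have "sq_int ?M (\<lambda>p. ?F p - test_jet (\<phi> n) p)" by (intro sq_int_diff F test_jet_sq_int \<phi>)
    then have i1: "integrable ?M (\<lambda>p. (?F p - test_jet (\<phi> n) p) \<bullet> (?F p - test_jet (\<phi> n) p))" by (simp add: sq_int_def)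
    have "sq_int ?M (\<lambda>p. f p - \<phi> n p)" by (intro sq_int_diff F H1_differentialD(4)[OF H1_differential_test] \<phi>)
    then have i2: "integrable ?M (\<lambda>p. (f p - \<phi> n p) \<bullet> (f p - \<phi> n p))" by (simp add: sq_int_def)
    have "ip ?M (\<lambda>p. f p - \<phi> n p) (\<lambda>p. f p - \<phi> n p) \<le> ip ?M (\<lambda>p. ?F p - test_jet (\<phi> n) p) (\<lambda>p. ?F p - test_jet (\<phi> n) p)"
      unfolding ip_def by (rule integral_mono[OF i2 i1]) (simp add: jet_def)
    then show "norm (ip ?M (\<lambda>p. f p - \<phi> n p) (\<lambda>p. f p - \<phi> n p)) \<le> ip ?M (\<lambda>p. ?F p - test_jet (\<phi> n) p) (\<lambda>p. ?F p - test_jet (\<phi> n) p)"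
      by (simp add: ip_nonneg)
  qed
  have q: "qform z ?F (test_jet v) = ip ?M ?r v" if "test_fun A v" for v
    using lap qform_jet[OF wd H1_differential_test[OF that], of z] that
      ip_diff_left[OF h szf H1_differentialD(4)[OF H1_differential_test[OF that]]] ip_scaleR_left[of ?M z f v]
    by (simp add: laplacian_iff)
  have l1: "(\<lambda>n. ip ?M ?r (\<phi> n)) \<longlonglongrightarrow> ip ?M ?r f"
    using ip_tendsto_left[OF H1_differentialD(4)[OF H1_differential_test[OF \<phi>(1)]] F(4) r f0] by (simp add: ip_commute[of _ ?r])
  have l2: "(\<lambda>n. qform z ?F (test_jet (\<phi> n))) \<longlonglongrightarrow> qform z ?F ?F"
    unfolding qform_commute[of z ?F "test_jet _"]
    by (rule qform_tendsto[OF test_jet_sq_int[OF \<phi>(1)] F(3,3) \<phi>(2)])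
  have qF: "qform z ?F ?F = ip ?M ?r f" using LIMSEQ_unique[OF l2[unfolded q[OF \<phi>(1)]] l1] .
  show ?thesis
  proof (intro exI[of _ \<phi>] conjI allI impI \<phi>(1))
    show "(\<lambda>n. ip ?M (\<phi> n) (\<phi> n)) \<longlonglongrightarrow> ip ?M f f"
      by (rule ip_tendsto_self[OF H1_differentialD(4)[OF H1_differential_test[OF \<phi>(1)]] F(4) f0])
    show "(\<lambda>n. qform z (test_jet (\<phi> n)) (test_jet (\<phi> n))) \<longlonglongrightarrow> ip ?M ?r f"
      using qform_tendsto_self[OF test_jet_sq_int[OF \<phi>(1)] F(3) \<phi>(2), of z] by (simp only: qF)
    show "(\<lambda>n. qform z (test_jet (\<phi> n)) (test_jet v)) \<longlonglongrightarrow> ip ?M ?r v" if v: "test_fun A v" for v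
      using qform_tendsto[OF test_jet_sq_int[OF \<phi>(1)] F(3) test_jet_sq_int[OF v] \<phi>(2), of z] by (simp only: q[OF v])
  qed
qed

text \<open>Surjectivity comes from \<open>weak_solution_exists\<close>. With r = (Delta - z) f, the
  gap and Cauchy-Schwarz give (m - z) |f|^2 \<le> <r, f> \<le> |r| |f|, which bounds the inverse by
  1 / (m - z).\<close>

lemma not_in_spectrum_if_gap:
  assumes "energy_gap m" "z < m" shows "z \<notin> L2_spectrum A g"
proof -
  let ?M = "vol A g"
  have ex: "\<exists>f. laplacian A g f (\<lambda>p. w p + z * f p)" if "w \<in> L2 A g" for w
  proof -
    have w: "sq_int ?M w" using that by (simp add: L2_iff_sq_int)
    obtain f \<omega> where f: "H1_differential A g f \<omega>"
      "\<And>\<eta>. test_fun A \<eta> ==> qform z (jet f \<omega>) (test_jet \<eta>) = ip ?M w \<eta>"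
      using weak_solution_exists[OF assms w] by blast
    have fH: "f \<in> H1 A g" using f(1) by (auto simp: H1_def)
    note wd = weak_differential[OF fH]
    note sf = H1_differentialD(4)[OF f(1)]
    have szf: "sq_int ?M (\<lambda>p. z * f p)" using sq_int_scaleR[OF sf, of z] by simp
    have "laplacian A g f (\<lambda>p. w p + z * f p)" unfolding laplacian_iff
    proof (intro conjI allI impI fH)
      show "sq_int ?M (\<lambda>p. w p + z * f p)" by (intro sq_int_add w szf)
      fix \<eta> assume \<eta>: "test_fun A \<eta>"
      note e = H1_differential_test[OF \<eta>]
      \<comment> \<open>\<open>laplacian\<close> refers to the chosen weak differential, whereas the
        solution comes with \<omega>; uniqueness identifies them.\<close>
      have ae: "AE p in ?M. frame (weak_differential A g f) p \<bullet> frame (differential \<eta>) p = frame \<omega> p \<bullet> frame (differential \<eta>) p"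
        using H1_differential_unique[OF wd f(1)] by (rule AE_mp) (auto intro!: AE_I2)
      have meas: "(\<lambda>p. frame \<alpha> p \<bullet> frame (differential \<eta>) p) \<in> borel_measurable ?M" if "covector_field A \<alpha>" for \<alpha>
        unfolding borel_measurable_vol using measurable_frame[OF that] measurable_frame[OF H1_differentialD(2)[OF e]] by measurable
      have "ip ?M (frame (weak_differential A g f)) (frame (differential \<eta>)) = ip ?M (frame \<omega>) (frame (differential \<eta>))"
        unfolding ip_def
        by (intro integral_cong_AE ae meas H1_differentialD(2)[OF wd] H1_differentialD(2)[OF f(1)])
      also have "\<dots> = ip ?M w \<eta> + z * ip ?M f \<eta>"
        using f(2)[OF \<eta>] qform_jet[OF f(1) e] by simp
      also have "\<dots> = ip ?M (\<lambda>p. w p + z * f p) \<eta>"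
        using ip_add_left[OF w szf H1_differentialD(4)[OF e]] ip_scaleR_left[of ?M z f \<eta>] by simp
      finally show "ip ?M (frame (weak_differential A g f)) (frame (differential \<eta>)) = ip ?M (\<lambda>p. w p + z * f p) \<eta>" .
    qed
    then show ?thesis by blast
  qed
  have bdd: "(LINT p|?M. (f p)\<^sup>2) \<le> 1 / (m - z)\<^sup>2 * (LINT p|?M. (h p - z * f p)\<^sup>2)" if lap: "laplacian A g f h" for f h
  proof -
    let ?r = "\<lambda>p. h p - z * f p"
    obtain \<phi> where \<phi>: "\<And>n. test_fun A (\<phi> n)" "(\<lambda>n. ip ?M (\<phi> n) (\<phi> n)) \<longlonglongrightarrow> ip ?M f f"
      "(\<lambda>n. qform z (test_jet (\<phi> n)) (test_jet (\<phi> n))) \<longlonglongrightarrow> ip ?M ?r f"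
      using laplacian_approximation[OF lap, of z] by blast
    have sf: "sq_int ?M f" and h: "sq_int ?M h"
      using lap H1_differentialD(4)[OF weak_differential] by (auto simp: laplacian_iff)
    have r: "sq_int ?M ?r" using sq_int_diff[OF h sq_int_scaleR[OF sf, of z]] by simp
    have le: "(m - z) * ip ?M f f \<le> ip ?M ?r f"
    proof (rule LIMSEQ_le)
      show "(\<lambda>n. (m - z) * ip ?M (\<phi> n) (\<phi> n)) \<longlonglongrightarrow> (m - z) * ip ?M f f"
        by (rule tendsto_mult[OF tendsto_const \<phi>(2)])
      show "\<exists>N. \<forall>n\<ge>N. (m - z) * ip ?M (\<phi> n) (\<phi> n) \<le> qform z (test_jet (\<phi> n)) (test_jet (\<phi> n))"
        using assms(1) \<phi>(1) by (auto simp: energy_gap_def test_qform algebra_simps)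
    qed (rule \<phi>(3))
    let ?a = "ip ?M f f" and ?b = "ip ?M ?r ?r"
    have "((m - z) * ?a)\<^sup>2 \<le> (ip ?M ?r f)\<^sup>2"
      using le assms(2) by (intro power_mono) (auto simp: ip_nonneg)
    also have "\<dots> \<le> ?b * ?a" by (rule ip_Cauchy_Schwarz[OF r sf])
    finally have "((m - z)\<^sup>2 * ?a) * ?a \<le> ?b * ?a" by (simp add: power2_eq_square algebra_simps)
    then have "(m - z)\<^sup>2 * ?a \<le> ?b"
      using ip_nonneg[of ?M f] ip_nonneg[of ?M ?r] by (cases "?a = 0") auto
    then have "?a \<le> 1 / (m - z)\<^sup>2 * ?b" using assms(2) by (simp add: field_simps)
    then show ?thesis by (simp add: ip_def power2_eq_square)
  qed
  show ?thesis
    unfolding L2_spectrum_def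
    by (simp only: mem_Collect_eq not_not) (intro conjI ballI exI[of _ "1 / (m - z)\<^sup>2"] allI impI ex bdd)
qed

lemma energy_gap_zero: "energy_gap 0"
  by (simp add: energy_gap_def energy_nonneg)

lemma energy_gap_mono: "energy_gap m ==> m' \<le> m ==> energy_gap m'"
  unfolding energy_gap_def by (meson ip_nonneg mult_right_mono order_trans)

text \<open>If \<open>\<mu>\<close> is a gap outside the spectrum, solving \<open>(\<Delta> - \<mu>) f = v\<close> and the Cauchy-Schwarz
  inequality for the semidefinite form of \<open>\<Delta> - \<mu>\<close> bound that form from below at \<open>v\<close>.\<close>

lemma energy_gap_improve:
  assumes gap: "energy_gap \<mu>" and "\<mu> \<notin> L2_spectrum A g"
  shows "\<exists>\<mu>'>\<mu>. energy_gap \<mu>'"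
proof -
  let ?M = "vol A g"
  obtain b0 where ex: "\<And>w. w \<in> L2 A g ==> \<exists>f. laplacian A g f (\<lambda>p. w p + \<mu> * f p)"
    and b0: "\<And>f h. laplacian A g f h ==> (LINT p|?M. (f p)\<^sup>2) \<le> b0 * (LINT p|?M. (h p - \<mu> * f p)\<^sup>2)"
    using assms(2) unfolding L2_spectrum_def by auto
  \<comment> \<open>The constant b0 may be any real number; b is positive and still a bound.\<close>
  define b where "b = \<bar>b0\<bar> + 1"
  have b: "b > 0" by (simp add: b_def)
  have "energy_gap (\<mu> + 1 / sqrt b)" unfolding energy_gap_def
  proof (intro allI impI)
    fix v assume v: "test_fun A v"
    have sv: "sq_int ?M v" by (rule H1_differentialD(4)[OF H1_differential_test[OF v]])
    let ?N = "ip ?M v v"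
    obtain f where f: "laplacian A g f (\<lambda>p. v p + \<mu> * f p)" using ex[of v] sv by (auto simp: L2_iff_sq_int)
    have sf: "sq_int ?M f" using f H1_differentialD(4)[OF weak_differential] by (auto simp: laplacian_iff)
    obtain \<phi> where \<phi>: "\<And>n. test_fun A (\<phi> n)"
      "(\<lambda>n. qform \<mu> (test_jet (\<phi> n)) (test_jet (\<phi> n))) \<longlonglongrightarrow> ip ?M v f"
      "(\<lambda>n. qform \<mu> (test_jet (\<phi> n)) (test_jet v)) \<longlonglongrightarrow> ?N"
      using laplacian_approximation[OF f, of \<mu>] v by auto
    let ?q = "qform \<mu> (test_jet v) (test_jet v)"
    have CS: "(qform \<mu> (test_jet (\<phi> n)) (test_jet v))\<^sup>2 \<le> qform \<mu> (test_jet (\<phi> n)) (test_jet (\<phi> n)) * ?q" for n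
    proof (rule nonneg_quadratic_discriminant)
      fix t
      have "0 \<le> qform \<mu> (test_jet (\<lambda>p. 1 * \<phi> n p + t * v p)) (test_jet (\<lambda>p. 1 * \<phi> n p + t * v p))"
        using gap test_fun_add[OF \<phi>(1)[of n] v, of 1 t] by (simp add: energy_gap_def test_qform)
      also have "\<dots> = qform \<mu> (test_jet (\<phi> n)) (test_jet (\<phi> n)) + 2 * qform \<mu> (test_jet (\<phi> n)) (test_jet v) * t + ?q * t\<^sup>2"
        unfolding test_jet_add[OF \<phi>(1) v] qform_quadratic[OF test_jet_sq_int[OF \<phi>(1)] test_jet_sq_int[OF v]]
        by (simp add: algebra_simps)
      finally show "0 \<le> qform \<mu> (test_jet (\<phi> n)) (test_jet (\<phi> n)) + 2 * qform \<mu> (test_jet (\<phi> n)) (test_jet v) * t + ?q * t\<^sup>2" .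
    qed
    \<comment> \<open>Here f is the preimage of v, so this reads |v|^4 \<le> <v, f> q(v). Once <v,
      f> \<le> sqrt b |v|^2 is known, dividing by |v|^2 leaves |v|^2 \<le> sqrt b q(v), which is the
      enlarged gap.\<close>
    have N2: "?N\<^sup>2 \<le> ip ?M v f * ?q"
      by (rule LIMSEQ_le[OF tendsto_power[OF \<phi>(3)] tendsto_mult[OF \<phi>(2) tendsto_const]]) (use CS in blast)
    have q0: "0 \<le> ?q" using gap v by (simp add: energy_gap_def test_qform)
    have "ip ?M f f \<le> b0 * ?N" using b0[OF f] by (simp add: ip_def power2_eq_square)
    also have "\<dots> \<le> b * ?N" by (intro mult_right_mono ip_nonneg) (simp add: b_def)
    finally have "(ip ?M v f)\<^sup>2 \<le> ?N * (b * ?N)"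
      using ip_Cauchy_Schwarz[OF sv sf] mult_left_mono[OF _ ip_nonneg[of ?M v], of "ip ?M f f" "b * ?N"] by linarith
    moreover have "(sqrt b * ?N)\<^sup>2 = ?N * (b * ?N)"
      using b by (simp add: power_mult_distrib) (simp add: power2_eq_square)
    ultimately have "(ip ?M v f)\<^sup>2 \<le> (sqrt b * ?N)\<^sup>2" by simp
    then have "ip ?M v f \<le> sqrt b * ?N" by (rule power2_le_imp_le) (use b in \<open>simp add: ip_nonneg\<close>)
    then have "?N\<^sup>2 \<le> sqrt b * ?N * ?q" using N2 q0 mult_right_mono[of "ip ?M v f" "sqrt b * ?N" ?q] by linarith
    then have "?N * ?N \<le> ?N * (sqrt b * ?q)" by (simp add: power2_eq_square algebra_simps)
    then have "?N \<le> sqrt b * ?q" using ip_nonneg[of ?M v] q0 b by (cases "?N = 0") auto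
    then have "1 / sqrt b * ?N \<le> ?q" using b by (simp add: field_simps)
    then show "(\<mu> + 1 / sqrt b) * ?N \<le> energy v" by (simp add: test_qform[OF v] algebra_simps)
  qed
  moreover have "\<mu> < \<mu> + 1 / sqrt b" using b by simp
  ultimately show ?thesis by blast
qed

text \<open>Gaps are closed downwards, so if m were none, all gaps would lie below m. Their supremum
  is itself a gap, hence below m and outside the spectrum, and \<open>energy_gap_improve\<close>
  produces a still larger one.\<close>

lemma energy_gap_if_spectrum_ge:
  assumes "\<And>z. z \<in> L2_spectrum A g ==> m \<le> z" shows "energy_gap m"
proof (rule ccontr)
  assume not: "\<not> energy_gap m"
  let ?S = "{t. energy_gap t}"
  have lt: "t < m" if "energy_gap t" for t using energy_gap_mono[OF that, of m] not by fastforce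
  have bdd: "bdd_above ?S" using lt by (auto intro!: bdd_aboveI less_imp_le)
  define \<mu> where "\<mu> = Sup ?S"
  have "energy_gap \<mu>" unfolding energy_gap_def
  proof (intro allI impI)
    fix \<phi> assume \<phi>: "test_fun A \<phi>"
    show "\<mu> * ip (vol A g) \<phi> \<phi> \<le> energy \<phi>"
    proof (cases "ip (vol A g) \<phi> \<phi> = 0")
      case False
      then have pos: "ip (vol A g) \<phi> \<phi> > 0" using ip_nonneg[of "vol A g" \<phi>] by simp
      have "\<mu> \<le> energy \<phi> / ip (vol A g) \<phi> \<phi>" unfolding \<mu>_def
      proof (rule cSup_least)
        show "?S \<noteq> {}" using energy_gap_zero by blast
        show "t \<le> energy \<phi> / ip (vol A g) \<phi> \<phi>" if "t \<in> ?S" for t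
          using that \<phi> pos by (simp add: energy_gap_def field_simps)
      qed
      then show ?thesis using pos by (simp add: field_simps)
    qed (simp add: energy_nonneg)
  qed
  moreover have "\<mu> \<notin> L2_spectrum A g" using lt[OF \<open>energy_gap \<mu>\<close>] assms by fastforce
  ultimately obtain \<mu>' where "\<mu>' > \<mu>" "energy_gap \<mu>'" using energy_gap_improve by blast
  then show False using cSup_upper[OF _ bdd, of \<mu>'] by (simp add: \<mu>_def)
qed

text \<open>Replaces the spectrum of an operator by an inequality on test functions, in which a
  conformal change can be followed directly.\<close>

lemma spectrum_bottom_ge_iff: "ereal m \<le> spectrum_bottom A g \<longleftrightarrow> energy_gap m"
proof
  assume "ereal m \<le> spectrum_bottom A g"
  then have "m \<le> z" if "z \<in> L2_spectrum A g" for z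
    using that unfolding spectrum_bottom_def by (meson INF_lower ereal_less_eq(3) order_trans)
  then show "energy_gap m" by (rule energy_gap_if_spectrum_ge)
next
  assume "energy_gap m"
  then have "m \<le> z" if "z \<in> L2_spectrum A g" for z
    using not_in_spectrum_if_gap[of m z] that by force
  then show "ereal m \<le> spectrum_bottom A g" unfolding spectrum_bottom_def by (intro INF_greatest) simp
qed

end

section \<open>Comparison of the bottoms of the spectra\<close>

context conformal_pair begin

lemma energy_gap_compare:
  assumes "H.energy_gap m" "m \<ge> 0" "K > 0" "\<And>p. exp (2 * u p) \<le> K"
  shows "G.energy_gap (m / K)"
  unfolding G.energy_gap_def
proof (intro allI impI)
  fix \<phi> assume \<phi>: "test_fun A \<phi>"
  have d: "covector_field A (differential \<phi>)" using \<phi> by (simp add: G.covector_field_differential test_fun_def)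
  have E: "G.energy \<phi> = H.energy \<phi>"
    using energy_eq[OF d d] unfolding G.energy_def H.energy_def ip_def
    by (simp add: G.covector_inner_frame[OF d d] H.covector_inner_frame[OF d d])
  note dg = G.H1_differentialD[OF G.H1_differential_test[OF \<phi>]] and dh = H.H1_differentialD[OF H.H1_differential_test[OF \<phi>]]
  have "ip (vol A g) \<phi> \<phi> \<le> K * ip (vol A h) \<phi> \<phi>"
    using L2_norm_le[OF dg(1) _ _ assms(4)] dg(4) dh(4) by (simp add: sq_int_def ip_def power2_eq_square)
  then have "m / K * ip (vol A g) \<phi> \<phi> \<le> m / K * (K * ip (vol A h) \<phi> \<phi>)"
    using assms by (intro mult_left_mono) auto
  also have "\<dots> \<le> H.energy \<phi>" using assms \<phi> by (simp add: H.energy_gap_def)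
  finally show "m / K * ip (vol A g) \<phi> \<phi> \<le> G.energy \<phi>" by (simp add: E)
qed

lemma spectrum_bottom_compare:
  assumes "K > 0" "\<And>p. exp (2 * u p) \<le> K"
  shows "ereal (1 / K) * spectrum_bottom A h \<le> spectrum_bottom A g"
proof -
  have h0: "0 \<le> spectrum_bottom A h" using H.spectrum_bottom_ge_iff[of 0] H.energy_gap_zero by (simp add: zero_ereal_def)
  have *: "ereal (m / K) \<le> spectrum_bottom A g" if "ereal m \<le> spectrum_bottom A h" "m \<ge> 0" for m
    using that energy_gap_compare[of m K] assms H.spectrum_bottom_ge_iff G.spectrum_bottom_ge_iff by blast
  show ?thesis
  proof (cases "spectrum_bottom A h")
    case (real r)
    then show ?thesis using *[of r] h0 by simp
  next
    case PInf
    \<comment> \<open>An infinite bottom, the infimum of an empty spectrum, makes every m a gap for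
      h; the bound B is reached from m = max B 0 * K.\<close>
    have "spectrum_bottom A g = \<infinity>"
    proof (rule ereal_top)
      fix B
      have "ereal (max B 0 * K / K) \<le> spectrum_bottom A g" by (rule *) (use PInf assms in auto)
      then show "ereal B \<le> spectrum_bottom A g" using assms(1) by (auto intro: order_trans[rotated])
    qed
    then show ?thesis by simp
  next
    case MInf
    then show ?thesis using h0 by simp
  qed
qed

end

section \<open>Metrics lifted to a covering surface\<close>

lemma matrix_mult_scaleR_left: "(x *\<^sub>R M) ** N = x *\<^sub>R (M ** (N :: real^'n^'n))"
  using matrix_mult_scaleR[of x M 1 N] by simp

lemma matrix_mult_scaleR_right: "M ** (x *\<^sub>R N) = x *\<^sub>R (M ** (N :: real^'n^'n))"
  using matrix_mult_scaleR[of 1 M x N] by simp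

lemma continuous_on_matrixI:
  fixes f :: "'a::topological_space \<Rightarrow> real^2^2"
  assumes "\<And>i j. continuous_on S (\<lambda>x. f x $ i $ j)" shows "continuous_on S f"
proof -
  have "continuous_on S (\<lambda>x. \<chi> i. f x $ i)"
  proof (rule continuous_on_vec_lambda)
    fix i
    have "continuous_on S (\<lambda>x. \<chi> j. f x $ i $ j)" by (intro continuous_on_vec_lambda assms)
    then show "continuous_on S (\<lambda>x. f x $ i)" by simp
  qed
  then show ?thesis by simp
qed

lemma riemannian_metric_cmetric:
  assumes "surface A" "riemannian_metric A g" shows "metric_surface A g"
proof -
  interpret surface A by fact
  show ?thesis
  proof unfold_locales
    show "cmetric A g" unfolding cmetric_def
    proof (intro conjI ballI)
      fix c assume c: "c \<in> A"
      show "continuous_on (fst c) (g c)"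
      proof (rule continuous_on_matrixI)
        fix i j
        have "smooth_on (snd c ` fst c) (\<lambda>x. g c (chart_inv c x) $ i $ j)"
          using assms(2) c unfolding riemannian_metric_def by blast
        from continuous_on_compose2[OF smooth_on_imp_continuous_on[OF this] continuous_chart[OF c] order_refl]
        show "continuous_on (fst c) (\<lambda>p. g c p $ i $ j)"
          by (rule continuous_on_eq) (use c in simp)
      qed
      fix p assume p: "p \<in> fst c"
      show "transpose (g c p) = g c p" "\<forall>v. v \<noteq> 0 \<longrightarrow> v \<bullet> (g c p *v v) > 0"
        using assms(2) c p unfolding riemannian_metric_def by blast+
    next
      fix c d p assume "c \<in> A" "d \<in> A" "p \<in> fst c \<inter> fst d"
      then show "g c p = transpose (tangent_matrix c d id p) ** g d p ** tangent_matrix c d id p"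
        using assms(2) unfolding riemannian_metric_def by blast
    qed
  qed
qed

locale smooth_covering = base: metric_surface A g + total: surface B
  for A :: "'m::{t2_space, second_countable_topology} chart set" and g
    and B :: "'n::{t2_space, second_countable_topology} chart set" +
  fixes \<pi> :: "'n \<Rightarrow> 'm"
  assumes smooth: "smooth_map B A \<pi>"
    and invertible: "d \<in> B ==> c \<in> A ==> x \<in> fst d ==> \<pi> x \<in> fst c ==> invertible (tangent_matrix d c \<pi> x)"
begin

lemma continuous: "continuous_on UNIV \<pi>"
  using smooth by (simp add: smooth_map_def)

lemma differentiable: "d \<in> B ==> c \<in> A ==> x \<in> fst d ==> \<pi> x \<in> fst c ==> in_charts d c \<pi> differentiable (at (snd d x))"
  by (rule smooth_map_differentiable[OF total.surface_axioms base.surface_axioms smooth])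

text \<open>\<open>lifted_metric\<close> uses the chart chosen by \<open>chart_at\<close>, which
  need not be locally constant. By the chain rule and the transformation law any chart around the
  image point gives the same matrix, so one chart can be kept in a neighbourhood.\<close>

lemma lifted_metric_in_chart:
  assumes "d \<in> B" "c \<in> A" "x \<in> fst d" "\<pi> x \<in> fst c"
  shows "lifted_metric A \<pi> g d x = transpose (tangent_matrix d c \<pi> x) ** g c (\<pi> x) ** tangent_matrix d c \<pi> x"
proof -
  let ?e = "chart_at A (\<pi> x)"
  note e = base.chart_at_in[of "\<pi> x"]
  have T: "tangent_matrix d ?e \<pi> x = tangent_matrix c ?e id (\<pi> x) ** tangent_matrix d c \<pi> x"
    using tangent_matrix_compose(1)[OF total.surface_axioms base.surface_axioms assms(1,2,3,4) continuous differentiable[OF assms]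
      base.transition_differentiable[OF assms(2) e(1) assms(4) e(2)]] by (simp only: id_o)
  have "g c (\<pi> x) = transpose (tangent_matrix c ?e id (\<pi> x)) ** g ?e (\<pi> x) ** tangent_matrix c ?e id (\<pi> x)"
    by (rule base.metric_transform[OF assms(2) e(1) assms(4) e(2)])
  then show ?thesis
    unfolding lifted_metric_def Let_def T by (simp only: matrix_transpose_mul matrix_mul_assoc)
qed

lemma metric_surface_lifted: "metric_surface B (lifted_metric A \<pi> g)"
proof unfold_locales
  show "cmetric B (lifted_metric A \<pi> g)" unfolding cmetric_def
  proof (intro conjI ballI)
    fix d assume d: "d \<in> B"
    have "continuous_on (fst d \<inter> \<pi> -` fst c) (lifted_metric A \<pi> g d)" if c: "c \<in> A" for c
    proof -
      let ?J = "\<lambda>x. tangent_matrix d c \<pi> x"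
      have J: "continuous_on (fst d \<inter> \<pi> -` fst c) (\<lambda>x. ?J x $ i $ j)" for i j
        by (rule continuous_tangent_matrix[OF total.surface_axioms base.surface_axioms smooth d c])
      have G: "continuous_on (fst d \<inter> \<pi> -` fst c) (\<lambda>x. g c (\<pi> x) $ i $ j)" for i j
      proof -
        have "continuous_on (fst d \<inter> \<pi> -` fst c) (\<lambda>x. g c (\<pi> x))"
          by (rule continuous_on_compose2[OF base.continuous_metric[OF c] continuous_on_subset[OF continuous]]) auto
        then show ?thesis by (intro continuous_intros)
      qed
      have "continuous_on (fst d \<inter> \<pi> -` fst c) (\<lambda>x. transpose (?J x) ** g c (\<pi> x) ** ?J x)"
      proof (rule continuous_on_matrixI)
        fix i j :: 2
        have gen: "continuous_on S (\<lambda>x. (a x * e x + b x * f x) * k x + (a x * e' x + b x * f' x) * k' x)"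
          if "continuous_on S a" "continuous_on S b" "continuous_on S e" "continuous_on S f" "continuous_on S e'" "continuous_on S f'"
            "continuous_on S k" "continuous_on S k'" for S :: "'n set" and a b e f e' f' k k' :: "'n \<Rightarrow> real"
          using that by (intro continuous_intros)
        show "continuous_on (fst d \<inter> \<pi> -` fst c) (\<lambda>x. (transpose (?J x) ** g c (\<pi> x) ** ?J x) $ i $ j)"
          unfolding matrix_matrix_mult_def transpose_def vec_lambda_beta sum_2
          by (rule gen[OF J J G G G G J J])
      qed
      then show ?thesis
        by (rule continuous_on_eq) (use lifted_metric_in_chart[OF d c] in auto)
    qed
    moreover have "open (fst d \<inter> \<pi> -` fst c)" if "c \<in> A" for c
      using that d continuous by (intro open_Int open_vimage total.open_dom base.open_dom)
    ultimately have "continuous_on (\<Union>c\<in>A. fst d \<inter> \<pi> -` fst c) (lifted_metric A \<pi> g d)"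
      by (intro continuous_on_open_UN) auto
    moreover have "(\<Union>c\<in>A. fst d \<inter> \<pi> -` fst c) = fst d" using base.cover by blast
    ultimately show "continuous_on (fst d) (lifted_metric A \<pi> g d)" by simp
    fix x assume x: "x \<in> fst d"
    let ?c = "chart_at A (\<pi> x)"
    note c = base.chart_at_in[of "\<pi> x"]
    let ?J = "tangent_matrix d ?c \<pi> x" and ?G = "g ?c (\<pi> x)"
    have L: "lifted_metric A \<pi> g d x = transpose ?J ** ?G ** ?J" by (rule lifted_metric_in_chart[OF d c(1) x c(2)])
    have sym: "transpose ?G = ?G" and pos: "\<And>v. v \<noteq> 0 ==> v \<bullet> (?G *v v) > 0"
      using base.cmetric c unfolding cmetric_def by blast+
    show "transpose (lifted_metric A \<pi> g d x) = lifted_metric A \<pi> g d x"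
      unfolding L by (simp only: matrix_transpose_mul transpose_transpose sym matrix_mul_assoc)
    show "\<forall>v. v \<noteq> 0 \<longrightarrow> v \<bullet> (lifted_metric A \<pi> g d x *v v) > 0"
    proof (intro allI impI)
      fix v :: "real^2" assume v: "v \<noteq> 0"
      obtain J' where J': "J' ** ?J = mat 1" using invertible[OF d c(1) x c(2)] unfolding invertible_def by blast
      \<comment> \<open>The tangent map of the covering is injective; this carries positive
        definiteness over to the lift.\<close>
      have "?J *v v \<noteq> 0"
      proof
        assume "?J *v v = 0"
        then have "J' *v (?J *v v) = 0" by simp
        then show False using v by (simp add: matrix_vector_mul_assoc J')
      qed
      from pos[OF this] show "v \<bullet> (lifted_metric A \<pi> g d x *v v) > 0"
        unfolding L matrix_vector_mul_assoc[symmetric] by (metis dot_lmul_matrix transpose_matrix_vector transpose_transpose)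
    qed
  next
    fix d e x assume d: "d \<in> B" and e: "e \<in> B" and x: "x \<in> fst d \<inter> fst e"
    let ?c = "chart_at A (\<pi> x)"
    note c = base.chart_at_in[of "\<pi> x"]
    have xd: "x \<in> fst d" and xe: "x \<in> fst e" "id x \<in> fst e" using x by auto
    have "tangent_matrix d ?c \<pi> x = tangent_matrix e ?c \<pi> x ** tangent_matrix d e id x"
      using tangent_matrix_compose(1)[OF total.surface_axioms total.surface_axioms d e xd xe(2) continuous_on_id'
          total.transition_differentiable[OF d e xd xe(1)], of ?c \<pi>] differentiable[OF e c(1) xe(1) c(2)] by simp
    then show "lifted_metric A \<pi> g d x = transpose (tangent_matrix d e id x) ** lifted_metric A \<pi> g e x ** tangent_matrix d e id x"
      unfolding lifted_metric_in_chart[OF d c(1) xd c(2)] lifted_metric_in_chart[OF e c(1) xe(1) c(2)]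
      by (simp only: matrix_transpose_mul matrix_mul_assoc)
  qed
qed

end

text \<open>The conformal factor lifts to u after \<pi> with the same bound b, whether or not the
  cover is compact, so all comparison lemmas apply upstairs.\<close>

lemma conformal_pair_lifted:
  assumes "conformal_pair A g h u b" "universal_cover B A \<pi>"
  shows "conformal_pair (B :: 'n::{t2_space, second_countable_topology} chart set)
     (lifted_metric A \<pi> g) (lifted_metric A \<pi> h) (\<lambda>x. u (\<pi> x)) b"
proof -
  interpret conformal_pair A g h u b by fact
  interpret B: surface B using assms(2) by unfold_locales (simp add: universal_cover_def)
  have cov: "smooth_covering A k B \<pi>" if "metric_surface A k" for k
  proof -
    interpret metric_surface A k by fact
    show ?thesis using assms(2) by unfold_locales (auto simp: universal_cover_def)
  qed
  interpret LG: metric_surface B "lifted_metric A \<pi> g"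
    by (rule smooth_covering.metric_surface_lifted[OF cov[OF G.metric_surface_axioms]])
  interpret LH: metric_surface B "lifted_metric A \<pi> h"
    by (rule smooth_covering.metric_surface_lifted[OF cov[OF H.metric_surface_axioms]])
  have "continuous_on UNIV \<pi>" using assms(2) by (simp add: universal_cover_def smooth_map_def)
  show ?thesis
  proof unfold_locales
    show "lifted_metric A \<pi> g c p = exp (2 * u (\<pi> p)) *\<^sub>R lifted_metric A \<pi> h c p" for c p
      by (simp add: lifted_metric_def Let_def conf[OF G.chart_at_in] matrix_mult_scaleR_left matrix_mult_scaleR_right)
    show "(\<lambda>x. u (\<pi> x)) \<in> borel_measurable borel"
      by (rule measurable_compose[OF borel_measurable_continuous_onI[OF \<open>continuous_on UNIV \<pi>\<close>] u_measurable])
    show "\<bar>u (\<pi> p)\<bar> \<le> b" for p by (rule u_bounded)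
  qed
qed

section \<open>Gauss curvature of a conformal metric\<close>

text \<open>Dictionary: e, f, h are G11, G12, G22; aij, bij the Christoffel symbols with upper index
  1 and 2; U1, U2 the gradient of u and Vij the i-th derivative of its j-th component; ui, uij
  derivatives of u; ei, fi, hi derivatives of the metric; pa1, pb1 the derivatives of a22, b22 in
  direction 1, and pa2, pb2 those of a12, b12 in direction 2. The hypotheses are metric
  compatibility and the lowering of the gradient, once plain and once differentiated.\<close>

lemma conformal_curvature_algebra:
  fixes e f h :: real
  assumes "u1 = e * U1 + f * U2" "u2 = f * U1 + h * U2"
    and "e1 = 2 * (e * a11 + f * b11)" "e2 = 2 * (e * a12 + f * b12)"
    and "f1 = f * a11 + h * b11 + e * a12 + f * b12" "f2 = f * a12 + h * b12 + e * a22 + f * b22"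
    and "h1 = 2 * (f * a12 + h * b12)" "h2 = 2 * (f * a22 + h * b22)"
    and "e1 * U1 + e * V11 + f1 * U2 + f * V12 = u11"
    and "e2 * U1 + e * V21 + f2 * U2 + f * V22 = u12"
  shows "e * ((pa1 - h1 * U1 - h * V11) - (pa2 + u22 - f2 * U1 - f * V21)
      + ((a11 + 2 * u1 - e * U1) * (a22 - h * U1) - (a12 + u2 - f * U1) * (a12 + u2 - f * U1))
      + ((a12 + u2 - f * U1) * (b22 + 2 * u2 - h * U2) - (a22 - h * U1) * (b12 + u1 - f * U2)))
    + f * ((pb1 + 2 * u12 - h1 * U2 - h * V12) - (pb2 + u12 - f2 * U2 - f * V22)
      + ((b11 - e * U2) * (a22 - h * U1) - (b12 + u1 - f * U2) * (a12 + u2 - f * U1))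
      + ((b12 + u1 - f * U2) * (b22 + 2 * u2 - h * U2) - (b22 + 2 * u2 - h * U2) * (b12 + u1 - f * U2)))
    = e * (pa1 - pa2 + (a11 * a22 - a12 * a12) + (a12 * b22 - a22 * b12))
    + f * (pb1 - pb2 + (b11 * a22 - b12 * a12) + (b12 * b22 - b22 * b12))
    - (h * u11 - 2 * f * u12 + e * u22
       - (h * a11 - 2 * f * a12 + e * a22) * u1 - (h * b11 - 2 * f * b12 + e * b22) * u2)"
  using assms by algebra

locale local_metric =
  fixes S :: "(real^2) set" and G :: "real^2 \<Rightarrow> real^2^2"
  assumes open_S: "open S"
    and smooth: "\<And>i j. smooth_on S (\<lambda>x. G x $ i $ j)"
    and sym: "\<And>x. x \<in> S ==> G x $ 2 $ 1 = G x $ 1 $ 2"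
    and pos: "\<And>x. x \<in> S ==> G x $ 1 $ 1 > 0"
    and det_pos: "\<And>x. x \<in> S ==> det (G x) > 0"
begin

lemma det_eq: "x \<in> S ==> det (G x) = G x $ 1 $ 1 * G x $ 2 $ 2 - G x $ 1 $ 2 * G x $ 1 $ 2"
  by (simp add: det_2 sym)

lemma smooth_det: "smooth_on S (\<lambda>x. det (G x))"
  unfolding det_2 by (intro smooth_on_diff smooth_on_mult smooth open_S)

lemma sym_all: "x \<in> S ==> G x $ i $ j = G x $ j $ i"
  using exhaust_2[of i] exhaust_2[of j] sym by auto

lemma matrix_inv_eq: "x \<in> S ==> matrix_inv (G x) =
  vector [vector [G x $ 2 $ 2 / det (G x), - G x $ 1 $ 2 / det (G x)], vector [- G x $ 1 $ 2 / det (G x), G x $ 1 $ 1 / det (G x)]]"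
  using matrix_inv_2[of "G x"] det_pos[of x] sym[of x] by simp

lemma smooth_matrix_inv: "smooth_on S (\<lambda>x. matrix_inv (G x) $ i $ j)"
proof -
  have *: "smooth_on S (\<lambda>x. f x / det (G x))" if "smooth_on S f" for f
    using that by (intro smooth_on_divide smooth_det open_S det_pos)
  have "smooth_on S (\<lambda>x. matrix_inv (G x) $ 1 $ 1)" "smooth_on S (\<lambda>x. matrix_inv (G x) $ 1 $ 2)"
    "smooth_on S (\<lambda>x. matrix_inv (G x) $ 2 $ 1)" "smooth_on S (\<lambda>x. matrix_inv (G x) $ 2 $ 2)"
    by (rule smooth_on_cong[OF open_S _ *[OF smooth[of 2 2]]], simp add: matrix_inv_eq,
        rule smooth_on_cong[OF open_S _ *[OF smooth_on_minus[OF open_S smooth[of 1 2]]]], simp add: matrix_inv_eq,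
        rule smooth_on_cong[OF open_S _ *[OF smooth_on_minus[OF open_S smooth[of 1 2]]]], simp add: matrix_inv_eq,
        rule smooth_on_cong[OF open_S _ *[OF smooth[of 1 1]]], simp add: matrix_inv_eq)
  then show ?thesis using exhaust_2[of i] exhaust_2[of j] by auto
qed

lemma smooth_christoffel: "smooth_on S (christoffel G k i j)"
  unfolding christoffel_def[abs_def]
  by (intro smooth_on_mult smooth_on_const smooth_on_sum smooth_on_add smooth_on_diff smooth_on_partial smooth smooth_matrix_inv open_S)

lemma partial_sym: "x \<in> S ==> partial_deriv k (\<lambda>y. G y $ i $ j) x = partial_deriv k (\<lambda>y. G y $ j $ i) x"
  by (rule partial_deriv_cong_open[OF open_S]) (auto intro: sym_all)

lemma christoffel_sym: "x \<in> S ==> christoffel G k i j x = christoffel G k j i x"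
  unfolding christoffel_def by (simp add: partial_sym[of x _ i j] add.commute)

lemma inv_mult:
  assumes "x \<in> S" shows "(\<Sum>l\<in>UNIV. G x $ k $ l * matrix_inv (G x) $ l $ m) = (if k = m then 1 else 0)"
proof -
  have "G x ** matrix_inv (G x) = mat 1"
    using det_pos[OF assms] by (metis invertible_det_nz invertible_def less_irrefl matrix_inv_eqI)
  then have "(G x ** matrix_inv (G x)) $ k $ m = mat 1 $ k $ m" by simp
  then show ?thesis by (simp add: matrix_matrix_mult_def mat_def)
qed

text \<open>Lowering the upper index removes the inverse metric and leaves the symbols of the first
  kind.\<close>

lemma christoffel_first_kind:
  assumes "x \<in> S"
  shows "(\<Sum>k\<in>UNIV. G x $ m $ k * christoffel G k i j x)
    = 1/2 * (partial_deriv i (\<lambda>y. G y $ j $ m) x + partial_deriv j (\<lambda>y. G y $ i $ m) x - partial_deriv m (\<lambda>y. G y $ i $ j) x)"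
proof -
  let ?P = "\<lambda>l. partial_deriv i (\<lambda>y. G y $ j $ l) x + partial_deriv j (\<lambda>y. G y $ i $ l) x - partial_deriv l (\<lambda>y. G y $ i $ j) x"
  have "(\<Sum>k\<in>UNIV. G x $ m $ k * christoffel G k i j x)
    = 1/2 * ((\<Sum>k\<in>UNIV. G x $ m $ k * matrix_inv (G x) $ k $ 1) * ?P 1 + (\<Sum>k\<in>UNIV. G x $ m $ k * matrix_inv (G x) $ k $ 2) * ?P 2)"
    by (simp add: christoffel_def sum_2 algebra_simps)
  also have "\<dots> = 1/2 * ?P m"
    unfolding inv_mult[OF assms] using exhaust_2[of m] by auto
  finally show ?thesis .
qed

text \<open>The connection preserves the metric: in the sum of the two symbols of the first kind
  four of the six derivatives cancel.\<close>

lemma metric_compatible: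
  assumes "x \<in> S"
  shows "partial_deriv i (\<lambda>y. G y $ j $ k) x
    = (\<Sum>l\<in>UNIV. G x $ k $ l * christoffel G l i j x) + (\<Sum>l\<in>UNIV. G x $ j $ l * christoffel G l i k x)"
  unfolding christoffel_first_kind[OF assms]
  by (simp add: partial_sym[OF assms, of _ k j] partial_sym[OF assms, of _ i j] partial_sym[OF assms, of _ i k] field_simps)

definition grad :: "(real^2 \<Rightarrow> real) \<Rightarrow> 2 \<Rightarrow> real^2 \<Rightarrow> real" where
  "grad u k x = (\<Sum>l\<in>UNIV. matrix_inv (G x) $ k $ l * partial_deriv l u x)"

lemma smooth_grad: "smooth_on S u ==> smooth_on S (grad u k)"
  unfolding grad_def[abs_def] by (intro smooth_on_sum smooth_on_mult smooth_on_partial smooth_matrix_inv open_S)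

lemma lower_grad: "x \<in> S ==> (\<Sum>l\<in>UNIV. G x $ k $ l * grad u l x) = partial_deriv k u x"
proof -
  assume x: "x \<in> S"
  have "(\<Sum>l\<in>UNIV. G x $ k $ l * grad u l x)
    = (\<Sum>l\<in>UNIV. G x $ k $ l * matrix_inv (G x) $ l $ 1) * partial_deriv 1 u x
    + (\<Sum>l\<in>UNIV. G x $ k $ l * matrix_inv (G x) $ l $ 2) * partial_deriv 2 u x"
    by (simp add: grad_def sum_2 algebra_simps)
  then show ?thesis unfolding inv_mult[OF x] using exhaust_2[of k] by auto
qed

text \<open>Differentiating the identity G grad u = du avoids ever differentiating the inverse
  metric.\<close>

lemma lower_grad_deriv:
  assumes u: "smooth_on S u" and x: "x \<in> S"
  shows "(\<Sum>l\<in>UNIV. partial_deriv m (\<lambda>y. G y $ k $ l) x * grad u l x + G x $ k $ l * partial_deriv m (grad u l) x)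
     = partial_deriv m (partial_deriv k u) x"
proof -
  have d: "(\<lambda>y. G y $ k $ l) differentiable (at x)" "grad u l differentiable (at x)" for k l
    using smooth_on_imp_differentiable[OF smooth open_S x] smooth_on_imp_differentiable[OF smooth_grad[OF u] open_S x] by auto
  have "partial_deriv m (partial_deriv k u) x = partial_deriv m (\<lambda>y. G y $ k $ 1 * grad u 1 y + G y $ k $ 2 * grad u 2 y) x"
    by (rule partial_deriv_cong_open[OF open_S x]) (use lower_grad[of _ k u] in \<open>simp add: sum_2\<close>)
  also have "\<dots> = partial_deriv m (\<lambda>y. G y $ k $ 1 * grad u 1 y) x + partial_deriv m (\<lambda>y. G y $ k $ 2 * grad u 2 y) x"
    by (intro partial_deriv_add differentiable_mult d)
  finally show ?thesis using d by (simp add: sum_2 partial_deriv_mult)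
qed

end

section \<open>Conformal change of the connection and the curvature\<close>

locale local_conformal = local_metric S G for S G +
  fixes u :: "real^2 \<Rightarrow> real" and G' :: "real^2 \<Rightarrow> real^2^2"
  assumes smooth_u: "smooth_on S u"
    and G': "\<And>y. y \<in> S ==> G' y = exp (2 * u y) *\<^sub>R G y"
begin

lemma partial_G':
  assumes "x \<in> S"
  shows "partial_deriv i (\<lambda>y. G' y $ j $ l) x
     = exp (2 * u x) * (partial_deriv i (\<lambda>y. G y $ j $ l) x + 2 * partial_deriv i u x * G x $ j $ l)"
proof -
  have du: "u differentiable (at x)" by (rule smooth_on_imp_differentiable[OF smooth_u open_S assms])
  have dG: "(\<lambda>y. G y $ j $ l) differentiable (at x)" by (rule smooth_on_imp_differentiable[OF smooth open_S assms])
  have F: "((\<lambda>t. exp (2 * t)) has_field_derivative 2 * exp (2 * u x)) (at (u x))"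
    by (auto intro!: derivative_eq_intros)
  have "partial_deriv i (\<lambda>y. G' y $ j $ l) x = partial_deriv i (\<lambda>y. exp (2 * u y) * G y $ j $ l) x"
    by (rule partial_deriv_cong_open[OF open_S assms]) (simp add: G')
  also have "\<dots> = exp (2 * u x) * partial_deriv i (\<lambda>y. G y $ j $ l) x + partial_deriv i (\<lambda>y. exp (2 * u y)) x * G x $ j $ l"
    by (rule partial_deriv_mult[OF differentiable_compose_real[OF du F] dG])
  also have "partial_deriv i (\<lambda>y. exp (2 * u y)) x = 2 * exp (2 * u x) * partial_deriv i u x"
    by (rule partial_deriv_compose[OF du F])
  finally show ?thesis by (simp add: algebra_simps)
qed

lemma matrix_inv_G':
  assumes "x \<in> S" shows "matrix_inv (G' x) $ k $ l = exp (- (2 * u x)) * matrix_inv (G x) $ k $ l"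
proof -
  have "det (G' x) = exp (2 * u x) * exp (2 * u x) * det (G x)"
    by (simp add: G'[OF assms] det_2 algebra_simps)
  then have "matrix_inv (G' x) = exp (- (2 * u x)) *\<^sub>R matrix_inv (G x)"
    using det_pos[OF assms]
    by (subst (1 2) matrix_inv_2) (simp_all add: G'[OF assms] vec_eq_iff forall_2 exp_minus field_simps)
  then show ?thesis by simp
qed

text \<open>Each derivative of the metric gains a term 2 du times G, and the common factor exp (2 u)
  cancels against the inverse metric.\<close>

lemma christoffel_conformal:
  assumes "x \<in> S"
  shows "christoffel G' k i j x = christoffel G k i j x
    + (if k = j then partial_deriv i u x else 0) + (if k = i then partial_deriv j u x else 0) - G x $ i $ j * grad u k x"
proof -
  have e: "exp (- (2 * u x)) * exp (2 * u x) = 1" by (simp add: exp_minus)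
  have s: "(\<Sum>l\<in>UNIV. matrix_inv (G x) $ k $ l * G x $ j $ l) = (if k = j then 1 else 0)" for k j
  proof -
    have sy: "matrix_inv (G x) $ k $ l = matrix_inv (G x) $ l $ k" for k l
      using exhaust_2[of k] exhaust_2[of l] by (auto simp: matrix_inv_eq[OF assms])
    show ?thesis using inv_mult[OF assms, of j k] by (subst sy) (simp add: mult.commute eq_commute)
  qed
  have "christoffel G' k i j x = 1/2 * (\<Sum>l\<in>UNIV. (exp (- (2 * u x)) * exp (2 * u x)) * (matrix_inv (G x) $ k $ l *
      ((partial_deriv i (\<lambda>y. G y $ j $ l) x + partial_deriv j (\<lambda>y. G y $ i $ l) x - partial_deriv l (\<lambda>y. G y $ i $ j) x)
      + 2 * (partial_deriv i u x * G x $ j $ l + partial_deriv j u x * G x $ i $ l - partial_deriv l u x * G x $ i $ j))))"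
    unfolding christoffel_def partial_G'[OF assms] matrix_inv_G'[OF assms]
    by (intro arg_cong[of _ _ "\<lambda>t. 1/2 * t"] sum.cong refl) (simp only: distrib_left right_diff_distrib mult_ac)
  also have "\<dots> = christoffel G k i j x + partial_deriv i u x * (\<Sum>l\<in>UNIV. matrix_inv (G x) $ k $ l * G x $ j $ l)
      + partial_deriv j u x * (\<Sum>l\<in>UNIV. matrix_inv (G x) $ k $ l * G x $ i $ l) - G x $ i $ j * grad u k x"
    unfolding e christoffel_def grad_def by (simp add: sum_2 algebra_simps)
  finally show ?thesis unfolding s by simp
qed

lemma partial_christoffel_conformal:
  assumes "x \<in> S"
  shows "partial_deriv m (christoffel G' k i j) x = partial_deriv m (christoffel G k i j) x
    + (if k = j then partial_deriv m (partial_deriv i u) x else 0) + (if k = i then partial_deriv m (partial_deriv j u) x else 0)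
    - (partial_deriv m (\<lambda>y. G y $ i $ j) x * grad u k x + G x $ i $ j * partial_deriv m (grad u k) x)"
proof -
  have z: "partial_deriv m (\<lambda>y. 0) x = 0"
    by (rule trans[OF partial_deriv_eqI[of _ "\<lambda>x. 0"]]) auto
  have neg: "partial_deriv m (\<lambda>y. - 1 * (G y $ i $ j * grad u k y)) x = - 1 * partial_deriv m (\<lambda>y. G y $ i $ j * grad u k y) x"
  proof -
    have "(\<lambda>y. G y $ i $ j * grad u k y) differentiable (at x)"
      using smooth_on_imp_differentiable[OF smooth_on_mult[OF open_S smooth smooth_grad[OF smooth_u]] open_S assms] by blast
    moreover have "((\<lambda>t. - 1 * t) has_field_derivative - 1) (at y)" for y :: real
      by (auto intro!: derivative_eq_intros)
    ultimately show ?thesis by (rule partial_deriv_compose)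
  qed
  let ?a = "\<lambda>y. if k = j then partial_deriv i u y else 0" and ?b = "\<lambda>y. if k = i then partial_deriv j u y else 0"
  have sm: "smooth_on S ?a" "smooth_on S ?b"
    using smooth_on_partial[OF smooth_u] by (cases "k = j"; simp) (cases "k = i"; simp add: smooth_on_partial[OF smooth_u])
  note d = smooth_on_imp_differentiable[OF _ open_S assms]
  note sms = smooth_christoffel sm smooth smooth_grad[OF smooth_u] open_S
  have "partial_deriv m (christoffel G' k i j) x
    = partial_deriv m (\<lambda>y. christoffel G k i j y + ?a y + ?b y + - 1 * (G y $ i $ j * grad u k y)) x"
    by (rule partial_deriv_cong_open[OF open_S assms]) (simp add: christoffel_conformal)
  also have "\<dots> = partial_deriv m (\<lambda>y. christoffel G k i j y + ?a y + ?b y) x + partial_deriv m (\<lambda>y. - 1 * (G y $ i $ j * grad u k y)) x"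
    by (rule partial_deriv_add; rule d; intro smooth_on_add smooth_on_mult smooth_on_const sms)
  also have "partial_deriv m (\<lambda>y. christoffel G k i j y + ?a y + ?b y) x
    = partial_deriv m (\<lambda>y. christoffel G k i j y + ?a y) x + partial_deriv m ?b x"
    by (rule partial_deriv_add; rule d; intro smooth_on_add sms)
  also have "partial_deriv m (\<lambda>y. christoffel G k i j y + ?a y) x = partial_deriv m (christoffel G k i j) x + partial_deriv m ?a x"
    by (rule partial_deriv_add; rule d; intro sms)
  also have "partial_deriv m (\<lambda>y. - 1 * (G y $ i $ j * grad u k y)) x
     = - 1 * (G x $ i $ j * partial_deriv m (grad u k) x + partial_deriv m (\<lambda>y. G y $ i $ j) x * grad u k x)"
    unfolding neg by (subst partial_deriv_mult) (auto intro!: d sms)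
  finally show ?thesis by (auto simp: z algebra_simps)
qed

text \<open>This is exp (2 u) K' = K - Delta u, multiplied by det G, where K and K' are the
  curvatures of G and G'. Lowering with G instead of G' removes one factor exp (2 u), and the
  bracket is det G times the Laplacian written as the trace of the covariant Hessian.\<close>

lemma curvature_conformal:
  assumes x: "x \<in> S"
  shows "(\<Sum>l\<in>UNIV. G x $ 1 $ l * riemann_tensor G' l 1 2 2 x) = (\<Sum>l\<in>UNIV. G x $ 1 $ l * riemann_tensor G l 1 2 2 x)
    - (G x $ 2 $ 2 * partial_deriv 1 (partial_deriv 1 u) x - 2 * G x $ 1 $ 2 * partial_deriv 1 (partial_deriv 2 u) x
       + G x $ 1 $ 1 * partial_deriv 2 (partial_deriv 2 u) x
       - (G x $ 2 $ 2 * christoffel G 1 1 1 x - 2 * G x $ 1 $ 2 * christoffel G 1 1 2 x + G x $ 1 $ 1 * christoffel G 1 2 2 x) * partial_deriv 1 u x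
       - (G x $ 2 $ 2 * christoffel G 2 1 1 x - 2 * G x $ 1 $ 2 * christoffel G 2 1 2 x + G x $ 1 $ 1 * christoffel G 2 2 2 x) * partial_deriv 2 u x)"
proof -
  note s = sym[OF x] and cs = christoffel_sym[OF x, of _ 2 1]
  note c = metric_compatible[OF x, unfolded sum_2] and l = lower_grad[OF x, of _ u, unfolded sum_2]
    and ld = lower_grad_deriv[OF smooth_u x, unfolded sum_2]
  have comm: "partial_deriv 2 (partial_deriv 1 u) x = partial_deriv 1 (partial_deriv 2 u) x"
    by (rule partial_deriv_commute[OF open_S smooth_u x])
  note alg = conformal_curvature_algebra[
      of "partial_deriv 1 u x" "G x $ 1 $ 1" "grad u 1 x" "G x $ 1 $ 2" "grad u 2 x" "partial_deriv 2 u x" "G x $ 2 $ 2"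
         "partial_deriv 1 (\<lambda>y. G y $ 1 $ 1) x" "christoffel G 1 1 1 x" "christoffel G 2 1 1 x"
         "partial_deriv 2 (\<lambda>y. G y $ 1 $ 1) x" "christoffel G 1 1 2 x" "christoffel G 2 1 2 x"
         "partial_deriv 1 (\<lambda>y. G y $ 1 $ 2) x" "partial_deriv 2 (\<lambda>y. G y $ 1 $ 2) x" "christoffel G 1 2 2 x" "christoffel G 2 2 2 x"
         "partial_deriv 1 (\<lambda>y. G y $ 2 $ 2) x" "partial_deriv 2 (\<lambda>y. G y $ 2 $ 2) x"
         "partial_deriv 1 (grad u 1) x" "partial_deriv 1 (grad u 2) x" "partial_deriv 1 (partial_deriv 1 u) x"
         "partial_deriv 2 (grad u 1) x" "partial_deriv 2 (grad u 2) x" "partial_deriv 2 (partial_deriv 1 u) x"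
         "partial_deriv 1 (christoffel G 1 2 2) x" "partial_deriv 2 (christoffel G 1 1 2) x" "partial_deriv 2 (partial_deriv 2 u) x"
         "partial_deriv 1 (christoffel G 2 2 2) x" "partial_deriv 2 (christoffel G 2 1 2) x"]
  have ne: "(1::2) \<noteq> 2" "(2::2) \<noteq> 1" by simp_all
  have "(\<Sum>l\<in>UNIV. G x $ 1 $ l * riemann_tensor G' l 1 2 2 x) = (\<Sum>l\<in>UNIV. G x $ 1 $ l * riemann_tensor G l 1 2 2 x)
    - (G x $ 2 $ 2 * partial_deriv 1 (partial_deriv 1 u) x - 2 * G x $ 1 $ 2 * partial_deriv 2 (partial_deriv 1 u) x
       + G x $ 1 $ 1 * partial_deriv 2 (partial_deriv 2 u) x
       - (G x $ 2 $ 2 * christoffel G 1 1 1 x - 2 * G x $ 1 $ 2 * christoffel G 1 1 2 x + G x $ 1 $ 1 * christoffel G 1 2 2 x) * partial_deriv 1 u x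
       - (G x $ 2 $ 2 * christoffel G 2 1 1 x - 2 * G x $ 1 $ 2 * christoffel G 2 1 2 x + G x $ 1 $ 1 * christoffel G 2 2 2 x) * partial_deriv 2 u x)"
    using alg l[of 1] l[of 2] c[of 1 1 1] c[of 2 1 1] c[of 1 1 2] c[of 2 1 2] c[of 1 2 2] c[of 2 2 2] ld[of 1 1] ld[of 2 1]
    unfolding riemann_tensor_def sum_2 partial_christoffel_conformal[OF x] christoffel_conformal[OF x]
    by (simp only: s cs comm ne if_True if_False refl) (simp add: algebra_simps)
  then show ?thesis unfolding comm .
qed

end

section \<open>A sup estimate for subsolutions\<close>

lemma partial_deriv_const: "partial_deriv i (\<lambda>y. c) x = 0"
  by (rule trans[OF partial_deriv_eqI[of _ "\<lambda>x. 0"]]) auto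

lemma differentiable_coord: "(\<lambda>y :: real^2. y $ j) differentiable (at x)"
  by (rule bounded_linear_imp_differentiable[OF bounded_linear_vec_nth])

lemma partial_deriv_coord: "partial_deriv i (\<lambda>y. y $ j) x = (if i = j then 1 else 0)"
  by (rule trans[OF partial_deriv_eqI[OF bounded_linear_imp_has_derivative[OF bounded_linear_vec_nth]]]) (simp add: axis_def)

lemma partial_deriv_diff:
  "f differentiable (at x) ==> g differentiable (at x) ==>
    partial_deriv i (\<lambda>y. f y - g y) x = partial_deriv i f x - partial_deriv i g x"
  by (rule trans, rule partial_deriv_eqI[OF has_derivative_diff])
     (auto simp: frechet_derivative_works[symmetric] partial_deriv_def)

lemma partial_deriv_power2:
  "f differentiable (at x) ==> partial_deriv i (\<lambda>y. (f y)\<^sup>2) x = 2 * f x * partial_deriv i f x"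
  using partial_deriv_mult[of f x f i] by (simp add: power2_eq_square)

lemma differentiable_power2: "f differentiable (at x) ==> (\<lambda>y. (f y)\<^sup>2 :: real) differentiable (at x)"
  unfolding power2_eq_square by (rule differentiable_mult)

lemmas pd_simps = partial_deriv_const partial_deriv_coord partial_deriv_add partial_deriv_diff partial_deriv_mult
  partial_deriv_power2 differentiable_coord differentiable_power2 differentiable_add differentiable_diff differentiable_mult

lemma square_powr:
  assumes "t > 0" shows "(t\<^sup>2) powr a = t powr (2 * a :: real)"
proof -
  have e: "t\<^sup>2 = t powr 2" using assms by simp
  show ?thesis unfolding e powr_powr ..
qed

text \<open>The function (t - a) ((t - a)^2 + \<epsilon>)^(-1/4) has a derivative of at least half
  the integrand and absolute value at most sqrt \<rho> at both ends. The bound has to be uniform in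
  \<epsilon>.\<close>

lemma integral_quartic_root_le:
  assumes "\<epsilon> > 0" "\<rho> > 0"
  shows "(LINT t|lborel. indicator {a - \<rho>..a + \<rho>} t * ((t - a)\<^sup>2 + \<epsilon>) powr (- 1/4)) \<le> 4 * sqrt \<rho>"
proof -
  let ?f = "\<lambda>t. ((t - a)\<^sup>2 + \<epsilon>) powr (- 1/4)" and ?F = "\<lambda>t. (t - a) * ((t - a)\<^sup>2 + \<epsilon>) powr (- 1/4)"
  let ?d = "\<lambda>t. ((t - a)\<^sup>2 + \<epsilon>) powr (- 1/4) - 1/2 * (t - a)\<^sup>2 * ((t - a)\<^sup>2 + \<epsilon>) powr (- 5/4)"
  have pos: "(t - a)\<^sup>2 + \<epsilon> > 0" for t using assms(1) by (simp add: add_nonneg_pos)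
  have F: "(?F has_real_derivative ?d t) (at t)" for t
  proof -
    have N: "((\<lambda>t. (t - a)\<^sup>2 + \<epsilon>) has_real_derivative 2 * (t - a)) (at t)"
      by (auto intro!: derivative_eq_intros)
    have l: "((\<lambda>t. t - a) has_real_derivative 1) (at t)" by (auto intro!: derivative_eq_intros)
    have alg: "1 * P + (- 1/4 * Q * (2 * d)) * d = P - 1/2 * d\<^sup>2 * Q" for P Q d :: real
      by (simp add: power2_eq_square)
    have e: "(- 1/4 - real (Suc 0)) = - 5/4" by simp
    show ?thesis
      by (rule DERIV_cong[OF DERIV_mult[OF l DERIV_fun_powr[OF N pos, of "- 1/4"]]], unfold One_nat_def e, rule alg)
  qed
  have cd: "continuous_on {a - \<rho>..a + \<rho>} ?d"
    using pos by (intro continuous_intros) (metis less_irrefl)+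
  have cf: "continuous_on {a - \<rho>..a + \<rho>} ?f"
    using pos by (intro continuous_intros) (metis less_irrefl)+
  have I: "(LINT t|lborel. indicator {a - \<rho>..a + \<rho>} t *\<^sub>R ?d t) = ?F (a + \<rho>) - ?F (a - \<rho>)"
    by (rule integral_FTC_atLeastAtMost[OF _ _ cd])
      (use assms F in \<open>auto simp: has_real_derivative_iff_has_vector_derivative intro: has_vector_derivative_at_within\<close>)
  have le: "?f t \<le> 2 * ?d t" for t
  proof -
    have "(t - a)\<^sup>2 * ((t - a)\<^sup>2 + \<epsilon>) powr (- 5/4) \<le> ((t - a)\<^sup>2 + \<epsilon>) * ((t - a)\<^sup>2 + \<epsilon>) powr (- 5/4)"
      using assms(1) by (intro mult_right_mono) auto
    also have "\<dots> = ((t - a)\<^sup>2 + \<epsilon>) powr (1 + - 5/4)" using pos[of t] by (subst powr_add) simp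
    finally show ?thesis by simp
  qed
  have "(LINT t|lborel. indicator {a - \<rho>..a + \<rho>} t * ?f t) \<le> (LINT t|lborel. 2 * (indicator {a - \<rho>..a + \<rho>} t * ?d t))"
  proof (rule integral_mono)
    show "integrable lborel (\<lambda>t. indicator {a - \<rho>..a + \<rho>} t * ?f t)"
      using integrable_cbox_continuous[of "a - \<rho>" "a + \<rho>" ?f] cf by simp
    show "integrable lborel (\<lambda>t. 2 * (indicator {a - \<rho>..a + \<rho>} t * ?d t))"
      using integrable_cbox_continuous[of "a - \<rho>" "a + \<rho>" ?d] cd by simp
    show "indicator {a - \<rho>..a + \<rho>} t * ?f t \<le> 2 * (indicator {a - \<rho>..a + \<rho>} t * ?d t)" for t
      using le[of t] by (auto simp: indicator_def)
  qed
  also have "\<dots> = 2 * (?F (a + \<rho>) - ?F (a - \<rho>))" using I by simp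
  also have "\<dots> = 4 * (\<rho> * (\<rho>\<^sup>2 + \<epsilon>) powr (- 1/4))" by (simp add: algebra_simps)
  also have "\<dots> \<le> 4 * (\<rho> * (\<rho>\<^sup>2) powr (- 1/4))"
    using assms by (intro mult_left_mono powr_mono2') auto
  also have "\<rho> * (\<rho>\<^sup>2) powr (- 1/4) = sqrt \<rho>"
  proof -
    have "\<rho> * (\<rho>\<^sup>2) powr (- 1/4) = \<rho> powr 1 * \<rho> powr (2 * (- 1/4))" using assms square_powr[of \<rho> "- 1/4"] by simp
    also have "\<dots> = \<rho> powr (1 + 2 * (- 1/4))" by (rule powr_add[symmetric])
    also have "\<dots> = \<rho> powr (1/2)" by simp
    finally show ?thesis using assms by (simp add: powr_half_sqrt)
  qed
  finally show ?thesis by simp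
qed

definition vec2 :: "real \<Rightarrow> real^2" where "vec2 t = (\<chi> i. t)"

lemma vec2_nth [simp]: "vec2 t $ i = t" by (simp add: vec2_def)

abbreviation square :: "real^2 \<Rightarrow> real \<Rightarrow> (real^2) set" where
  "square z t \<equiv> cbox (z - vec2 t) (z + vec2 t)"

lemma mem_square: "x \<in> square z t \<longleftrightarrow> \<bar>x $ 1 - z $ 1\<bar> \<le> t \<and> \<bar>x $ 2 - z $ 2\<bar> \<le> t"
  by (auto simp: mem_box_cart forall_2 abs_le_iff)

text \<open>Since (p + \<epsilon>) (q + \<epsilon>) \<le> (p + q + \<epsilon>)^2, the integrand is
  dominated by a product of functions of one coordinate each. The bound is (4 sqrt \<rho>)^2, again
  uniform in \<epsilon>; Fubini replaces polar coordinates.\<close>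

lemma integral_inverse_norm_le:
  fixes z :: "real^2"
  assumes "\<epsilon> > 0" "\<rho> > 0"
  shows "(LINT x|lborel. indicator (square z \<rho>) x
      * (1 / sqrt ((x $ 1 - z $ 1)\<^sup>2 + (x $ 2 - z $ 2)\<^sup>2 + \<epsilon>))) \<le> 16 * \<rho>"
proof -
  let ?f = "\<lambda>a t. (((t - a)\<^sup>2 + \<epsilon>) powr (- 1/4) :: real)" and ?B = "square z \<rho>"
  have pos: "(t - a)\<^sup>2 + \<epsilon> > 0" for t a :: real using assms(1) by (simp add: add_nonneg_pos)
  have pos2: "(t - a)\<^sup>2 + (s - b)\<^sup>2 + \<epsilon> > 0" for t a s b :: real using assms(1) by (simp add: add_nonneg_pos)
  have le: "1 / sqrt ((t - a)\<^sup>2 + (s - b)\<^sup>2 + \<epsilon>) \<le> ?f a t * ?f b s" for t a s b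
  proof -
    let ?p = "(t - a)\<^sup>2" and ?q = "(s - b)\<^sup>2"
    have "1 / sqrt (?p + ?q + \<epsilon>) = ((?p + ?q + \<epsilon>)\<^sup>2) powr (- 1/4)"
    proof -
      have "((?p + ?q + \<epsilon>)\<^sup>2) powr (- 1/4) = (?p + ?q + \<epsilon>) powr (- (1/2))"
        unfolding square_powr[OF pos2] by simp
      also have "\<dots> = inverse (sqrt (?p + ?q + \<epsilon>))"
        unfolding powr_minus using pos2[of t a s b] by (subst powr_half_sqrt) auto
      finally show ?thesis by (simp only: inverse_eq_divide)
    qed
    also have "\<dots> \<le> ((?p + \<epsilon>) * (?q + \<epsilon>)) powr (- 1/4)"
    proof (rule powr_mono2')
      have "(p + \<epsilon>) * (q + \<epsilon>) \<le> (p + q + \<epsilon>)\<^sup>2" if "0 \<le> p" "0 \<le> q" for p q :: real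
      proof -
        have "0 \<le> p * q + p * p + q * q + \<epsilon> * (p + q)" using assms(1) that by simp
        then show ?thesis by (simp add: power2_eq_square algebra_simps)
      qed
      then show "(?p + \<epsilon>) * (?q + \<epsilon>) \<le> (?p + ?q + \<epsilon>)\<^sup>2" by simp
    qed (use pos[of t a] pos[of s b] in auto)
    also have "\<dots> = ?f a t * ?f b s" by (rule powr_mult)
    finally show ?thesis .
  qed
  have c1: "continuous_on ?B (\<lambda>x. ?f (z $ 1) (x $ 1) * ?f (z $ 2) (x $ 2))"
    using pos by (intro continuous_intros) (metis less_irrefl)+
  have c2: "continuous_on ?B (\<lambda>x. 1 / sqrt ((x $ 1 - z $ 1)\<^sup>2 + (x $ 2 - z $ 2)\<^sup>2 + \<epsilon>))"
  proof -
    have "sqrt ((x $ 1 - z $ 1)\<^sup>2 + (x $ 2 - z $ 2)\<^sup>2 + \<epsilon>) \<noteq> 0" for x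
      using pos2[of "x $ 1" "z $ 1" "x $ 2" "z $ 2"] by simp
    then show ?thesis by (intro continuous_intros) auto
  qed
  let ?g = "\<lambda>a t. indicator {a - \<rho>..a + \<rho>} t * ?f a t"
  have "(LINT x|lborel. indicator ?B x * (1 / sqrt ((x $ 1 - z $ 1)\<^sup>2 + (x $ 2 - z $ 2)\<^sup>2 + \<epsilon>)))
     \<le> (LINT x|lborel. indicator ?B x * (?f (z $ 1) (x $ 1) * ?f (z $ 2) (x $ 2)))"
    by (rule integral_mono[OF integrable_cbox_continuous[OF c2] integrable_cbox_continuous[OF c1]])
      (use le in \<open>auto simp: indicator_def\<close>)
  also have "\<dots> = (LINT t|lborel. LINT s|lborel. ?g (z $ 1) t * ?g (z $ 2) s)"
    unfolding integral_coord_pair[OF integrable_cbox_continuous[OF c1], of 2]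
    by (intro Bochner_Integration.integral_cong refl)
      (auto simp: indicator_def mem_square coord_pair_def abs_le_iff)
  also have "\<dots> = (LINT t|lborel. ?g (z $ 1) t) * (LINT s|lborel. ?g (z $ 2) s)" by simp
  also have "\<dots> \<le> (4 * sqrt \<rho>) * (4 * sqrt \<rho>)"
    by (intro mult_mono integral_quartic_root_le assms integral_nonneg_AE AE_I2) (use assms in auto)
  also have "\<dots> = 16 * \<rho>" using assms by simp
  finally show ?thesis .
qed

section \<open>Operators in divergence form with unimodular coefficients\<close>

locale elliptic_operator =
  fixes S :: "(real^2) set" and \<alpha> \<beta> \<gamma> :: "real^2 \<Rightarrow> real"
  assumes open_S: "open S"
    and smooth_coeffs: "smooth_on S \<alpha>" "smooth_on S \<beta>" "smooth_on S \<gamma>"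
    and \<alpha>_pos: "\<And>x. x \<in> S ==> \<alpha> x > 0"
    and unimodular: "\<And>x. x \<in> S ==> \<alpha> x * \<gamma> x - (\<beta> x)\<^sup>2 = 1"
begin

definition L :: "(real^2 \<Rightarrow> real) \<Rightarrow> real^2 \<Rightarrow> real" where
  "L w x = partial_deriv 1 (\<lambda>y. \<alpha> y * partial_deriv 1 w y + \<beta> y * partial_deriv 2 w y) x
         + partial_deriv 2 (\<lambda>y. \<beta> y * partial_deriv 1 w y + \<gamma> y * partial_deriv 2 w y) x"

lemma smooth_L: "smooth_on S w ==> smooth_on S (L w)"
  unfolding L_def[abs_def] by (intro smooth_on_add smooth_on_partial smooth_on_mult smooth_coeffs open_S)

lemma L_expand:
  assumes "smooth_on S w" "x \<in> S"
  shows "L w x = \<alpha> x * partial_deriv 1 (partial_deriv 1 w) x + 2 * \<beta> x * partial_deriv 1 (partial_deriv 2 w) x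
     + \<gamma> x * partial_deriv 2 (partial_deriv 2 w) x
     + (partial_deriv 1 \<alpha> x + partial_deriv 2 \<beta> x) * partial_deriv 1 w x
     + (partial_deriv 1 \<beta> x + partial_deriv 2 \<gamma> x) * partial_deriv 2 w x"
proof -
  note d = smooth_on_imp_differentiable[OF _ open_S assms(2)]
  show ?thesis
    unfolding L_def
    by (simp add: partial_deriv_add partial_deriv_mult differentiable_mult d smooth_coeffs smooth_on_partial assms(1)
        partial_deriv_commute[OF open_S assms(1,2), of 2 1] algebra_simps)
qed

text \<open>Green's second identity. The flux \<open>?X\<close>, \<open>?Y\<close> is linear in
  \<psi> and its first derivatives, which all vanish on the boundary of the box.\<close>

lemma L_symmetric:
  assumes w: "smooth_on S w" and \<psi>: "smooth_on S \<psi>" and box: "cbox a b \<subseteq> S"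
    and z: "\<And>x i. x \<in> cbox a b ==> x $ i = a $ i \<or> x $ i = b $ i ==> \<psi> x = 0"
    and z': "\<And>x i j. x \<in> cbox a b ==> x $ i = a $ i \<or> x $ i = b $ i ==> partial_deriv j \<psi> x = 0"
  shows "(LINT x|lborel. indicator (cbox a b) x * (L w x * \<psi> x)) = (LINT x|lborel. indicator (cbox a b) x * (w x * L \<psi> x))"
proof -
  let ?B = "cbox a b"
  let ?P = "\<lambda>v y. \<alpha> y * partial_deriv 1 v y + \<beta> y * partial_deriv 2 v y"
  let ?R = "\<lambda>v y. \<beta> y * partial_deriv 1 v y + \<gamma> y * partial_deriv 2 v y"
  let ?X = "\<lambda>y. ?P w y * \<psi> y - w y * ?P \<psi> y" and ?Y = "\<lambda>y. ?R w y * \<psi> y - w y * ?R \<psi> y"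
  have sP: "smooth_on S (?P v)" "smooth_on S (?R v)" if "smooth_on S v" for v
    by (intro smooth_on_add smooth_on_mult smooth_coeffs smooth_on_partial open_S that)+
  have sX: "smooth_on S ?X" "smooth_on S ?Y"
    by (intro smooth_on_diff smooth_on_mult sP w \<psi> open_S)+
  have div: "partial_deriv 1 ?X x + partial_deriv 2 ?Y x = L w x * \<psi> x - w x * L \<psi> x" if x: "x \<in> S" for x
  proof -
    note d = smooth_on_imp_differentiable[OF _ open_S x]
    have dP: "?P v differentiable (at x)" "?R v differentiable (at x)" if "smooth_on S v" for v
      using sP[OF that] d by auto
    have "partial_deriv 1 ?X x = partial_deriv 1 (?P w) x * \<psi> x + ?P w x * partial_deriv 1 \<psi> x
        - (partial_deriv 1 w x * ?P \<psi> x + w x * partial_deriv 1 (?P \<psi>) x)"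
      by (subst partial_deriv_diff; (subst partial_deriv_mult)?; (subst partial_deriv_mult)?; (intro differentiable_mult)?)
        (use dP[OF w] dP[OF \<psi>] d[OF w] d[OF \<psi>] in auto)
    moreover have "partial_deriv 2 ?Y x = partial_deriv 2 (?R w) x * \<psi> x + ?R w x * partial_deriv 2 \<psi> x
        - (partial_deriv 2 w x * ?R \<psi> x + w x * partial_deriv 2 (?R \<psi>) x)"
      by (subst partial_deriv_diff; (subst partial_deriv_mult)?; (subst partial_deriv_mult)?; (intro differentiable_mult)?)
        (use dP[OF w] dP[OF \<psi>] d[OF w] d[OF \<psi>] in auto)
    ultimately show ?thesis unfolding L_def by (simp add: algebra_simps)
  qed
  note c = smooth_on_imp_continuous_on[THEN continuous_on_subset[OF _ box]]
  note int = integrable_cbox_continuous[OF c]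
  have "(LINT x|lborel. indicator ?B x * (L w x * \<psi> x)) - (LINT x|lborel. indicator ?B x * (w x * L \<psi> x))
    = (LINT x|lborel. indicator ?B x * (L w x * \<psi> x) - indicator ?B x * (w x * L \<psi> x))"
    by (intro Bochner_Integration.integral_diff[symmetric] int smooth_on_mult smooth_L w \<psi> open_S)
  also have "\<dots> = (LINT x|lborel. indicator ?B x * partial_deriv 1 ?X x + indicator ?B x * partial_deriv 2 ?Y x)"
    by (intro Bochner_Integration.integral_cong refl) (use div box in \<open>auto simp: indicator_def subset_iff\<close>)
  also have "\<dots> = (LINT x|lborel. indicator ?B x * partial_deriv 1 ?X x) + (LINT x|lborel. indicator ?B x * partial_deriv 2 ?Y x)"
    by (intro Bochner_Integration.integral_add int smooth_on_partial sX)
  also have "\<dots> = 0"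
    using box_integral_partial_deriv_zero[OF open_S box sX(1), of 1] box_integral_partial_deriv_zero[OF open_S box sX(2), of 2] z z'
    by simp
  finally show ?thesis by simp
qed

end

lemma abs_mult_le: "\<bar>p\<bar> \<le> P ==> \<bar>q\<bar> \<le> R ==> \<bar>p * q\<bar> \<le> P * (R :: real)"
  unfolding abs_mult by (rule mult_mono') auto

text \<open>The quadratic form with unimodular matrix \<open>(c0, -b0; -b0, a0)\<close> is bounded below because
  \<open>(a0 + c0) Q - y1 ^ 2 - y2 ^ 2\<close> is a sum of two squares.\<close>

lemma unimodular_form_bounds:
  fixes y1 y2 :: real
  assumes u: "a0 * c0 - b0\<^sup>2 = 1" and a0: "0 < a0" "a0 \<le> \<Lambda>" and "\<bar>b0\<bar> \<le> \<Lambda>" "\<bar>c0\<bar> \<le> \<Lambda>"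
  defines "Q \<equiv> c0 * y1\<^sup>2 - 2 * b0 * (y1 * y2) + a0 * y2\<^sup>2"
  shows "0 \<le> Q" "y1\<^sup>2 + y2\<^sup>2 \<le> 2 * \<Lambda> * Q" "Q \<le> 2 * \<Lambda> * (y1\<^sup>2 + y2\<^sup>2)"
proof -
  have "0 < a0 * c0" using u zero_le_power2[of b0] by linarith
  then have c0: "0 < c0" using a0(1) by (simp add: zero_less_mult_iff)
  have "(a0 + c0) * Q = (a0 * c0 - b0\<^sup>2) * (y1\<^sup>2 + y2\<^sup>2) + (c0 * y1 - b0 * y2)\<^sup>2 + (a0 * y2 - b0 * y1)\<^sup>2"
    unfolding Q_def by (simp add: power2_eq_square algebra_simps)
  then have 1: "y1\<^sup>2 + y2\<^sup>2 \<le> (a0 + c0) * Q" unfolding u by simp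
  then have "0 \<le> (a0 + c0) * Q" by (rule order_trans[rotated]) simp
  then show Q0: "0 \<le> Q" using a0 c0 by (simp add: zero_le_mult_iff)
  have "(a0 + c0) * Q \<le> (2 * \<Lambda>) * Q" using Q0 assms by (intro mult_right_mono) auto
  with 1 show "y1\<^sup>2 + y2\<^sup>2 \<le> 2 * \<Lambda> * Q" by simp
  have "\<bar>y1 * y2\<bar> \<le> (y1\<^sup>2 + y2\<^sup>2) / 2"
    using zero_le_power2[of "y1 + y2"] zero_le_power2[of "y1 - y2"] by (simp add: power2_eq_square algebra_simps abs_le_iff)
  then have "\<bar>b0 * (y1 * y2)\<bar> \<le> \<Lambda> * ((y1\<^sup>2 + y2\<^sup>2) / 2)" using assms by (intro abs_mult_le) auto
  moreover have "c0 * y1\<^sup>2 \<le> \<Lambda> * y1\<^sup>2" "a0 * y2\<^sup>2 \<le> \<Lambda> * y2\<^sup>2" using assms by (intro mult_right_mono; simp)+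
  ultimately show "Q \<le> 2 * \<Lambda> * (y1\<^sup>2 + y2\<^sup>2)" unfolding Q_def by (simp add: abs_le_iff algebra_simps)
qed

lemma barrier_bound:
  fixes y1 y2 \<epsilon> \<Lambda> \<sigma> \<kappa> X l :: real
  assumes u: "a0 * c0 - b0\<^sup>2 = 1" and a0: "0 < a0"
    and \<Lambda>: "1 \<le> \<Lambda>" "\<bar>a\<bar> \<le> \<Lambda>" "\<bar>b\<bar> \<le> \<Lambda>" "\<bar>c\<bar> \<le> \<Lambda>" "\<bar>a0\<bar> \<le> \<Lambda>" "\<bar>b0\<bar> \<le> \<Lambda>" "\<bar>c0\<bar> \<le> \<Lambda>"
    and lip: "\<bar>a - a0\<bar> \<le> 2 * \<Lambda> * \<sigma>" "\<bar>b - b0\<bar> \<le> 2 * \<Lambda> * \<sigma>" "\<bar>c - c0\<bar> \<le> 2 * \<Lambda> * \<sigma>"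
    and d: "\<bar>d1\<bar> \<le> 2 * \<Lambda>" "\<bar>d2\<bar> \<le> 2 * \<Lambda>"
    and \<epsilon>: "0 < \<epsilon>" and \<sigma>: "0 < \<sigma>" "\<sigma>\<^sup>2 = y1\<^sup>2 + y2\<^sup>2 + \<epsilon>"
    and N: "N = c0 * y1\<^sup>2 - 2 * b0 * (y1 * y2) + a0 * y2\<^sup>2 + \<epsilon>"
    and q: "q1 = 2 * (c0 * y1 - b0 * y2)" "q2 = 2 * (a0 * y2 - b0 * y1)"
    and X: "0 \<le> X" "X \<le> 1" "\<bar>X1\<bar> \<le> 4" "\<bar>X2\<bar> \<le> 4" "\<bar>X11\<bar> \<le> 16" "\<bar>X12\<bar> \<le> 16" "\<bar>X22\<bar> \<le> 16"
    and l: "0 \<le> l" "l \<le> 10 * \<Lambda>\<^sup>2 / \<sigma>" and \<kappa>: "0 \<le> \<kappa>"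
  shows "a * (X11 * l - X1 * (q1 / N) - X * (c0 / N) + X * (q1 / N)\<^sup>2 / 2)
    + 2 * b * (X12 * l - (X1 * (q2 / N) + X2 * (q1 / N)) / 2 + X * (b0 / N) + X * ((q1 / N) * (q2 / N)) / 2)
    + c * (X22 * l - X2 * (q2 / N) - X * (a0 / N) + X * (q2 / N)\<^sup>2 / 2)
    + d1 * (X1 * l - X * (q1 / N) / 2) + d2 * (X2 * l - X * (q2 / N) / 2) + \<kappa> * (X * l)
    \<le> - (2 * X * \<epsilon> / N\<^sup>2) + (1216 * \<Lambda>^5 + 10 * \<kappa> * \<Lambda>\<^sup>2) / \<sigma>"
proof -
  define Q where "Q = c0 * y1\<^sup>2 - 2 * b0 * (y1 * y2) + a0 * y2\<^sup>2"
  have Qb: "0 \<le> Q" "y1\<^sup>2 + y2\<^sup>2 \<le> 2 * \<Lambda> * Q"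
    using unimodular_form_bounds[OF u a0, of \<Lambda> y1 y2] \<Lambda> by (auto simp: Q_def)
  have NQ: "N = Q + \<epsilon>" by (simp add: N Q_def)
  have N0: "0 < N" using NQ Qb \<epsilon> by simp
  have "\<sigma>\<^sup>2 \<le> 2 * \<Lambda> * N"
  proof -
    have "\<epsilon> * 1 \<le> \<epsilon> * (2 * \<Lambda>)" using \<epsilon> \<Lambda>(1) by (intro mult_left_mono) auto
    then show ?thesis unfolding \<sigma>(2) NQ using Qb(2) by (simp add: algebra_simps)
  qed
  then have iN: "1 / N \<le> 2 * \<Lambda> / \<sigma>\<^sup>2" using N0 \<sigma>(1) by (simp add: field_simps)
  have y: "\<bar>y1\<bar> \<le> \<sigma>" "\<bar>y2\<bar> \<le> \<sigma>"
    by (rule power2_le_imp_le; use \<sigma> \<epsilon> in simp)+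
  have q1: "\<bar>q1\<bar> \<le> 4 * \<Lambda> * \<sigma>"
    using abs_mult_le[OF \<Lambda>(7) y(1)] abs_mult_le[OF \<Lambda>(6) y(2)] by (simp add: q)
  have q2: "\<bar>q2\<bar> \<le> 4 * \<Lambda> * \<sigma>"
    using abs_mult_le[OF \<Lambda>(5) y(2)] abs_mult_le[OF \<Lambda>(6) y(1)] by (simp add: q)
  define r1 r2 where "r1 = q1 / N" and "r2 = q2 / N"
  have r: "\<bar>v / N\<bar> \<le> 8 * \<Lambda>\<^sup>2 / \<sigma>" if "\<bar>v\<bar> \<le> 4 * \<Lambda> * \<sigma>" for v
  proof -
    have "\<bar>v * (1 / N)\<bar> \<le> (4 * \<Lambda> * \<sigma>) * (2 * \<Lambda> / \<sigma>\<^sup>2)"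
      using iN N0 by (intro abs_mult_le that) simp
    also have "\<dots> = 8 * \<Lambda>\<^sup>2 / \<sigma>" using \<sigma>(1) by (simp add: power2_eq_square)
    finally show ?thesis by simp
  qed
  have r1: "\<bar>r1\<bar> \<le> 8 * \<Lambda>\<^sup>2 / \<sigma>" and r2: "\<bar>r2\<bar> \<le> 8 * \<Lambda>\<^sup>2 / \<sigma>" using r q1 q2 by (auto simp: r1_def r2_def)
  have X': "\<bar>X\<bar> \<le> 1" using X by simp
  have E1: "\<bar>(a * X11 + 2 * (b * X12) + c * X22 + d1 * X1 + d2 * X2 + \<kappa> * X) * l\<bar> \<le> (80 * \<Lambda> + \<kappa>) * (10 * \<Lambda>\<^sup>2 / \<sigma>)"
  proof (rule abs_mult_le)
    have k: "\<bar>\<kappa>\<bar> \<le> \<kappa>" using \<kappa> by simp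
    show "\<bar>a * X11 + 2 * (b * X12) + c * X22 + d1 * X1 + d2 * X2 + \<kappa> * X\<bar> \<le> 80 * \<Lambda> + \<kappa>"
      using abs_mult_le[OF \<Lambda>(2) X(5)] abs_mult_le[OF \<Lambda>(3) X(6)] abs_mult_le[OF \<Lambda>(4) X(7)]
        abs_mult_le[OF d(1) X(3)] abs_mult_le[OF d(2) X(4)] abs_mult_le[OF k X'] by linarith
  qed (use l in auto)
  define R where "R = 8 * \<Lambda>\<^sup>2 / \<sigma>"
  note r1 = r1[folded R_def] and r2 = r2[folded R_def]
  have E2: "\<bar>a * (X1 * r1) + b * (X1 * r2 + X2 * r1) + c * (X2 * r2)\<bar> \<le> 16 * \<Lambda> * R"
  proof -
    note xr = abs_mult_le[OF X(3) r1] abs_mult_le[OF X(3) r2] abs_mult_le[OF X(4) r1] abs_mult_le[OF X(4) r2]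
    have s: "\<bar>X1 * r1\<bar> \<le> 4 * R" "\<bar>X1 * r2 + X2 * r1\<bar> \<le> 8 * R" "\<bar>X2 * r2\<bar> \<le> 4 * R"
      using xr by linarith+
    show ?thesis
      using abs_mult_le[OF \<Lambda>(2) s(1)] abs_mult_le[OF \<Lambda>(3) s(2)] abs_mult_le[OF \<Lambda>(4) s(3)] by linarith
  qed
  have E3: "\<bar>X * (d1 * r1 + d2 * r2)\<bar> \<le> 1 * (4 * \<Lambda> * R)"
  proof (rule abs_mult_le[OF X'])
    have "\<bar>d1 * r1\<bar> \<le> 2 * \<Lambda> * R" "\<bar>d2 * r2\<bar> \<le> 2 * \<Lambda> * R" by (intro abs_mult_le d r1 r2)+
    then show "\<bar>d1 * r1 + d2 * r2\<bar> \<le> 4 * \<Lambda> * R" by linarith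
  qed
  have E4: "\<bar>X * (((a - a0) * c0 - 2 * ((b - b0) * b0) + (c - c0) * a0) * (1 / N))\<bar> \<le> 1 * ((8 * \<Lambda>\<^sup>2 * \<sigma>) * (2 * \<Lambda> / \<sigma>\<^sup>2))"
  proof (intro abs_mult_le X')
    have e: "2 * \<Lambda> * \<sigma> * \<Lambda> = 2 * (\<Lambda>\<^sup>2 * \<sigma>)" "8 * \<Lambda>\<^sup>2 * \<sigma> = 8 * (\<Lambda>\<^sup>2 * \<sigma>)"
      by (simp_all add: power2_eq_square)
    show "\<bar>(a - a0) * c0 - 2 * ((b - b0) * b0) + (c - c0) * a0\<bar> \<le> 8 * \<Lambda>\<^sup>2 * \<sigma>"
      using abs_mult_le[OF lip(1) \<Lambda>(7)] abs_mult_le[OF lip(2) \<Lambda>(6)] abs_mult_le[OF lip(3) \<Lambda>(5)]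
      unfolding e by linarith
  qed (use iN N0 in simp)
  have E5: "\<bar>X * ((a - a0) * r1\<^sup>2 + 2 * ((b - b0) * (r1 * r2)) + (c - c0) * r2\<^sup>2)\<bar> \<le> 1 * (8 * \<Lambda> * \<sigma> * (R * R))"
  proof (rule abs_mult_le[OF X'])
    show "\<bar>(a - a0) * r1\<^sup>2 + 2 * ((b - b0) * (r1 * r2)) + (c - c0) * r2\<^sup>2\<bar> \<le> 8 * \<Lambda> * \<sigma> * (R * R)"
      using abs_mult_le[OF lip(1) abs_mult_le[OF r1 r1]] abs_mult_le[OF lip(2) abs_mult_le[OF r1 r2]]
        abs_mult_le[OF lip(3) abs_mult_le[OF r2 r2]] unfolding power2_eq_square by linarith
  qed
  have main: "- (X * ((a0 * c0 - 2 * (b0 * b0) + c0 * a0) * (1 / N))) + X * (a0 * r1\<^sup>2 + 2 * (b0 * (r1 * r2)) + c0 * r2\<^sup>2) / 2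
      = - (2 * X * \<epsilon> / N\<^sup>2)"
  proof -
    have 1: "a0 * c0 - 2 * (b0 * b0) + c0 * a0 = 2" using u by (simp add: power2_eq_square algebra_simps)
    have "a0 * q1\<^sup>2 + 2 * (b0 * (q1 * q2)) + c0 * q2\<^sup>2 = 4 * ((a0 * c0 - b0\<^sup>2) * Q)"
      unfolding q Q_def by (simp add: power2_eq_square algebra_simps)
    then have 2: "a0 * r1\<^sup>2 + 2 * (b0 * (r1 * r2)) + c0 * r2\<^sup>2 = 4 * Q / N\<^sup>2"
      unfolding u r1_def r2_def by (simp add: power_divide power2_eq_square add_divide_distrib[symmetric])
    have "- (X * (2 * (1 / N))) + X * (4 * Q / N\<^sup>2) / 2 = - (2 * X * (N - Q) / N\<^sup>2)"
      using N0 by (simp add: field_simps power2_eq_square)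
    then show ?thesis unfolding 1 2 NQ by simp
  qed
  have split: "a * (X11 * l - X1 * (q1 / N) - X * (c0 / N) + X * (q1 / N)\<^sup>2 / 2)
    + 2 * b * (X12 * l - (X1 * (q2 / N) + X2 * (q1 / N)) / 2 + X * (b0 / N) + X * ((q1 / N) * (q2 / N)) / 2)
    + c * (X22 * l - X2 * (q2 / N) - X * (a0 / N) + X * (q2 / N)\<^sup>2 / 2)
    + d1 * (X1 * l - X * (q1 / N) / 2) + d2 * (X2 * l - X * (q2 / N) / 2) + \<kappa> * (X * l)
    = (a * X11 + 2 * (b * X12) + c * X22 + d1 * X1 + d2 * X2 + \<kappa> * X) * l
      - (a * (X1 * r1) + b * (X1 * r2 + X2 * r1) + c * (X2 * r2))
      - X * (d1 * r1 + d2 * r2) / 2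
      - X * (((a - a0) * c0 - 2 * ((b - b0) * b0) + (c - c0) * a0) * (1 / N))
      + X * ((a - a0) * r1\<^sup>2 + 2 * ((b - b0) * (r1 * r2)) + (c - c0) * r2\<^sup>2) / 2
      + (- (X * ((a0 * c0 - 2 * (b0 * b0) + c0 * a0) * (1 / N))) + X * (a0 * r1\<^sup>2 + 2 * (b0 * (r1 * r2)) + c0 * r2\<^sup>2) / 2)"
  proof -
    have n: "c0 / N = c0 * (1 / N)" "b0 / N = b0 * (1 / N)" "a0 / N = a0 * (1 / N)" by simp_all
    show ?thesis unfolding r1_def[symmetric] r2_def[symmetric] n
      by (simp add: power2_eq_square left_diff_distrib right_diff_distrib distrib_left distrib_right
          add_divide_distrib diff_divide_distrib mult.assoc mult.left_commute)
  qed
  have b1: "(80 * \<Lambda> + \<kappa>) * (10 * \<Lambda>\<^sup>2 / \<sigma>) = (800 * \<Lambda>^3 + 10 * \<kappa> * \<Lambda>\<^sup>2) / \<sigma>"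
    by (simp add: power2_eq_square power3_eq_cube algebra_simps add_divide_distrib)
  have b2: "16 * \<Lambda> * R = 128 * \<Lambda>^3 / \<sigma>" by (simp add: R_def power2_eq_square power3_eq_cube)
  have b3: "1 * (4 * \<Lambda> * R) / 2 = 16 * \<Lambda>^3 / \<sigma>" by (simp add: R_def power2_eq_square power3_eq_cube)
  have b4: "1 * ((8 * \<Lambda>\<^sup>2 * \<sigma>) * (2 * \<Lambda> / \<sigma>\<^sup>2)) = 16 * \<Lambda>^3 / \<sigma>" using \<sigma>(1) by (simp add: power2_eq_square power3_eq_cube)
  have b5: "1 * (8 * \<Lambda> * \<sigma> * (R * R)) / 2 = 256 * \<Lambda>^5 / \<sigma>" using \<sigma>(1) by (simp add: R_def power2_eq_square eval_nat_numeral)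
  \<comment> \<open>1216 = 800 + 128 + 16 + 16 + 256 collects the five errors; the first four carry
    \<Lambda>^3 and are raised to \<Lambda>^5.\<close>
  have "\<Lambda>^3 \<le> \<Lambda>^5" using \<Lambda>(1) by (intro power_increasing) auto
  then have "(960 * \<Lambda>^3) / \<sigma> \<le> (960 * \<Lambda>^5) / \<sigma>" using \<sigma>(1) by (intro divide_right_mono) auto
  then have sum: "(800 * \<Lambda>^3 + 10 * \<kappa> * \<Lambda>\<^sup>2) / \<sigma> + 128 * \<Lambda>^3 / \<sigma> + 16 * \<Lambda>^3 / \<sigma> + 16 * \<Lambda>^3 / \<sigma> + 256 * \<Lambda>^5 / \<sigma>
     \<le> (1216 * \<Lambda>^5 + 10 * \<kappa> * \<Lambda>\<^sup>2) / \<sigma>"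
    by (simp add: add_divide_distrib)
  have fin: "A - B - C / 2 - D + E / 2 + m \<le> m + (\<bar>A\<bar> + \<bar>B\<bar> + \<bar>C\<bar> / 2 + \<bar>D\<bar> + \<bar>E\<bar> / 2)" for A B C D E m :: real
    by linarith
  show ?thesis unfolding split main
    by (rule order_trans[OF fin]) (use E1 E2 E3 E4 E5 b1 b2 b3 b4 b5 sum in linarith)
qed

lemma lipschitz_from_partials:
  fixes f :: "real^2 \<Rightarrow> real"
  assumes "convex K" "\<And>x. x \<in> K ==> f differentiable (at x)"
    and "\<And>x i. x \<in> K ==> \<bar>partial_deriv i f x\<bar> \<le> B" "x \<in> K" "y \<in> K"
  shows "\<bar>f x - f y\<bar> \<le> 2 * B * norm (x - y)"
proof -
  let ?f' = "\<lambda>x (h :: real^2). h $ 1 * partial_deriv 1 f x + h $ 2 * partial_deriv 2 f x"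
  have der: "(f has_derivative ?f' z) (at z within K)" if "z \<in> K" for z
    using smooth_on_has_derivative[OF assms(2)[OF that]] by (rule has_derivative_at_withinI)
  have on: "onorm (?f' z) \<le> 2 * B" if z: "z \<in> K" for z
  proof -
    have "norm (?f' z h) \<le> 2 * B * norm h" for h :: "real^2"
    proof -
      have "\<bar>h $ 1 * partial_deriv 1 f z\<bar> \<le> norm h * B" "\<bar>h $ 2 * partial_deriv 2 f z\<bar> \<le> norm h * B"
        by (intro abs_mult_le component_le_norm_cart assms(3)[OF z])+
      then have "\<bar>h $ 1 * partial_deriv 1 f z + h $ 2 * partial_deriv 2 f z\<bar> \<le> norm h * B + norm h * B" by linarith
      then show ?thesis by (simp add: algebra_simps)
    qed
    then show ?thesis by (rule onorm_le)
  qed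
  have "norm (f x - f y) \<le> (2 * B) * norm (x - y)"
    by (rule differentiable_bound[OF assms(1) der on assms(4,5)])
  then show ?thesis by simp
qed

section \<open>The barrier: a cut-off logarithm\<close>

context elliptic_operator
begin

lemma coefficient_bounds:
  assumes "cbox p q \<subseteq> S"
  obtains \<Lambda> where "1 \<le> \<Lambda>"
    "\<And>x. x \<in> cbox p q ==> \<bar>\<alpha> x\<bar> \<le> \<Lambda> \<and> \<bar>\<beta> x\<bar> \<le> \<Lambda> \<and> \<bar>\<gamma> x\<bar> \<le> \<Lambda>"
    "\<And>x i. x \<in> cbox p q ==> \<bar>partial_deriv i \<alpha> x\<bar> \<le> \<Lambda> \<and> \<bar>partial_deriv i \<beta> x\<bar> \<le> \<Lambda> \<and> \<bar>partial_deriv i \<gamma> x\<bar> \<le> \<Lambda>"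
proof -
  have bdd: "\<exists>B. \<forall>x\<in>cbox p q. \<bar>f x\<bar> \<le> B" if "smooth_on S f" for f
  proof -
    have "bounded (f ` cbox p q)"
      by (intro compact_imp_bounded compact_continuous_image compact_cbox
          continuous_on_subset[OF smooth_on_imp_continuous_on[OF that] assms])
    then show ?thesis unfolding bounded_iff by auto
  qed
  define F where "F = {\<alpha>, \<beta>, \<gamma>, partial_deriv 1 \<alpha>, partial_deriv 1 \<beta>, partial_deriv 1 \<gamma>, partial_deriv 2 \<alpha>, partial_deriv 2 \<beta>, partial_deriv 2 \<gamma>}"
  have "\<forall>f\<in>F. \<exists>B. \<forall>x\<in>cbox p q. \<bar>f x\<bar> \<le> B"
    unfolding F_def using smooth_coeffs by (auto intro!: bdd smooth_on_partial)
  from bchoice[OF this] obtain b where b: "\<forall>f\<in>F. \<forall>x\<in>cbox p q. \<bar>f x\<bar> \<le> b f" ..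
  have finF: "finite F" by (simp add: F_def)
  define \<Lambda> where "\<Lambda> = 1 + (\<Sum>f\<in>F. \<bar>b f\<bar>)"
  have le: "\<bar>f x\<bar> \<le> \<Lambda>" if "f \<in> F" "x \<in> cbox p q" for f x
  proof -
    have "\<bar>f x\<bar> \<le> \<bar>b f\<bar>" using b that by force
    also have "\<dots> \<le> (\<Sum>f\<in>F. \<bar>b f\<bar>)" using that finF by (intro member_le_sum) auto
    finally show ?thesis by (simp add: \<Lambda>_def)
  qed
  show ?thesis
  proof (rule that[of \<Lambda>])
    show "1 \<le> \<Lambda>" unfolding \<Lambda>_def by (simp add: sum_nonneg)
    show "\<bar>\<alpha> x\<bar> \<le> \<Lambda> \<and> \<bar>\<beta> x\<bar> \<le> \<Lambda> \<and> \<bar>\<gamma> x\<bar> \<le> \<Lambda>" if "x \<in> cbox p q" for x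
      by (intro conjI le that) (simp_all add: F_def)
    show "\<bar>partial_deriv i \<alpha> x\<bar> \<le> \<Lambda> \<and> \<bar>partial_deriv i \<beta> x\<bar> \<le> \<Lambda> \<and> \<bar>partial_deriv i \<gamma> x\<bar> \<le> \<Lambda>" if "x \<in> cbox p q" for x i
    proof -
      have "i = 1 \<or> i = 2" by (rule exhaust_2)
      then show ?thesis by (intro conjI le that) (auto simp: F_def)
    qed
  qed
qed

text \<open>The test function is a cut-off of the fundamental solution of the operator frozen at \<open>x0\<close>,
  regularised by \<open>\<epsilon>\<close>.\<close>

definition barrier_form :: "real^2 \<Rightarrow> real \<Rightarrow> real^2 \<Rightarrow> real" where
  "barrier_form x0 \<epsilon> x = \<gamma> x0 * (x $ 1 - x0 $ 1)\<^sup>2 - 2 * \<beta> x0 * ((x $ 1 - x0 $ 1) * (x $ 2 - x0 $ 2)) + \<alpha> x0 * (x $ 2 - x0 $ 2)\<^sup>2 + \<epsilon>"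

text \<open>Each factor is squared so that the cut-off and its first derivatives vanish on the
  boundary of the square, as \<open>L_symmetric\<close> demands of the test function.\<close>

definition cutoff :: "real \<Rightarrow> real^2 \<Rightarrow> real^2 \<Rightarrow> real" where
  "cutoff r x0 x = (r\<^sup>2 - (x $ 1 - x0 $ 1)\<^sup>2)\<^sup>2 * (r\<^sup>2 - (x $ 2 - x0 $ 2)\<^sup>2)\<^sup>2"

definition barrier :: "real \<Rightarrow> real \<Rightarrow> real^2 \<Rightarrow> real \<Rightarrow> real^2 \<Rightarrow> real" where
  "barrier M r x0 \<epsilon> x = cutoff r x0 x * ((ln M - ln (barrier_form x0 \<epsilon> x)) / 2)"

context
  fixes x0 :: "real^2" and \<epsilon> M r \<Lambda> :: real
  assumes x0: "x0 \<in> S" and \<epsilon>: "0 < \<epsilon>" and \<Lambda>0: "\<bar>\<alpha> x0\<bar> \<le> \<Lambda>" "\<bar>\<beta> x0\<bar> \<le> \<Lambda>" "\<bar>\<gamma> x0\<bar> \<le> \<Lambda>"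
begin

abbreviation "N \<equiv> barrier_form x0 \<epsilon>"
abbreviation "X \<equiv> cutoff r x0"
abbreviation "l \<equiv> \<lambda>x. (ln M - ln (N x)) / 2"
abbreviation "y1 \<equiv> \<lambda>x :: real^2. x $ 1 - x0 $ 1"
abbreviation "y2 \<equiv> \<lambda>x :: real^2. x $ 2 - x0 $ 2"
text \<open>Closed forms of derivatives: q1, q2 are the partial derivatives of N, and Xi, Xij those
  of the cut-off X.\<close>

abbreviation "q1 \<equiv> \<lambda>x :: real^2. 2 * (\<gamma> x0 * y1 x - \<beta> x0 * y2 x)"
abbreviation "q2 \<equiv> \<lambda>x :: real^2. 2 * (\<alpha> x0 * y2 x - \<beta> x0 * y1 x)"
abbreviation "X1 \<equiv> \<lambda>x :: real^2. (- 4 * y1 x * (r\<^sup>2 - (y1 x)\<^sup>2)) * (r\<^sup>2 - (y2 x)\<^sup>2)\<^sup>2"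
abbreviation "X2 \<equiv> \<lambda>x :: real^2. (r\<^sup>2 - (y1 x)\<^sup>2)\<^sup>2 * (- 4 * y2 x * (r\<^sup>2 - (y2 x)\<^sup>2))"
abbreviation "X11 \<equiv> \<lambda>x :: real^2. (12 * (y1 x)\<^sup>2 - 4 * r\<^sup>2) * (r\<^sup>2 - (y2 x)\<^sup>2)\<^sup>2"
abbreviation "X12 \<equiv> \<lambda>x :: real^2. (- 4 * y1 x * (r\<^sup>2 - (y1 x)\<^sup>2)) * (- 4 * y2 x * (r\<^sup>2 - (y2 x)\<^sup>2))"
abbreviation "X22 \<equiv> \<lambda>x :: real^2. (r\<^sup>2 - (y1 x)\<^sup>2)\<^sup>2 * (12 * (y2 x)\<^sup>2 - 4 * r\<^sup>2)"

lemma unimodular0: "\<alpha> x0 * \<gamma> x0 - (\<beta> x0)\<^sup>2 = 1" and \<alpha>0: "0 < \<alpha> x0"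
  using unimodular[OF x0] \<alpha>_pos[OF x0] by auto

lemma N_pos: "0 < N x"
  using unimodular_form_bounds(1)[OF unimodular0 \<alpha>0, of \<Lambda> "y1 x" "y2 x"] \<Lambda>0 \<epsilon> \<alpha>0
  by (simp add: barrier_form_def)

lemma partial_N: "partial_deriv 1 N x = q1 x" "partial_deriv 2 N x = q2 x" and differentiable_N: "N differentiable (at x)"
  unfolding barrier_form_def[abs_def] by (simp_all add: pd_simps algebra_simps)

lemma partial_X: "partial_deriv 1 X x = X1 x" "partial_deriv 2 X x = X2 x" and differentiable_X: "X differentiable (at x)"
  unfolding cutoff_def[abs_def] by (simp_all add: pd_simps algebra_simps)

lemma partial_X': "partial_deriv 1 X1 x = X11 x" "partial_deriv 1 X2 x = X12 x" "partial_deriv 2 X2 x = X22 x"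
  and differentiable_X': "X1 differentiable (at x)" "X2 differentiable (at x)"
  by (simp_all add: pd_simps, simp_all add: power2_eq_square algebra_simps)

lemma partial_l: "partial_deriv i l x = - (partial_deriv i N x / N x) / 2" and differentiable_l: "l differentiable (at x)"
proof -
  have d: "((\<lambda>t. (ln M - ln t) / 2) has_field_derivative - (1 / N x) / 2) (at (N x))"
    using N_pos[of x] by (auto intro!: derivative_eq_intros)
  show "partial_deriv i l x = - (partial_deriv i N x / N x) / 2"
    using partial_deriv_compose[OF differentiable_N d, of i] by simp
  show "l differentiable (at x)" by (rule differentiable_compose_real[OF differentiable_N d])
qed

lemma partial_quotient:
  assumes "f differentiable (at x)"
  shows "partial_deriv i (\<lambda>y. f y / N y) x = partial_deriv i f x / N x - f x * partial_deriv i N x / (N x)\<^sup>2"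
    and "(\<lambda>y. f y / N y) differentiable (at x)"
proof -
  have d: "((\<lambda>t. inverse t) has_field_derivative - inverse ((N x)\<^sup>2)) (at (N x))"
    using N_pos[of x] by (auto intro!: derivative_eq_intros simp: power2_eq_square)
  have di: "(\<lambda>y. inverse (N y)) differentiable (at x)" by (rule differentiable_compose_real[OF differentiable_N d])
  show "partial_deriv i (\<lambda>y. f y / N y) x = partial_deriv i f x / N x - f x * partial_deriv i N x / (N x)\<^sup>2"
    using partial_deriv_mult[OF assms di, of i] partial_deriv_compose[OF differentiable_N d, of i]
    by (simp add: divide_inverse algebra_simps)
  show "(\<lambda>y. f y / N y) differentiable (at x)"
    using differentiable_mult[OF assms di] by (simp add: divide_inverse)
qed

lemma smooth_barrier: "smooth_on T (barrier M r x0 \<epsilon>)" if "open T"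
proof -
  have "smooth_on T N" unfolding barrier_form_def[abs_def]
    by (intro smooth_on_add smooth_on_diff smooth_on_mult smooth_on_power smooth_on_const smooth_on_coord that)
  then have "smooth_on T (\<lambda>x. X x * ((1/2) * (ln M - ln (N x))))"
    unfolding cutoff_def[abs_def]
    by (intro smooth_on_mult smooth_on_diff smooth_on_ln smooth_on_power smooth_on_const smooth_on_coord that N_pos)
  then show ?thesis by (simp add: barrier_def[abs_def])
qed

lemma partial_barrier:
  "partial_deriv 1 (barrier M r x0 \<epsilon>) = (\<lambda>x. X1 x * l x - X x * (q1 x / N x) / 2)"
  "partial_deriv 2 (barrier M r x0 \<epsilon>) = (\<lambda>x. X2 x * l x - X x * (q2 x / N x) / 2)"
  unfolding barrier_def[abs_def] fun_eq_iff
  by (simp_all only: partial_deriv_mult[OF differentiable_X differentiable_l] partial_X partial_l partial_N) (auto simp: algebra_simps)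

text \<open>Both first derivatives of the barrier have the shape Y l - X (f / N) / 2, so one formula
  covers all its second derivatives.\<close>

lemma second_partial:
  assumes "Y differentiable (at x)" "f differentiable (at x)"
  shows "partial_deriv i (\<lambda>x. Y x * l x - X x * (f x / N x) / 2) x
    = partial_deriv i Y x * l x - Y x * (partial_deriv i N x / N x) / 2
      - (partial_deriv i X x * (f x / N x) + X x * (partial_deriv i f x / N x - (f x / N x) * (partial_deriv i N x / N x))) / 2"
proof -
  note q = partial_quotient[OF assms(2)]
  have h: "(\<lambda>x. Y x * l x - X x * (f x / N x) / 2) = (\<lambda>x. Y x * l x - 1/2 * (X x * (f x / N x)))" by auto
  have d: "(\<lambda>x. X x * (f x / N x)) differentiable (at x)" by (intro differentiable_mult differentiable_X q)
  have e: "partial_deriv i (\<lambda>x. Y x * l x - 1/2 * (X x * (f x / N x))) x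
    = partial_deriv i (\<lambda>x. Y x * l x) x - 1/2 * partial_deriv i (\<lambda>x. X x * (f x / N x)) x"
  proof -
    have c: "(\<lambda>x. 1/2 :: real) differentiable (at x)" by simp
    show ?thesis
      unfolding partial_deriv_diff[OF differentiable_mult[OF assms(1) differentiable_l] differentiable_mult[OF c d]]
        partial_deriv_mult[OF c d] partial_deriv_const by simp
  qed
  show ?thesis
    unfolding h e partial_deriv_mult[OF assms(1) differentiable_l] partial_deriv_mult[OF differentiable_X q(2)] partial_l q(1)
    by (simp add: power2_eq_square algebra_simps add_divide_distrib diff_divide_distrib)
qed

lemma L_barrier:
  assumes "x \<in> S"
  shows "L (barrier M r x0 \<epsilon>) x
    = \<alpha> x * (X11 x * l x - X1 x * (q1 x / N x) - X x * (\<gamma> x0 / N x) + X x * (q1 x / N x)\<^sup>2 / 2)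
    + 2 * \<beta> x * (X12 x * l x - (X1 x * (q2 x / N x) + X2 x * (q1 x / N x)) / 2 + X x * (\<beta> x0 / N x) + X x * ((q1 x / N x) * (q2 x / N x)) / 2)
    + \<gamma> x * (X22 x * l x - X2 x * (q2 x / N x) - X x * (\<alpha> x0 / N x) + X x * (q2 x / N x)\<^sup>2 / 2)
    + (partial_deriv 1 \<alpha> x + partial_deriv 2 \<beta> x) * (X1 x * l x - X x * (q1 x / N x) / 2)
    + (partial_deriv 1 \<beta> x + partial_deriv 2 \<gamma> x) * (X2 x * l x - X x * (q2 x / N x) / 2)"
proof -
  have dq: "q1 differentiable (at x)" "q2 differentiable (at x)" by (simp_all add: pd_simps)
  have pq: "partial_deriv 1 q1 x = 2 * \<gamma> x0" "partial_deriv 1 q2 x = - 2 * \<beta> x0" "partial_deriv 2 q2 x = 2 * \<alpha> x0"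
    by (simp_all add: pd_simps)
  have a: "Y' * l' - Y * t / 2 - (Y * t + Z * (2 * g / n - t * t)) / 2 = Y' * l' - Y * t - Z * (g / n) + Z * t\<^sup>2 / 2"
    for Y' l' Y t Z g n :: real by (simp add: power2_eq_square field_simps)
  have b: "Y' * l' - Y * s / 2 - (W * t + Z * (- 2 * g / n - t * s)) / 2 = Y' * l' - (W * t + Y * s) / 2 + Z * (g / n) + Z * (s * t) / 2"
    for Y' l' Y t s W Z g n :: real by (simp add: field_simps)
  show ?thesis
    unfolding L_expand[OF smooth_barrier[OF open_S] assms] partial_barrier
      second_partial[OF differentiable_X'(1) dq(1)] second_partial[OF differentiable_X'(2) dq(2)] partial_X' partial_N partial_X pq a b
    by (rule refl)
qed

end

end

lemma measure_square: "0 \<le> t ==> measure lborel (square z t) = 4 * t\<^sup>2"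
proof -
  assume t: "0 \<le> t"
  then have "z \<in> square z t" by (simp add: mem_square)
  then have "square z t \<noteq> {}" by blast
  then show ?thesis by (subst content_cbox_cart) (auto simp: UNIV_2 power2_eq_square algebra_simps)
qed

context elliptic_operator
begin

lemma cutoff_bounds:
  assumes "\<bar>s\<bar> \<le> r" "\<bar>t\<bar> \<le> r" "0 < r" "r \<le> (1::real)"
  shows "0 \<le> (r\<^sup>2 - s\<^sup>2)\<^sup>2 * (r\<^sup>2 - t\<^sup>2)\<^sup>2" "(r\<^sup>2 - s\<^sup>2)\<^sup>2 * (r\<^sup>2 - t\<^sup>2)\<^sup>2 \<le> 1"
    "\<bar>(- 4 * s * (r\<^sup>2 - s\<^sup>2)) * (r\<^sup>2 - t\<^sup>2)\<^sup>2\<bar> \<le> 4" "\<bar>(r\<^sup>2 - s\<^sup>2)\<^sup>2 * (- 4 * t * (r\<^sup>2 - t\<^sup>2))\<bar> \<le> 4"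
    "\<bar>(12 * s\<^sup>2 - 4 * r\<^sup>2) * (r\<^sup>2 - t\<^sup>2)\<^sup>2\<bar> \<le> 16" "\<bar>(- 4 * s * (r\<^sup>2 - s\<^sup>2)) * (- 4 * t * (r\<^sup>2 - t\<^sup>2))\<bar> \<le> 16"
    "\<bar>(r\<^sup>2 - s\<^sup>2)\<^sup>2 * (12 * t\<^sup>2 - 4 * r\<^sup>2)\<bar> \<le> 16"
proof -
  have *: "\<bar>r\<^sup>2 - s\<^sup>2\<bar> \<le> 1 \<and> \<bar>(r\<^sup>2 - s\<^sup>2)\<^sup>2\<bar> \<le> 1 \<and> \<bar>- 4 * s * (r\<^sup>2 - s\<^sup>2)\<bar> \<le> 4 \<and> \<bar>12 * s\<^sup>2 - 4 * r\<^sup>2\<bar> \<le> 16"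
    if "\<bar>s\<bar> \<le> r" for s :: real
  proof -
    have "s\<^sup>2 \<le> r\<^sup>2" using that by (simp add: abs_le_square_iff[symmetric])
    moreover have "r\<^sup>2 \<le> 1" using assms(3,4) by (simp add: power_le_one)
    moreover have "0 \<le> s\<^sup>2" by simp
    ultimately have 1: "\<bar>r\<^sup>2 - s\<^sup>2\<bar> \<le> 1" and 4: "\<bar>12 * s\<^sup>2 - 4 * r\<^sup>2\<bar> \<le> 16" by linarith+
    have 2: "\<bar>(r\<^sup>2 - s\<^sup>2)\<^sup>2\<bar> \<le> 1" using abs_mult_le[OF 1 1] by (simp add: power2_eq_square)
    have "\<bar>- 4 * s\<bar> \<le> 4" using that assms(4) by (simp add: abs_mult)
    from abs_mult_le[OF this 1] 1 2 4 show ?thesis by simp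
  qed
  note s = *[OF assms(1)] and t = *[OF assms(2)]
  show "0 \<le> (r\<^sup>2 - s\<^sup>2)\<^sup>2 * (r\<^sup>2 - t\<^sup>2)\<^sup>2" by simp
  show "(r\<^sup>2 - s\<^sup>2)\<^sup>2 * (r\<^sup>2 - t\<^sup>2)\<^sup>2 \<le> 1"
    using abs_mult_le[of "(r\<^sup>2 - s\<^sup>2)\<^sup>2" 1 "(r\<^sup>2 - t\<^sup>2)\<^sup>2" 1] s t by simp
  show "\<bar>(- 4 * s * (r\<^sup>2 - s\<^sup>2)) * (r\<^sup>2 - t\<^sup>2)\<^sup>2\<bar> \<le> 4"
    using abs_mult_le[of "- 4 * s * (r\<^sup>2 - s\<^sup>2)" 4 "(r\<^sup>2 - t\<^sup>2)\<^sup>2" 1] s t by simp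
  show "\<bar>(r\<^sup>2 - s\<^sup>2)\<^sup>2 * (- 4 * t * (r\<^sup>2 - t\<^sup>2))\<bar> \<le> 4"
    using abs_mult_le[of "(r\<^sup>2 - s\<^sup>2)\<^sup>2" 1 "- 4 * t * (r\<^sup>2 - t\<^sup>2)" 4] s t by simp
  show "\<bar>(12 * s\<^sup>2 - 4 * r\<^sup>2) * (r\<^sup>2 - t\<^sup>2)\<^sup>2\<bar> \<le> 16"
    using abs_mult_le[of "12 * s\<^sup>2 - 4 * r\<^sup>2" 16 "(r\<^sup>2 - t\<^sup>2)\<^sup>2" 1] s t by simp
  show "\<bar>(- 4 * s * (r\<^sup>2 - s\<^sup>2)) * (- 4 * t * (r\<^sup>2 - t\<^sup>2))\<bar> \<le> 16"
    using abs_mult_le[of "- 4 * s * (r\<^sup>2 - s\<^sup>2)" 4 "- 4 * t * (r\<^sup>2 - t\<^sup>2)" 4] s t by simp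
  show "\<bar>(r\<^sup>2 - s\<^sup>2)\<^sup>2 * (12 * t\<^sup>2 - 4 * r\<^sup>2)\<bar> \<le> 16"
    using abs_mult_le[of "(r\<^sup>2 - s\<^sup>2)\<^sup>2" 1 "12 * t\<^sup>2 - 4 * r\<^sup>2" 16] s t by simp
qed

lemma convex_square: "convex (square z t)"
  by (rule convex_box)

lemma norm_vec2: "norm (v :: real^2) = sqrt ((v $ 1)\<^sup>2 + (v $ 2)\<^sup>2)"
  by (simp add: norm_eq_sqrt_inner inner_vec_def sum_2 power2_eq_square)

text \<open>As \<open>\<epsilon>\<close> tends to 0, the first term on the right concentrates at \<open>x0\<close> with mass bounded
  below, while the second stays integrable with a factor independent of \<open>\<epsilon>\<close>.\<close>

lemma barrier_properties:
  assumes r: "0 < r" "r \<le> 1" and box: "square x0 r \<subseteq> S"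
    and \<Lambda>: "1 \<le> \<Lambda>"
    and b0: "\<And>x. x \<in> square x0 r ==> \<bar>\<alpha> x\<bar> \<le> \<Lambda> \<and> \<bar>\<beta> x\<bar> \<le> \<Lambda> \<and> \<bar>\<gamma> x\<bar> \<le> \<Lambda>"
    and b1: "\<And>x i. x \<in> square x0 r ==>
      \<bar>partial_deriv i \<alpha> x\<bar> \<le> \<Lambda> \<and> \<bar>partial_deriv i \<beta> x\<bar> \<le> \<Lambda> \<and> \<bar>partial_deriv i \<gamma> x\<bar> \<le> \<Lambda>"
    and \<epsilon>: "0 < \<epsilon>" "\<epsilon> \<le> 1" and \<kappa>: "0 \<le> \<kappa>"
    and x: "x \<in> square x0 r"
  shows "0 \<le> barrier (5 * \<Lambda>) r x0 \<epsilon> x"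
    and "L (barrier (5 * \<Lambda>) r x0 \<epsilon>) x + \<kappa> * barrier (5 * \<Lambda>) r x0 \<epsilon> x
      \<le> - (2 * cutoff r x0 x * \<epsilon> / (barrier_form x0 \<epsilon> x)\<^sup>2)
        + (1216 * \<Lambda>^5 + 10 * \<kappa> * \<Lambda>\<^sup>2) * (1 / sqrt ((x $ 1 - x0 $ 1)\<^sup>2 + (x $ 2 - x0 $ 2)\<^sup>2 + \<epsilon>))"
    and "0 < barrier_form x0 \<epsilon> x"
    and "barrier_form x0 \<epsilon> x \<le> 2 * \<Lambda> * ((x $ 1 - x0 $ 1)\<^sup>2 + (x $ 2 - x0 $ 2)\<^sup>2) + \<epsilon>"
proof -
  let ?K = "square x0 r"
  have x0K: "x0 \<in> ?K" using r by (simp add: mem_square)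
  then have x0: "x0 \<in> S" using box by blast
  have xS: "x \<in> S" using x box by blast
  have L0: "\<bar>\<alpha> x0\<bar> \<le> \<Lambda>" "\<bar>\<beta> x0\<bar> \<le> \<Lambda>" "\<bar>\<gamma> x0\<bar> \<le> \<Lambda>" using b0[OF x0K] by auto
  note u = unimodular0[OF x0 \<epsilon>(1) L0] and a0 = \<alpha>0[OF x0 \<epsilon>(1) L0]
  define y1 y2 where "y1 = x $ 1 - x0 $ 1" and "y2 = x $ 2 - x0 $ 2"
  have yr: "\<bar>y1\<bar> \<le> r" "\<bar>y2\<bar> \<le> r" using x by (auto simp: mem_square y1_def y2_def)
  define N where "N = barrier_form x0 \<epsilon> x"
  define \<sigma> where "\<sigma> = sqrt (y1\<^sup>2 + y2\<^sup>2 + \<epsilon>)"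
  have \<sigma>2: "\<sigma>\<^sup>2 = y1\<^sup>2 + y2\<^sup>2 + \<epsilon>" unfolding \<sigma>_def using \<epsilon> by simp
  have \<sigma>: "0 < \<sigma>" unfolding \<sigma>_def using \<epsilon> by (simp add: add_nonneg_pos)
  have Neq: "N = \<gamma> x0 * y1\<^sup>2 - 2 * \<beta> x0 * (y1 * y2) + \<alpha> x0 * y2\<^sup>2 + \<epsilon>"
    by (simp add: N_def barrier_form_def y1_def y2_def)
  have aL: "\<alpha> x0 \<le> \<Lambda>" using L0 by simp
  note Q = unimodular_form_bounds[OF u a0 aL L0(2,3), of y1 y2]
  have N0: "0 < N" using Q(1) \<epsilon> by (simp add: Neq)
  then show "0 < barrier_form x0 \<epsilon> x" by (simp add: N_def)
  have Nup: "N \<le> 2 * \<Lambda> * (y1\<^sup>2 + y2\<^sup>2) + \<epsilon>" using Q(3) by (simp add: Neq)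
  then show "barrier_form x0 \<epsilon> x \<le> 2 * \<Lambda> * ((x $ 1 - x0 $ 1)\<^sup>2 + (x $ 2 - x0 $ 2)\<^sup>2) + \<epsilon>"
    by (simp add: N_def y1_def y2_def)
  have sq: "y\<^sup>2 \<le> 1" if "\<bar>y\<bar> \<le> r" for y
    using that r(2) abs_le_square_iff[of y 1] by simp
  note sq1 = sq[OF yr(1)] sq[OF yr(2)]
  \<comment> \<open>Here M = 5 \<Lambda> is explained: on a square with r \<le> 1 the form is at
    most 4 \<Lambda> + \<epsilon>, so the logarithm in the barrier is nonnegative.\<close>
  have N5: "N \<le> 5 * \<Lambda>"
  proof -
    have "2 * \<Lambda> * (y1\<^sup>2 + y2\<^sup>2) \<le> 2 * \<Lambda> * 2" using sq1 \<Lambda> by (intro mult_left_mono) auto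
    then show ?thesis using Nup \<epsilon> \<Lambda> by linarith
  qed
  define l where "l = (ln (5 * \<Lambda>) - ln N) / 2"
  have l0: "0 \<le> l" using N5 N0 \<Lambda> by (simp add: l_def)
  \<comment> \<open>The logarithm is bounded very crudely, by ln t \<le> t - 1; any bound of order 1
    / \<sigma> will do, as the other errors are of that order.\<close>
  have lup: "l \<le> 10 * \<Lambda>\<^sup>2 / \<sigma>"
  proof -
    have "\<sigma>\<^sup>2 \<le> 2 * \<Lambda> * N"
    proof -
      have "\<epsilon> * 1 \<le> \<epsilon> * (2 * \<Lambda>)" using \<epsilon> \<Lambda> by (intro mult_left_mono) auto
      then show ?thesis unfolding \<sigma>2 Neq using Q(2) by (simp add: algebra_simps)
    qed
    then have "5 * \<Lambda> * \<sigma>\<^sup>2 \<le> 5 * \<Lambda> * (2 * \<Lambda> * N)" using \<Lambda> by (intro mult_left_mono) auto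
    also have "\<dots> \<le> (4 * \<Lambda>)\<^sup>2 * N" using N0 \<Lambda> by (simp add: power2_eq_square)
    finally have "5 * \<Lambda> / N \<le> (4 * \<Lambda> / \<sigma>)\<^sup>2" using N0 \<sigma> by (simp add: field_simps power2_eq_square)
    then have "ln (5 * \<Lambda> / N) \<le> ln ((4 * \<Lambda> / \<sigma>)\<^sup>2)" using N0 \<Lambda> \<sigma> by (subst ln_le_cancel_iff) auto
    also have "\<dots> = 2 * ln (4 * \<Lambda> / \<sigma>)" using \<Lambda> \<sigma> by (subst ln_realpow) auto
    also have "\<dots> \<le> 2 * (4 * \<Lambda> / \<sigma>)" using ln_le_minus_one[of "4 * \<Lambda> / \<sigma>"] \<Lambda> \<sigma> by simp
    finally have "l \<le> 4 * \<Lambda> / \<sigma>" using N0 \<Lambda> by (simp add: l_def ln_div)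
    also have "\<dots> \<le> 10 * \<Lambda>\<^sup>2 / \<sigma>"
    proof (rule divide_right_mono)
      have "\<Lambda> * 1 \<le> \<Lambda> * \<Lambda>" using \<Lambda> by (intro mult_left_mono) auto
      then show "4 * \<Lambda> \<le> 10 * \<Lambda>\<^sup>2" using \<Lambda> unfolding power2_eq_square by linarith
    qed (use \<sigma> in simp)
    finally show ?thesis .
  qed
  note X = cutoff_bounds[OF yr r]
  have Xeq: "cutoff r x0 x = (r\<^sup>2 - y1\<^sup>2)\<^sup>2 * (r\<^sup>2 - y2\<^sup>2)\<^sup>2" by (simp add: cutoff_def y1_def y2_def)
  have beq: "barrier (5 * \<Lambda>) r x0 \<epsilon> x = cutoff r x0 x * l" by (simp add: barrier_def l_def N_def)
  show "0 \<le> barrier (5 * \<Lambda>) r x0 \<epsilon> x" unfolding beq Xeq using X(1) l0 by (rule mult_nonneg_nonneg)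
  have nle: "norm (x - x0) \<le> \<sigma>"
    unfolding norm_vec2 \<sigma>_def using \<epsilon> by (simp add: y1_def y2_def)
  have lip: "\<bar>f x - f x0\<bar> \<le> 2 * \<Lambda> * \<sigma>" if "smooth_on S f" "\<And>x i. x \<in> ?K ==> \<bar>partial_deriv i f x\<bar> \<le> \<Lambda>" for f
  proof -
    have "\<bar>f x - f x0\<bar> \<le> 2 * \<Lambda> * norm (x - x0)"
      by (rule lipschitz_from_partials[OF convex_square _ that(2) x x0K])
        (use box smooth_on_imp_differentiable[OF that(1) open_S] in blast)
    also have "\<dots> \<le> 2 * \<Lambda> * \<sigma>" using nle \<Lambda> by (intro mult_left_mono) auto
    finally show ?thesis .
  qed
  have lips: "\<bar>\<alpha> x - \<alpha> x0\<bar> \<le> 2 * \<Lambda> * \<sigma>" "\<bar>\<beta> x - \<beta> x0\<bar> \<le> 2 * \<Lambda> * \<sigma>" "\<bar>\<gamma> x - \<gamma> x0\<bar> \<le> 2 * \<Lambda> * \<sigma>"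
    using b1 by (auto intro!: lip smooth_coeffs)
  have Lx: "\<bar>\<alpha> x\<bar> \<le> \<Lambda>" "\<bar>\<beta> x\<bar> \<le> \<Lambda>" "\<bar>\<gamma> x\<bar> \<le> \<Lambda>" using b0[OF x] by auto
  have d: "\<bar>partial_deriv 1 \<alpha> x + partial_deriv 2 \<beta> x\<bar> \<le> 2 * \<Lambda>" "\<bar>partial_deriv 1 \<beta> x + partial_deriv 2 \<gamma> x\<bar> \<le> 2 * \<Lambda>"
    using b1[OF x, of 1] b1[OF x, of 2] by linarith+
  have "L (barrier (5 * \<Lambda>) r x0 \<epsilon>) x + \<kappa> * (cutoff r x0 x * l) \<le> - (2 * cutoff r x0 x * \<epsilon> / N\<^sup>2) + (1216 * \<Lambda>^5 + 10 * \<kappa> * \<Lambda>\<^sup>2) / \<sigma>"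
    unfolding L_barrier[OF x0 \<epsilon>(1) L0 xS]
    unfolding N_def[symmetric] l_def[symmetric] y1_def[symmetric] y2_def[symmetric] Xeq
    by (rule barrier_bound[OF u a0 \<Lambda> Lx L0 lips d \<epsilon>(1) \<sigma> \<sigma>2 Neq refl refl X(1-7) l0 lup \<kappa>])
  then show "L (barrier (5 * \<Lambda>) r x0 \<epsilon>) x + \<kappa> * barrier (5 * \<Lambda>) r x0 \<epsilon> x
      \<le> - (2 * cutoff r x0 x * \<epsilon> / (barrier_form x0 \<epsilon> x)\<^sup>2)
        + (1216 * \<Lambda>^5 + 10 * \<kappa> * \<Lambda>\<^sup>2) * (1 / sqrt ((x $ 1 - x0 $ 1)\<^sup>2 + (x $ 2 - x0 $ 2)\<^sup>2 + \<epsilon>))"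
    by (simp add: beq N_def \<sigma>_def y1_def y2_def)
qed

text \<open>Green's identity moves L to the barrier; the sign conditions then bound the integral of
  w against the concentrating term by C0 times the integral of w / \<sigma>. The former is at least
  A0 w(x0). In the latter, w \<le> w(x0) is used on the square of half side \<rho> about x0 and 1 /
  \<sigma> \<le> 1 / \<rho> outside it, so that for small \<rho> the inner part is absorbed. C
  depends on the operator, the box and \<kappa>, but not on w or x0.\<close>

lemma sup_estimate_box:
  assumes r: "0 < r" "r \<le> 1" and box: "square z (2 * r) \<subseteq> S" and \<kappa>: "0 \<le> \<kappa>"
  shows "\<exists>C>0. \<forall>w x0. smooth_on S w \<longrightarrow> x0 \<in> square z r \<longrightarrow>
    (\<forall>x\<in>square z (2 * r). 0 \<le> w x \<and> w x \<le> w x0 \<and> - (\<kappa> * w x) \<le> L w x) \<longrightarrow>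
    w x0 \<le> C * (LINT x|lborel. indicator (square z (2 * r)) x * w x)"
proof -
  let ?K = "square z (2 * r)"
  obtain \<Lambda> where \<Lambda>: "1 \<le> \<Lambda>"
    "\<And>x. x \<in> ?K ==> \<bar>\<alpha> x\<bar> \<le> \<Lambda> \<and> \<bar>\<beta> x\<bar> \<le> \<Lambda> \<and> \<bar>\<gamma> x\<bar> \<le> \<Lambda>"
    "\<And>x i. x \<in> ?K ==> \<bar>partial_deriv i \<alpha> x\<bar> \<le> \<Lambda> \<and> \<bar>partial_deriv i \<beta> x\<bar> \<le> \<Lambda> \<and> \<bar>partial_deriv i \<gamma> x\<bar> \<le> \<Lambda>"
  proof (rule coefficient_bounds[OF box])
    fix \<Lambda>
    assume a: "1 \<le> \<Lambda>" "\<And>x. x \<in> ?K ==> \<bar>\<alpha> x\<bar> \<le> \<Lambda> \<and> \<bar>\<beta> x\<bar> \<le> \<Lambda> \<and> \<bar>\<gamma> x\<bar> \<le> \<Lambda>"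
      "\<And>x i. x \<in> ?K ==> \<bar>partial_deriv i \<alpha> x\<bar> \<le> \<Lambda> \<and> \<bar>partial_deriv i \<beta> x\<bar> \<le> \<Lambda> \<and> \<bar>partial_deriv i \<gamma> x\<bar> \<le> \<Lambda>"
    show thesis by (rule that[OF a])
  qed
  define C0 where "C0 = 1216 * \<Lambda>^5 + 10 * \<kappa> * \<Lambda>\<^sup>2"
  have "1 \<le> \<Lambda>^5" using \<Lambda>(1) by (rule one_le_power)
  moreover have "0 \<le> 10 * \<kappa> * \<Lambda>\<^sup>2" using \<kappa> by simp
  ultimately have C0: "0 < C0" unfolding C0_def by linarith
  \<comment> \<open>The concentrating term yields at least w(x0) r^8 / (100 \<Lambda>^2 \<epsilon>)
    on a square of area 4 \<epsilon>; in the product \<epsilon> cancels.\<close>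
  define A0 where "A0 = r^8 / (25 * \<Lambda>\<^sup>2)"
  have A0: "0 < A0" using r \<Lambda>(1) by (simp add: A0_def)
  \<comment> \<open>With the bound 16 \<rho> of \<open>integral_inverse_norm_le\<close>, the inner
    part of the error is then at most half of A0 w(x0).\<close>
  define \<rho> where "\<rho> = min r (A0 / (32 * C0))"
  have \<rho>: "0 < \<rho>" "\<rho> \<le> r" "32 * C0 * \<rho> \<le> A0"
  proof -
    show "0 < \<rho>" "\<rho> \<le> r" using r A0 C0 by (auto simp: \<rho>_def)
    have "\<rho> \<le> A0 / (32 * C0)" by (simp add: \<rho>_def)
    then show "32 * C0 * \<rho> \<le> A0" using C0 by (simp add: field_simps)
  qed
  define C where "C = 2 * C0 / (A0 * \<rho>)"
  have C: "0 < C" using A0 C0 \<rho> by (simp add: C_def)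
  have "w x0 \<le> C * (LINT x|lborel. indicator ?K x * w x)"
    if w: "smooth_on S w" and x0z: "x0 \<in> square z r"
      and sub: "\<And>x. x \<in> ?K ==> 0 \<le> w x \<and> w x \<le> w x0 \<and> - (\<kappa> * w x) \<le> L w x" for w x0
  proof -
    let ?B = "square x0 r"
    have BK: "?B \<subseteq> ?K"
    proof
      fix x assume "x \<in> ?B"
      then show "x \<in> ?K" using x0z unfolding mem_square by linarith
    qed
    have BS: "?B \<subseteq> S" using BK box by blast
    have x0B: "x0 \<in> ?B" using r by (simp add: mem_square)
    have x0S: "x0 \<in> S" using x0B BS by blast
    have cw: "continuous_on S w" by (rule smooth_on_imp_continuous_on[OF w])
    have intK: "integrable lborel (\<lambda>x. indicator ?K x * w x)" by (rule integrable_cbox_continuous[OF continuous_on_subset[OF cw box]])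
    have intB: "integrable lborel (\<lambda>x. indicator ?B x * w x)" by (rule integrable_cbox_continuous[OF continuous_on_subset[OF cw BS]])
    have IK0: "0 \<le> (LINT x|lborel. indicator ?K x * w x)"
      using sub by (intro integral_nonneg_AE AE_I2) (auto simp: indicator_def)
    define s where "s = w x0"
    show ?thesis
    proof (cases "s = 0")
      case True
      then show ?thesis using C IK0 by (simp add: s_def)
    next
      case False
      then have s: "0 < s" using sub[of x0] x0B BK by (auto simp: s_def less_le)
      have "isCont w x0" using cw x0S open_S by (simp add: continuous_on_eq_continuous_at)
      then obtain \<delta> where \<delta>: "0 < \<delta>" "\<And>x. dist x x0 < \<delta> ==> dist (w x) (w x0) < s / 2"
        unfolding continuous_at_eps_delta using s by (metis half_gt_zero)
      define \<eta> where "\<eta> = min (r / 2) (\<delta> / 3)"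
      have \<eta>: "0 < \<eta>" "\<eta> \<le> r / 2" "\<eta> \<le> \<delta> / 3" using r \<delta> by (auto simp: \<eta>_def)
      \<comment> \<open>The regularisation is tied to the scale \<eta> on which w stays above half
        its maximum. It depends on w, but the resulting constant does not.\<close>
      define \<epsilon> where "\<epsilon> = \<eta>\<^sup>2"
      have \<epsilon>: "0 < \<epsilon>" "\<epsilon> \<le> 1" using \<eta> r by (auto simp: \<epsilon>_def power_le_one)
      let ?\<psi> = "barrier (5 * \<Lambda>) r x0 \<epsilon>" and ?N = "barrier_form x0 \<epsilon>" and ?X = "cutoff r x0"
      let ?\<sigma> = "\<lambda>x. 1 / sqrt ((x $ 1 - x0 $ 1)\<^sup>2 + (x $ 2 - x0 $ 2)\<^sup>2 + \<epsilon>)"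
      note bp = barrier_properties[OF r BS \<Lambda>(1) _ _ \<epsilon> \<kappa>]
      have bp: "0 \<le> ?\<psi> x" "L ?\<psi> x + \<kappa> * ?\<psi> x \<le> - (2 * ?X x * \<epsilon> / (?N x)\<^sup>2) + C0 * ?\<sigma> x" "0 < ?N x"
        "?N x \<le> 2 * \<Lambda> * ((x $ 1 - x0 $ 1)\<^sup>2 + (x $ 2 - x0 $ 2)\<^sup>2) + \<epsilon>" if "x \<in> ?B" for x
        using bp[OF _ _ that] \<Lambda>(2,3) BK unfolding C0_def by blast+
      have L0: "\<bar>\<alpha> x0\<bar> \<le> \<Lambda>" "\<bar>\<beta> x0\<bar> \<le> \<Lambda>" "\<bar>\<gamma> x0\<bar> \<le> \<Lambda>" using \<Lambda>(2)[of x0] x0B BK by auto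
      have s\<psi>: "smooth_on S ?\<psi>" by (rule smooth_barrier[OF x0S \<epsilon>(1) L0 open_S])
      have bd: "?X x = 0 \<and> partial_deriv 1 ?\<psi> x = 0 \<and> partial_deriv 2 ?\<psi> x = 0 \<and> ?\<psi> x = 0"
        if "x $ i = (x0 - vec2 r) $ i \<or> x $ i = (x0 + vec2 r) $ i" for x i
      proof -
        have "i = 1 \<or> i = 2" by (rule exhaust_2)
        then have "r\<^sup>2 - (x $ 1 - x0 $ 1)\<^sup>2 = 0 \<or> r\<^sup>2 - (x $ 2 - x0 $ 2)\<^sup>2 = 0"
          using that by (auto simp: power2_eq_square)
        then show ?thesis
          unfolding partial_barrier[OF x0S \<epsilon>(1) L0] by (auto simp: cutoff_def barrier_def)
      qed
      have sym: "(LINT x|lborel. indicator ?B x * (L w x * ?\<psi> x)) = (LINT x|lborel. indicator ?B x * (w x * L ?\<psi> x))"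
      proof (rule L_symmetric[OF w s\<psi> BS])
        fix x i assume h: "x $ i = (x0 - vec2 r) $ i \<or> x $ i = (x0 + vec2 r) $ i"
        show "?\<psi> x = 0" using bd[OF h] by blast
        fix j :: 2
        have "j = 1 \<or> j = 2" by (rule exhaust_2)
        then show "partial_deriv j ?\<psi> x = 0" using bd[OF h] by auto
      qed
      note c = continuous_on_subset[OF smooth_on_imp_continuous_on BS]
      have i1: "integrable lborel (\<lambda>x. indicator ?B x * (L w x * ?\<psi> x))"
        and i2: "integrable lborel (\<lambda>x. indicator ?B x * (w x * L ?\<psi> x))"
        and i3: "integrable lborel (\<lambda>x. indicator ?B x * (w x * ?\<psi> x))"
        by (intro integrable_cbox_continuous c smooth_on_mult smooth_L w s\<psi> open_S)+
      have sN: "smooth_on S ?N" unfolding barrier_form_def[abs_def]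
        by (intro smooth_on_add smooth_on_diff smooth_on_mult smooth_on_power smooth_on_const smooth_on_coord open_S)
      have sX: "smooth_on S ?X" unfolding cutoff_def[abs_def]
        by (intro smooth_on_diff smooth_on_mult smooth_on_power smooth_on_const smooth_on_coord open_S)
      have i4: "integrable lborel (\<lambda>x. indicator ?B x * (w x * (2 * ?X x * \<epsilon> / (?N x)\<^sup>2)))"
      proof -
        have nz: "\<forall>x\<in>?B. (?N x)\<^sup>2 \<noteq> 0" using bp(3) by fastforce
        have "continuous_on ?B (\<lambda>x. 2 * ?X x * \<epsilon>)" by (intro continuous_on_mult continuous_on_const c sX)
        moreover have "continuous_on ?B (\<lambda>x. (?N x)\<^sup>2)" by (intro continuous_on_power c sN)
        ultimately have "continuous_on ?B (\<lambda>x. 2 * ?X x * \<epsilon> / (?N x)\<^sup>2)" using nz by (rule continuous_on_divide)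
        then show ?thesis by (intro integrable_cbox_continuous continuous_on_mult[OF c[OF w]])
      qed
      have pos\<sigma>: "0 < (x $ 1 - x0 $ 1)\<^sup>2 + (x $ 2 - x0 $ 2)\<^sup>2 + \<epsilon>" for x :: "real^2" using \<epsilon> by (simp add: add_nonneg_pos)
      have c\<sigma>: "continuous_on T ?\<sigma>" for T :: "(real^2) set"
      proof -
        have nz: "\<forall>x\<in>T. sqrt ((x $ 1 - x0 $ 1)\<^sup>2 + (x $ 2 - x0 $ 2)\<^sup>2 + \<epsilon>) \<noteq> 0"
          using pos\<sigma> by (metis less_irrefl real_sqrt_gt_0_iff)
        have "continuous_on T (\<lambda>x. sqrt ((x $ 1 - x0 $ 1)\<^sup>2 + (x $ 2 - x0 $ 2)\<^sup>2 + \<epsilon>))" by (intro continuous_intros)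
        from continuous_on_divide[OF continuous_on_const this nz] show ?thesis .
      qed
      have i5: "integrable lborel (\<lambda>x. indicator ?B x * (w x * ?\<sigma> x))"
        by (intro integrable_cbox_continuous continuous_on_mult[OF c[OF w]] c\<sigma>)
      let ?I4 = "LINT x|lborel. indicator ?B x * (w x * (2 * ?X x * \<epsilon> / (?N x)\<^sup>2))"
      let ?I5 = "LINT x|lborel. indicator ?B x * (w x * ?\<sigma> x)"
      have "0 \<le> (LINT x|lborel. indicator ?B x * (L w x * ?\<psi> x) + \<kappa> * (indicator ?B x * (w x * ?\<psi> x)))"
      proof (intro integral_nonneg_AE AE_I2)
        fix x
        show "0 \<le> indicator ?B x * (L w x * ?\<psi> x) + \<kappa> * (indicator ?B x * (w x * ?\<psi> x))"
        proof (cases "x \<in> ?B")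
          case True
          have "0 \<le> (L w x + \<kappa> * w x) * ?\<psi> x"
            using sub[of x] BK True bp(1)[OF True] by (intro mult_nonneg_nonneg) auto
          then show ?thesis using True by (simp add: algebra_simps)
        qed simp
      qed
      also have "\<dots> = (LINT x|lborel. indicator ?B x * (w x * L ?\<psi> x) + \<kappa> * (indicator ?B x * (w x * ?\<psi> x)))"
        using i1 i2 i3 sym by simp
      also have "\<dots> \<le> (LINT x|lborel. C0 * (indicator ?B x * (w x * ?\<sigma> x)) - indicator ?B x * (w x * (2 * ?X x * \<epsilon> / (?N x)\<^sup>2)))"
      proof (rule integral_mono)
        fix x
        show "indicator ?B x * (w x * L ?\<psi> x) + \<kappa> * (indicator ?B x * (w x * ?\<psi> x))
           \<le> C0 * (indicator ?B x * (w x * ?\<sigma> x)) - indicator ?B x * (w x * (2 * ?X x * \<epsilon> / (?N x)\<^sup>2))"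
        proof (cases "x \<in> ?B")
          case True
          have "0 \<le> w x" using sub True BK by blast
          from mult_left_mono[OF bp(2)[OF True] this] show ?thesis using True by (simp add: algebra_simps)
        qed simp
      qed (intro Bochner_Integration.integrable_diff Bochner_Integration.integrable_add integrable_mult_right i2 i3 i4 i5)+
      also have "\<dots> = C0 * ?I5 - ?I4"
        using Bochner_Integration.integral_diff[OF integrable_mult_right[OF i5, of C0] i4] by (simp only: integral_mult_right_zero)
      finally have main: "?I4 \<le> C0 * ?I5" by simp
      let ?H = "square x0 \<eta>"
      have lower: "A0 * s \<le> ?I4"
      proof -
        have cm: "integrable lborel (\<lambda>x. indicator ?H x * (s * r^8 / (100 * \<Lambda>\<^sup>2 * \<epsilon>)))"
          by (rule integrable_cbox_continuous) simp
        have "(LINT x|lborel. indicator ?H x * (s * r^8 / (100 * \<Lambda>\<^sup>2 * \<epsilon>))) \<le> ?I4"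
        proof (rule integral_mono[OF cm i4])
          fix x
          show "indicator ?H x * (s * r^8 / (100 * \<Lambda>\<^sup>2 * \<epsilon>)) \<le> indicator ?B x * (w x * (2 * ?X x * \<epsilon> / (?N x)\<^sup>2))"
          proof (cases "x \<in> ?H")
            case True
            then have y: "\<bar>x $ 1 - x0 $ 1\<bar> \<le> \<eta>" "\<bar>x $ 2 - x0 $ 2\<bar> \<le> \<eta>" by (auto simp: mem_square)
            then have xB: "x \<in> ?B" using \<eta> r unfolding mem_square by linarith
            have y2: "(x $ 1 - x0 $ 1)\<^sup>2 \<le> \<epsilon>" "(x $ 2 - x0 $ 2)\<^sup>2 \<le> \<epsilon>"
              using y \<eta>(1) unfolding \<epsilon>_def by (simp_all add: abs_le_square_iff[symmetric])
            have "norm (x - x0) \<le> \<bar>x $ 1 - x0 $ 1\<bar> + \<bar>x $ 2 - x0 $ 2\<bar>"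
              using norm_le_l1_cart[of "x - x0"] by (simp add: sum_2)
            then have "dist x x0 < \<delta>" using y \<eta> \<delta>(1) unfolding dist_norm by linarith
            then have ws: "s / 2 \<le> w x" using \<delta>(2)[of x] by (simp add: dist_real_def s_def abs_if split: if_splits)
            have "2 * \<Lambda> * ((x $ 1 - x0 $ 1)\<^sup>2 + (x $ 2 - x0 $ 2)\<^sup>2) \<le> 2 * \<Lambda> * (2 * \<epsilon>)" using y2 \<Lambda>(1) by (intro mult_left_mono) auto
            moreover have "\<epsilon> * 1 \<le> \<epsilon> * \<Lambda>" using \<epsilon> \<Lambda>(1) by (intro mult_left_mono) auto
            ultimately have "?N x \<le> 5 * \<Lambda> * \<epsilon>" using bp(4)[OF xB] by (simp add: algebra_simps)
            then have N2: "(?N x)\<^sup>2 \<le> (5 * \<Lambda> * \<epsilon>)\<^sup>2" using bp(3)[OF xB] by (intro power_mono) auto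
            have er: "\<epsilon> \<le> r\<^sup>2 / 4" unfolding \<epsilon>_def using power_mono[OF \<eta>(2), of 2] \<eta>(1) by (simp add: power_divide)
            \<comment> \<open>Since t \<le> \<epsilon> \<le> r^2 / 4, the factor is at least (3/4)^2
              r^4, rounded down to r^4 / 2.\<close>
            have h: "r^4 / 2 \<le> (r\<^sup>2 - t)\<^sup>2" if "0 \<le> t" "t \<le> \<epsilon>" for t
            proof -
              have "(3/4 * r\<^sup>2)\<^sup>2 \<le> (r\<^sup>2 - t)\<^sup>2" by (rule power_mono) (use that er in auto)
              moreover have "(3/4 * r\<^sup>2)\<^sup>2 = 9/16 * r^4" by (simp add: power_mult_distrib power2_eq_square power4_eq_xxxx)
              moreover have "0 \<le> r^4" by simp
              ultimately show ?thesis by linarith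
            qed
            have "r^4 / 2 * (r^4 / 2) \<le> ?X x"
              unfolding cutoff_def using r y2 by (intro mult_mono h) auto
            then have Xl: "r^8 / 4 \<le> ?X x" by (simp add: power_add[symmetric])
            have X0: "0 \<le> ?X x" by (simp add: cutoff_def)
            have "s * r^8 / (100 * \<Lambda>\<^sup>2 * \<epsilon>) = s / 2 * (2 * (r^8 / 4) * \<epsilon> / (5 * \<Lambda> * \<epsilon>)\<^sup>2)"
              using \<epsilon> \<Lambda>(1) by (simp add: field_simps power2_eq_square)
            also have "\<dots> \<le> w x * (2 * ?X x * \<epsilon> / (?N x)\<^sup>2)"
              using ws Xl X0 N2 s \<epsilon> \<Lambda>(1) bp(3)[OF xB] r
              by (intro mult_mono frac_le mult_right_mono mult_left_mono) auto
            finally show ?thesis using True xB by simp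
          next
            case False
            have "0 \<le> indicator ?B x * (w x * (2 * ?X x * \<epsilon> / (?N x)\<^sup>2))"
              using sub BK \<epsilon> by (auto simp: indicator_def cutoff_def)
            then show ?thesis using False by simp
          qed
        qed
        moreover have "(LINT x|lborel. indicator ?H x * (s * r^8 / (100 * \<Lambda>\<^sup>2 * \<epsilon>))) = A0 * s"
        proof -
          have "(LINT x|lborel. indicator ?H x * (s * r^8 / (100 * \<Lambda>\<^sup>2 * \<epsilon>))) = measure lborel ?H * (s * r^8 / (100 * \<Lambda>\<^sup>2 * \<epsilon>))"
            by simp
          also have "measure lborel ?H = 4 * \<epsilon>" using measure_square[of \<eta> x0] \<eta>(1) by (simp add: \<epsilon>_def)
          finally show ?thesis using \<epsilon> \<Lambda>(1) by (simp add: A0_def field_simps)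
        qed
        ultimately show ?thesis by simp
      qed
      have upper: "?I5 \<le> s * (16 * \<rho>) + 1 / \<rho> * (LINT x|lborel. indicator ?K x * w x)"
      proof -
        let ?R = "square x0 \<rho>"
        have iR: "integrable lborel (\<lambda>x. indicator ?R x * ?\<sigma> x)" by (rule integrable_cbox_continuous[OF c\<sigma>])
        have "?I5 \<le> (LINT x|lborel. s * (indicator ?R x * ?\<sigma> x) + 1 / \<rho> * (indicator ?K x * w x))"
        proof (rule integral_mono[OF i5])
          fix x :: "real^2"
          have \<sigma>0: "0 \<le> ?\<sigma> x" using pos\<sigma>[of x] by simp
          show "indicator ?B x * (w x * ?\<sigma> x) \<le> s * (indicator ?R x * ?\<sigma> x) + 1 / \<rho> * (indicator ?K x * w x)"
          proof (cases "x \<in> ?B")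
            case xB: True
            then have xK: "x \<in> ?K" using BK by blast
            have w0: "0 \<le> w x" "w x \<le> s" using sub[OF xK] by (auto simp: s_def)
            show ?thesis
            proof (cases "x \<in> ?R")
              case True
              have "w x * ?\<sigma> x \<le> s * ?\<sigma> x" by (rule mult_right_mono[OF w0(2) \<sigma>0])
              moreover have "0 \<le> 1 / \<rho> * w x" using w0 \<rho> by simp
              ultimately show ?thesis using True xB xK by simp
            next
              case False
              then have "\<rho> \<le> \<bar>x $ 1 - x0 $ 1\<bar> \<or> \<rho> \<le> \<bar>x $ 2 - x0 $ 2\<bar>" by (auto simp: mem_square)
              then have "\<rho>\<^sup>2 \<le> (x $ 1 - x0 $ 1)\<^sup>2 \<or> \<rho>\<^sup>2 \<le> (x $ 2 - x0 $ 2)\<^sup>2"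
                using \<rho>(1) by (auto simp: abs_le_square_iff[symmetric])
              moreover have "0 \<le> (x $ 1 - x0 $ 1)\<^sup>2" "0 \<le> (x $ 2 - x0 $ 2)\<^sup>2" by simp_all
              ultimately have "\<rho>\<^sup>2 \<le> (x $ 1 - x0 $ 1)\<^sup>2 + (x $ 2 - x0 $ 2)\<^sup>2 + \<epsilon>" using \<epsilon>(1) by linarith
              then have "\<rho> \<le> sqrt ((x $ 1 - x0 $ 1)\<^sup>2 + (x $ 2 - x0 $ 2)\<^sup>2 + \<epsilon>)" by (rule real_le_rsqrt)
              then have "?\<sigma> x \<le> 1 / \<rho>" using \<rho>(1) pos\<sigma>[of x] by (intro divide_left_mono mult_pos_pos) auto
              from mult_left_mono[OF this w0(1)] show ?thesis using False xB xK by (simp add: mult.commute)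
            qed
          next
            case False
            have "0 \<le> s * (indicator ?R x * ?\<sigma> x)" using s \<sigma>0 by (simp add: indicator_def)
            moreover have "0 \<le> 1 / \<rho> * (indicator ?K x * w x)" using sub \<rho>(1) by (auto simp: indicator_def)
            ultimately show ?thesis using False by simp
          qed
        qed (intro Bochner_Integration.integrable_add integrable_mult_right iR intK)
        also have "\<dots> = s * (LINT x|lborel. indicator ?R x * ?\<sigma> x) + 1 / \<rho> * (LINT x|lborel. indicator ?K x * w x)"
          using Bochner_Integration.integral_add[OF integrable_mult_right[OF iR, of s] integrable_mult_right[OF intK, of "1 / \<rho>"]]
          by (simp only: integral_mult_right_zero)
        also have "\<dots> \<le> s * (16 * \<rho>) + 1 / \<rho> * (LINT x|lborel. indicator ?K x * w x)"
          using integral_inverse_norm_le[OF \<epsilon>(1) \<rho>(1), of x0] s by (intro add_right_mono mult_left_mono) auto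
        finally show ?thesis .
      qed
      have "A0 * s \<le> C0 * (s * (16 * \<rho>) + 1 / \<rho> * (LINT x|lborel. indicator ?K x * w x))"
        using lower main mult_left_mono[OF upper, of C0] C0 by linarith
      moreover have "C0 * (s * (16 * \<rho>)) \<le> A0 * s / 2"
        using mult_right_mono[OF \<rho>(3), of s] s by (simp add: algebra_simps)
      ultimately have "A0 * s / 2 \<le> C0 * (1 / \<rho> * (LINT x|lborel. indicator ?K x * w x))"
        unfolding distrib_left by linarith
      then have "s \<le> 2 / A0 * (C0 * (1 / \<rho> * (LINT x|lborel. indicator ?K x * w x)))"
        using A0 \<rho>(1) by (simp add: field_simps)
      also have "\<dots> = C * (LINT x|lborel. indicator ?K x * w x)" by (simp add: C_def)
      finally show ?thesis by (simp add: s_def)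
    qed
  qed
  then show ?thesis using C by (intro exI[of _ C]) auto
qed

end

section \<open>The Laplace-Beltrami operator in divergence form\<close>

lemma frame_det_derivative:
  fixes e f h :: real
  assumes "e1 = 2 * (e * a + f * b)" "f1 = f * a + h * b + e * c + f * d" "h1 = 2 * (f * c + h * d)"
  shows "e1 * h + e * h1 - 2 * f * f1 = 2 * (e * h - f * f) * (a + d)"
  using assms by algebra

context local_metric
begin

lemma G22_pos: "x \<in> S ==> 0 < G x $ 2 $ 2"
proof -
  assume x: "x \<in> S"
  have "0 < G x $ 1 $ 1 * G x $ 2 $ 2"
    using det_pos[OF x] zero_le_square[of "G x $ 1 $ 2"] unfolding det_eq[OF x] by linarith
  then show ?thesis using pos[OF x] by (simp add: zero_less_mult_iff)
qed

definition density :: "real^2 \<Rightarrow> real" where "density x = sqrt (det (G x))"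

lemma density_pos: "x \<in> S ==> 0 < density x"
  by (simp add: density_def det_pos)

lemma smooth_density: "smooth_on S density"
  unfolding density_def[abs_def] by (intro smooth_on_sqrt open_S smooth_det det_pos)

text \<open>The contracted Christoffel symbol is the logarithmic derivative of sqrt (det G), because
  metric compatibility expresses the derivative of the determinant through it.\<close>

lemma partial_density:
  assumes "x \<in> S"
  shows "partial_deriv m density x = density x * (christoffel G 1 1 m x + christoffel G 2 2 m x)"
proof -
  have d: "(\<lambda>y. det (G y)) differentiable (at x)" by (rule smooth_on_imp_differentiable[OF smooth_det open_S assms])
  have dG: "(\<lambda>y. G y $ i $ j) differentiable (at x)" for i j by (rule smooth_on_imp_differentiable[OF smooth open_S assms])
  have "partial_deriv m (\<lambda>y. det (G y)) x
    = partial_deriv m (\<lambda>y. G y $ 1 $ 1 * G y $ 2 $ 2 - G y $ 1 $ 2 * G y $ 1 $ 2) x"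
    by (rule partial_deriv_cong_open[OF open_S assms]) (simp add: det_eq)
  also have "\<dots> = partial_deriv m (\<lambda>y. G y $ 1 $ 1) x * G x $ 2 $ 2 + G x $ 1 $ 1 * partial_deriv m (\<lambda>y. G y $ 2 $ 2) x
     - 2 * G x $ 1 $ 2 * partial_deriv m (\<lambda>y. G y $ 1 $ 2) x"
    by (simp add: partial_deriv_diff partial_deriv_mult differentiable_mult dG algebra_simps)
  also have "\<dots> = 2 * (G x $ 1 $ 1 * G x $ 2 $ 2 - G x $ 1 $ 2 * G x $ 1 $ 2) * (christoffel G 1 m 1 x + christoffel G 2 m 2 x)"
    using metric_compatible[OF assms, of m 1 1] metric_compatible[OF assms, of m 1 2] metric_compatible[OF assms, of m 2 2]
    unfolding sum_2 sym[OF assms] by (intro frame_det_derivative[of _ _ _ _ "christoffel G 2 m 1 x" _ _ "christoffel G 1 m 2 x"]) auto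
  finally have D: "partial_deriv m (\<lambda>y. det (G y)) x = 2 * det (G x) * (christoffel G 1 1 m x + christoffel G 2 2 m x)"
    by (simp add: det_eq[OF assms] christoffel_sym[OF assms, of _ m])
  have "partial_deriv m density x = inverse (sqrt (det (G x))) / 2 * partial_deriv m (\<lambda>y. det (G y)) x"
    unfolding density_def[abs_def]
    by (rule partial_deriv_compose[OF d]) (rule DERIV_real_sqrt[OF det_pos[OF assms]])
  also have "\<dots> = density x * (christoffel G 1 1 m x + christoffel G 2 2 m x)"
  proof -
    have "det (G x) = density x * density x" using det_pos[OF assms] by (simp add: density_def)
    then show ?thesis unfolding D using density_pos[OF assms] by (simp add: density_def[symmetric] field_simps)
  qed
  finally show ?thesis .
qed

text \<open>With these coefficients \<open>laplace.L u\<close> is sqrt (det G) times the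
  Laplace-Beltrami operator of G applied to u.\<close>

sublocale laplace: elliptic_operator S "\<lambda>x. G x $ 2 $ 2 / density x" "\<lambda>x. - G x $ 1 $ 2 / density x" "\<lambda>x. G x $ 1 $ 1 / density x"
proof
  have nz: "\<And>x. x \<in> S ==> density x \<noteq> 0" using density_pos by force
  show "open S" by (rule open_S)
  show "smooth_on S (\<lambda>x. G x $ 2 $ 2 / density x)" "smooth_on S (\<lambda>x. G x $ 1 $ 1 / density x)" "smooth_on S (\<lambda>x. - G x $ 1 $ 2 / density x)"
    by (intro smooth_on_divide smooth_on_minus open_S smooth smooth_density density_pos; assumption)+
  show "0 < G x $ 2 $ 2 / density x" if "x \<in> S" for x using G22_pos density_pos that by simp
  show "G x $ 2 $ 2 / density x * (G x $ 1 $ 1 / density x) - (- G x $ 1 $ 2 / density x)\<^sup>2 = 1" if "x \<in> S" for x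
  proof -
    have "(density x)\<^sup>2 = G x $ 1 $ 1 * G x $ 2 $ 2 - G x $ 1 $ 2 * G x $ 1 $ 2"
      using det_pos[OF that] by (simp add: density_def det_eq[OF that])
    then show ?thesis using density_pos[OF that] by (simp add: field_simps power2_eq_square)
  qed
qed

text \<open>Expanding the divergence form by \<open>partial_density\<close> and metric compatibility
  produces the very bracket of \<open>curvature_conformal\<close>. This is where the curvature and
  the operator of the sup estimate meet.\<close>

lemma density_laplace:
  assumes u: "smooth_on S u" and x: "x \<in> S"
  shows "density x * laplace.L u x =
    G x $ 2 $ 2 * partial_deriv 1 (partial_deriv 1 u) x - 2 * G x $ 1 $ 2 * partial_deriv 1 (partial_deriv 2 u) x
       + G x $ 1 $ 1 * partial_deriv 2 (partial_deriv 2 u) x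
       - (G x $ 2 $ 2 * christoffel G 1 1 1 x - 2 * G x $ 1 $ 2 * christoffel G 1 1 2 x + G x $ 1 $ 1 * christoffel G 1 2 2 x) * partial_deriv 1 u x
       - (G x $ 2 $ 2 * christoffel G 2 1 1 x - 2 * G x $ 1 $ 2 * christoffel G 2 1 2 x + G x $ 1 $ 1 * christoffel G 2 2 2 x) * partial_deriv 2 u x"
proof -
  have D: "0 < density x" by (rule density_pos[OF x])
  have quot: "density x * partial_deriv m (\<lambda>y. f y / density y) x
     = partial_deriv m f x - f x * (christoffel G 1 1 m x + christoffel G 2 2 m x)" if f: "smooth_on S f" for f m
  proof -
    have sq: "smooth_on S (\<lambda>y. f y / density y)" by (intro smooth_on_divide open_S f smooth_density density_pos)
    have "partial_deriv m f x = partial_deriv m (\<lambda>y. density y * (f y / density y)) x"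
      by (rule partial_deriv_cong_open[OF open_S x]) (use density_pos in force)
    also have "\<dots> = density x * partial_deriv m (\<lambda>y. f y / density y) x + partial_deriv m density x * (f x / density x)"
      by (intro partial_deriv_mult smooth_on_imp_differentiable[OF _ open_S x] sq smooth_density)
    finally have "partial_deriv m f x = density x * partial_deriv m (\<lambda>y. f y / density y) x
      + density x * (christoffel G 1 1 m x + christoffel G 2 2 m x) * (f x / density x)" unfolding partial_density[OF x] .
    moreover have "density x * c * (f x / density x) = f x * c" for c using D by simp
    ultimately show ?thesis by simp
  qed
  have neg: "smooth_on S (\<lambda>y. - G y $ 1 $ 2)" by (intro smooth_on_minus open_S smooth)
  have negd: "partial_deriv m (\<lambda>y. - G y $ 1 $ 2) x = - partial_deriv m (\<lambda>y. G y $ 1 $ 2) x" for m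
  proof -
    have "((\<lambda>t. - t) has_field_derivative - 1) (at (G x $ 1 $ 2))" by (auto intro!: derivative_eq_intros)
    from partial_deriv_compose[OF smooth_on_imp_differentiable[OF smooth[of 1 2] open_S x] this] show ?thesis by simp
  qed
  note c = metric_compatible[OF x, unfolded sum_2 sym[OF x]] and cs = christoffel_sym[OF x, of _ 2 1]
  have "density x * laplace.L u x =
    density x * (G x $ 2 $ 2 / density x) * partial_deriv 1 (partial_deriv 1 u) x
    + 2 * (density x * (- G x $ 1 $ 2 / density x)) * partial_deriv 1 (partial_deriv 2 u) x
    + density x * (G x $ 1 $ 1 / density x) * partial_deriv 2 (partial_deriv 2 u) x
    + (density x * partial_deriv 1 (\<lambda>y. G y $ 2 $ 2 / density y) x + density x * partial_deriv 2 (\<lambda>y. - G y $ 1 $ 2 / density y) x) * partial_deriv 1 u x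
    + (density x * partial_deriv 1 (\<lambda>y. - G y $ 1 $ 2 / density y) x + density x * partial_deriv 2 (\<lambda>y. G y $ 1 $ 1 / density y) x) * partial_deriv 2 u x"
    unfolding laplace.L_expand[OF u x] by (simp only: distrib_left distrib_right mult.assoc mult.left_commute[of 2])
  also have "\<dots> = G x $ 2 $ 2 * partial_deriv 1 (partial_deriv 1 u) x - 2 * G x $ 1 $ 2 * partial_deriv 1 (partial_deriv 2 u) x
       + G x $ 1 $ 1 * partial_deriv 2 (partial_deriv 2 u) x
       - (G x $ 2 $ 2 * christoffel G 1 1 1 x - 2 * G x $ 1 $ 2 * christoffel G 1 1 2 x + G x $ 1 $ 1 * christoffel G 1 2 2 x) * partial_deriv 1 u x
       - (G x $ 2 $ 2 * christoffel G 2 1 1 x - 2 * G x $ 1 $ 2 * christoffel G 2 1 2 x + G x $ 1 $ 1 * christoffel G 2 2 2 x) * partial_deriv 2 u x"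
    unfolding quot[OF smooth] quot[OF neg] negd c
    using D by (simp add: cs sym[OF x] algebra_simps)
  finally show ?thesis .
qed

end

text \<open>By the chain rule the difference is 4 exp (2 u) times the coefficient form on the
  gradient of u, which is nonnegative by ellipticity.\<close>

lemma (in elliptic_operator) L_exp_ge:
  assumes u: "smooth_on S u" and x: "x \<in> S"
  shows "2 * exp (2 * u x) * L u x \<le> L (\<lambda>y. exp (2 * u y)) x" and "smooth_on S (\<lambda>y. exp (2 * u y))"
proof -
  let ?w = "\<lambda>y. exp (2 * u y)"
  have F: "((\<lambda>t. exp (2 * t)) has_field_derivative 2 * exp (2 * t)) (at t)" for t :: real
    by (auto intro!: derivative_eq_intros)
  show sw: "smooth_on S ?w" by (intro smooth_on_exp smooth_on_mult smooth_on_const open_S u)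
  have w1: "partial_deriv i ?w y = 2 * ?w y * partial_deriv i u y" if "y \<in> S" for i y
    by (rule partial_deriv_compose[OF smooth_on_imp_differentiable[OF u open_S that] F])
  have w2: "partial_deriv j (partial_deriv i ?w) x
     = 2 * ?w x * partial_deriv j (partial_deriv i u) x + 4 * ?w x * (partial_deriv i u x * partial_deriv j u x)" for i j
  proof -
    have "partial_deriv j (partial_deriv i ?w) x = partial_deriv j (\<lambda>y. (2 * ?w y) * partial_deriv i u y) x"
      by (rule partial_deriv_cong_open[OF open_S x]) (simp add: w1)
    also have "\<dots> = (2 * ?w x) * partial_deriv j (partial_deriv i u) x + partial_deriv j (\<lambda>y. 2 * ?w y) x * partial_deriv i u x"
      by (intro partial_deriv_mult smooth_on_imp_differentiable[OF _ open_S x] smooth_on_mult smooth_on_const smooth_on_partial open_S sw u)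
    also have "partial_deriv j (\<lambda>y. 2 * ?w y) x = 2 * partial_deriv j ?w x"
      by (rule partial_deriv_compose[OF smooth_on_imp_differentiable[OF sw open_S x]]) (auto intro!: derivative_eq_intros)
    finally show ?thesis by (simp add: w1[OF x])
  qed
  let ?p = "partial_deriv 1 u x" and ?q = "partial_deriv 2 u x"
  have "0 \<le> \<alpha> x * ((\<alpha> x * ?p\<^sup>2 + 2 * \<beta> x * (?p * ?q) + \<gamma> x * ?q\<^sup>2))"
  proof -
    have "\<alpha> x * ((\<alpha> x * ?p\<^sup>2 + 2 * \<beta> x * (?p * ?q) + \<gamma> x * ?q\<^sup>2)) = (\<alpha> x * ?p + \<beta> x * ?q)\<^sup>2 + (\<alpha> x * \<gamma> x - (\<beta> x)\<^sup>2) * ?q\<^sup>2"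
      by (simp add: power2_eq_square algebra_simps)
    then show ?thesis unfolding unimodular[OF x] by simp
  qed
  then have "0 \<le> \<alpha> x * ?p\<^sup>2 + 2 * \<beta> x * (?p * ?q) + \<gamma> x * ?q\<^sup>2" using \<alpha>_pos[OF x] by (simp add: zero_le_mult_iff)
  then have "0 \<le> 4 * ?w x * (\<alpha> x * ?p\<^sup>2 + 2 * \<beta> x * (?p * ?q) + \<gamma> x * ?q\<^sup>2)" by simp
  also have "\<dots> = L ?w x - 2 * ?w x * L u x"
    unfolding L_expand[OF u x] L_expand[OF sw x] w2 w1[OF x] by (simp add: power2_eq_square algebra_simps)
  finally show "2 * ?w x * L u x \<le> L ?w x" by simp
qed

context local_metric
begin

lemma smooth_riemann_tensor: "smooth_on S (riemann_tensor G l i j k)"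
  unfolding riemann_tensor_def[abs_def]
  by (intro smooth_on_add smooth_on_diff smooth_on_sum smooth_on_mult smooth_on_partial smooth_christoffel open_S)

text \<open>For a conformal metric of nonpositive curvature the conformal factor is a subsolution, hence
  the barrier estimate applies to it.\<close>

lemma conformal_factor_estimate_box:
  assumes r: "0 < r" "r \<le> 1" and box: "square z (2 * r) \<subseteq> S"
  shows "\<exists>C>0. \<forall>u G' x0. local_conformal S G u G' \<longrightarrow> x0 \<in> square z r \<longrightarrow>
    (\<forall>x\<in>square z (2 * r). u x \<le> u x0 \<and>
        (\<Sum>l\<in>UNIV. G' x $ 1 $ l * riemann_tensor G' l 1 2 2 x) / det (G' x) \<le> 0) \<longrightarrow>
    exp (2 * u x0) \<le> C * (LINT x|lborel. indicator (square z (2 * r)) x * exp (2 * u x))"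
proof -
  let ?K = "square z (2 * r)"
  let ?R = "\<lambda>x. (\<Sum>l\<in>UNIV. G x $ 1 $ l * riemann_tensor G l 1 2 2 x) / density x"
  have "smooth_on S ?R"
    by (intro smooth_on_divide smooth_on_sum smooth_on_mult smooth smooth_riemann_tensor smooth_density density_pos open_S)
  then have "continuous_on ?K ?R" using box by (meson continuous_on_subset smooth_on_imp_continuous_on)
  then have "bounded (?R ` ?K)" by (intro compact_imp_bounded compact_continuous_image compact_cbox)
  then obtain b where b: "\<And>x. x \<in> ?K ==> \<bar>?R x\<bar> \<le> b" unfolding bounded_iff by auto
  \<comment> \<open>The factor 2 comes from \<open>L_exp_ge\<close>; the maximum with 0 makes
    \<kappa> nonnegative outright.\<close>
  define \<kappa> where "\<kappa> = 2 * max b 0"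
  have \<kappa>: "0 \<le> \<kappa>" by (simp add: \<kappa>_def)
  obtain C where C: "C > 0" and *: "\<And>w x0. smooth_on S w ==> x0 \<in> square z r ==>
    (\<forall>x\<in>?K. 0 \<le> w x \<and> w x \<le> w x0 \<and> - (\<kappa> * w x) \<le> laplace.L w x) ==>
    w x0 \<le> C * (LINT x|lborel. indicator ?K x * w x)"
    using laplace.sup_estimate_box[OF r box \<kappa>] by blast
  have "exp (2 * u x0) \<le> C * (LINT x|lborel. indicator ?K x * exp (2 * u x))"
    if lc: "local_conformal S G u G'" and x0: "x0 \<in> square z r"
      and h: "\<And>x. x \<in> ?K ==> u x \<le> u x0 \<and> (\<Sum>l\<in>UNIV. G' x $ 1 $ l * riemann_tensor G' l 1 2 2 x) / det (G' x) \<le> 0"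
    for u G' x0
  proof (rule *[of "\<lambda>x. exp (2 * u x)", OF _ x0])
    interpret lc: local_conformal S G u G' by (rule lc)
    have us: "smooth_on S u" by (rule lc.smooth_u)
    show "smooth_on S (\<lambda>x. exp (2 * u x))" by (intro smooth_on_exp smooth_on_mult smooth_on_const open_S us)
    show "\<forall>x\<in>?K. 0 \<le> exp (2 * u x) \<and> exp (2 * u x) \<le> exp (2 * u x0) \<and> - (\<kappa> * exp (2 * u x)) \<le> laplace.L (\<lambda>x. exp (2 * u x)) x"
    proof
      fix x assume xK: "x \<in> ?K"
      then have x: "x \<in> S" using box by blast
      have "(\<Sum>l\<in>UNIV. G' x $ 1 $ l * riemann_tensor G' l 1 2 2 x) \<le> 0"
      proof -
        have "det (G' x) = exp (2 * u x) * exp (2 * u x) * det (G x)" by (simp add: lc.G'[OF x] det_2 algebra_simps)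
        then have "0 < det (G' x)" using det_pos[OF x] by simp
        then show ?thesis using h[OF xK] by (simp add: divide_le_0_iff)
      qed
      \<comment> \<open>Lowering with G instead of G' takes out a positive factor, so the sign of
        the curvature passes to the expression in \<open>curvature_conformal\<close>.\<close>
      then have "exp (2 * u x) * (\<Sum>l\<in>UNIV. G x $ 1 $ l * riemann_tensor G' l 1 2 2 x) \<le> 0"
        by (simp add: lc.G'[OF x] sum_distrib_left mult.assoc)
      then have "(\<Sum>l\<in>UNIV. G x $ 1 $ l * riemann_tensor G' l 1 2 2 x) \<le> 0"
        by (simp add: mult_le_0_iff)
      then have "(\<Sum>l\<in>UNIV. G x $ 1 $ l * riemann_tensor G l 1 2 2 x) \<le> density x * laplace.L u x"
        unfolding lc.curvature_conformal[OF x] density_laplace[OF us x] by simp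
      then have "?R x \<le> laplace.L u x" using density_pos[OF x] by (simp add: field_simps)
      then have "- max b 0 \<le> laplace.L u x" using b[OF xK] by linarith
      then have "2 * exp (2 * u x) * (- max b 0) \<le> 2 * exp (2 * u x) * laplace.L u x" by (intro mult_left_mono) auto
      then have "- (\<kappa> * exp (2 * u x)) \<le> laplace.L (\<lambda>x. exp (2 * u x)) x"
        using laplace.L_exp_ge(1)[OF us x] by (simp add: \<kappa>_def algebra_simps)
      then show "0 \<le> exp (2 * u x) \<and> exp (2 * u x) \<le> exp (2 * u x0) \<and> - (\<kappa> * exp (2 * u x)) \<le> laplace.L (\<lambda>x. exp (2 * u x)) x"
        using h[OF xK] by simp
    qed
  qed
  then show ?thesis using C by (intro exI[of _ C]) auto
qed

end

section \<open>The supremum estimate on a compact surface\<close>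

lemma square_neighbourhood:
  fixes z :: "real^2"
  assumes "open S" "z \<in> S"
  obtains r where "0 < r" "r \<le> 1" "square z (2 * r) \<subseteq> S"
proof -
  obtain e where e: "e > 0" "ball z e \<subseteq> S" using assms open_contains_ball by blast
  \<comment> \<open>A point of the square of half side 2 r is at distance at most 4 r \<le> e / 2
    from z.\<close>
  define r where "r = min 1 (e / 8)"
  have r: "0 < r" "r \<le> 1" "r \<le> e / 8" using e by (auto simp: r_def)
  have "x \<in> S" if "x \<in> square z (2 * r)" for x
  proof -
    have "norm (z - x) \<le> \<bar>x $ 1 - z $ 1\<bar> + \<bar>x $ 2 - z $ 2\<bar>"
      using norm_le_l1_cart[of "z - x"] by (simp add: sum_2 abs_minus_commute)
    also have "\<dots> \<le> 4 * r" using that unfolding mem_square by linarith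
    also have "\<dots> < e" using r e by linarith
    finally show ?thesis using e(2) by (auto simp: dist_norm)
  qed
  then show thesis using that[OF r(1,2)] by blast
qed

locale riemannian_surface = surface A for A :: "'m::{t2_space, second_countable_topology} chart set" +
  fixes h :: "'m metric_field"
  assumes riemannian: "riemannian_metric A h"

sublocale riemannian_surface \<subseteq> metric_surface A h
  by (rule riemannian_metric_cmetric[OF surface_axioms riemannian])

context riemannian_surface
begin

lemma smooth_conformal_pair:
  assumes "compact (UNIV :: 'm set)" "riemannian_metric A g" "smooth_fun A u"
    and "\<And>c p. c \<in> A ==> p \<in> fst c ==> g c p = exp (2 * u p) *\<^sub>R h c p"
  shows "\<exists>b. conformal_pair A g h u b"
proof -
  interpret g: metric_surface A g by (rule riemannian_metric_cmetric[OF surface_axioms assms(2)])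
  have u: "continuous_on UNIV u" by (rule smooth_fun_continuous[OF assms(3)])
  then have "bounded (range u)" by (intro compact_imp_bounded compact_continuous_image assms(1))
  then obtain b where "\<And>p. \<bar>u p\<bar> \<le> b" unfolding bounded_iff by auto
  then have "conformal_pair A g h u b"
    by unfold_locales (use assms(4) borel_measurable_continuous_onI[OF u] in auto)
  then show ?thesis ..
qed

lemma total_area_conformal:
  assumes "compact (UNIV :: 'm set)" "conformal_pair A g h u b"
  shows "(\<integral>\<^sup>+p. ennreal (exp (2 * u p)) \<partial>vol A h) = ennreal (total_area A g)"
proof -
  interpret conformal_pair A g h u b by fact
  have "(\<integral>\<^sup>+p. ennreal (exp (2 * u p)) \<partial>vol A h) = emeasure (vol A g) UNIV"
    unfolding vol_eq by (subst emeasure_density) auto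
  also have "\<dots> = ennreal (total_area A g)"
    unfolding total_area_def using G.emeasure_compact_finite[OF assms(1)] by (intro emeasure_eq_ennreal_measure) auto
  finally show ?thesis .
qed

lemma local_metric_chart: "c \<in> A ==> local_metric (snd c ` fst c) (\<lambda>x. h c (chart_inv c x))"
proof
  assume c: "c \<in> A"
  show "open (snd c ` fst c)" by (rule open_img[OF c])
  show "smooth_on (snd c ` fst c) (\<lambda>x. h c (chart_inv c x) $ i $ j)" for i j
    using riemannian c unfolding riemannian_metric_def by blast
  show "h c (chart_inv c x) $ 2 $ 1 = h c (chart_inv c x) $ 1 $ 2" "0 < h c (chart_inv c x) $ 1 $ 1"
    "0 < det (h c (chart_inv c x))" if "x \<in> snd c ` fst c" for x
    using metric_spd[OF c chart_inv_in[OF c that]] by blast+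
qed

text \<open>U and K are found before g, u and q, from h and a chart alone. A maximum point q in U
  lies in the square of half side r, where the box estimate is available, and the integral over the
  square of half side 2 r is at most B times the area of g.\<close>

lemma conformal_factor_estimate_near:
  assumes compact: "compact (UNIV :: 'm set)"
  shows "\<exists>U. open U \<and> p \<in> U \<and> (\<exists>K>0. \<forall>g u q. riemannian_metric A g \<longrightarrow> nonpositively_curved A g \<longrightarrow> smooth_fun A u \<longrightarrow>
    (\<forall>c\<in>A. \<forall>p\<in>fst c. g c p = exp (2 * u p) *\<^sub>R h c p) \<longrightarrow> q \<in> U \<longrightarrow> (\<forall>p. u p \<le> u q) \<longrightarrow> exp (2 * u q) \<le> K * total_area A g)"
proof -
  define c where "c = chart_at A p"
  have c: "c \<in> A" "p \<in> fst c" unfolding c_def by (rule chart_at_in)+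
  define z where "z = snd c p"
  let ?S = "snd c ` fst c" and ?G = "\<lambda>x. h c (chart_inv c x)"
  interpret local_metric ?S ?G by (rule local_metric_chart[OF c(1)])
  have "z \<in> ?S" using c by (simp add: z_def)
  then obtain r where r: "0 < r" "r \<le> 1" and K: "square z (2 * r) \<subseteq> ?S"
    using square_neighbourhood[OF open_S] by blast
  let ?K = "square z (2 * r)"
  obtain C where C: "C > 0" and est: "\<And>u G' x0. local_conformal ?S ?G u G' ==> x0 \<in> square z r ==>
    (\<forall>x\<in>?K. u x \<le> u x0 \<and> (\<Sum>l\<in>UNIV. G' x $ 1 $ l * riemann_tensor G' l 1 2 2 x) / det (G' x) \<le> 0) ==>
    exp (2 * u x0) \<le> C * (LINT x|lborel. indicator ?K x * exp (2 * u x))"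
    using conformal_factor_estimate_box[OF r K] by blast
  obtain B where B: "B > 0" "\<And>x. x \<in> ?K ==> 1 \<le> B * area_density c x"
    using metric_bounded_on_box[OF c(1) K] by metis
  define U where "U = fst c \<inter> snd c -` box (z - vec2 r) (z + vec2 r)"
  have U: "open U" unfolding U_def
    by (rule continuous_open_preimage[OF continuous_chart[OF c(1)] open_dom[OF c(1)] open_box])
  have pU: "p \<in> U" using c r by (auto simp: U_def z_def mem_box_cart)
  have "exp (2 * u q) \<le> C * B * total_area A g"
    if g: "riemannian_metric A g" "nonpositively_curved A g" and u: "smooth_fun A u"
      and conf: "\<And>c p. c \<in> A ==> p \<in> fst c ==> g c p = exp (2 * u p) *\<^sub>R h c p"
      and q: "q \<in> U" and max: "\<And>p. u p \<le> u q" for g u q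
  proof -
    obtain b where cp: "conformal_pair A g h u b" using smooth_conformal_pair[OF compact g(1) u conf] by blast
    have qc: "q \<in> fst c" "snd c q \<in> square z r" using q box_subset_cbox by (auto simp: U_def)
    have su: "smooth_on ?S (\<lambda>x. u (chart_inv c x))" using u c(1) unfolding smooth_fun_def comp_def by blast
    have lc: "local_conformal ?S ?G (\<lambda>x. u (chart_inv c x)) (\<lambda>x. g c (chart_inv c x))"
    proof
      show "smooth_on ?S (\<lambda>x. u (chart_inv c x))" by (rule su)
      show "g c (chart_inv c x) = exp (2 * u (chart_inv c x)) *\<^sub>R h c (chart_inv c x)" if "x \<in> ?S" for x
        by (rule conf[OF c(1) chart_inv_in[OF c(1) that]])
    qed
    have "exp (2 * u (chart_inv c (snd c q))) \<le> C * (LINT x|lborel. indicator ?K x * exp (2 * u (chart_inv c x)))"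
    proof (rule est[OF lc qc(2)], intro ballI conjI)
      fix x assume x: "x \<in> ?K"
      show "u (chart_inv c x) \<le> u (chart_inv c (snd c q))" using max qc c by simp
      have xS: "x \<in> ?S" using x K by blast
      have "gauss_curvature g c (chart_inv c x) \<le> 0"
        using g(2) c(1) chart_inv_in[OF c(1) xS] unfolding nonpositively_curved_def by blast
      then show "(\<Sum>l\<in>UNIV. g c (chart_inv c x) $ 1 $ l * riemann_tensor (\<lambda>x. g c (chart_inv c x)) l 1 2 2 x)
          / det (g c (chart_inv c x)) \<le> 0"
        unfolding gauss_curvature_def Let_def snd_chart_inv[OF c(1) xS] .
    qed
    also have "\<dots> \<le> C * (B * total_area A g)"
    proof (rule mult_left_mono)
      have cont: "continuous_on ?K (\<lambda>x. exp (2 * u (chart_inv c x)))"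
        using continuous_on_subset[OF smooth_on_imp_continuous_on[OF su] K] by (intro continuous_intros)
      have int: "integrable lborel (\<lambda>x. indicator ?K x * exp (2 * u (chart_inv c x)))"
        by (rule integrable_cbox_continuous[OF cont])
      have [measurable]: "u \<in> borel_measurable borel"
        by (rule borel_measurable_continuous_onI[OF smooth_fun_continuous[OF u]])
      have "ennreal (LINT x|lborel. indicator ?K x * exp (2 * u (chart_inv c x)))
        = (\<integral>\<^sup>+x. ennreal (indicator ?K x * exp (2 * u (chart_inv c x))) \<partial>lborel)"
        by (rule nn_integral_eq_integral[symmetric, OF int]) simp
      also have "\<dots> = (\<integral>\<^sup>+x. ennreal (exp (2 * u (chart_inv c x))) * indicator ?K x \<partial>lborel)"
        by (intro nn_integral_cong) (simp add: indicator_def)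
      also have "\<dots> \<le> ennreal B * (\<integral>\<^sup>+p. ennreal (exp (2 * u p)) \<partial>vol A h)"
        by (rule nn_integral_box_le_vol[OF c(1) K _ B(2,1)]) auto
      also have "\<dots> = ennreal (B * total_area A g)"
        unfolding total_area_conformal[OF compact cp] using B(1) by (intro ennreal_mult[symmetric]) (auto simp: total_area_def)
      finally show "(LINT x|lborel. indicator ?K x * exp (2 * u (chart_inv c x))) \<le> B * total_area A g"
        using B(1) by (subst (asm) ennreal_le_iff) (auto simp: total_area_def)
    qed (use C in simp)
    finally show ?thesis using qc c by (simp add: mult.assoc)
  qed
  moreover have "C * B > 0" using C B by simp
  ultimately show ?thesis using U pU by (intro exI[of _ U] conjI exI[of _ "C * B"]) blast+
qed

text \<open>By compactness finitely many such neighbourhoods cover the surface, and u attains its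
  maximum in one of them. The sum of their constants serves all cases.\<close>

lemma conformal_factor_estimate:
  assumes compact: "compact (UNIV :: 'm set)"
  shows "\<exists>K>0. \<forall>g u. riemannian_metric A g \<longrightarrow> nonpositively_curved A g \<longrightarrow> smooth_fun A u \<longrightarrow>
    (\<forall>c\<in>A. \<forall>p\<in>fst c. g c p = exp (2 * u p) *\<^sub>R h c p) \<longrightarrow> (\<forall>p. exp (2 * u p) \<le> K * total_area A g)"
proof -
  define P where "P K U \<longleftrightarrow> (\<forall>g u q. riemannian_metric A g \<longrightarrow> nonpositively_curved A g \<longrightarrow> smooth_fun A u \<longrightarrow>
    (\<forall>c\<in>A. \<forall>p\<in>fst c. g c p = exp (2 * u p) *\<^sub>R h c p) \<longrightarrow> q \<in> U \<longrightarrow> (\<forall>p. u p \<le> u q) \<longrightarrow>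
    exp (2 * u q) \<le> K * total_area A g)" for K :: real and U
  define \<U> where "\<U> = {U. open U \<and> (\<exists>K>0. P K U)}"
  have "UNIV \<subseteq> \<Union>\<U>" using conformal_factor_estimate_near[OF compact] unfolding P_def[symmetric] \<U>_def by blast
  then obtain F where F: "F \<subseteq> \<U>" "finite F" "UNIV \<subseteq> \<Union>F"
    using compactE[OF compact] unfolding \<U>_def by (metis (no_types, lifting) mem_Collect_eq)
  have "\<forall>U\<in>F. \<exists>K>0. P K U" using F(1) by (auto simp: \<U>_def)
  then obtain k where k: "\<And>U. U \<in> F ==> k U > 0 \<and> P (k U) U" by metis
  define K where "K = 1 + (\<Sum>U\<in>F. k U)"
  have kK: "k U \<le> K" if "U \<in> F" for U
    using member_le_sum[OF that, of k] k F(2) by (force simp: K_def less_imp_le)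
  have "K > 0" unfolding K_def using sum_nonneg[of F k] k by (force simp: less_imp_le)
  moreover have "exp (2 * u p) \<le> K * total_area A g"
    if g: "riemannian_metric A g" "nonpositively_curved A g" "smooth_fun A u"
      "\<forall>c\<in>A. \<forall>p\<in>fst c. g c p = exp (2 * u p) *\<^sub>R h c p" for g u p
  proof -
    obtain q where q: "\<And>p. u p \<le> u q"
      using continuous_attains_sup[OF compact _ smooth_fun_continuous[OF g(3)]] by auto
    obtain U where U: "U \<in> F" "q \<in> U" using F(3) by blast
    have "exp (2 * u p) \<le> exp (2 * u q)" using q by simp
    also have "\<dots> \<le> k U * total_area A g" using k[OF U(1)] U(2) g q unfolding P_def by blast
    also have "\<dots> \<le> K * total_area A g" using kK[OF U(1)] by (intro mult_right_mono) (auto simp: total_area_def)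
    finally show ?thesis .
  qed
  ultimately show ?thesis by blast
qed

end

section \<open>The Poincare inequality\<close>

text \<open>Somewhere on K the function g is at most its mean. It serves to pick a line carrying no
  more than its share of the energy.\<close>

lemma average_point:
  fixes g :: "'a \<Rightarrow> ennreal"
  assumes [measurable]: "g \<in> borel_measurable M" "K \<in> sets M" and K: "emeasure M K = ennreal m" "0 < m"
  shows "\<exists>y\<in>K. ennreal m * g y \<le> (\<integral>\<^sup>+y. g y * indicator K y \<partial>M)"
proof (rule ccontr)
  let ?I = "\<integral>\<^sup>+y. g y * indicator K y \<partial>M"
  assume "\<not> ?thesis"
  then have less: "?I < ennreal m * g y" if "y \<in> K" for y using that by (auto simp: not_le)
  have "K \<noteq> {}" using K by auto
  then obtain y where "y \<in> K" by blast
  from less[OF this] have fin: "?I < top" by (rule less_le_trans) simp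
  have I: "(\<integral>\<^sup>+y. ?I * indicator K y \<partial>M) = ?I * ennreal m"
    by (subst nn_integral_cmult_indicator) (simp_all add: K)
  \<comment> \<open>If g exceeded its mean everywhere on K, integrating over K would give m I < m I;
    strictness holds because I is finite and K is not a null set.\<close>
  have "(\<integral>\<^sup>+y. ?I * indicator K y \<partial>M) < (\<integral>\<^sup>+y. (ennreal m * g y) * indicator K y \<partial>M)"
  proof (rule nn_integral_less)
    show "(\<integral>\<^sup>+y. ?I * indicator K y \<partial>M) \<noteq> \<infinity>"
      unfolding I using fin by (simp add: ennreal_mult_eq_top_iff less_top)
    show "AE y in M. ?I * indicator K y \<le> ennreal m * g y * indicator K y"
      using less by (intro AE_I2) (auto simp: indicator_def less_imp_le)
    show "\<not> (AE y in M. ennreal m * g y * indicator K y \<le> ?I * indicator K y)"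
    proof
      assume "AE y in M. ennreal m * g y * indicator K y \<le> ?I * indicator K y"
      then have "AE y in M. y \<notin> K"
        by (rule eventually_mono) (use less in \<open>auto simp: indicator_def not_le[symmetric] split: if_splits\<close>)
      then have "K \<in> null_sets M" by (subst AE_iff_null_sets) auto
      then show False using K by auto
    qed
  qed measurable
  also have "(\<integral>\<^sup>+y. (ennreal m * g y) * indicator K y \<partial>M) = ennreal m * ?I"
    by (subst nn_integral_cmult[symmetric]) (simp_all add: mult.assoc)
  finally show False unfolding I by (simp add: mult.commute)
qed

text \<open>The Cauchy-Schwarz inequality on an interval, obtained by integrating (F - m)^2 \<ge> 0
  with m the mean of F between the two points.\<close>

lemma slice_oscillation:
  fixes f F :: "real \<Rightarrow> real"
  assumes der: "\<And>t. t \<in> {a..b} ==> (f has_real_derivative F t) (at t within {a..b})"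
    and F: "continuous_on {a..b} F" and xy: "x \<in> {a..b}" "y \<in> {a..b}"
  shows "ennreal ((f x - f y)\<^sup>2) \<le> ennreal (b - a) * (\<integral>\<^sup>+t. ennreal ((F t)\<^sup>2) * indicator {a..b} t \<partial>lborel)"
proof -
  let ?R = "integral {a..b} (\<lambda>t. (F t)\<^sup>2)"
  have F2: "continuous_on {a..b} (\<lambda>t. (F t)\<^sup>2)" using F by (intro continuous_intros)
  have R0: "0 \<le> ?R" by (intro integral_nonneg integrable_continuous_real F2) simp
  have main: "(f x - f y)\<^sup>2 \<le> (b - a) * ?R" if xy: "x \<in> {a..b}" "y \<in> {a..b}" "y \<le> x" for x y
  proof (cases "x = y")
    case True
    then show ?thesis using R0 xy by simp
  next
    case False
    then have l: "0 < x - y" using xy by simp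
    have sub: "{y..x} \<subseteq> {a..b}" using xy by auto
    let ?I = "integral {y..x} (\<lambda>t. (F t)\<^sup>2)" and ?d = "f x - f y"
    have 1: "(F has_integral ?d) {y..x}"
    proof (rule fundamental_theorem_of_calculus[OF xy(3)])
      fix t assume "t \<in> {y..x}"
      then have "t \<in> {a..b}" using sub by blast
      from DERIV_subset[OF der[OF this] sub] show "(f has_vector_derivative F t) (at t within {y..x})"
        by (simp add: has_real_derivative_iff_has_vector_derivative)
    qed
    have int: "(\<lambda>t. (F t)\<^sup>2) integrable_on {y..x}" by (intro integrable_continuous_real continuous_on_subset[OF F2 sub])
    define m where "m = ?d / (x - y)"
    have md: "m * (x - y) = ?d" using l by (simp add: m_def)
    have "((\<lambda>t. (F t)\<^sup>2 - (2 * m) * F t + m\<^sup>2) has_integral (?I - (2 * m) * ?d + (x - y) *\<^sub>R m\<^sup>2)) {y..x}"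
      using has_integral_add[OF has_integral_diff[OF integrable_integral[OF int] has_integral_mult_right[OF 1, of "2 * m"]] has_integral_const_real[of "m\<^sup>2" y x]] xy
      by simp
    then have "0 \<le> ?I - (2 * m) * ?d + (x - y) *\<^sub>R m\<^sup>2"
    proof (rule has_integral_nonneg)
      show "0 \<le> (F t)\<^sup>2 - (2 * m) * F t + m\<^sup>2" for t
        using zero_le_power2[of "F t - m"] by (simp add: power2_diff algebra_simps)
    qed
    then have "0 \<le> ?I - m\<^sup>2 * (x - y)" unfolding md[symmetric] by (simp add: power2_eq_square algebra_simps)
    then have "0 \<le> (x - y) * (?I - m\<^sup>2 * (x - y))" using l by simp
    then have "?d\<^sup>2 \<le> (x - y) * ?I" unfolding md[symmetric] by (simp add: power2_eq_square algebra_simps)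
    also have "\<dots> \<le> (b - a) * ?R"
      using xy l R0 by (intro mult_mono integral_subset_le[OF sub int integrable_continuous_real[OF F2]]) (auto intro!: integral_nonneg int)
    finally show ?thesis .
  qed
  have le: "(f x - f y)\<^sup>2 \<le> (b - a) * ?R"
    using main[of x y] main[of y x] xy by (cases "y \<le> x") (auto simp: power2_commute)
  have "(\<lambda>t. indicator {a..b} t * (F t)\<^sup>2) \<in> borel_measurable borel"
    using borel_measurable_continuous_on_indicator[OF _ F2] by simp
  then have "(\<integral>\<^sup>+t. ennreal ((F t)\<^sup>2) * indicator {a..b} t \<partial>lborel) = ennreal ?R"
    using has_integral_iff_nn_integral_indicator[of "{a..b}" "\<lambda>t. (F t)\<^sup>2" ?R] R0 integrable_integral[OF integrable_continuous_real[OF F2]] by simp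
  then show ?thesis using le R0 xy by (simp add: ennreal_mult[symmetric] ennreal_leI)
qed

lemma coord_slice_oscillation:
  assumes S: "open S" "smooth_on S f" and K: "square z r \<subseteq> S"
    and st: "coord_pair i t s \<in> square z r" "coord_pair i t s' \<in> square z r"
  shows "ennreal ((f (coord_pair i t s) - f (coord_pair i t s'))\<^sup>2) \<le> ennreal (2 * r) *
    (\<integral>\<^sup>+v. ennreal ((partial_deriv i f (coord_pair i t v))\<^sup>2) * indicator (square z r) (coord_pair i t v) \<partial>lborel)"
proof -
  let ?K = "square z r" and ?T = "{z $ i - r..z $ i + r}" and ?c = "coord_pair i t"
  have iK: "?c v \<in> ?K \<longleftrightarrow> v \<in> ?T" for v
    using st(1) exhaust_2[of i] by (auto simp: mem_square coord_pair_def abs_le_iff)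
  have sub: "?c v \<in> S" if "v \<in> ?T" for v using that iK K by blast
  have "ennreal ((f (?c s) - f (?c s'))\<^sup>2) \<le> ennreal ((z $ i + r) - (z $ i - r)) *
    (\<integral>\<^sup>+v. ennreal ((partial_deriv i f (?c v))\<^sup>2) * indicator ?T v \<partial>lborel)"
  proof (rule slice_oscillation[where f = "\<lambda>v. f (?c v)"])
    show "((\<lambda>v. f (?c v)) has_real_derivative partial_deriv i f (?c v)) (at v within ?T)" if "v \<in> ?T" for v
      using partial_deriv_has_field_derivative[of f "coord_pair i t 0" v i] smooth_on_imp_differentiable[OF S(2,1) sub[OF that]]
      by (simp add: coord_pair_axis[symmetric] has_field_derivative_at_within)
    have "continuous_on ?T (\<lambda>v. coord_pair i t 0 + v *\<^sub>R axis i 1)" by (intro continuous_intros)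
    then have "continuous_on ?T ?c" unfolding coord_pair_axis[symmetric] .
    then show "continuous_on ?T (\<lambda>v. partial_deriv i f (?c v))"
      by (rule continuous_on_compose2[OF smooth_on_imp_continuous_on[OF smooth_on_partial[OF S(2)]]]) (use sub in auto)
  qed (use st iK in auto)
  also have "(\<integral>\<^sup>+v. ennreal ((partial_deriv i f (?c v))\<^sup>2) * indicator ?T v \<partial>lborel)
     = (\<integral>\<^sup>+v. ennreal ((partial_deriv i f (?c v))\<^sup>2) * indicator ?K (?c v) \<partial>lborel)"
    by (intro nn_integral_cong) (simp add: indicator_def iK)
  finally show ?thesis by simp
qed

lemma ennreal_square_diff_le: "ennreal ((x - z)\<^sup>2) \<le> 2 * ennreal ((x - y)\<^sup>2) + 2 * ennreal ((y - z)\<^sup>2)"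
proof -
  have "(x - z)\<^sup>2 \<le> 2 * (x - y)\<^sup>2 + 2 * (y - z)\<^sup>2"
    using zero_le_power2[of "(x - y) - (y - z)"] by (simp add: power2_eq_square algebra_simps)
  then have "ennreal ((x - z)\<^sup>2) \<le> ennreal (2 * (x - y)\<^sup>2 + 2 * (y - z)\<^sup>2)" by (rule ennreal_leI)
  then show ?thesis by (simp add: ennreal_plus ennreal_mult)
qed

text \<open>Each point is joined to the fixed point (s0, z2) by a horizontal segment to the line x1
  = s0 and a segment of that line. By \<open>average_point\<close>, s0 can be chosen so that the
  energy on this line is at most its mean over all vertical lines. The constant is 2 (2 r)^2: the 2
  comes from splitting a square, one side length from the oscillation bound, the other from
  integrating over the square.\<close>

lemma square_poincare:
  assumes S: "open S" "smooth_on S f" and K: "square z r \<subseteq> S" and r: "0 < r"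
  shows "\<exists>a. (\<integral>\<^sup>+x. ennreal ((f x - a)\<^sup>2) * indicator (square z r) x \<partial>lborel)
    \<le> ennreal (8 * r\<^sup>2) * ((\<integral>\<^sup>+x. ennreal ((partial_deriv 1 f x)\<^sup>2) * indicator (square z r) x \<partial>lborel)
      + (\<integral>\<^sup>+x. ennreal ((partial_deriv 2 f x)\<^sup>2) * indicator (square z r) x \<partial>lborel))"
proof -
  let ?K = "square z r" and ?T = "\<lambda>i. {z $ i - r..z $ i + r}"
  define H where "H i x = ennreal ((partial_deriv i f x)\<^sup>2) * indicator ?K x" for i x
  have Hm: "H i \<in> borel_measurable borel" for i
  proof -
    have "(\<lambda>x. indicator ?K x * partial_deriv i f x) \<in> borel_measurable borel"
      using borel_measurable_integrable[OF integrable_cbox_continuous[OF continuous_on_subset[OF smooth_on_imp_continuous_on[OF smooth_on_partial[OF S(2)]] K]]] by simp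
    then have "(\<lambda>x. ennreal ((indicator ?K x * partial_deriv i f x)\<^sup>2)) \<in> borel_measurable borel" by measurable
    moreover have "H i = (\<lambda>x. ennreal ((indicator ?K x * partial_deriv i f x)\<^sup>2))" by (auto simp: H_def indicator_def)
    ultimately show ?thesis by simp
  qed
  define W where "W i t = (\<integral>\<^sup>+v. H i (coord_pair i t v) \<partial>lborel)" for i t
  have Wm [measurable]: "W i \<in> borel_measurable borel" for i
  proof -
    have "(\<lambda>t. \<integral>\<^sup>+v. H i (case (t, v) of (t, s) \<Rightarrow> coord_pair i t s) \<partial>lborel) \<in> borel_measurable lborel"
      by (rule lborel.borel_measurable_nn_integral_fst[OF measurable_compose[OF measurable_coord_pair Hm]])
    then show ?thesis by (simp add: W_def[abs_def])
  qed
  have HW: "(\<integral>\<^sup>+x. H i x \<partial>lborel) = (\<integral>\<^sup>+t. W i t \<partial>lborel)" for i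
    unfolding W_def by (rule nn_integral_coord_pair[OF Hm])
  have T: "emeasure lborel (?T i) = ennreal (2 * r)" for i using r by simp
  obtain s0 where s0: "s0 \<in> ?T 1" "ennreal (2 * r) * W 2 s0 \<le> (\<integral>\<^sup>+t. W 2 t * indicator (?T 1) t \<partial>lborel)"
    using average_point[of "W 2" lborel "?T 1", OF _ _ T] r by auto
  have W2: "ennreal (2 * r) * W 2 s0 \<le> (\<integral>\<^sup>+x. H 2 x \<partial>lborel)"
    unfolding HW by (rule order_trans[OF s0(2)]) (intro nn_integral_mono, simp add: indicator_def)
  define a where "a = f (coord_pair 2 s0 (z $ 2))"
  let ?c = "ennreal (2 * r)"
  have pt: "ennreal ((f x - a)\<^sup>2) \<le> 2 * (?c * W 1 (x $ 2)) + 2 * (?c * W 2 s0)" if x: "x \<in> ?K" for x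
  proof -
    have e: "x = coord_pair 1 (x $ 2) (x $ 1)" "coord_pair 2 s0 (x $ 2) = coord_pair 1 (x $ 2) s0"
      by (auto simp: coord_pair_def vec_eq_iff forall_2)
    have y: "coord_pair 1 (x $ 2) s0 \<in> ?K" "coord_pair 2 s0 (z $ 2) \<in> ?K"
      using x s0(1) r by (auto simp: mem_square coord_pair_def abs_le_iff)
    let ?y = "coord_pair 1 (x $ 2) s0"
    have "ennreal ((f (coord_pair 1 (x $ 2) (x $ 1)) - f ?y)\<^sup>2) \<le> ?c * W 1 (x $ 2)"
      unfolding W_def H_def by (rule coord_slice_oscillation[OF S K]) (use x y e in simp_all)
    moreover have "ennreal ((f (coord_pair 2 s0 (x $ 2)) - a)\<^sup>2) \<le> ?c * W 2 s0"
      unfolding W_def H_def a_def by (rule coord_slice_oscillation[OF S K]) (use y e in simp_all)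
    ultimately have "2 * ennreal ((f x - f ?y)\<^sup>2) + 2 * ennreal ((f ?y - a)\<^sup>2) \<le> 2 * (?c * W 1 (x $ 2)) + 2 * (?c * W 2 s0)"
      unfolding e(1)[symmetric] e(2) by (intro add_mono mult_left_mono) auto
    then show ?thesis by (rule order_trans[OF ennreal_square_diff_le])
  qed
  let ?X = "\<lambda>t. 2 * (?c * W 1 t) + 2 * (?c * W 2 s0)"
  have "(\<integral>\<^sup>+x. ennreal ((f x - a)\<^sup>2) * indicator ?K x \<partial>lborel) \<le> (\<integral>\<^sup>+x. ?X (x $ 2) * indicator ?K x \<partial>lborel)"
    using pt by (intro nn_integral_mono) (auto simp: indicator_def)
  also have "\<dots> = (\<integral>\<^sup>+t. \<integral>\<^sup>+s. ?X (coord_pair 1 t s $ 2) * indicator ?K (coord_pair 1 t s) \<partial>lborel \<partial>lborel)"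
    by (rule nn_integral_coord_pair) measurable
  also have "\<dots> = (\<integral>\<^sup>+t. \<integral>\<^sup>+s. (?X t * indicator (?T 2) t) * indicator (?T 1) s \<partial>lborel \<partial>lborel)"
    by (intro nn_integral_cong) (auto simp: indicator_def mem_square coord_pair_def abs_le_iff)
  also have "\<dots> = (\<integral>\<^sup>+t. (?X t * indicator (?T 2) t) * ?c \<partial>lborel)"
    by (intro nn_integral_cong, subst nn_integral_cmult_indicator) (simp_all only: T sets_lborel borel_closed[OF closed_atLeastAtMost])
  also have "\<dots> \<le> (\<integral>\<^sup>+t. (2 * ?c * ?c) * W 1 t + (2 * ?c * ?c * W 2 s0) * indicator (?T 2) t \<partial>lborel)"
    by (intro nn_integral_mono) (auto simp: indicator_def algebra_simps)
  also have "\<dots> = 2 * ?c * ?c * (\<integral>\<^sup>+t. W 1 t \<partial>lborel) + 2 * ?c * ?c * W 2 s0 * ?c"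
  proof -
    have "(\<integral>\<^sup>+t. (2 * ?c * ?c * W 2 s0) * indicator (?T 2) t \<partial>lborel) = 2 * ?c * ?c * W 2 s0 * ?c"
      by (subst nn_integral_cmult_indicator) (simp_all only: T sets_lborel borel_closed[OF closed_atLeastAtMost])
    then show ?thesis by (subst nn_integral_add) (simp_all add: nn_integral_cmult)
  qed
  also have "\<dots> = 2 * ?c * ?c * ((\<integral>\<^sup>+x. H 1 x \<partial>lborel) + ?c * W 2 s0)" unfolding HW by (simp add: algebra_simps)
  also have "\<dots> \<le> 2 * ?c * ?c * ((\<integral>\<^sup>+x. H 1 x \<partial>lborel) + (\<integral>\<^sup>+x. H 2 x \<partial>lborel))"
    by (intro mult_left_mono add_left_mono W2) simp
  also have "2 * ?c * ?c = ennreal (8 * r\<^sup>2)"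
  proof -
    have "2 * ?c * ?c = ennreal (2 * (2 * r) * (2 * r))" using r by (simp only: ennreal_mult ennreal_numeral zero_le_numeral mult_nonneg_nonneg less_imp_le)
    then show ?thesis by (simp add: power2_eq_square)
  qed
  finally show ?thesis unfolding H_def by blast
qed

section \<open>From squares to the whole surface\<close>

context metric_surface
begin

definition test_energy :: "('m \<Rightarrow> real) \<Rightarrow> ennreal" where
  "test_energy \<phi> = (\<integral>\<^sup>+p. ennreal (covector_inner A g (differential \<phi>) (differential \<phi>) p) \<partial>vol A g)"

text \<open>The energy on the right is that of the whole surface, so the inequalities of overlapping
  sets can be combined by enlarging the constant. The number a may depend on \<phi>.\<close>

definition poincare_set :: "'m set \<Rightarrow> bool" where
  "poincare_set U \<longleftrightarrow> open U \<and> (\<exists>C<top. \<forall>\<phi>. test_fun A \<phi> \<longrightarrow>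
    (\<exists>a. (\<integral>\<^sup>+p. ennreal ((\<phi> p - a)\<^sup>2) * indicator U p \<partial>vol A g) \<le> C * test_energy \<phi>))"

lemma covector_inner_nonneg: "covector_field A \<alpha> ==> 0 \<le> covector_inner A g \<alpha> \<alpha> p"
  by (simp add: covector_inner_frame)

lemma covector_inner_measurable:
  assumes "covector_field A \<alpha>" "covector_field A \<beta>"
  shows "covector_inner A g \<alpha> \<beta> \<in> borel_measurable borel"
proof -
  have [measurable]: "frame \<alpha> \<in> borel_measurable borel" "frame \<beta> \<in> borel_measurable borel"
    using assms measurable_frame by auto
  show ?thesis unfolding covector_inner_frame[OF assms, abs_def] by measurable
qed

text \<open>Used in \<open>poincare_Un\<close>, where the area of an overlap appears as a
  divisor.\<close>

lemma emeasure_open_pos: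
  assumes "open W" "W \<noteq> {}" shows "0 < emeasure (vol A g) W"
proof -
  obtain p where p: "p \<in> W" using assms(2) by blast
  define c where "c = chart_at A p"
  have c: "c \<in> A" "p \<in> fst c" unfolding c_def by (rule chart_at_in)+
  let ?S = "snd c ` (fst c \<inter> W)"
  have "open ?S" by (intro open_image c open_Int open_dom assms) auto
  then obtain r where r: "0 < r" and K: "square (snd c p) (2 * r) \<subseteq> ?S"
    using square_neighbourhood[of ?S "snd c p"] c p by blast
  let ?K = "square (snd c p) (2 * r)"
  have K': "?K \<subseteq> snd c ` fst c" using K by blast
  obtain B where B: "B > 0" "\<And>x. x \<in> ?K ==> 1 \<le> B * area_density c x"
    using metric_bounded_on_box[OF c(1) K'] by metis
  have "emeasure lborel ?K = ennreal (4 * (2 * r)\<^sup>2)"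
    using r measure_square[of "2 * r" "snd c p"] emeasure_lborel_cbox_finite
    by (subst emeasure_eq_ennreal_measure) (auto simp: less_top)
  moreover have "emeasure lborel ?K = (\<integral>\<^sup>+x. indicator W (chart_inv c x) * indicator ?K x \<partial>lborel)"
  proof -
    have "indicator W (chart_inv c x) * indicator ?K x = (indicator ?K x :: ennreal)" for x
      using K c(1) by (auto simp: indicator_def)
    then show ?thesis by simp
  qed
  moreover have "\<dots> \<le> ennreal B * (\<integral>\<^sup>+p. indicator W p \<partial>vol A g)"
    by (rule nn_integral_box_le_vol[OF c(1) K' _ B(2,1)]) (use assms(1) in auto)
  ultimately have "ennreal (4 * (2 * r)\<^sup>2) \<le> ennreal B * emeasure (vol A g) W" using assms(1) by simp
  moreover have "0 < ennreal (4 * (2 * r)\<^sup>2)" using r by simp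
  ultimately have "0 < ennreal B * emeasure (vol A g) W" by (rule less_le_trans[rotated])
  then show ?thesis by (auto simp: ennreal_zero_less_mult_iff)
qed

lemma poincare_near: "\<exists>U. poincare_set U \<and> p \<in> U"
proof -
  define c where "c = chart_at A p"
  have c: "c \<in> A" "p \<in> fst c" unfolding c_def by (rule chart_at_in)+
  let ?S = "snd c ` fst c" and ?z = "snd c p"
  obtain r' where r': "0 < r'" and K': "square ?z (2 * r') \<subseteq> ?S"
    using square_neighbourhood[OF open_img[OF c(1)], of ?z] c by blast
  define r where "r = 2 * r'"
  have r: "0 < r" and K: "square ?z r \<subseteq> ?S" using r' K' by (simp_all add: r_def)
  let ?K = "square ?z r"
  obtain B where B: "B > 0" "\<And>x. x \<in> ?K ==> 1 \<le> B * area_density c x" "\<And>x. x \<in> ?K ==> area_density c x \<le> B"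
    "\<And>x i. x \<in> ?K ==> g c (chart_inv c x) $ i $ i \<le> B"
    using metric_bounded_on_box[OF c(1) K] by metis
  define U where "U = fst c \<inter> snd c -` box (?z - vec2 r) (?z + vec2 r)"
  have U: "open U" unfolding U_def
    by (rule continuous_open_preimage[OF continuous_chart[OF c(1)] open_dom[OF c(1)] open_box])
  have pU: "p \<in> U" using c r by (auto simp: U_def mem_box_cart)
  have Uc: "U \<subseteq> fst c" and UK: "snd c ` U \<subseteq> ?K" using box_subset_cbox by (auto simp: U_def)
  \<comment> \<open>One B for the area density and 8 r^2 from the square; for each of the two
    partial derivatives one B compares it with the metric norm and another compares the
    integrals.\<close>
  define C where "C = ennreal B * (ennreal (8 * r\<^sup>2) * (2 * (ennreal B * ennreal B)))"
  have "\<exists>a. (\<integral>\<^sup>+p. ennreal ((\<phi> p - a)\<^sup>2) * indicator U p \<partial>vol A g) \<le> C * test_energy \<phi>" if t: "test_fun A \<phi>" for \<phi>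
  proof -
    have sm: "smooth_fun A \<phi>" using t by (simp add: test_fun_def)
    have [measurable]: "\<phi> \<in> borel_measurable borel"
      by (rule borel_measurable_continuous_onI[OF smooth_fun_continuous[OF sm]])
    let ?f = "\<phi> \<circ> chart_inv c" and ?d = "covector_inner A g (differential \<phi>) (differential \<phi>)"
    have sf: "smooth_on ?S ?f" using sm c(1) unfolding smooth_fun_def by blast
    note cd = covector_field_differential[OF sm]
    have [measurable]: "?d \<in> borel_measurable borel" by (rule covector_inner_measurable[OF cd cd])
    obtain a where a: "(\<integral>\<^sup>+x. ennreal ((?f x - a)\<^sup>2) * indicator ?K x \<partial>lborel)
      \<le> ennreal (8 * r\<^sup>2) * ((\<integral>\<^sup>+x. ennreal ((partial_deriv 1 ?f x)\<^sup>2) * indicator ?K x \<partial>lborel)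
      + (\<integral>\<^sup>+x. ennreal ((partial_deriv 2 ?f x)\<^sup>2) * indicator ?K x \<partial>lborel))"
      using square_poincare[OF open_img[OF c(1)] sf K r] by blast
    have D: "(\<integral>\<^sup>+x. ennreal ((partial_deriv i ?f x)\<^sup>2) * indicator ?K x \<partial>lborel) \<le> ennreal B * ennreal B * test_energy \<phi>" for i
    proof -
      have "(\<integral>\<^sup>+x. ennreal ((partial_deriv i ?f x)\<^sup>2) * indicator ?K x \<partial>lborel)
        \<le> (\<integral>\<^sup>+x. ennreal (B * ?d (chart_inv c x)) * indicator ?K x \<partial>lborel)"
      proof (rule nn_integral_mono)
        fix x
        have "(partial_deriv i ?f x)\<^sup>2 \<le> B * ?d (chart_inv c x)" if x: "x \<in> ?K"
        proof -
          have xS: "x \<in> ?S" using x K by blast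
          let ?p = "chart_inv c x"
          have pc: "?p \<in> fst c" by (rule chart_inv_in[OF c(1) xS])
          have "partial_deriv i ?f x = differential \<phi> c ?p $ i"
            using snd_chart_inv[OF c(1) xS] by (simp add: differential_def)
          then have "(partial_deriv i ?f x)\<^sup>2 \<le> g c ?p $ i $ i * ?d ?p"
            using covector_component_le[OF metric_spd(1-4)[OF c(1) pc], of "differential \<phi> c ?p" i]
            unfolding covector_inner_in_chart[OF cd cd c(1) pc] by simp
          also have "\<dots> \<le> B * ?d ?p" by (intro mult_right_mono B(4) x covector_inner_nonneg cd)
          finally show ?thesis .
        qed
        then show "ennreal ((partial_deriv i ?f x)\<^sup>2) * indicator ?K x \<le> ennreal (B * ?d (chart_inv c x)) * indicator ?K x"
          by (auto simp: indicator_def ennreal_leI simp del: ennreal_le_iff)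
      qed
      also have "\<dots> \<le> ennreal B * (\<integral>\<^sup>+p. ennreal (B * ?d p) \<partial>vol A g)"
        by (rule nn_integral_box_le_vol[OF c(1) K _ B(2,1)]) auto
      also have "(\<integral>\<^sup>+p. ennreal (B * ?d p) \<partial>vol A g) = ennreal B * test_energy \<phi>"
        unfolding test_energy_def using B(1) covector_inner_nonneg[OF cd]
        by (subst nn_integral_cmult[symmetric]) (auto simp: ennreal_mult)
      finally show ?thesis unfolding mult.assoc .
    qed
    have m: "(\<lambda>x. ennreal ((?f x - a)\<^sup>2) * indicator ?K x) \<in> borel_measurable borel"
    proof -
      have "continuous_on ?K (\<lambda>x. ?f x - a)"
        using continuous_on_subset[OF smooth_on_imp_continuous_on[OF sf] K] by (intro continuous_on_diff continuous_on_const)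
      then have "(\<lambda>x. indicator ?K x * (?f x - a)) \<in> borel_measurable borel"
        using borel_measurable_integrable[OF integrable_cbox_continuous] by simp
      then have "(\<lambda>x. ennreal ((indicator ?K x * (?f x - a))\<^sup>2)) \<in> borel_measurable borel" by measurable
      moreover have "(\<lambda>x. ennreal ((?f x - a)\<^sup>2) * indicator ?K x) = (\<lambda>x. ennreal ((indicator ?K x * (?f x - a))\<^sup>2))"
        by (auto simp: indicator_def)
      ultimately show ?thesis by simp
    qed
    have "(\<integral>\<^sup>+p. ennreal ((\<phi> p - a)\<^sup>2) * indicator U p \<partial>vol A g)
      = (\<integral>\<^sup>+x. ennreal (area_density c x) * ennreal ((\<phi> (chart_inv c x) - a)\<^sup>2) * indicator (snd c ` U) x \<partial>lborel)"
      by (rule nn_integral_vol_chart[OF c(1) _ Uc]) (use U in auto)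
    also have "\<dots> \<le> (\<integral>\<^sup>+x. ennreal B * (ennreal ((?f x - a)\<^sup>2) * indicator ?K x) \<partial>lborel)"
    proof (rule nn_integral_mono)
      fix x
      show "ennreal (area_density c x) * ennreal ((\<phi> (chart_inv c x) - a)\<^sup>2) * indicator (snd c ` U) x
        \<le> ennreal B * (ennreal ((?f x - a)\<^sup>2) * indicator ?K x)"
      proof (cases "x \<in> snd c ` U")
        case True
        then have x: "x \<in> ?K" using UK by blast
        have "ennreal (area_density c x) * ennreal ((\<phi> (chart_inv c x) - a)\<^sup>2) \<le> ennreal B * ennreal ((\<phi> (chart_inv c x) - a)\<^sup>2)"
          by (intro mult_right_mono ennreal_leI B(3) x) simp
        then show ?thesis using True x by simp
      qed simp
    qed
    also have "\<dots> = ennreal B * (\<integral>\<^sup>+x. ennreal ((?f x - a)\<^sup>2) * indicator ?K x \<partial>lborel)"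
      by (rule nn_integral_cmult) (use m in simp)
    also have "\<dots> \<le> ennreal B * (ennreal (8 * r\<^sup>2) * (ennreal B * ennreal B * test_energy \<phi> + ennreal B * ennreal B * test_energy \<phi>))"
      by (intro mult_left_mono order_trans[OF a] add_mono D) auto
    also have "\<dots> = C * test_energy \<phi>" unfolding C_def mult_2 by (simp add: algebra_simps)
    finally show ?thesis by blast
  qed
  moreover have "C < top" by (simp add: C_def ennreal_mult_less_top)
  ultimately show ?thesis using U pU unfolding poincare_set_def by blast
qed

text \<open>On the overlap \<phi> is close to both constants a and b, so |a - b|^2 times its area m
  is controlled by the energy. Replacing b by a on V then costs |a - b|^2 times the area v of V,
  whence the factor v / m.\<close>

lemma poincare_Un:
  assumes "compact (UNIV :: 'm set)" "poincare_set U" "poincare_set V" "U \<inter> V \<noteq> {}"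
  shows "poincare_set (U \<union> V)"
proof -
  have o: "open U" "open V" using assms by (auto simp: poincare_set_def)
  then have [measurable]: "U \<in> sets borel" "V \<in> sets borel" by auto
  obtain C1 C2 where C: "C1 < top" "C2 < top"
    and P1: "\<And>\<phi>. test_fun A \<phi> ==> \<exists>a. (\<integral>\<^sup>+p. ennreal ((\<phi> p - a)\<^sup>2) * indicator U p \<partial>vol A g) \<le> C1 * test_energy \<phi>"
    and P2: "\<And>\<phi>. test_fun A \<phi> ==> \<exists>a. (\<integral>\<^sup>+p. ennreal ((\<phi> p - a)\<^sup>2) * indicator V p \<partial>vol A g) \<le> C2 * test_energy \<phi>"
  proof -
    from assms(2) obtain C1 where 1: "C1 < top" "\<forall>\<phi>. test_fun A \<phi> \<longrightarrow> (\<exists>a. (\<integral>\<^sup>+p. ennreal ((\<phi> p - a)\<^sup>2) * indicator U p \<partial>vol A g) \<le> C1 * test_energy \<phi>)"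
      unfolding poincare_set_def by (elim conjE exE)
    from assms(3) obtain C2 where 2: "C2 < top" "\<forall>\<phi>. test_fun A \<phi> \<longrightarrow> (\<exists>a. (\<integral>\<^sup>+p. ennreal ((\<phi> p - a)\<^sup>2) * indicator V p \<partial>vol A g) \<le> C2 * test_energy \<phi>)"
      unfolding poincare_set_def by (elim conjE exE)
    show thesis by (rule that[OF 1(1) 2(1) 1(2)[rule_format] 2(2)[rule_format]])
  qed
  have fin: "emeasure (vol A g) X = ennreal (measure (vol A g) X)" for X
  proof -
    have "emeasure (vol A g) X \<le> emeasure (vol A g) UNIV" by (rule emeasure_mono) auto
    then show ?thesis using emeasure_compact_finite[OF assms(1)] by (intro emeasure_eq_ennreal_measure) auto
  qed
  define m v where "m = measure (vol A g) (U \<inter> V)" and "v = measure (vol A g) V"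
  have m: "0 < m" using emeasure_open_pos[OF open_Int[OF o] assms(4)] unfolding fin m_def by simp
  have v: "0 \<le> v" by (simp add: v_def)
  define C where "C = C1 + 2 * C2 + 2 * ((2 * C1 + 2 * C2) * ennreal (v / m))"
  have "\<exists>a. (\<integral>\<^sup>+p. ennreal ((\<phi> p - a)\<^sup>2) * indicator (U \<union> V) p \<partial>vol A g) \<le> C * test_energy \<phi>" if t: "test_fun A \<phi>" for \<phi>
  proof -
    have [measurable]: "\<phi> \<in> borel_measurable borel"
      using t by (intro borel_measurable_continuous_onI smooth_fun_continuous) (simp add: test_fun_def)
    obtain a b where a: "(\<integral>\<^sup>+p. ennreal ((\<phi> p - a)\<^sup>2) * indicator U p \<partial>vol A g) \<le> C1 * test_energy \<phi>"
      and b: "(\<integral>\<^sup>+p. ennreal ((\<phi> p - b)\<^sup>2) * indicator V p \<partial>vol A g) \<le> C2 * test_energy \<phi>"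
      using P1[OF t] P2[OF t] by blast
    let ?E = "test_energy \<phi>" and ?X = "\<lambda>p. ennreal ((\<phi> p - a)\<^sup>2) * indicator U p" and ?Y = "\<lambda>p. ennreal ((\<phi> p - b)\<^sup>2) * indicator V p"
    let ?D = "ennreal ((a - b)\<^sup>2)"
    have 1: "?D * ennreal m \<le> 2 * (C1 * ?E) + 2 * (C2 * ?E)"
    proof -
      have "?D * ennreal m = (\<integral>\<^sup>+p. ?D * indicator (U \<inter> V) p \<partial>vol A g)"
        unfolding m_def fin[symmetric] by (subst nn_integral_cmult_indicator) auto
      also have "\<dots> \<le> (\<integral>\<^sup>+p. 2 * ?X p + 2 * ?Y p \<partial>vol A g)"
      proof (rule nn_integral_mono)
        fix p
        show "?D * indicator (U \<inter> V) p \<le> 2 * ?X p + 2 * ?Y p"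
          using ennreal_square_diff_le[of a b "\<phi> p"] by (auto simp: indicator_def power2_commute[of a "\<phi> p"])
      qed
      also have "\<dots> = 2 * (\<integral>\<^sup>+p. ?X p \<partial>vol A g) + 2 * (\<integral>\<^sup>+p. ?Y p \<partial>vol A g)"
        by (subst nn_integral_add) (simp_all add: nn_integral_cmult)
      also have "\<dots> \<le> 2 * (C1 * ?E) + 2 * (C2 * ?E)" by (intro add_mono mult_left_mono a b) auto
      finally show ?thesis .
    qed
    have 2: "?D * ennreal v \<le> (2 * (C1 * ?E) + 2 * (C2 * ?E)) * ennreal (v / m)"
    proof -
      have "?D * ennreal v = ?D * ennreal m * ennreal (v / m)"
        using m v by (simp add: mult.assoc ennreal_mult[symmetric])
      also have "\<dots> \<le> (2 * (C1 * ?E) + 2 * (C2 * ?E)) * ennreal (v / m)" by (intro mult_right_mono 1) simp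
      finally show ?thesis .
    qed
    have "(\<integral>\<^sup>+p. ennreal ((\<phi> p - a)\<^sup>2) * indicator (U \<union> V) p \<partial>vol A g)
      \<le> (\<integral>\<^sup>+p. ?X p + (2 * ?Y p + 2 * ?D * indicator V p) \<partial>vol A g)"
    proof (rule nn_integral_mono)
      fix p
      show "ennreal ((\<phi> p - a)\<^sup>2) * indicator (U \<union> V) p \<le> ?X p + (2 * ?Y p + 2 * ?D * indicator V p)"
        using ennreal_square_diff_le[of "\<phi> p" a b] by (auto simp: indicator_def power2_commute[of b a])
    qed
    also have "\<dots> = (\<integral>\<^sup>+p. ?X p \<partial>vol A g) + (2 * (\<integral>\<^sup>+p. ?Y p \<partial>vol A g) + 2 * ?D * ennreal v)"
      unfolding v_def fin[symmetric]
      by (subst nn_integral_add, simp, simp, subst nn_integral_add) (simp_all add: nn_integral_cmult nn_integral_cmult_indicator)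
    also have "\<dots> \<le> C1 * ?E + (2 * (C2 * ?E) + 2 * ((2 * (C1 * ?E) + 2 * (C2 * ?E)) * ennreal (v / m)))"
      unfolding mult.assoc by (intro add_mono mult_left_mono a b 2[unfolded mult.assoc]) auto
    also have "\<dots> = C * ?E" by (simp add: C_def algebra_simps)
    finally show ?thesis by blast
  qed
  moreover have "C < top" using C by (simp add: C_def ennreal_mult_less_top)
  ultimately show ?thesis using o unfolding poincare_set_def by blast
qed

text \<open>Among the subfamilies of a finite cover whose union has the property, take a maximal
  one. A remaining set that met this union could be added, so the remaining sets are disjoint from
  it, and connectedness excludes them.\<close>

lemma poincare_UNIV:
  assumes compact: "compact (UNIV :: 'm set)" and connected: "connected (UNIV :: 'm set)"
  shows "poincare_set UNIV"
proof -
  define \<U> where "\<U> = {U. poincare_set U \<and> U \<noteq> {}}"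
  have "UNIV \<subseteq> \<Union>\<U>" using poincare_near unfolding \<U>_def by blast
  moreover have op: "\<And>U. U \<in> \<U> ==> open U" by (auto simp: \<U>_def poincare_set_def)
  ultimately obtain F where F: "F \<subseteq> \<U>" "finite F" "UNIV \<subseteq> \<Union>F" by (rule compactE[OF compact])
  define \<G> where "\<G> = {G. G \<subseteq> F \<and> G \<noteq> {} \<and> poincare_set (\<Union>G)}"
  obtain U0 where U0: "U0 \<in> F" using F(3) by blast
  have "{U0} \<in> \<G>" using U0 F(1) by (auto simp: \<G>_def \<U>_def)
  moreover have "finite \<G>" by (rule finite_subset[of _ "Pow F"]) (use F(2) in \<open>auto simp: \<G>_def\<close>)
  ultimately obtain G where G: "G \<in> \<G>" "\<And>G'. G' \<in> \<G> ==> G \<subseteq> G' ==> G = G'"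
    using finite_has_maximal[of \<G>] by blast
  have disj: "\<Union>G \<inter> W = {}" if W: "W \<in> F - G" for W
  proof (rule ccontr)
    assume "\<Union>G \<inter> W \<noteq> {}"
    then have "poincare_set (\<Union>G \<union> W)" using G(1) W F(1) by (intro poincare_Un[OF compact]) (auto simp: \<G>_def \<U>_def)
    then have "insert W G \<in> \<G>" using G(1) W by (auto simp: \<G>_def Un_commute)
    then show False using G(2)[of "insert W G"] W by blast
  qed
  have "open (\<Union>G)" "open (\<Union>(F - G))" by (rule open_Union; use op F(1) G(1) in \<open>auto simp: \<G>_def\<close>)+
  moreover have "\<Union>G \<inter> \<Union>(F - G) = {}" using disj by blast
  moreover have "UNIV \<subseteq> \<Union>G \<union> \<Union>(F - G)" using F(3) by blast
  ultimately have "\<Union>G = {} \<or> \<Union>(F - G) = {}" using connectedD[OF connected, of "\<Union>G" "\<Union>(F - G)"] by blast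
  moreover have "\<Union>G \<noteq> {}" using G(1) F(1) by (auto simp: \<G>_def \<U>_def)
  ultimately have "\<Union>G = UNIV" using F(3) by blast
  then show ?thesis using G(1) by (simp add: \<G>_def)
qed

section \<open>The inequality in H1 and the first eigenvalue\<close>

lemma H1_integrable:
  assumes "compact (UNIV :: 'm set)" "f \<in> H1 A g"
  shows "f \<in> borel_measurable borel" "integrable (vol A g) (\<lambda>p. (f p)\<^sup>2)" "integrable (vol A g) f"
proof -
  interpret finite_measure "vol A g"
    using emeasure_compact_finite[OF assms(1)] by (intro finite_measureI) simp
  have "f \<in> L2 A g" using assms(2) by (auto simp: H1_def H1_differential_def)
  then show m: "f \<in> borel_measurable borel" and 2: "integrable (vol A g) (\<lambda>p. (f p)\<^sup>2)" by (auto simp: L2_def)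
  have "\<bar>f p\<bar> \<le> 1 + (f p)\<^sup>2" for p
    using zero_le_power2[of "\<bar>f p\<bar> - 1"] zero_le_power2[of "f p"] unfolding power2_diff by simp
  then show "integrable (vol A g) f"
    by (intro Bochner_Integration.integrable_bound[OF Bochner_Integration.integrable_add[OF integrable_const[of 1] 2]])
      (use m in \<open>auto simp: abs_of_nonneg\<close>)
qed

text \<open>The inequality with an unknown constant a passes from test functions to f by
  approximation. As f has mean zero, subtracting a can only increase its L2 norm, so a may be
  dropped.\<close>

lemma poincare_inequality:
  assumes compact: "compact (UNIV :: 'm set)" and connected: "connected (UNIV :: 'm set)"
  shows "\<exists>C>0. \<forall>f\<in>H1 A g. (LINT p|vol A g. f p) = 0 \<longrightarrow>
    (LINT p|vol A g. (f p)\<^sup>2) \<le> C * (LINT p|vol A g. covector_inner A g (weak_differential A g f) (weak_differential A g f) p)"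
proof -
  obtain C where C: "C < top" and P: "\<And>\<phi>. test_fun A \<phi> ==> \<exists>a. (\<integral>\<^sup>+p. ennreal ((\<phi> p - a)\<^sup>2) \<partial>vol A g) \<le> C * test_energy \<phi>"
    using poincare_UNIV[OF assms] unfolding poincare_set_def by auto
  \<comment> \<open>The 4 comes from two splittings of a square, one for f - a and one for the
    differential; the 1 makes the constant positive.\<close>
  define C' where "C' = 4 * enn2real C + 1"
  have "(LINT p|vol A g. (f p)\<^sup>2) \<le> C' * (LINT p|vol A g. covector_inner A g (weak_differential A g f) (weak_differential A g f) p)"
    if f: "f \<in> H1 A g" and f0: "(LINT p|vol A g. f p) = 0" for f
  proof -
    interpret finite_measure "vol A g"
      using emeasure_compact_finite[OF compact] by (intro finite_measureI) simp
    note fi = H1_integrable[OF compact f]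
    note [measurable] = fi(1)
    define \<omega> where "\<omega> = weak_differential A g f"
    have "H1_differential A g f \<omega>" unfolding \<omega>_def by (rule weak_differential[OF f])
    then obtain \<phi> where w: "covector_field A \<omega>" and wi: "integrable (vol A g) (covector_inner A g \<omega> \<omega>)"
      and t: "\<And>n. test_fun A (\<phi> n)"
      and l1: "(\<lambda>n. \<integral>\<^sup>+p. ennreal ((f p - \<phi> n p)\<^sup>2) \<partial>vol A g) \<longlonglongrightarrow> 0"
      and l2: "(\<lambda>n. \<integral>\<^sup>+p. ennreal (covector_inner A g (\<lambda>c q. \<omega> c q - differential (\<phi> n) c q)
                                           (\<lambda>c q. \<omega> c q - differential (\<phi> n) c q) p) \<partial>vol A g) \<longlonglongrightarrow> 0"
      unfolding H1_differential_def by blast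
    let ?\<delta> = "\<lambda>n. \<integral>\<^sup>+p. ennreal ((f p - \<phi> n p)\<^sup>2) \<partial>vol A g"
    let ?\<epsilon> = "\<lambda>n. \<integral>\<^sup>+p. ennreal (covector_inner A g (\<lambda>c q. \<omega> c q - differential (\<phi> n) c q) (\<lambda>c q. \<omega> c q - differential (\<phi> n) c q) p) \<partial>vol A g"
    let ?F = "\<integral>\<^sup>+p. ennreal ((f p)\<^sup>2) \<partial>vol A g" and ?W = "\<integral>\<^sup>+p. ennreal (covector_inner A g \<omega> \<omega> p) \<partial>vol A g"
    have mean: "?F \<le> (\<integral>\<^sup>+p. ennreal ((f p - a)\<^sup>2) \<partial>vol A g)" for a
    proof -
      have e: "(f p - a)\<^sup>2 = (f p)\<^sup>2 - (2 * a) * f p + a\<^sup>2" for p by (simp add: power2_diff)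
      have i: "integrable (vol A g) (\<lambda>p. (f p - a)\<^sup>2)" unfolding e
        by (intro Bochner_Integration.integrable_add Bochner_Integration.integrable_diff integrable_mult_right fi integrable_const)
      have "(LINT p|vol A g. (f p)\<^sup>2) \<le> (LINT p|vol A g. (f p - a)\<^sup>2)"
        unfolding e by (subst Bochner_Integration.integral_add Bochner_Integration.integral_diff; (intro Bochner_Integration.integrable_diff integrable_mult_right fi integrable_const)?)+
          (simp add: f0)
      then show ?thesis using i fi(2) by (simp add: nn_integral_eq_integral ennreal_leI)
    qed
    have bound: "?F \<le> 2 * ?\<delta> n + 2 * (C * (2 * ?\<epsilon> n + 2 * ?W))" for n
    proof -
      have sm: "smooth_fun A (\<phi> n)" using t[of n] by (simp add: test_fun_def)
      have [measurable]: "\<phi> n \<in> borel_measurable borel"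
        by (rule borel_measurable_continuous_onI[OF smooth_fun_continuous[OF sm]])
      note cd = covector_field_differential[OF sm]
      have cdiff: "covector_field A (\<lambda>c q. \<omega> c q - differential (\<phi> n) c q)"
        using covector_field_diff[OF w cd, of 1 "-1"] by simp
      note [measurable] = covector_inner_measurable[OF w w] covector_inner_measurable[OF cdiff cdiff]
      obtain a where a: "(\<integral>\<^sup>+p. ennreal ((\<phi> n p - a)\<^sup>2) \<partial>vol A g) \<le> C * test_energy (\<phi> n)" using P[OF t] by blast
      have E: "test_energy (\<phi> n) \<le> 2 * ?\<epsilon> n + 2 * ?W"
      proof -
        have "ennreal (covector_inner A g (differential (\<phi> n)) (differential (\<phi> n)) p)
          \<le> 2 * ennreal (covector_inner A g (\<lambda>c q. \<omega> c q - differential (\<phi> n) c q) (\<lambda>c q. \<omega> c q - differential (\<phi> n) c q) p)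
            + 2 * ennreal (covector_inner A g \<omega> \<omega> p)" for p
        proof -
          let ?x = "frame \<omega> p" and ?y = "frame (differential (\<phi> n)) p"
          have "?y \<bullet> ?y \<le> 2 * ((?x - ?y) \<bullet> (?x - ?y)) + 2 * (?x \<bullet> ?x)"
          proof -
            have e: "(a *\<^sub>R x - y) \<bullet> (a *\<^sub>R x - y) = a * a * (x \<bullet> x) - 2 * a * (x \<bullet> y) + y \<bullet> y" for a and x y :: "real^2"
              by (simp add: inner_diff_left inner_diff_right inner_commute)
            show ?thesis using e[of 2 ?x ?y] e[of 1 ?x ?y] inner_ge_zero[of "2 *\<^sub>R ?x - ?y"] by simp
          qed
          then have "ennreal (?y \<bullet> ?y) \<le> ennreal (2 * ((?x - ?y) \<bullet> (?x - ?y)) + 2 * (?x \<bullet> ?x))" by (rule ennreal_leI)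
          also have "\<dots> = 2 * ennreal ((?x - ?y) \<bullet> (?x - ?y)) + 2 * ennreal (?x \<bullet> ?x)" by (simp add: ennreal_plus ennreal_mult)
          finally show ?thesis unfolding covector_inner_frame[OF cd cd] covector_inner_frame[OF w w] covector_inner_frame[OF cdiff cdiff] frame_diff .
        qed
        then have "(\<integral>\<^sup>+p. ennreal (covector_inner A g (differential (\<phi> n)) (differential (\<phi> n)) p) \<partial>vol A g) \<le> (\<integral>\<^sup>+p. 2 * ennreal (covector_inner A g (\<lambda>c q. \<omega> c q - differential (\<phi> n) c q) (\<lambda>c q. \<omega> c q - differential (\<phi> n) c q) p)
            + 2 * ennreal (covector_inner A g \<omega> \<omega> p) \<partial>vol A g)"
          by (rule nn_integral_mono)
        also have "\<dots> = 2 * ?\<epsilon> n + 2 * ?W" by (subst nn_integral_add) (simp_all add: nn_integral_cmult)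
        finally show ?thesis unfolding test_energy_def .
      qed
      have "?F \<le> (\<integral>\<^sup>+p. ennreal ((f p - a)\<^sup>2) \<partial>vol A g)" by (rule mean)
      also have "\<dots> \<le> (\<integral>\<^sup>+p. 2 * ennreal ((f p - \<phi> n p)\<^sup>2) + 2 * ennreal ((\<phi> n p - a)\<^sup>2) \<partial>vol A g)"
        by (intro nn_integral_mono ennreal_square_diff_le)
      also have "\<dots> = 2 * ?\<delta> n + 2 * (\<integral>\<^sup>+p. ennreal ((\<phi> n p - a)\<^sup>2) \<partial>vol A g)"
        by (subst nn_integral_add) (simp_all add: nn_integral_cmult)
      also have "\<dots> \<le> 2 * ?\<delta> n + 2 * (C * (2 * ?\<epsilon> n + 2 * ?W))"
        by (intro add_left_mono mult_left_mono order_trans[OF a] E) auto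
      finally show ?thesis .
    qed
    have "(\<lambda>n. 2 * ?\<epsilon> n + 2 * ?W) \<longlonglongrightarrow> 2 * 0 + 2 * ?W"
      by (rule tendsto_add[OF ennreal_tendsto_cmult[OF _ l2] tendsto_const]) simp
    then have "(\<lambda>n. 2 * (C * (2 * ?\<epsilon> n + 2 * ?W))) \<longlonglongrightarrow> 2 * (C * (2 * 0 + 2 * ?W))"
      by (rule ennreal_tendsto_cmult[rotated, OF ennreal_tendsto_cmult[OF C]]) simp
    moreover have "(\<lambda>n. 2 * ?\<delta> n) \<longlonglongrightarrow> 2 * 0"
      by (rule ennreal_tendsto_cmult[OF _ l1]) simp
    ultimately have "(\<lambda>n. 2 * ?\<delta> n + 2 * (C * (2 * ?\<epsilon> n + 2 * ?W))) \<longlonglongrightarrow> 2 * 0 + 2 * (C * (2 * 0 + 2 * ?W))"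
      by (rule tendsto_add[rotated])
    then have "?F \<le> 2 * 0 + 2 * (C * (2 * 0 + 2 * ?W))" by (rule LIMSEQ_le_const) (use bound in blast)
    also have "\<dots> = 4 * C * ?W"
    proof -
      have "2 * (c * (2 * w)) = (2 * 2) * (c * w)" for c w :: ennreal by (simp only: mult_ac)
      then have "2 * (C * (2 * ?W)) = (2 * 2) * (C * ?W)" .
      moreover have "2 * 2 = (4 :: ennreal)" by (simp only: numeral_times_numeral num.simps mult_num_simps)
      ultimately show ?thesis by (simp only: mult_zero_right add_0 mult.assoc)
    qed
    also have "\<dots> \<le> ennreal C' * ?W"
    proof (rule mult_right_mono)
      have "ennreal (4 * enn2real C) = ennreal 4 * ennreal (enn2real C)" by (rule ennreal_mult) auto
      then have "4 * C = ennreal (4 * enn2real C)" using C by simp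
      also have "\<dots> \<le> ennreal C'" by (rule ennreal_leI) (simp add: C'_def)
      finally show "4 * C \<le> ennreal C'" .
    qed simp
    finally have "?F \<le> ennreal C' * ?W" .
    moreover have "?F = ennreal (LINT p|vol A g. (f p)\<^sup>2)" using fi(2) by (intro nn_integral_eq_integral) auto
    moreover have W: "?W = ennreal (LINT p|vol A g. covector_inner A g \<omega> \<omega> p)"
      using wi covector_inner_nonneg[OF w] by (intro nn_integral_eq_integral) auto
    moreover have W0: "0 \<le> (LINT p|vol A g. covector_inner A g \<omega> \<omega> p)"
      by (intro integral_nonneg_AE AE_I2 covector_inner_nonneg w)
    moreover have "0 \<le> C'" by (simp add: C'_def)
    ultimately show ?thesis unfolding \<omega>_def[symmetric] by (simp add: ennreal_mult[symmetric])
  qed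
  moreover have "C' > 0" by (simp add: C'_def add_nonneg_pos)
  ultimately show ?thesis by blast
qed

text \<open>Every two-dimensional space contains a nonzero function of mean zero, and for it the
  Poincare inequality bounds the Rayleigh quotient below by 1 / C.\<close>

lemma eigenvalue_1_pos:
  assumes compact: "compact (UNIV :: 'm set)" and connected: "connected (UNIV :: 'm set)"
  shows "\<exists>\<epsilon>>0. ereal \<epsilon> \<le> eigenvalue A g 1"
proof -
  obtain C where C: "C > 0" and P: "\<And>f. f \<in> H1 A g ==> (LINT p|vol A g. f p) = 0 ==>
    (LINT p|vol A g. (f p)\<^sup>2) \<le> C * (LINT p|vol A g. covector_inner A g (weak_differential A g f) (weak_differential A g f) p)"
    using poincare_inequality[OF assms] by blast
  have "ereal (1 / C) \<le> eigenvalue A g 1"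
    unfolding eigenvalue_def
  proof (rule INF_greatest)
    fix V assume "V \<in> {V. H1_subspace A g (1 + 1) V}"
    then have "H1_subspace A g (1 + 1) V" by (rule CollectD)
    then have "H1_subspace A g 2 V" unfolding one_add_one .
    then obtain b where b': "\<forall>i<2. b i \<in> H1 A g"
      "\<forall>a :: nat \<Rightarrow> real. (AE p in vol A g. (\<Sum>i<2. a i * b i p) = 0) \<longrightarrow> (\<forall>i<2. a i = 0)"
      and V: "V = range (\<lambda>a :: nat \<Rightarrow> real. \<lambda>p. \<Sum>i<2. a i * b i p)"
      unfolding H1_subspace_def by (elim exE conjE)
    note b = b'(1)[rule_format]
    define m where "m i = (LINT p|vol A g. b i p)" for i
    \<comment> \<open>The coefficients (m 1, - m 0) cancel the mean. If both means vanish this would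
      be the zero vector, and (1, 1) does instead.\<close>
    define a where "a = (\<lambda>i. if m 0 = 0 \<and> m 1 = 0 then 1 else if i = (0::nat) then m 1 else - m 0)"
    define f where "f p = (\<Sum>i<(2::nat). a i * b i p)" for p
    have fV: "f \<in> V" unfolding V f_def by blast
    have fH: "f \<in> H1 A g" unfolding f_def by (intro H1_sum b)
    have "a 0 \<noteq> 0 \<or> a 1 \<noteq> 0" by (simp add: a_def)
    then have a0: "\<not> (\<forall>i<2. a i = 0)" by (metis pos2 one_less_numeral_iff semiring_norm(76))
    have f0: "\<not> (AE p in vol A g. f p = 0)"
    proof
      assume "AE p in vol A g. f p = 0"
      then have "AE p in vol A g. (\<Sum>i<2. a i * b i p) = 0" unfolding f_def .
      from b'(2)[THEN spec, of a, THEN mp, OF this] a0 show False by contradiction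
    qed
    have "(LINT p|vol A g. f p) = (\<Sum>i<(2::nat). a i * m i)"
      unfolding f_def m_def using H1_integrable(3)[OF compact b] by (subst Bochner_Integration.integral_sum) auto
    also have "\<dots> = 0" by (auto simp: a_def numeral_2_eq_2)
    finally have mean: "(LINT p|vol A g. f p) = 0" .
    let ?N = "LINT p|vol A g. covector_inner A g (weak_differential A g f) (weak_differential A g f) p"
    let ?D = "LINT p|vol A g. (f p)\<^sup>2"
    have "?D \<noteq> 0" using f0 integral_nonneg_eq_0_iff_AE[OF H1_integrable(2)[OF compact fH]] by simp
    moreover have "0 \<le> ?D" by simp
    ultimately have D: "0 < ?D" by linarith
    have "1 / C \<le> rayleigh_quotient A g f"
      unfolding rayleigh_quotient_def using P[OF fH mean] D C by (simp add: field_simps)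
    then have "ereal (1 / C) \<le> ereal (rayleigh_quotient A g f)" by simp
    moreover have "f \<in> {f \<in> V. \<not> (AE p in vol A g. f p = 0)}" using fV f0 by blast
    ultimately show "ereal (1 / C) \<le> (SUP f\<in>{f \<in> V. \<not> (AE p in vol A g. f p = 0)}. ereal (rayleigh_quotient A g f))"
      by (metis (no_types, lifting) SUP_upper2)
  qed
  then show ?thesis using C by (intro exI[of _ "1 / C"]) simp
qed

end

section \<open>Assembling the eigenvalue and spectral bounds\<close>

theorem corollary2p5:
  fixes A :: "'m::{t2_space, second_countable_topology} chart set"
    and \<sigma> :: "'m metric_field"
  assumes "smooth_atlas A"
    and "compact (UNIV :: 'm set)" and "connected (UNIV :: 'm set)"
    and "genus (UNIV :: 'm set) \<ge> 2"
    and "hyperbolic_metric A \<sigma>"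
  shows "(\<exists>C>0. \<forall>g. riemannian_metric A g \<and> nonpositively_curved A g \<and>
              total_area A g = total_area A \<sigma> \<and> conformally_equivalent A g \<sigma> \<longrightarrow>
            (\<forall>k. eigenvalue A g k \<ge> ereal C * eigenvalue A \<sigma> k) \<and>
            (\<forall>(B :: 'n::{t2_space, second_countable_topology} chart set) \<pi>.
              universal_cover B A \<pi> \<longrightarrow>
              spectrum_bottom B (lifted_metric A \<pi> g)
                \<ge> ereal C * spectrum_bottom B (lifted_metric A \<pi> \<sigma>)))
       \<and> (\<forall>h. riemannian_metric A h \<longrightarrow>
            (\<exists>\<epsilon>>0. \<forall>g. riemannian_metric A g \<and> nonpositively_curved A g \<and>
                conformally_equivalent A g h \<longrightarrow>
              eigenvalue A g 1 * ereal (total_area A g) \<ge> ereal \<epsilon>))"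
proof -
  interpret surface A using assms(1) by unfold_locales
  note compact = assms(2)
  \<comment> \<open>Shared by both halves, for h = \<sigma> and for arbitrary h. The bound carries
    the area of g as a factor: fixing the area gives the first half, multiplying by it the
    second.\<close>
  have estimate: "\<exists>K>0. \<forall>g. riemannian_metric A g \<longrightarrow> nonpositively_curved A g \<longrightarrow> conformally_equivalent A g h \<longrightarrow>
     0 < total_area A g \<and> (\<exists>u b. conformal_pair A g h u b \<and> (\<forall>p. exp (2 * u p) \<le> K * total_area A g))"
    if h: "riemannian_metric A h" for h
  proof -
    interpret riemannian_surface A h using h by unfold_locales
    obtain K where K: "K > 0" and est: "\<And>g u p. riemannian_metric A g ==> nonpositively_curved A g ==> smooth_fun A u ==>
      (\<forall>c\<in>A. \<forall>p\<in>fst c. g c p = exp (2 * u p) *\<^sub>R h c p) ==> exp (2 * u p) \<le> K * total_area A g"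
      using conformal_factor_estimate[OF compact] by blast
    have "0 < total_area A g \<and> (\<exists>u b. conformal_pair A g h u b \<and> (\<forall>p. exp (2 * u p) \<le> K * total_area A g))"
      if g: "riemannian_metric A g" "nonpositively_curved A g" "conformally_equivalent A g h" for g
    proof -
      obtain u where u: "smooth_fun A u" "\<forall>c\<in>A. \<forall>p\<in>fst c. g c p = exp (2 * u p) *\<^sub>R h c p"
        using g(3) unfolding conformally_equivalent_def by blast
      note e = est[OF g(1,2) u]
      \<comment> \<open>Positivity of the area comes for free, as the estimate bounds a positive
        exponential.\<close>
      have "0 < K * total_area A g" by (rule less_le_trans[OF exp_gt_zero e])
      then have "0 < total_area A g" using K by (simp add: zero_less_mult_iff)
      moreover have "\<exists>b. conformal_pair A g h u b" by (rule smooth_conformal_pair[OF compact g(1) u(1)]) (use u(2) in blast)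
      ultimately show ?thesis using e by blast
    qed
    then show ?thesis using K by blast
  qed
  show ?thesis
  proof (intro conjI allI impI)
    have \<sigma>: "riemannian_metric A \<sigma>" using assms(5) by (simp add: hyperbolic_metric_def)
    obtain K where K: "K > 0" and est: "\<And>g. riemannian_metric A g ==> nonpositively_curved A g ==> conformally_equivalent A g \<sigma> ==>
      0 < total_area A g \<and> (\<exists>u b. conformal_pair A g \<sigma> u b \<and> (\<forall>p. exp (2 * u p) \<le> K * total_area A g))"
      using estimate[OF \<sigma>] by blast
    \<comment> \<open>\<sigma> is conformal to itself with u = 0 and has negative curvature, so the
      estimate applies to it.\<close>
    have "total_area A \<sigma> > 0"
    proof -
      have "nonpositively_curved A \<sigma>" using assms(5) by (simp add: hyperbolic_metric_def nonpositively_curved_def)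
      moreover have "smooth_fun A (\<lambda>p. 0)" by (simp add: smooth_fun_def comp_def smooth_on_const)
      then have "conformally_equivalent A \<sigma> \<sigma>" unfolding conformally_equivalent_def by (intro exI[of _ "\<lambda>p. 0"]) simp
      ultimately show ?thesis using est[OF \<sigma>] by blast
    qed
    then have K': "0 < K * total_area A \<sigma>" using K by simp
    let ?C = "1 / (K * total_area A \<sigma>)"
    have "(\<forall>k. eigenvalue A g k \<ge> ereal ?C * eigenvalue A \<sigma> k) \<and>
            (\<forall>(B :: 'n chart set) \<pi>. universal_cover B A \<pi> \<longrightarrow>
              spectrum_bottom B (lifted_metric A \<pi> g) \<ge> ereal ?C * spectrum_bottom B (lifted_metric A \<pi> \<sigma>))"
      if g: "riemannian_metric A g \<and> nonpositively_curved A g \<and> total_area A g = total_area A \<sigma> \<and> conformally_equivalent A g \<sigma>" for g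
    proof -
      obtain u b where cp: "conformal_pair A g \<sigma> u b" and u: "\<And>p. exp (2 * u p) \<le> K * total_area A \<sigma>"
        using est[of g] g by auto
      show ?thesis
      proof (intro conjI allI impI)
        show "ereal ?C * eigenvalue A \<sigma> k \<le> eigenvalue A g k" for k
          by (rule conformal_pair.eigenvalue_compare[OF cp K' u])
        show "ereal ?C * spectrum_bottom B (lifted_metric A \<pi> \<sigma>) \<le> spectrum_bottom B (lifted_metric A \<pi> g)"
          if "universal_cover B A \<pi>" for B :: "'n chart set" and \<pi>
          by (rule conformal_pair.spectrum_bottom_compare[OF conformal_pair_lifted[OF cp that] K' u])
      qed
    qed
    then show "\<exists>C>0. \<forall>g. riemannian_metric A g \<and> nonpositively_curved A g \<and>
              total_area A g = total_area A \<sigma> \<and> conformally_equivalent A g \<sigma> \<longrightarrow>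
            (\<forall>k. eigenvalue A g k \<ge> ereal C * eigenvalue A \<sigma> k) \<and>
            (\<forall>(B :: 'n chart set) \<pi>. universal_cover B A \<pi> \<longrightarrow>
              spectrum_bottom B (lifted_metric A \<pi> g) \<ge> ereal C * spectrum_bottom B (lifted_metric A \<pi> \<sigma>))"
      using K' by (intro exI[of _ ?C]) (simp only: zero_less_divide_1_iff, blast)
  next
    fix h assume h: "riemannian_metric A h"
    interpret riemannian_surface A h using h by unfold_locales
    obtain \<epsilon> where \<epsilon>: "\<epsilon> > 0" "ereal \<epsilon> \<le> eigenvalue A h 1" using eigenvalue_1_pos[OF assms(2,3)] by blast
    obtain K where K: "K > 0" and est: "\<And>g. riemannian_metric A g ==> nonpositively_curved A g ==> conformally_equivalent A g h ==>
      0 < total_area A g \<and> (\<exists>u b. conformal_pair A g h u b \<and> (\<forall>p. exp (2 * u p) \<le> K * total_area A g))"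
      using estimate[OF h] by blast
    \<comment> \<open>The comparison factor is 1 / (K * area), so multiplying by the area leaves the
      same \<epsilon> / K for every g in the class.\<close>
    have "ereal (\<epsilon> / K) \<le> eigenvalue A g 1 * ereal (total_area A g)"
      if g: "riemannian_metric A g \<and> nonpositively_curved A g \<and> conformally_equivalent A g h" for g
    proof -
      let ?a = "total_area A g"
      obtain u b where a: "0 < ?a" and cp: "conformal_pair A g h u b" and u: "\<And>p. exp (2 * u p) \<le> K * ?a"
        using est[of g] g by auto
      have "0 < K * ?a" using K a by simp
      from conformal_pair.eigenvalue_compare[OF cp this u, of 1]
      have "ereal (1 / (K * ?a)) * eigenvalue A h 1 \<le> eigenvalue A g 1" .
      moreover have "ereal (1 / (K * ?a)) * ereal \<epsilon> \<le> ereal (1 / (K * ?a)) * eigenvalue A h 1"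
        using K a by (intro ereal_mult_left_mono \<epsilon>(2)) simp
      ultimately have "ereal (1 / (K * ?a)) * ereal \<epsilon> \<le> eigenvalue A g 1" by (rule order_trans[rotated])
      then have "ereal (1 / (K * ?a)) * ereal \<epsilon> * ereal ?a \<le> eigenvalue A g 1 * ereal ?a"
        using a by (intro ereal_mult_right_mono) auto
      moreover have "ereal (1 / (K * ?a)) * ereal \<epsilon> * ereal ?a = ereal (\<epsilon> / K)" using a K by simp
      ultimately show ?thesis by simp
    qed
    then show "\<exists>\<epsilon>>0. \<forall>g. riemannian_metric A g \<and> nonpositively_curved A g \<and> conformally_equivalent A g h \<longrightarrow>
              ereal \<epsilon> \<le> eigenvalue A g 1 * ereal (total_area A g)"
      using \<epsilon> K by (intro exI[of _ "\<epsilon> / K"]) simp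
  qed
qed

end
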